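(* Let $\Omega\subset\mathbb{R}^2$, $u_0$, $A$, and the classes and functionals be as in the context. Let $f(\xi)=f_1(\xi_1)+A(|\xi_2|)$, $\xi=(\xi_1,\xi_2)\in\mathbb{R}^2$, where $f_1:\mathbb{R}\to\mathbb{R}$ is convex, of class $C^1$, and satisfies $a_1|t|-a_2\le f_1(t)\le a_3|t|+a_4$ for all $t\in\mathbb{R}$ with constants $a_1,a_3>0$, $a_2,a_4\ge0$; $A$ is of class $C^1([0,\infty))$ and satisfies (N1)-(N3); $f_2(t):=A(|t|)$ satisfies $f_2(t+\hat t)\le c_3[f_2(t)+f_2(\hat t)]$ for all $t,\hat t\in\mathbb{R}$ with some $c_3>0$; and $$A^*(A'(t))\le c\,[A(t)+1]\quad\text{for all }t\ge0$$ with some constant $c$. Let $\overline{u}\in\mathcal{C}_{\mathrm{BV}}$ denote a solution of the problem $K[w]\to\min$ in $\mathcal{C}_{\mathrm{BV}}$. Then the "stress tensor" $$\sigma(x):=Df\big(\nabla^a\overline{u}(x)\big)$$ is of class $L^{\infty,A^*}(\Omega;\mathbb{R}^2)$ and maximizes the dual variational problem $$R[\tau]\to\max\quad\text{in } L^{\infty,A^*}(\Omega;\mathbb{R}^2).$$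
   Context: $\Omega\subset\mathbb{R}^2$ is a bounded Lipschitz domain that is normal with respect to the $x_2$-axis: there are $a<b$ and Lipschitz functions $\kappa_1,\kappa_2:(a,b)\to\mathbb{R}$ with $\Omega=\{x\in\mathbb{R}^2: x_1\in(a,b),\ \kappa_1(x_1)<x_2<\kappa_2(x_1)\}$. $\nu=(\nu_1,\nu_2)$ is the outward unit normal to $\partial\Omega$. The boundary datum satisfies $u_0\in W^{1,\infty}(\Omega)$. $A:[0,\infty)\to[0,\infty)$ is an $N$-function satisfying: (N1) $A$ is continuous, strictly increasing and convex; (N2) $\lim_{t\downarrow0}A(t)/t=0$ and $\lim_{t\to\infty}A(t)/t=\infty$; (N3) there are $k,t_0>0$ with $A(2t)\le kA(t)$ for all $t\ge t_0$. Its conjugate is $A^*(s)=\max_{t\ge0}\{st-A(t)\}$, $s\ge0$, and $f_1^*(s)=\sup_{t\in\mathbb{R}}\{st-f_1(t)\}$. For an $N$-function $B$, $L_B(\Omega)$ is the Orlicz space of measurable $u:\Omega\to\mathbb{R}$ with $\int_\Omega B(\lambda|u|)\,dx<\infty$ for some $\lambda>0$. $L^{\infty,A^*}(\Omega;\mathbb{R}^2):=L^\infty(\Omega)\times L_{A^*}(\Omega)$. $\mathcal{C}_{\mathrm{Sob}}=\{w\in W^{1,1}(\Omega):\ \partial_2w\in L_A(\Omega),\ w-u_0\in W^{1,1}_0(\Omega)\}$. $\mathcal{C}_{\mathrm{BV}}$ is the set of all $w\in BV(\Omega)$ such that the distributional derivative $\partial_2w$ is given by a function in $L_A(\Omega)$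 and $(w-u_0)\nu_2=0$ $\mathcal{H}^1$-a.e. on $\partial\Omega$ (BV-trace). For $w\in BV(\Omega)$, $\nabla^aw$ and $\nabla^sw$ denote the absolutely continuous and singular parts of $\nabla w$ with respect to Lebesgue measure (first components $\partial_1^aw$, $\partial_1^sw$), and $f_1^\infty(t)=\lim_{s\to\infty}f_1(st)/s$. For $w\in\mathcal{C}_{\mathrm{BV}}$, $$K[w]=\int_\Omega f_1(\partial_1^aw)\,dx+\int_\Omega f_1^\infty\Big(\frac{\partial_1^sw}{|\partial_1^sw|}\Big)\,d|\partial_1^sw|+\int_{\partial\Omega}f_1^\infty\big((u_0-w)\nu_1\big)\,d\mathcal{H}^1+\int_\Omega A(|\partial_2w|)\,dx.$$ The Lagrangian is, for $v\in\mathcal{C}_{\mathrm{Sob}}$ and $\tau=(\tau_1,\tau_2)\in L^{\infty,A^*}(\Omega;\mathbb{R}^2)$, $$l(v,\tau)=\int_\Omega\tau\cdot\nabla v\,dx-\int_\Omega f_1^*(\tau_1)\,dx-\int_\Omega A^*(|\tau_2|)\,dx\in[-\infty,\infty),$$ and the dual functional is $R[\tau]=\inf_{w\in\mathcal{C}_{\mathrm{Sob}}}l(w,\tau)$. *)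

theory Defs
  imports "HOL-Analysis.Analysis"
begin

section \<open>Domains, outward normal and one-dimensional Hausdorff measure\<close>

type_synonym plane = "real \<times> real"

abbreviation e1 :: plane where "e1 \<equiv> (1, 0)"
abbreviation e2 :: plane where "e2 \<equiv> (0, 1)"

definition bounded_lipschitz_domain :: "plane set \<Rightarrow> bool" where
  "bounded_lipschitz_domain \<Omega> \<longleftrightarrow>
     open \<Omega> \<and> connected \<Omega> \<and> \<Omega> \<noteq> {} \<and> bounded \<Omega> \<and>
     (\<forall>p \<in> frontier \<Omega>. \<exists>r>0. \<exists>(Q :: plane \<Rightarrow> plane) (g :: real \<Rightarrow> real) L. orthogonal_transformation Q \<and>
        L-lipschitz_on UNIV g \<and>
        \<Omega> \<inter> ball p r = {x \<in> ball p r. snd (Q x) < g (fst (Q x))})"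

definition normal_wrt_x2_axis :: "plane set \<Rightarrow> bool" where
  "normal_wrt_x2_axis \<Omega> \<longleftrightarrow>
     (\<exists>a b \<kappa>1 \<kappa>2. a < b \<and>
        (\<exists>L. L-lipschitz_on {a<..<b} \<kappa>1) \<and> (\<exists>L. L-lipschitz_on {a<..<b} \<kappa>2) \<and>
        \<Omega> = {x. fst x \<in> {a<..<b} \<and> \<kappa>1 (fst x) < snd x \<and> snd x < \<kappa>2 (fst x)})"

text \<open>Where the boundary is a graph \<open>y\<^sub>2 = g y\<^sub>1\<close> over a domain below it and \<open>g\<close> is
  differentiable, the following is the familiar vector \<open>(-g', 1) / sqrt (1 + g'^2)\<close> in the
  coordinates of the chart; it states that the boundary has a tangent line orthogonal to \<open>n\<close>
  and that \<open>\<Omega>\<close> lies on the side of \<open>-n\<close>. For a Lipschitz domain such an \<open>n\<close> exists at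
  almost every boundary point, and it is unique where it exists.\<close>

definition is_outward_normal :: "plane set \<Rightarrow> plane \<Rightarrow> plane \<Rightarrow> bool" where
  "is_outward_normal \<Omega> x n \<longleftrightarrow> norm n = 1 \<and>
     (\<forall>\<epsilon>>0. \<exists>\<delta>>0. \<forall>y \<in> ball x \<delta>.
        (n \<bullet> (y - x) < - \<epsilon> * norm (y - x) \<longrightarrow> y \<in> \<Omega>) \<and>
        (n \<bullet> (y - x) > \<epsilon> * norm (y - x) \<longrightarrow> y \<notin> \<Omega>))"

definition outward_normal :: "plane set \<Rightarrow> plane \<Rightarrow> plane" where
  "outward_normal \<Omega> x = (THE n. is_outward_normal \<Omega> x n)"

definition hausdorff1_outer :: "plane set \<Rightarrow> ennreal" where
  "hausdorff1_outer E =
     (SUP \<delta> \<in> {0<..}.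
        INF C \<in> {C :: nat \<Rightarrow> plane set. E \<subseteq> (\<Union>n. C n) \<and>
                   (\<forall>n. bounded (C n) \<and> diameter (C n) \<le> \<delta>)}.
          \<Sum>n. ennreal (diameter (C n)))"

text \<open>The measure lives on the Caratheodory measurable sets; in particular it is complete.\<close>

definition hausdorff1 :: "plane measure" where
  "hausdorff1 =
     measure_of UNIV (lambda_system UNIV UNIV hausdorff1_outer) hausdorff1_outer"

definition boundary_measure :: "plane set \<Rightarrow> plane measure" where
  "boundary_measure \<Omega> = restrict_space hausdorff1 (frontier \<Omega>)"


section \<open>Smooth functions\<close>

definition partial_deriv :: "plane \<Rightarrow> (plane \<Rightarrow> real) \<Rightarrow> plane \<Rightarrow> real" where
  "partial_deriv e \<phi> x = frechet_derivative \<phi> (at x) e"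

definition gradient :: "(plane \<Rightarrow> real) \<Rightarrow> plane \<Rightarrow> plane" where
  "gradient \<phi> x = (partial_deriv e1 \<phi> x, partial_deriv e2 \<phi> x)"

primrec C_k :: "nat \<Rightarrow> (plane \<Rightarrow> real) \<Rightarrow> bool" where
  "C_k 0 \<phi> \<longleftrightarrow> continuous_on UNIV \<phi>"
| "C_k (Suc k) \<phi> \<longleftrightarrow> (\<forall>x. \<phi> differentiable (at x)) \<and>
     C_k k (partial_deriv e1 \<phi>) \<and> C_k k (partial_deriv e2 \<phi>)"

definition test_functions :: "plane set \<Rightarrow> (plane \<Rightarrow> real) set" where
  "test_functions \<Omega> = {\<phi>. (\<forall>k. C_k k \<phi>) \<and>
     compact (closure {x. \<phi> x \<noteq> 0}) \<and> closure {x. \<phi> x \<noteq> 0} \<subseteq> \<Omega>}"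


section \<open>Lebesgue, Orlicz and Sobolev spaces\<close>

text \<open>Functions on \<open>\<Omega>\<close> are represented by functions on the whole plane whose values
  outside \<open>\<Omega>\<close> are irrelevant; all spaces are closed under equality a.e. in \<open>\<Omega>\<close>.\<close>

definition L1 :: "plane set \<Rightarrow> (plane \<Rightarrow> real) set" where
  "L1 \<Omega> = {u. integrable (lebesgue_on \<Omega>) u}"

definition Linf :: "plane set \<Rightarrow> (plane \<Rightarrow> real) set" where
  "Linf \<Omega> = {u. u \<in> borel_measurable (lebesgue_on \<Omega>) \<and>
     (\<exists>C. AE x in lebesgue_on \<Omega>. \<bar>u x\<bar> \<le> C)}"

definition orlicz :: "(real \<Rightarrow> real) \<Rightarrow> plane set \<Rightarrow> (plane \<Rightarrow> real) set" where
  "orlicz B \<Omega> = {u. u \<in> borel_measurable (lebesgue_on \<Omega>) \<and>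
     (\<exists>l>0. (\<integral>\<^sup>+ x. ennreal (B (l * \<bar>u x\<bar>)) \<partial>lebesgue_on \<Omega>) < \<infinity>)}"

definition locally_integrable :: "plane set \<Rightarrow> (plane \<Rightarrow> real) \<Rightarrow> bool" where
  "locally_integrable \<Omega> u \<longleftrightarrow>
     (\<forall>C. compact C \<and> C \<subseteq> \<Omega> \<longrightarrow> integrable (lebesgue_on C) u)"

definition has_weak_deriv ::
  "plane set \<Rightarrow> plane \<Rightarrow> (plane \<Rightarrow> real) \<Rightarrow> (plane \<Rightarrow> real) \<Rightarrow> bool" where
  "has_weak_deriv \<Omega> e u g \<longleftrightarrow> locally_integrable \<Omega> u \<and> locally_integrable \<Omega> g \<and>
     (\<forall>\<phi> \<in> test_functions \<Omega>.
        (\<integral>x. u x * partial_deriv e \<phi> x \<partial>lebesgue_on \<Omega>) = - (\<integral>x. g x * \<phi> x \<partial>lebesgue_on \<Omega>))"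

definition weak_deriv :: "plane set \<Rightarrow> plane \<Rightarrow> (plane \<Rightarrow> real) \<Rightarrow> plane \<Rightarrow> real" where
  "weak_deriv \<Omega> e u = (SOME g. has_weak_deriv \<Omega> e u g)"

definition weak_gradient :: "plane set \<Rightarrow> (plane \<Rightarrow> real) \<Rightarrow> plane \<Rightarrow> plane" where
  "weak_gradient \<Omega> u x = (weak_deriv \<Omega> e1 u x, weak_deriv \<Omega> e2 u x)"

definition W11 :: "plane set \<Rightarrow> (plane \<Rightarrow> real) set" where
  "W11 \<Omega> = {u \<in> L1 \<Omega>. (\<exists>g \<in> L1 \<Omega>. has_weak_deriv \<Omega> e1 u g) \<and>
                       (\<exists>g \<in> L1 \<Omega>. has_weak_deriv \<Omega> e2 u g)}"

definition W1inf :: "plane set \<Rightarrow> (plane \<Rightarrow> real) set" where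
  "W1inf \<Omega> = {u \<in> Linf \<Omega>. (\<exists>g \<in> Linf \<Omega>. has_weak_deriv \<Omega> e1 u g) \<and>
                           (\<exists>g \<in> Linf \<Omega>. has_weak_deriv \<Omega> e2 u g)}"

definition W11_0 :: "plane set \<Rightarrow> (plane \<Rightarrow> real) set" where
  "W11_0 \<Omega> = {u \<in> W11 \<Omega>. \<forall>\<epsilon>>0. \<exists>\<phi> \<in> test_functions \<Omega>.
     (\<integral>x. \<bar>u x - \<phi> x\<bar> \<partial>lebesgue_on \<Omega>)
     + (\<integral>x. norm (weak_gradient \<Omega> u x - gradient \<phi> x) \<partial>lebesgue_on \<Omega>) < \<epsilon>}"


section \<open>Functions of bounded variation and their traces\<close>

definition finite_borel_measure_on :: "plane set \<Rightarrow> plane measure \<Rightarrow> bool" where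
  "finite_borel_measure_on \<Omega> M \<longleftrightarrow>
     finite_measure M \<and> sets M = sets (restrict_space borel \<Omega>)"

text \<open>The distributional derivative of \<open>u\<close> in direction \<open>e\<close> is the finite signed measure
  \<open>P - N\<close>. Finite signed measures are represented as differences of finite measures, without
  requiring that \<open>P\<close> and \<open>N\<close> be mutually singular.\<close>

definition has_deriv_measure ::
  "plane set \<Rightarrow> plane \<Rightarrow> (plane \<Rightarrow> real) \<Rightarrow> plane measure \<Rightarrow> plane measure \<Rightarrow> bool" where
  "has_deriv_measure \<Omega> e u P N \<longleftrightarrow>
     finite_borel_measure_on \<Omega> P \<and> finite_borel_measure_on \<Omega> N \<and>
     (\<forall>\<phi> \<in> test_functions \<Omega>.
        (\<integral>x. u x * partial_deriv e \<phi> x \<partial>lebesgue_on \<Omega>) = - ((\<integral>x. \<phi> x \<partial>P) - (\<integral>x. \<phi> x \<partial>N)))"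

definition BV :: "plane set \<Rightarrow> (plane \<Rightarrow> real) set" where
  "BV \<Omega> = {u \<in> L1 \<Omega>. (\<exists>P N. has_deriv_measure \<Omega> e1 u P N) \<and>
                      (\<exists>P N. has_deriv_measure \<Omega> e2 u P N)}"

text \<open>Lebesgue decomposition of the derivative: \<open>\<rho>\<close> is the density of the absolutely
  continuous part, \<open>S\<close> the total variation of the singular part and \<open>h\<close> the
  Radon-Nikodym density of the singular part with respect to \<open>S\<close> (polar decomposition).\<close>

definition has_lebesgue_decomposition ::
  "plane set \<Rightarrow> plane \<Rightarrow> (plane \<Rightarrow> real) \<Rightarrow> (plane \<Rightarrow> real) \<Rightarrow> plane measure \<Rightarrow> (plane \<Rightarrow> real) \<Rightarrow> bool"
  where
  "has_lebesgue_decomposition \<Omega> e u \<rho> S h \<longleftrightarrow>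
     \<rho> \<in> L1 \<Omega> \<and>
     finite_borel_measure_on \<Omega> S \<and>
     (\<exists>Z \<in> null_sets lborel. Z \<subseteq> \<Omega> \<and> emeasure S (\<Omega> - Z) = 0) \<and>
     h \<in> borel_measurable S \<and> (AE x in S. \<bar>h x\<bar> = 1) \<and>
     (\<exists>P N. has_deriv_measure \<Omega> e u P N \<and>
        (\<forall>B \<in> sets borel. B \<subseteq> \<Omega> \<longrightarrow>
           measure P B - measure N B
           = (\<integral>x. indicator B x * \<rho> x \<partial>lebesgue_on \<Omega>) + (\<integral>x. indicator B x * h x \<partial>S)))"

definition ac_deriv :: "plane set \<Rightarrow> plane \<Rightarrow> (plane \<Rightarrow> real) \<Rightarrow> plane \<Rightarrow> real" where
  "ac_deriv \<Omega> e u = (SOME \<rho>. \<exists>S h. has_lebesgue_decomposition \<Omega> e u \<rho> S h)"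

definition sing_variation :: "plane set \<Rightarrow> plane \<Rightarrow> (plane \<Rightarrow> real) \<Rightarrow> plane measure" where
  "sing_variation \<Omega> e u = (SOME S. \<exists>\<rho> h. has_lebesgue_decomposition \<Omega> e u \<rho> S h)"

definition sing_density :: "plane set \<Rightarrow> plane \<Rightarrow> (plane \<Rightarrow> real) \<Rightarrow> plane \<Rightarrow> real" where
  "sing_density \<Omega> e u =
     (SOME h. \<exists>\<rho>. has_lebesgue_decomposition \<Omega> e u \<rho> (sing_variation \<Omega> e u) h)"

definition ac_gradient :: "plane set \<Rightarrow> (plane \<Rightarrow> real) \<Rightarrow> plane \<Rightarrow> plane" where
  "ac_gradient \<Omega> u x = (ac_deriv \<Omega> e1 u x, ac_deriv \<Omega> e2 u x)"

text \<open>The trace of a BV function is the integrable boundary function, unique up to null sets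
  of the boundary measure, for which the Gauss-Green formula holds for all vector fields of
  class \<open>C^1\<close> on the plane. The formula is written for the two components of the field
  separately.\<close>

definition gauss_green ::
  "plane set \<Rightarrow> plane \<Rightarrow> (plane \<Rightarrow> real) \<Rightarrow> (plane \<Rightarrow> real) \<Rightarrow> bool" where
  "gauss_green \<Omega> e u g \<longleftrightarrow>
     (\<exists>P N. has_deriv_measure \<Omega> e u P N \<and>
        (\<forall>\<phi>. C_k 1 \<phi> \<longrightarrow>
           (\<integral>x. u x * partial_deriv e \<phi> x \<partial>lebesgue_on \<Omega>)
           = - ((\<integral>x. \<phi> x \<partial>P) - (\<integral>x. \<phi> x \<partial>N))
             + (\<integral>x. \<phi> x * (outward_normal \<Omega> x \<bullet> e) * g x \<partial>boundary_measure \<Omega>)))"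

definition has_trace :: "plane set \<Rightarrow> (plane \<Rightarrow> real) \<Rightarrow> (plane \<Rightarrow> real) \<Rightarrow> bool" where
  "has_trace \<Omega> u g \<longleftrightarrow> u \<in> BV \<Omega> \<and> integrable (boundary_measure \<Omega>) g \<and>
     gauss_green \<Omega> e1 u g \<and> gauss_green \<Omega> e2 u g"

definition bv_trace :: "plane set \<Rightarrow> (plane \<Rightarrow> real) \<Rightarrow> plane \<Rightarrow> real" where
  "bv_trace \<Omega> u = (SOME g. has_trace \<Omega> u g)"


section \<open>N-functions, conjugates and recession function\<close>

definition N_function :: "(real \<Rightarrow> real) \<Rightarrow> bool" where
  "N_function A \<longleftrightarrow>
     (\<forall>t\<ge>0. A t \<ge> 0) \<and>
     continuous_on {0..} A \<and> strict_mono_on {0..} A \<and> convex_on {0..} A \<and>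
     ((\<lambda>t. A t / t) \<longlongrightarrow> 0) (at_right 0) \<and> filterlim (\<lambda>t. A t / t) at_top at_top \<and>
     (\<exists>k t0. k > 0 \<and> t0 > 0 \<and> (\<forall>t\<ge>t0. A (2 * t) \<le> k * A t))"

text \<open>The supremum is finite and attained because an N-function grows superlinearly.\<close>

definition N_conjugate :: "(real \<Rightarrow> real) \<Rightarrow> real \<Rightarrow> real" where
  "N_conjugate A s = (SUP t \<in> {0..}. s * t - A t)"

definition convex_conjugate :: "(real \<Rightarrow> real) \<Rightarrow> real \<Rightarrow> ereal" where
  "convex_conjugate f s = (SUP t. ereal (s * t - f t))"

definition recession :: "(real \<Rightarrow> real) \<Rightarrow> real \<Rightarrow> real" where
  "recession f t = Lim at_top (\<lambda>s. f (s * t) / s)"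

text \<open>Integral of an extended real function as positive minus negative part, where
  \<^const>\<open>e2ennreal\<close> maps negative numbers to 0. It is only used for functions whose negative
  part has a finite integral.\<close>

definition ext_integral :: "'a measure \<Rightarrow> ('a \<Rightarrow> ereal) \<Rightarrow> ereal" where
  "ext_integral M g =
     enn2ereal (\<integral>\<^sup>+ x. e2ennreal (g x) \<partial>M) - enn2ereal (\<integral>\<^sup>+ x. e2ennreal (- g x) \<partial>M)"


section \<open>The variational problem and its dual\<close>

definition C_Sob :: "plane set \<Rightarrow> (real \<Rightarrow> real) \<Rightarrow> (plane \<Rightarrow> real) \<Rightarrow> (plane \<Rightarrow> real) set" where
  "C_Sob \<Omega> A u0 = {w \<in> W11 \<Omega>. weak_deriv \<Omega> e2 w \<in> orlicz A \<Omega> \<and> (\<lambda>x. w x - u0 x) \<in> W11_0 \<Omega>}"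

definition C_BV :: "plane set \<Rightarrow> (real \<Rightarrow> real) \<Rightarrow> (plane \<Rightarrow> real) \<Rightarrow> (plane \<Rightarrow> real) set" where
  "C_BV \<Omega> A u0 = {w \<in> BV \<Omega>.
     (\<exists>g \<in> orlicz A \<Omega>. has_weak_deriv \<Omega> e2 w g) \<and>
     (\<exists>g. has_trace \<Omega> (\<lambda>x. w x - u0 x) g \<and>
        (AE x in boundary_measure \<Omega>. g x * snd (outward_normal \<Omega> x) = 0))}"

definition K_functional ::
  "plane set \<Rightarrow> (real \<Rightarrow> real) \<Rightarrow> (real \<Rightarrow> real) \<Rightarrow> (plane \<Rightarrow> real) \<Rightarrow> (plane \<Rightarrow> real) \<Rightarrow> ereal" where
  "K_functional \<Omega> f1 A u0 w =
     ext_integral (lebesgue_on \<Omega>) (\<lambda>x. f1 (ac_deriv \<Omega> e1 w x))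
     + ext_integral (sing_variation \<Omega> e1 w) (\<lambda>x. recession f1 (sing_density \<Omega> e1 w x))
     + ext_integral (boundary_measure \<Omega>)
         (\<lambda>x. recession f1 (bv_trace \<Omega> (\<lambda>y. u0 y - w y) x * fst (outward_normal \<Omega> x)))
     + ext_integral (lebesgue_on \<Omega>) (\<lambda>x. A \<bar>weak_deriv \<Omega> e2 w x\<bar>)"

definition Linf_orlicz :: "(real \<Rightarrow> real) \<Rightarrow> plane set \<Rightarrow> (plane \<Rightarrow> plane) set" where
  "Linf_orlicz B \<Omega> = {\<tau>. (\<lambda>x. fst (\<tau> x)) \<in> Linf \<Omega> \<and> (\<lambda>x. snd (\<tau> x)) \<in> orlicz B \<Omega>}"

definition lagrangian ::
  "plane set \<Rightarrow> (real \<Rightarrow> real) \<Rightarrow> (real \<Rightarrow> real) \<Rightarrow> (plane \<Rightarrow> real) \<Rightarrow> (plane \<Rightarrow> plane) \<Rightarrow> ereal" where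
  "lagrangian \<Omega> f1 A v \<tau> =
     ereal (\<integral>x. \<tau> x \<bullet> weak_gradient \<Omega> v x \<partial>lebesgue_on \<Omega>)
     - ext_integral (lebesgue_on \<Omega>) (\<lambda>x. convex_conjugate f1 (fst (\<tau> x)))
     - ext_integral (lebesgue_on \<Omega>) (\<lambda>x. N_conjugate A \<bar>snd (\<tau> x)\<bar>)"

definition dual_functional ::
  "plane set \<Rightarrow> (real \<Rightarrow> real) \<Rightarrow> (real \<Rightarrow> real) \<Rightarrow> (plane \<Rightarrow> real) \<Rightarrow> (plane \<Rightarrow> plane) \<Rightarrow> ereal" where
  "dual_functional \<Omega> f1 A u0 \<tau> = (INF w \<in> C_Sob \<Omega> A u0. lagrangian \<Omega> f1 A w \<tau>)"

end

theory Submission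
 imports Defs "HOL-Analysis.Analysis" "HOL-Computational_Algebra.Polynomial"
begin

text \<open>
  The stress tensor is optimal because \<open>R[\<tau>] \<le> K[u] \<le> R[\<sigma>]\<close> for every admissible \<open>\<tau>\<close>.

  In the lemmas the open set \<open>\<Omega>\<close> is called \<open>G\<close>.

  The second inequality is the Euler inequality of the primal problem. For a Sobolev competitor \<open>w\<close> the
  segment \<open>(1 - e) u + e w\<close> stays in the BV class. Along it the singular and the boundary part of \<open>K\<close>
  are multiplied by \<open>1 - e\<close>: the gradient of \<open>w\<close> has no singular part, \<open>w - u0\<close> has trace zero, and the
  recession function is positively homogeneous. Dividing the increment of \<open>K\<close> by \<open>e\<close> and letting \<open>e\<close>
  tend to zero gives a lower bound for the integral of \<open>\<sigma> \<bullet> \<nabla>w\<close>, which equality in Young's inequality at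
  \<open>\<sigma> = Df (\<nabla>\<^sup>a u)\<close> turns into \<open>K[u] \<le> l(w, \<sigma>)\<close> (lemma \<open>lagrangian_stress_ge\<close>).

  For the first inequality, Young's inequality bounds \<open>l(u0 + \<phi>, \<tau>)\<close> by the energy of \<open>u0 + \<phi>\<close> for every
  test function \<open>\<phi>\<close> (lemma \<open>lagrangian_le\<close>), so it suffices to find \<open>\<phi>\<close> with energy at most \<open>K[u]\<close> up
  to a small error (lemma \<open>smooth_competitor\<close>). Extend \<open>U = u - u0\<close> by zero. Its derivative in direction \<open>x\<^sub>1\<close> is an
  integrable function plus finite measures carried by a null set and by the boundary. Its
  derivative in direction \<open>x\<^sub>2\<close> is a function, since the trace times \<open>\<nu>\<^sub>2\<close> vanishes. Cut \<open>U\<close> by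
  a partition of unity, move each piece into \<open>\<Omega>\<close> by a translation combined with a vertical
  contraction, and mollify. The weights depend on \<open>x\<^sub>1\<close> only; this is possible because \<open>\<Omega>\<close> lies between
  two graphs, and it keeps the derivative of the weights, multiplied by \<open>U\<close>, out of the \<open>x\<^sub>2\<close>-derivative, where
  \<open>A\<close> could not control it. In the \<open>x\<^sub>2\<close>-derivative Jensen's inequality and the doubling property of \<open>A\<close> provide a convergent
  majorant. In the \<open>x\<^sub>1\<close>-derivative the inequality \<open>f\<^sub>1(x + t) \<le> f\<^sub>1(x) + f\<^sub>1\<^sup>\<infinity>(t)\<close> charges the measures with at
  most their recession energy, because smearing preserves mass.

  Both parts use that \<open>K\<close> can be evaluated with arbitrary representatives (lemma \<open>K_functional_eq\<close>). This
  rests on the uniqueness of the Lebesgue decomposition and on the fact that the Gauss-Green formula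
  determines the trace times the normal almost everywhere on the boundary; the latter needs that the
  normal is measurable and that Hausdorff measure is regular.
\<close>

text \<open>The integration lemmas of these names refer to the Lebesgue integral throughout.\<close>

lemmas integrable_add = Bochner_Integration.integrable_add
lemmas integrable_bound = Bochner_Integration.integrable_bound
lemmas integrable_diff = Bochner_Integration.integrable_diff
lemmas integrable_sum = Bochner_Integration.integrable_sum
lemmas integral_add = Bochner_Integration.integral_add
lemmas integral_cong = Bochner_Integration.integral_cong
lemmas integral_diff = Bochner_Integration.integral_diff
lemmas integral_mult_right_zero = Bochner_Integration.integral_mult_right_zero
lemmas integral_nonneg = Bochner_Integration.integral_nonneg
lemmas integral_sum = Bochner_Integration.integral_sum

section \<open>Smooth functions and mollification\<close>

lemma integrable_abs_le:
 fixes f g :: "'a => real"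
 assumes g: "integrable M g" and f: "f \<in> borel_measurable M" and le: "!!x. x \<in> space M ==> \<bar>f x\<bar> \<le> g x"
 shows "integrable M f"
proof (rule integrable_bound[OF g f], rule AE_I2)
 fix x assume "x \<in> space M"
 from le[OF this] show "norm (f x) \<le> norm (g x)" unfolding real_norm_def by linarith
qed

lemma integrable_mult_bounded:
 fixes f \<phi> :: "'a => real"
 assumes f: "integrable M f" and \<phi>: "\<phi> \<in> borel_measurable M" "!!x. x \<in> space M ==> \<bar>\<phi> x\<bar> \<le> C"
 shows "integrable M (%x. \<phi> x * f x)"
proof (rule integrable_abs_le)
 show "integrable M (%x. C * abs (f x))" using f by simp
 show "(%x. \<phi> x * f x) \<in> borel_measurable M" using \<phi>(1) f by auto
 show "\<bar>\<phi> x * f x\<bar> \<le> C * abs (f x)" if "x \<in> space M" for x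
  unfolding abs_mult using \<phi>(2)[OF that] by (rule mult_right_mono) simp
qed

lemma partial_deriv_eq:
 "(\<phi> has_derivative D) (at x) ==> partial_deriv e \<phi> x = D e"
 unfolding partial_deriv_def by (simp add: frechet_derivative_at[symmetric])

lemma C_k_has_derivative:
 assumes "C_k (Suc k) \<phi>"
 shows "(\<phi> has_derivative (%h. fst h * partial_deriv e1 \<phi> x + snd h * partial_deriv e2 \<phi> x)) (at x)"
proof -
 have d: "(\<phi> has_derivative frechet_derivative \<phi> (at x)) (at x)"
  using assms unfolding C_k.simps frechet_derivative_works by blast
 interpret linear "frechet_derivative \<phi> (at x)"
  using d has_derivative_linear by blast
 have "frechet_derivative \<phi> (at x) h = fst h * partial_deriv e1 \<phi> x + snd h * partial_deriv e2 \<phi> x" for h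
 proof -
  have "h = fst h *\<^sub>R e1 + snd h *\<^sub>R e2" by (cases h) auto
  then have "frechet_derivative \<phi> (at x) h = frechet_derivative \<phi> (at x) (fst h *\<^sub>R e1 + snd h *\<^sub>R e2)" by simp
  also have "... = fst h * partial_deriv e1 \<phi> x + snd h * partial_deriv e2 \<phi> x"
   by (simp only: add scale partial_deriv_def real_scaleR_def)
  finally show ?thesis .
 qed
 then have "frechet_derivative \<phi> (at x) = (%h. fst h * partial_deriv e1 \<phi> x + snd h * partial_deriv e2 \<phi> x)" by blast
 then show ?thesis using d by simp
qed

text \<open>The class is defined through the library derivative; this rule lets a candidate for the derivative be verified
 instead.\<close>

lemma C_k_SucI:
 assumes "!!x. (\<phi> has_derivative (%h. fst h * g1 x + snd h * g2 x)) (at x)"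
  and "C_k k g1" and "C_k k g2"
 shows "C_k (Suc k) \<phi>"
proof -
 have "partial_deriv e1 \<phi> = g1" "partial_deriv e2 \<phi> = g2"
  using partial_deriv_eq[OF assms(1)] by auto
 then show ?thesis using assms by (auto simp: differentiable_def)
qed

lemma C_k_Suc_imp: "C_k (Suc k) \<phi> ==> C_k k \<phi>"
proof (induction k arbitrary: \<phi>)
 case 0
 then show ?case
  by (auto simp: continuous_on_eq_continuous_within intro: differentiable_imp_continuous_within)
next
 case (Suc k)
 then show ?case by (metis C_k.simps(2))
qed

lemma C_k_continuous: "C_k k \<phi> ==> continuous_on UNIV \<phi>"
proof (induction k)
 case (Suc k) then show ?case using C_k_Suc_imp by blast
qed simp

lemma C_k_add: "C_k k \<phi> ==> C_k k ps ==> C_k k (%x. \<phi> x + ps x)"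
proof (induction k arbitrary: \<phi> ps)
 case 0 then show ?case by (auto intro: continuous_intros)
next
 case (Suc k)
 show ?case
 proof (rule C_k_SucI)
  show "((%x. \<phi> x + ps x) has_derivative (%h. fst h * (partial_deriv e1 \<phi> x + partial_deriv e1 ps x)
    + snd h * (partial_deriv e2 \<phi> x + partial_deriv e2 ps x))) (at x)" for x
   using has_derivative_add[OF C_k_has_derivative[OF Suc.prems(1)] C_k_has_derivative[OF Suc.prems(2)], of x]
   by (simp add: algebra_simps)
 qed (use Suc in auto)
qed

lemma C_k_const: "C_k k (%x. c)"
proof (induction k arbitrary: c)
 case 0 then show ?case by simp
next
 case (Suc k)
 show ?case by (rule C_k_SucI[of _ "%_. 0" "%_. 0"]) (use Suc in "auto intro!: derivative_eq_intros")
qed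

lemma C_k_mult: "C_k k \<phi> ==> C_k k ps ==> C_k k (%x. \<phi> x * ps x)"
proof (induction k arbitrary: \<phi> ps)
 case 0 then show ?case by (auto intro: continuous_intros)
next
 case (Suc k)
 show ?case
 proof (rule C_k_SucI)
  show "((%x. \<phi> x * ps x) has_derivative (%h. fst h * (\<phi> x * partial_deriv e1 ps x + partial_deriv e1 \<phi> x * ps x)
    + snd h * (\<phi> x * partial_deriv e2 ps x + partial_deriv e2 \<phi> x * ps x))) (at x)" for x
   using has_derivative_mult[OF C_k_has_derivative[OF Suc.prems(1)] C_k_has_derivative[OF Suc.prems(2)], of x]
   by (simp add: algebra_simps)
 qed (use Suc.IH Suc.prems C_k_Suc_imp[OF Suc.prems(1)] C_k_Suc_imp[OF Suc.prems(2)] in "auto intro!: C_k_add")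
qed

lemma C_k_cmult: "C_k k \<phi> ==> C_k k (%x. c * \<phi> x)"
 by (rule C_k_mult[OF C_k_const])

lemma C_k_sum: "(!!i. i \<in> I ==> C_k k (\<phi> i)) ==> C_k k (%x. \<Sum>i\<in>I. \<phi> i x)"
proof (induction I rule: infinite_finite_induct)
 case (infinite A) then show ?case using C_k_const[of k 0] by simp
next
 case empty then show ?case using C_k_const[of k 0] by simp
next
 case (insert i I) then show ?case by (auto intro!: C_k_add)
qed

text \<open>Derivatives of \<open>exp (-1/t)\<close> are polynomials in \<open>1/t\<close> times \<open>exp (-1/t)\<close>; the family is
 closed under differentiation and vanishes to infinite order at \<open>0\<close>.\<close>

definition flat :: "real poly => real => real" where
 "flat p t = (if t \<le> 0 then 0 else poly p (1 / t) * exp (- (1 / t)))"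

lemma tendsto_poly_exp_neg: "((%s::real. poly p s * exp (- s)) \<longlongrightarrow> 0) at_top"
proof -
 have 1: "((%s::real. coeff p i * (s ^ i / exp s)) \<longlongrightarrow> 0) at_top" for i
  using tendsto_mult_right_zero[OF tendsto_power_div_exp_0[of i], of "coeff p i"] .
 have "((%s::real. \<Sum>i\<le>degree p. coeff p i * (s ^ i / exp s)) \<longlongrightarrow> 0) at_top"
  using tendsto_sum[of "{..degree p}" "%i s. coeff p i * (s ^ i / exp s)" "%_. 0" at_top] 1 by simp
 then show ?thesis
  by (simp add: poly_altdef sum_distrib_right exp_minus divide_inverse mult.assoc)
qed

lemma flat_has_derivative:
 "(flat p has_real_derivative flat ([:0, 0, 1:] * (p - pderiv p)) t) (at t)"
proof -
 consider "t < 0" | "t > 0" | "t = 0" by linarith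
 then show ?thesis
 proof cases
  case 1
  have "((%_. 0) has_real_derivative 0) (at t)" by simp
  then have "(flat p has_real_derivative 0) (at t)"
   by (rule has_field_derivative_transform_within_open[of _ _ _ "{..<0}"])
     (use 1 in "auto simp: flat_def")
  then show ?thesis using 1 by (simp add: flat_def)
 next
  case 2
  have "((%t. poly p (1 / t) * exp (- (1 / t))) has_real_derivative
    flat ([:0, 0, 1:] * (p - pderiv p)) t) (at t)"
   using 2 by (auto intro!: derivative_eq_intros poly_DERIV[THEN DERIV_chain2]
     simp: flat_def field_simps power2_eq_square)
  then show ?thesis
   by (rule has_field_derivative_transform_within_open[of _ _ _ "{0<..}"])
     (use 2 in "auto simp: flat_def")
 next
  case 3
  have r: "((%h. flat p h / h) \<longlongrightarrow> 0) (at_right 0)"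
  proof -
   have "((%s::real. poly ([:0,1:] * p) s * exp (- s)) \<longlongrightarrow> 0) at_top"
    by (rule tendsto_poly_exp_neg)
   then have "((%h::real. poly ([:0,1:] * p) (inverse h) * exp (- inverse h)) \<longlongrightarrow> 0) (at_right 0)"
    using filterlim_inverse_at_top_right by (rule filterlim_compose)
   then show ?thesis
    by (rule Lim_transform_eventually)
      (auto simp: flat_def eventually_at_right_field field_simps intro!: exI[of _ 1])
  qed
  have l: "((%h. flat p h / h) \<longlongrightarrow> 0) (at_left 0)"
   by (rule Lim_transform_eventually[of "%_. 0"])
     (auto simp: flat_def eventually_at_left_field intro!: exI[of _ "-1"])
  have "((%h. flat p h / h) \<longlongrightarrow> 0) (at 0)" using l r filterlim_split_at by blast
  then have "(flat p has_real_derivative 0) (at 0)"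
   by (simp add: DERIV_def flat_def)
  then show ?thesis using 3 by (simp add: flat_def)
 qed
qed

lemma C_k_flat: "C_k k (%x. flat p (a * fst x + b * snd x + c))"
proof (induction k arbitrary: p)
 case 0
 have "continuous_on UNIV (flat p)"
  using flat_has_derivative DERIV_isCont by (metis continuous_at_imp_continuous_on)
 then show ?case
  by (auto intro!: continuous_intros continuous_on_compose2[of UNIV "flat p"])
next
 case (Suc k)
 let ?q = "[:0, 0, 1:] * (p - pderiv p)"
 show ?case
 proof (rule C_k_SucI)
  fix x :: plane
  have 1: "((%x::plane. a * fst x + b * snd x + c) has_derivative (%h. a * fst h + b * snd h)) (at x)"
   by (auto intro!: derivative_eq_intros)
  have 2: "(flat p has_derivative (*) (flat ?q (a * fst x + b * snd x + c))) (at (a * fst x + b * snd x + c))"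
   using flat_has_derivative has_field_derivative_def by blast
  show "((%x. flat p (a * fst x + b * snd x + c)) has_derivative
    (%h. fst h * (a * flat ?q (a * fst x + b * snd x + c)) + snd h * (b * flat ?q (a * fst x + b * snd x + c)))) (at x)"
   using has_derivative_compose[OF 1 2] by (simp add: algebra_simps)
 qed (auto intro!: C_k_cmult Suc)
qed

lemma test_functions_UNIV_iff:
 "\<phi> \<in> test_functions UNIV \<longleftrightarrow> (\<forall>k. C_k k \<phi>) \<and> bounded {x. \<phi> x \<noteq> 0}"
 unfolding test_functions_def by (auto simp: compact_closure)

lemma test_functions_mono: "O1 \<subseteq> O2 ==> test_functions O1 \<subseteq> test_functions O2"
 unfolding test_functions_def by auto

lemma partial_support: "{x. partial_deriv e \<phi> x \<noteq> 0} \<subseteq> closure {x. \<phi> x \<noteq> 0}"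
proof -
 have "partial_deriv e \<phi> x = 0" if "x \<notin> closure {x. \<phi> x \<noteq> 0}" for x
 proof -
  have "((%_. 0) has_derivative (%_. 0)) (at x)" by simp
  then have "(\<phi> has_derivative (%_. 0)) (at x)"
   by (rule has_derivative_transform_within_open[of _ _ _ _ "- closure {x. \<phi> x \<noteq> 0}"])
     (use that closure_subset[of "{x. \<phi> x \<noteq> 0}"] in auto)
  from partial_deriv_eq[OF this] show ?thesis by simp
 qed
 then show ?thesis by auto
qed

lemma test_partial:
 assumes "\<phi> \<in> test_functions UNIV" and "e = e1 \<or> e = e2"
 shows "partial_deriv e \<phi> \<in> test_functions UNIV"
proof -
 have c: "C_k (Suc k) \<phi>" for k using assms(1) by (auto simp: test_functions_UNIV_iff)
 have "bounded (closure {x. \<phi> x \<noteq> 0})"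
  using assms(1) by (auto simp: test_functions_UNIV_iff)
 then have "bounded {x. partial_deriv e \<phi> x \<noteq> 0}" using partial_support bounded_subset by metis
 then show ?thesis using c assms(2) by (auto simp: test_functions_UNIV_iff)
qed

lemma compact_support_bounded:
 fixes \<phi> :: "plane => real"
 assumes "continuous_on UNIV \<phi>" and "bounded {x. \<phi> x \<noteq> 0}"
 obtains B where "B > 0" and "!!x. \<bar>\<phi> x\<bar> \<le> B"
proof -
 let ?K = "closure {x. \<phi> x \<noteq> 0}"
 have "compact (\<phi> ` ?K)"
  using assms by (intro compact_continuous_image) (auto intro: continuous_on_subset)
 then obtain B where B: "!!y. y \<in> \<phi> ` ?K ==> norm y \<le> B" by (meson compact_imp_bounded bounded_iff)
 have "\<bar>\<phi> x\<bar> \<le> max B 1" for x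
 proof (cases "\<phi> x = 0")
  case False
  then have "x \<in> ?K" using closure_subset by force
  then show ?thesis using B[of "\<phi> x"] by auto
 qed auto
 then show ?thesis using that[of "max B 1"] by auto
qed

lemma plane_linear_bound:
 fixes h :: plane shows "\<bar>fst h * a + snd h * b\<bar> \<le> norm h * (abs a + abs b)"
proof -
 have "abs (fst h) \<le> norm h" "abs (snd h) \<le> norm h"
  using norm_fst_le[of "fst h" "snd h"] norm_snd_le[of "snd h" "fst h"] by auto
 then have "abs (fst h) * abs a \<le> norm h * abs a" "abs (snd h) * abs b \<le> norm h * abs b"
  by (simp_all add: mult_right_mono)
 moreover have "\<bar>fst h * a + snd h * b\<bar> \<le> abs (fst h) * abs a + abs (snd h) * abs b"
  using abs_triangle_ineq[of "fst h * a" "snd h * b"] by (simp add: abs_mult)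
 ultimately show ?thesis by (simp add: distrib_left)
qed

text \<open>A compactly supported \<open>C\<^sup>1\<close> function has bounded derivatives, hence is Lipschitz by the mean
 value theorem.\<close>

lemma C1_compact_lipschitz:
 assumes c: "C_k (Suc 0) \<phi>" and s: "bounded {x. \<phi> x \<noteq> 0}"
 obtains L where "L > 0" and "!!x y. \<bar>\<phi> y - \<phi> x\<bar> \<le> L * norm (y - x)"
proof -
 have t: "bounded {x. partial_deriv e1 \<phi> x \<noteq> 0}" "bounded {x. partial_deriv e2 \<phi> x \<noteq> 0}"
  using partial_support[of _ \<phi>] s bounded_closure bounded_subset by metis+
 have ct: "continuous_on UNIV (partial_deriv e1 \<phi>)" "continuous_on UNIV (partial_deriv e2 \<phi>)" using c by auto
 obtain B1 where B1: "B1 > 0" "!!x. \<bar>partial_deriv e1 \<phi> x\<bar> \<le> B1"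
  using compact_support_bounded[OF ct(1) t(1)] by metis
 obtain B2 where B2: "B2 > 0" "!!x. \<bar>partial_deriv e2 \<phi> x\<bar> \<le> B2"
  using compact_support_bounded[OF ct(2) t(2)] by metis
 have "\<bar>\<phi> y - \<phi> x\<bar> \<le> (B1 + B2) * norm (y - x)" for x y
 proof -
  have "norm (\<phi> y - \<phi> x) \<le> (B1 + B2) * norm (y - x)"
  proof (rule differentiable_bound[of UNIV])
   show "(\<phi> has_derivative (%h. fst h * partial_deriv e1 \<phi> x + snd h * partial_deriv e2 \<phi> x)) (at x within UNIV)" for x
    using C_k_has_derivative[OF c] by simp
   show "onorm (%h::plane. fst h * partial_deriv e1 \<phi> x + snd h * partial_deriv e2 \<phi> x) \<le> B1 + B2" for x
   proof (rule onorm_bound)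
    show "norm (fst h * partial_deriv e1 \<phi> x + snd h * partial_deriv e2 \<phi> x) \<le> (B1 + B2) * norm h" for h :: plane
     using plane_linear_bound[of h "partial_deriv e1 \<phi> x" "partial_deriv e2 \<phi> x"]
      mult_left_mono[of "\<bar>partial_deriv e1 \<phi> x\<bar> + \<bar>partial_deriv e2 \<phi> x\<bar>" "B1 + B2" "norm h"]
      B1(2)[of x] B2(2)[of x] by (simp add: mult.commute)
   qed (use B1(1) B2(1) in auto)
  qed auto
  then show ?thesis by simp
 qed
 then show ?thesis using that[of "B1 + B2"] B1 B2 by auto
qed

lemma test_lipschitz:
 assumes "\<phi> \<in> test_functions UNIV"
 obtains L where "L > 0" and "!!x y. \<bar>\<phi> y - \<phi> x\<bar> \<le> L * norm (y - x)"
 using C1_compact_lipschitz[of \<phi>] assms by (metis test_functions_UNIV_iff)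

text \<open>The derivatives are themselves test functions, hence Lipschitz; the remainder is therefore quadratic uniformly in
 the base point.\<close>

lemma test_taylor:
 assumes "\<phi> \<in> test_functions UNIV"
 obtains L where "L > 0"
  and "!!x h. \<bar>\<phi> (x + h) - \<phi> x - (fst h * partial_deriv e1 \<phi> x + snd h * partial_deriv e2 \<phi> x)\<bar> \<le> L * (norm h)^2"
proof -
 have t: "partial_deriv e1 \<phi> \<in> test_functions UNIV" "partial_deriv e2 \<phi> \<in> test_functions UNIV"
  using test_partial assms by auto
 obtain L1 where L1: "L1 > 0" "!!x y. \<bar>partial_deriv e1 \<phi> y - partial_deriv e1 \<phi> x\<bar> \<le> L1 * norm (y - x)"
  using test_lipschitz[OF t(1)] by metis
 obtain L2 where L2: "L2 > 0" "!!x y. \<bar>partial_deriv e2 \<phi> y - partial_deriv e2 \<phi> x\<bar> \<le> L2 * norm (y - x)"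
  using test_lipschitz[OF t(2)] by metis
 have c: "C_k (Suc 0) \<phi>" using assms by (auto simp: test_functions_UNIV_iff)
 let ?D = "%x h. fst h * partial_deriv e1 \<phi> x + snd h * partial_deriv e2 \<phi> x"
 have "\<bar>\<phi> (x + h) - \<phi> x - ?D x h\<bar> \<le> (L1 + L2) * (norm h)^2" for x h
 proof -
  have "norm (\<phi> (x + h) - \<phi> x - ?D x (x + h - x)) \<le> norm (x + h - x) * ((L1 + L2) * norm h)"
  proof (rule differentiable_bound_linearization[of _ _ "cball x (norm h)"])
   show "x + t *\<^sub>R (x + h - x) \<in> cball x (norm h)" if "t \<in> {0..1}" for t
    using that by (auto simp: dist_norm mult_left_le_one_le)
   show "(\<phi> has_derivative ?D z) (at z within cball x (norm h))" for z
    using C_k_has_derivative[OF c] has_derivative_at_withinI by blast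
   show "onorm (?D z - ?D x) \<le> (L1 + L2) * norm h" if "z \<in> cball x (norm h)" for z
    unfolding fun_diff_def
   proof (rule onorm_bound)
    fix i :: plane
    have "norm (z - x) \<le> norm h" using that by (simp add: dist_norm norm_minus_commute)
    then have "\<bar>partial_deriv e1 \<phi> z - partial_deriv e1 \<phi> x\<bar> \<le> L1 * norm h"
     "\<bar>partial_deriv e2 \<phi> z - partial_deriv e2 \<phi> x\<bar> \<le> L2 * norm h"
     using L1(2)[of z x] L2(2)[of z x] L1(1) L2(1) mult_left_mono[of "norm (z - x)" "norm h"]
     by (smt (verit))+
    then have "norm i * (\<bar>partial_deriv e1 \<phi> z - partial_deriv e1 \<phi> x\<bar> + \<bar>partial_deriv e2 \<phi> z - partial_deriv e2 \<phi> x\<bar>)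
     \<le> norm i * ((L1 + L2) * norm h)" by (intro mult_left_mono) (auto simp: algebra_simps)
    then show "norm (?D z i - ?D x i) \<le> (L1 + L2) * norm h * norm i"
     using plane_linear_bound[of i "partial_deriv e1 \<phi> z - partial_deriv e1 \<phi> x" "partial_deriv e2 \<phi> z - partial_deriv e2 \<phi> x"]
     by (simp add: algebra_simps)
   qed (use L1(1) L2(1) in auto)
  qed auto
  then show ?thesis by (simp add: power2_eq_square algebra_simps)
 qed
 then show ?thesis using that[of "L1 + L2"] L1 L2 by auto
qed

text \<open>Differentiation under the integral sign: the first order Taylor remainder of the kernel is
 bounded by \<open>L * (norm h)^2\<close> uniformly.\<close>

definition smear :: "'a measure => ('a => plane) => ('a => real) => (plane => real) => plane => real" where
 "smear M T g k x = (LINT y|M. k (x - T y) * g y)"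

lemma smear_integrable:
 fixes k :: "plane => real" and g :: "'a => real"
 assumes "continuous_on UNIV k" and "bounded {x. k x \<noteq> 0}"
  and [measurable]: "T \<in> borel_measurable M" and g: "integrable M g"
 shows "integrable M (%y. k (x - T y) * g y)"
proof -
 obtain B where B: "!!x. \<bar>k x\<bar> \<le> B" using compact_support_bounded[OF assms(1,2)] by metis
 have [measurable]: "k \<in> borel_measurable borel" using assms(1) by (rule borel_measurable_continuous_onI)
 have [measurable]: "g \<in> borel_measurable M" using g by auto
 show ?thesis by (rule integrable_mult_bounded[OF g _ B]) measurable
qed

lemma smear_has_derivative:
 fixes g :: "'a => real"
 assumes k: "k \<in> test_functions UNIV"
  and T: "T \<in> borel_measurable M" and g: "integrable M g"
 shows "(smear M T g k has_derivative
  (%h. fst h * smear M T g (partial_deriv e1 k) x + snd h * smear M T g (partial_deriv e2 k) x)) (at x)"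
proof -
 obtain L where L: "L > 0"
  "!!x h. \<bar>k (x + h) - k x - (fst h * partial_deriv e1 k x + snd h * partial_deriv e2 k x)\<bar> \<le> L * (norm h)^2"
  using test_taylor[OF k] by metis
 have i: "integrable M (%y. q (x - T y) * g y)" if "q \<in> test_functions UNIV" for q x
  using that smear_integrable[OF _ _ T g] C_k_continuous by (metis test_functions_UNIV_iff)
 have ik: "integrable M (%y. k (x - T y) * g y)" "integrable M (%y. partial_deriv e1 k (x - T y) * g y)"
   "integrable M (%y. partial_deriv e2 k (x - T y) * g y)" for x
  using i k test_partial by auto
 let ?G = "\<integral>y. \<bar>g y\<bar> \<partial>M"
 let ?D = "%h. fst h * smear M T g (partial_deriv e1 k) x + snd h * smear M T g (partial_deriv e2 k) x"
 have rem: "\<bar>smear M T g k (x + h) - smear M T g k x - ?D h\<bar> \<le> L * ?G * (norm h)^2" for h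
 proof -
  let ?r = "%y. (k (x - T y + h) - k (x - T y) - (fst h * partial_deriv e1 k (x - T y) + snd h * partial_deriv e2 k (x - T y))) * g y"
  have ih: "integrable M (%y. k (x - T y + h) * g y)" using ik(1)[of "x + h"] by (simp add: algebra_simps)
  have req: "?r = (%y. k (x - T y + h) * g y - k (x - T y) * g y
    - (fst h * (partial_deriv e1 k (x - T y) * g y) + snd h * (partial_deriv e2 k (x - T y) * g y)))"
   by (auto simp: algebra_simps)
  have ir: "integrable M ?r" unfolding req
   by (intro integrable_diff integrable_add integrable_mult_right ih ik)
  have "smear M T g k (x + h) - smear M T g k x - ?D h = (LINT y|M. ?r y)"
   unfolding req smear_def using ih ik by (simp add: algebra_simps)
  then have "\<bar>smear M T g k (x + h) - smear M T g k x - ?D h\<bar> = \<bar>\<integral>y. ?r y \<partial>M\<bar>" by (rule arg_cong)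
  also have "... \<le> (LINT y|M. \<bar>?r y\<bar>)" by (rule integral_abs_bound)
  also have "... \<le> (LINT y|M. L * (norm h)^2 * abs (g y))"
  proof (rule integral_mono)
   show "integrable M (%y. \<bar>?r y\<bar>)" using ir by (rule integrable_abs)
   show "integrable M (%y. L * (norm h)^2 * abs (g y))" using g by simp
   show "abs (?r y) \<le> L * (norm h)^2 * abs (g y)" for y
    unfolding abs_mult by (intro mult_right_mono L) simp
  qed
  finally show ?thesis by (simp add: algebra_simps)
 qed
 have bl: "bounded_linear ?D"
  by (intro bounded_linear_add bounded_linear_mult_const bounded_linear_fst bounded_linear_snd)
 show ?thesis
  unfolding has_derivative_at
 proof (intro conjI bl)
  have G0: "?G \<ge> 0" by simp
  show "(%h. norm (smear M T g k (x + h) - smear M T g k x - ?D h) / norm h) \<midarrow>0\<rightarrow> 0"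
  proof (rule tendsto_sandwich[of "%_. 0" _ _ "%h. L * ?G * norm h"])
   show "\<forall>\<^sub>F h in at 0. norm (smear M T g k (x + h) - smear M T g k x - ?D h) / norm h \<le> L * ?G * norm h"
   proof (rule always_eventually, rule allI)
    fix h :: plane
    show "norm (smear M T g k (x + h) - smear M T g k x - ?D h) / norm h \<le> L * ?G * norm h"
    proof (cases "h = 0")
     case False
     then have "norm h > 0" by simp
     then show ?thesis using rem[of h] by (simp add: pos_divide_le_eq power2_eq_square algebra_simps)
    qed simp
   qed
   show "((%h. L * ?G * norm h) \<longlongrightarrow> 0) (at (0::plane))"
    using tendsto_mult_right_zero[OF tendsto_norm_zero[OF tendsto_ident_at[of "0::plane" UNIV]], of "L * ?G"]
    by simp
  qed auto
 qed
qed

lemma smear_C_k: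
 assumes "k \<in> test_functions UNIV" and "T \<in> borel_measurable M" and "integrable M g"
 shows "C_k n (smear M T g k)"
 using assms(1)
proof (induction n arbitrary: k)
 case 0
 have "isCont (smear M T g k) x" for x
  using smear_has_derivative[OF 0 assms(2,3)] has_derivative_continuous by blast
 then show ?case by (simp add: continuous_at_imp_continuous_on)
next
 case (Suc n)
 show ?case
  by (rule C_k_SucI[OF smear_has_derivative[OF Suc.prems assms(2,3)]]) (use Suc test_partial in auto)
qed

text \<open>A kernel supported in the unit square, to be normalized below.\<close>

definition bump :: "plane => real" where
 "bump x = flat 1 (- fst x + 1/2) * flat 1 (fst x + 1/2) * (flat 1 (- snd x + 1/2) * flat 1 (snd x + 1/2))"

lemma bump_nonneg: "bump x \<ge> 0"
 by (auto simp: bump_def flat_def)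

lemma bump_supp:
 assumes "bump x \<noteq> 0" shows "norm x < 1"
proof -
 have p: "t > 0 \<longleftrightarrow> flat 1 t \<noteq> 0" for t by (simp add: flat_def)
 have "- fst x + 1/2 > 0 \<and> fst x + 1/2 > 0 \<and> - snd x + 1/2 > 0 \<and> snd x + 1/2 > 0"
  using assms unfolding bump_def p by simp
 then have 1: "abs (fst x) < 1/2" "abs (snd x) < 1/2" by linarith+
 have "norm x \<le> norm (fst x) + norm (snd x)" using norm_Pair_le[of "fst x" "snd x"] by simp
 then show ?thesis using 1 by simp
qed

lemma bump_test: "bump \<in> test_functions UNIV"
proof -
 have "C_k k bump" for k
 proof -
  have "C_k k (%x. flat 1 ((-1) * fst x + 0 * snd x + 1/2) * flat 1 (1 * fst x + 0 * snd x + 1/2)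
   * (flat 1 (0 * fst x + (-1) * snd x + 1/2) * flat 1 (0 * fst x + 1 * snd x + 1/2)))"
   by (intro C_k_mult C_k_flat)
  then show ?thesis by (simp add: bump_def[abs_def])
 qed
 moreover have "bounded {x. bump x \<noteq> 0}"
  unfolding bounded_iff using bump_supp less_imp_le by blast
 ultimately show ?thesis by (simp add: test_functions_UNIV_iff)
qed

lemma test_scale:
 assumes "\<phi> \<in> test_functions UNIV" and "a > 0"
 shows "(%x. c * \<phi> (a *\<^sub>R x)) \<in> test_functions UNIV"
proof -
 have "C_k k (%x. c * \<phi> (a *\<^sub>R x))" if "C_k k \<phi>" for k \<phi> c using that
 proof (induction k arbitrary: \<phi> c)
  case 0 then show ?case by (auto intro!: continuous_intros continuous_on_compose2[of UNIV \<phi>])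
 next
  case (Suc k)
  show ?case
  proof (rule C_k_SucI)
   fix x :: plane
   have 1: "((%x::plane. a *\<^sub>R x) has_derivative (%h. a *\<^sub>R h)) (at x)" by (auto intro!: derivative_eq_intros)
   show "((%x. c * \<phi> (a *\<^sub>R x)) has_derivative (%h. fst h * ((c * a) * partial_deriv e1 \<phi> (a *\<^sub>R x))
     + snd h * ((c * a) * partial_deriv e2 \<phi> (a *\<^sub>R x)))) (at x)"
    using has_derivative_mult_right[OF has_derivative_compose[OF 1 C_k_has_derivative[OF Suc.prems]], of c]
    by (simp add: algebra_simps)
  qed (use Suc in auto)
 qed
 moreover have "bounded {x. c * \<phi> (a *\<^sub>R x) \<noteq> 0}"
 proof -
  have "{x. c * \<phi> (a *\<^sub>R x) \<noteq> 0} \<subseteq> (%x. (1/a) *\<^sub>R x) ` {x. \<phi> x \<noteq> 0}"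
   using assms(2) by (force intro: image_eqI[of _ _ "a *\<^sub>R _"])
  then show ?thesis using assms(1) by (auto simp: test_functions_UNIV_iff intro: bounded_subset bounded_scaling)
 qed
 ultimately show ?thesis using assms by (auto simp: test_functions_UNIV_iff)
qed

lemma integrable_lborel_compact_support:
 fixes F :: "plane => real"
 assumes "continuous_on UNIV F" and "bounded {x. F x \<noteq> 0}"
 shows "integrable lborel F"
proof -
 obtain B where B: "!!x. \<bar>F x\<bar> \<le> B" using compact_support_bounded[OF assms] by metis
 obtain R where R: "{x. F x \<noteq> 0} \<subseteq> cball 0 R"
  using bounded_subset_ballD[OF assms(2), of 0] ball_subset_cball by (meson order_trans)
 show ?thesis
 proof (rule integrable_abs_le)
  show "integrable lborel (%x. B * indicator (cball (0::plane) R) x)"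
   using emeasure_lborel_cball_finite[of "0::plane" R]
   by (intro integrable_mult_right integrable_real_indicator) auto
  show "abs (F x) \<le> B * indicator (cball 0 R) x" for x
   using R B[of x] by (cases "F x = 0") (auto simp: indicator_def)
 qed (use borel_measurable_continuous_onI[OF assms(1)] in simp)
qed

lemma test_integrable: "\<phi> \<in> test_functions UNIV ==> integrable lborel \<phi>"
 using C_k_continuous by (intro integrable_lborel_compact_support) (auto simp: test_functions_UNIV_iff)

lemma bump_integral_pos: "(LBINT x. bump x) > 0"
proof -
 have i: "integrable lborel bump" using test_integrable[OF bump_test] .
 have [measurable]: "bump \<in> borel_measurable borel" using i by auto
 have "(LBINT x. bump x) \<noteq> 0"
 proof
  assume "(LBINT x. bump x) = 0"
  then have "AE x in lborel. bump x = 0"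
   using integral_nonneg_eq_0_iff_AE[OF i] bump_nonneg by simp
  then have "emeasure lborel {x. bump x \<noteq> 0} = 0" by (subst (asm) AE_iff_measurable[of "{x. bump x \<noteq> 0}"]) auto
  then have "{x. bump x \<noteq> 0} \<in> null_sets lebesgue" by (auto intro: null_sets_completionI)
  moreover have "open {x. bump x \<noteq> 0}"
   using bump_test C_k_continuous[of 0 bump] by (intro open_Collect_neq) (auto simp: test_functions_UNIV_iff)
  moreover have "{x. bump x \<noteq> 0} \<noteq> {}"
  proof -
   have "bump 0 \<noteq> 0" by (simp add: bump_def flat_def)
   then show ?thesis by blast
  qed
  ultimately show False using open_not_negligible[of "{x. bump x \<noteq> 0}"] negligible_iff_null_sets[of "{x. bump x \<noteq> 0}"] by blast
 qed
 moreover have "(LBINT x. bump x) \<ge> 0" using bump_nonneg by simp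
 ultimately show ?thesis by linarith
qed

definition mollifier :: "real => plane => real" where
 "mollifier eps x = bump ((1 / eps) *\<^sub>R x) / (eps^2 * (LBINT x. bump x))"

lemma mollifier_test: "eps > 0 ==> mollifier eps \<in> test_functions UNIV"
 using test_scale[OF bump_test, of "1 / eps" "1 / (eps^2 * (LBINT x. bump x))"]
 by (simp add: mollifier_def[abs_def])

lemma mollifier_nonneg: "mollifier eps x \<ge> 0"
 using bump_integral_pos bump_nonneg by (auto simp: mollifier_def)

lemma mollifier_supp: "eps > 0 ==> mollifier eps x \<noteq> 0 ==> norm x < eps"
 using bump_supp[of "(1 / eps) *\<^sub>R x"] by (auto simp: mollifier_def field_simps)

lemma mollifier_measurable [measurable]: "eps > 0 ==> mollifier eps \<in> borel_measurable borel"
 using test_integrable[OF mollifier_test] by auto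

lemma mollifier_integrable: "eps > 0 ==> integrable lborel (mollifier eps)"
 by (rule test_integrable[OF mollifier_test])

lemma mollifier_integral:
 assumes "eps > 0" shows "(LBINT x. mollifier eps x) = 1"
proof -
 have i: "integrable lborel (mollifier 1)" by (rule mollifier_integrable) simp
 have "(LBINT x. mollifier 1 x) = 1"
  using bump_integral_pos by (simp add: mollifier_def)
 moreover have "mollifier eps x = mollifier 1 ((1/eps) *\<^sub>R x) / eps^2" for x
  by (simp add: mollifier_def)
 moreover have "(LBINT x. mollifier 1 ((1/eps) *\<^sub>R x)) = eps^2 * (LBINT x. mollifier 1 x)"
 proof -
  have "(lborel :: plane measure) = density (distr lborel borel (%x. 0 + (1/eps) *\<^sub>R x)) (%_. ennreal (\<bar>1/eps\<bar> ^ DIM(plane)))"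
   using assms by (intro lborel_affine) auto
  then have "(LBINT x. mollifier 1 x) =
   (LINT x|density (distr lborel borel (%x. 0 + (1/eps) *\<^sub>R x)) (%_. ennreal (\<bar>1/eps\<bar> ^ DIM(plane))). mollifier 1 x)" by simp
  also have "... = (\<bar>1/eps\<bar> ^ DIM(plane)) * (LBINT x. mollifier 1 ((1/eps) *\<^sub>R x))"
   by (subst integral_real_density) (auto simp: integral_distr)
  finally show ?thesis using assms by (simp add: field_simps power2_eq_square)
 qed
 ultimately show ?thesis using assms by simp
qed

declare split_paired_All [simp del] split_paired_Ex [simp del]

section \<open>Integration by parts and Lebesgue integrals over a set\<close>

lemma integral_lborel_reflect:
 fixes F :: "plane => real"
 assumes [measurable]: "F \<in> borel_measurable borel"
 shows "(LBINT y. F (x - y)) = (LBINT y. F y)"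
proof -
 have "(lborel :: plane measure) = density (distr lborel borel (%y. x + (-1) *\<^sub>R y)) (%_. ennreal (\<bar>-1\<bar> ^ DIM(plane)))"
  by (rule lborel_affine) simp
 then have "(lborel :: plane measure) = distr lborel borel (%y. x - y)"
  by (simp add: density_1)
 then have "(LBINT y. F y) = (LINT y|distr lborel borel (%y. x - y). F y)" by simp
 also have "... = (LBINT y. F (x - y))" by (rule integral_distr) auto
 finally show ?thesis by simp
qed

lemma integral_lborel_translate:
 fixes F :: "plane => real"
 assumes [measurable]: "F \<in> borel_measurable borel"
 shows "(LBINT y. F (y + x)) = (LBINT y. F y)"
proof -
 have "(LBINT y. F (y + x)) = (LBINT y. (%z. F (x - z)) (0 - y))" by (simp add: add.commute)
 also have "... = (LBINT y. F y)"
  using integral_lborel_reflect[of "%z. F (x - z)" 0] integral_lborel_reflect[of F x] by simp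
 finally show ?thesis .
qed

text \<open>The integral of a derivative vanishes: difference quotients have integral zero by translation
 invariance, and they converge boundedly.\<close>

lemma integral_partial_deriv_zero:
 assumes c: "C_k (Suc 0) F" and s: "bounded {x. F x \<noteq> 0}" and e: "e = e1 \<or> e = e2"
 shows "(LBINT x. partial_deriv e F x) = 0"
proof -
 have cF: "continuous_on UNIV F" using C_k_continuous c by blast
 have [measurable]: "F \<in> borel_measurable borel" using cF by (rule borel_measurable_continuous_onI)
 have iF: "integrable lborel F" by (rule integrable_lborel_compact_support[OF cF s])
 have iFt: "integrable lborel (%x. F (x + a))" for a
 proof (rule integrable_lborel_compact_support)
  show "continuous_on UNIV (%x. F (x + a))"
   by (rule continuous_on_compose2[OF cF]) (auto intro: continuous_intros)
  have "{x. F (x + a) \<noteq> 0} \<subseteq> (%x. - a + x) ` {x. F x \<noteq> 0}"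
   by (force intro: image_eqI[of _ _ "_ + a"])
  then show "bounded {x. F (x + a) \<noteq> 0}" using s bounded_subset bounded_translation by metis
 qed
 obtain L where L: "L > 0" "!!x y. \<bar>F y - F x\<bar> \<le> L * norm (y - x)"
  using C1_compact_lipschitz[OF c s] by metis
 have ne: "norm e = 1" using e by auto
 define h where "h n = 1 / real (Suc n)" for n
 have h: "h n > 0" "h n \<le> 1" for n by (auto simp: h_def)
 have hl: "h \<longlonglongrightarrow> 0" unfolding h_def by (rule LIMSEQ_Suc[OF lim_1_over_n])
 obtain R where R: "{x. F x \<noteq> 0} \<subseteq> ball 0 R" using bounded_subset_ballD[OF s, of 0] by blast
 define q where "q n x = (F (x + h n *\<^sub>R e) - F x) / h n" for n x
 have q0: "(LBINT x. q n x) = 0" for n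
  unfolding q_def using iF iFt integral_lborel_translate[of F "h n *\<^sub>R e"] by simp
 have "(%n. \<integral>x. q n x \<partial>lborel) \<longlonglongrightarrow> (LBINT x. partial_deriv e F x)"
 proof (rule integral_dominated_convergence[where w="%x. L * indicator (cball 0 (R + 1)) x"])
  show "integrable lborel (%x. L * indicator (cball (0::plane) (R + 1)) x)"
   using emeasure_lborel_cball_finite[of "0::plane" "R + 1"]
   by (intro integrable_mult_right integrable_real_indicator) auto
  show "q n \<in> borel_measurable lborel" for n unfolding q_def by measurable
  have "continuous_on UNIV (partial_deriv e F)" using c e by auto
  then show "partial_deriv e F \<in> borel_measurable lborel" by (simp add: borel_measurable_continuous_onI)
  show "AE x in lborel. (%n. q n x) \<longlonglongrightarrow> partial_deriv e F x"
  proof (rule always_eventually, rule allI)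
   fix x
   have d: "(F has_derivative (%h. fst h * partial_deriv e1 F x + snd h * partial_deriv e2 F x)) (at x)"
    by (rule C_k_has_derivative[OF c])
   have 1: "((%t::real. x + t *\<^sub>R e) has_derivative (%t. t *\<^sub>R e)) (at 0)" by (auto intro!: derivative_eq_intros)
   have "((%t. F (x + t *\<^sub>R e)) has_derivative (%t. fst (t *\<^sub>R e) * partial_deriv e1 F x + snd (t *\<^sub>R e) * partial_deriv e2 F x)) (at 0)"
    by (rule has_derivative_compose[OF 1, of F]) (use d in simp)
   moreover have "(%t. fst (t *\<^sub>R e) * partial_deriv e1 F x + snd (t *\<^sub>R e) * partial_deriv e2 F x) = (*) (partial_deriv e F x)"
    using e by (auto simp: fun_eq_iff)
   ultimately have "((%t. F (x + t *\<^sub>R e)) has_real_derivative partial_deriv e F x) (at 0)"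
    by (simp add: has_field_derivative_def)
   then have "(%t. (F (x + t *\<^sub>R e) - F x) / t) \<midarrow>0\<rightarrow> partial_deriv e F x"
    by (simp add: DERIV_def)
   moreover have "filterlim h (at 0) sequentially"
    using hl h by (auto simp: filterlim_at less_imp_neq[symmetric])
   ultimately show "(%n. q n x) \<longlonglongrightarrow> partial_deriv e F x"
    unfolding q_def by (rule filterlim_compose)
  qed
  show "AE x in lborel. norm (q n x) \<le> L * indicator (cball 0 (R + 1)) x" for n
  proof (rule always_eventually, rule allI)
   fix x
   show "norm (q n x) \<le> L * indicator (cball 0 (R + 1)) x"
   proof (cases "norm x \<le> R + 1")
    case True
    have "\<bar>F (x + h n *\<^sub>R e) - F x\<bar> \<le> L * h n"
     using L(2)[of x "x + h n *\<^sub>R e"] h[of n] ne by simp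
    then show ?thesis using True h[of n] by (simp add: q_def divide_le_eq)
   next
    case False
    have "norm (h n *\<^sub>R e) \<le> 1" using h[of n] ne by simp
    then have "norm (x + h n *\<^sub>R e) > R" "norm x > R"
     using False norm_triangle_ineq4[of "x + h n *\<^sub>R e" "h n *\<^sub>R e"] by auto
    moreover have "F z = 0" if "norm z > R" for z
    proof (rule ccontr)
     assume "F z \<noteq> 0"
     then have "z \<in> ball 0 R" using R by blast
     then show False using that by simp
    qed
    ultimately have "F (x + h n *\<^sub>R e) = 0" "F x = 0" by blast+
    then show ?thesis using L(1) by (simp add: q_def)
   qed
  qed
 qed
 then have "(%n. 0) \<longlonglongrightarrow> (LBINT x. partial_deriv e F x)" by (simp only: q0)
 then show ?thesis using LIMSEQ_unique tendsto_const by metis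
qed

lemma integral_by_parts:
 assumes c: "C_k (Suc 0) ps" "C_k (Suc 0) \<phi>" and s: "bounded {x. ps x \<noteq> 0}" and e: "e = e1 \<or> e = e2"
 shows "(LBINT x. ps x * partial_deriv e \<phi> x) = - (LBINT x. partial_deriv e ps x * \<phi> x)"
proof -
 let ?F = "%x. ps x * \<phi> x"
 have cF: "C_k (Suc 0) ?F" by (rule C_k_mult[OF c])
 have cc: "continuous_on UNIV ps" "continuous_on UNIV \<phi>" using c C_k_continuous by blast+
 have cp: "continuous_on UNIV (partial_deriv e ps)" "continuous_on UNIV (partial_deriv e \<phi>)" using c e by auto
 have "bounded {x. ?F x \<noteq> 0}" using s by (rule bounded_subset) auto
 from integral_partial_deriv_zero[OF cF this e]
 have 0: "(LBINT x. partial_deriv e ?F x) = 0" .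
 have p: "partial_deriv e ?F x = ps x * partial_deriv e \<phi> x + partial_deriv e ps x * \<phi> x" for x
  using partial_deriv_eq[OF has_derivative_mult[OF C_k_has_derivative[OF c(1)] C_k_has_derivative[OF c(2)]], of e x] e
  by auto
 have i1: "integrable lborel (%x. ps x * partial_deriv e \<phi> x)"
  by (rule integrable_lborel_compact_support)
    (use cc cp s in "auto intro!: continuous_intros intro: bounded_subset")
 have "bounded {x. partial_deriv e ps x \<noteq> 0}" using s partial_support bounded_closure bounded_subset by metis
 then have i2: "integrable lborel (%x. partial_deriv e ps x * \<phi> x)"
  by (intro integrable_lborel_compact_support)
    (use cc cp in "auto intro!: continuous_intros intro: bounded_subset")
 show ?thesis using 0 i1 i2 by (simp add: p)
qed

lemma integral_lebesgue_on_eq: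
 fixes F :: "plane => real"
 assumes "S \<in> sets borel" and "F \<in> borel_measurable borel" and "!!x. x \<notin> S ==> F x = 0"
 shows "(LINT x|lebesgue_on S. F x) = (LBINT x. F x)"
  and "integrable (lebesgue_on S) F \<longleftrightarrow> integrable lborel F"
proof -
 have S: "S \<inter> space lebesgue \<in> sets lebesgue" using assms(1) by simp
 have eq: "(%x. indicat_real S x *\<^sub>R F x) = F" using assms(3) by (auto simp: indicator_def fun_eq_iff)
 have F: "F \<in> borel_measurable lborel" using assms(2) by simp
 show "(LINT x|lebesgue_on S. F x) = (LBINT x. F x)"
  unfolding integral_restrict_space[OF S] eq by (rule integral_completion[OF F])
 show "integrable (lebesgue_on S) F \<longleftrightarrow> integrable lborel F"
  unfolding integrable_restrict_space[OF S] eq by (rule integrable_completion[OF F])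
qed

lemma AE_lebesgue_on_iff:
 assumes "S \<in> sets borel"
 shows "(AE x in lebesgue_on S. P x) \<longleftrightarrow> (AE x in lborel. x \<in> S --> P x)"
 using assms by (simp add: AE_restrict_space_iff AE_completion_iff)

lemma borel_measurable_lebesgue_on:
 "f \<in> borel_measurable borel ==> f \<in> borel_measurable (lebesgue_on S)" for f :: "plane => real"
 by (rule measurable_restrict_space1, rule measurable_completion) simp

lemma borel_representative:
 fixes f :: "plane => real"
 assumes "f \<in> borel_measurable (lebesgue_on S)" and S [measurable]: "S \<in> sets borel"
 shows "\<exists>g\<in>borel_measurable borel. (\<forall>x. x \<notin> S --> g x = 0) \<and> (AE x in lebesgue_on S. f x = g x)"
proof -
 have "(%x. indicat_real S x *\<^sub>R f x) \<in> borel_measurable lebesgue"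
  using assms borel_measurable_restrict_space_iff[of S lebesgue f] by simp
 then obtain g where [measurable]: "g \<in> borel_measurable lborel"
  and g: "AE x in lborel. indicat_real S x *\<^sub>R f x = g x"
  using completion_ex_borel_measurable_real by blast
 let ?g = "%x. indicator S x * g x"
 have "?g \<in> borel_measurable borel" by measurable
 moreover have "AE x in lebesgue_on S. f x = ?g x"
  unfolding AE_lebesgue_on_iff[OF S] using g by eventually_elim auto
 ultimately show ?thesis by (intro bexI[of _ ?g]) auto
qed

lemma borel_representative_integrable:
 fixes f :: "plane => real"
 assumes f: "integrable (lebesgue_on S) f" and S [measurable]: "S \<in> sets borel"
 shows "\<exists>g\<in>borel_measurable borel. integrable lborel g \<and> (\<forall>x. x \<notin> S --> g x = 0) \<and> (AE x in lebesgue_on S. f x = g x)"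
proof -
 obtain g where g: "g \<in> borel_measurable borel" "\<forall>x. x \<notin> S --> g x = 0" "AE x in lebesgue_on S. f x = g x"
  using borel_representative[OF borel_measurable_integrable[OF f] S] by blast
 have "g \<in> borel_measurable (lebesgue_on S)"
  using g(1) by (rule borel_measurable_lebesgue_on)
 then have "integrable (lebesgue_on S) g" by (rule integrable_cong_AE_imp[OF f _ g(3)])
 then have "integrable lborel g" by (subst (asm) integral_lebesgue_on_eq(2)[OF S g(1)]) (use g(2) in simp)
 then show ?thesis using g by blast
qed

text \<open>Test the difference with the set on which it is positive.\<close>

lemma AE_eq_if_borel_integrals_eq:
 fixes f g :: "plane => real"
 assumes f: "integrable (lebesgue_on S) f" and g: "integrable (lebesgue_on S) g" and S [measurable]: "S \<in> sets borel"
  and eq: "!!B. B \<in> sets borel ==> B \<subseteq> S ==>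
   (LINT x|lebesgue_on S. indicator B x * f x) = (LINT x|lebesgue_on S. indicator B x * g x)"
 shows "AE x in lebesgue_on S. f x = g x"
proof -
 obtain d where d: "d \<in> borel_measurable borel" "integrable lborel d" "\<forall>x. x \<notin> S --> d x = 0"
  "AE x in lebesgue_on S. f x - g x = d x"
  using borel_representative_integrable[OF integrable_diff[OF f g] S] by blast
 note [measurable] = d(1)
 have m: "(indicator B :: plane => real) \<in> borel_measurable (lebesgue_on S)" if "B \<in> sets borel" for B :: "plane set"
  using that by (intro borel_measurable_lebesgue_on) simp
 have ib: "integrable (lebesgue_on S) (%x. indicator B x * k x)" if "B \<in> sets borel" "integrable (lebesgue_on S) k"
  for B and k :: "plane => real"
 proof (rule integrable_bound[OF that(2)])
  show "(%x. indicator B x * k x) \<in> borel_measurable (lebesgue_on S)"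
   using that m[OF that(1)] by (intro borel_measurable_times) auto
 qed (auto simp: indicator_def)
 have z: "(LBINT x. indicator B x * d x) = 0" if B: "B \<in> sets borel" "B \<subseteq> S" for B
 proof -
  have "(LBINT x. indicator B x * d x) = (LINT x|lebesgue_on S. indicator B x * d x)"
   using B by (intro integral_lebesgue_on_eq(1)[symmetric] S) (auto simp: indicator_def)
  also have "... = (LINT x|lebesgue_on S. indicator B x * f x - indicator B x * g x)"
  proof (rule integral_cong_AE)
   show "(%x. indicator B x * d x) \<in> borel_measurable (lebesgue_on S)"
    using B d(1) by (intro borel_measurable_lebesgue_on) simp
   show "(%x. indicator B x * f x - indicator B x * g x) \<in> borel_measurable (lebesgue_on S)"
    using B f g by (intro borel_measurable_diff borel_measurable_times m) auto
   show "AE x in lebesgue_on S. indicator B x * d x = indicator B x * f x - indicator B x * g x"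
    using d(4) by eventually_elim (auto simp: algebra_simps indicator_def)
  qed
  also have "... = 0" using eq[OF B] ib[OF B(1) f] ib[OF B(1) g] by simp
  finally show ?thesis .
 qed
 have pos: "AE x in lborel. k x \<le> 0" if k: "k \<in> borel_measurable borel" "integrable lborel k"
  "!!B. B \<in> sets borel ==> B \<subseteq> S ==> (LBINT x. indicator B x * k x) = 0" "!!x. x \<notin> S ==> k x = 0" for k :: "plane => real"
 proof -
  let ?B = "{x \<in> S. k x > 0}"
  have [measurable]: "k \<in> borel_measurable borel" by fact
  have B: "?B \<in> sets borel" by measurable
  have "integrable lborel (%x. indicator ?B x * k x)"
   by (rule integrable_bound[OF k(2)]) (auto simp: indicator_def)
  moreover have "(LBINT x. indicator ?B x * k x) = 0" using k(3)[OF B] by auto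
  ultimately have "AE x in lborel. indicator ?B x * k x = 0"
   by (subst (asm) integral_nonneg_eq_0_iff_AE) (auto simp: indicator_def)
  then show ?thesis by eventually_elim (use k(4) in "auto simp: indicator_def not_less[symmetric] split: if_splits")
 qed
 have "AE x in lborel. d x \<le> 0" using pos[of d] d z by blast
 moreover have "AE x in lborel. - d x \<le> 0"
  using pos[of "%x. - d x"] d z by (auto simp: integral_minus)
 ultimately have "AE x in lborel. d x = 0" by eventually_elim auto
 then have "AE x in lebesgue_on S. d x = 0" unfolding AE_lebesgue_on_iff[OF S] by eventually_elim auto
 with d(4) show ?thesis by eventually_elim auto
qed

text \<open>Test functions determine finite signed measures: the mollified indicator functions of the
 compact sets of points of \<open>V\<close> far from the complement of \<open>V\<close> are test functions in \<open>V\<close> and converge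
 boundedly to the indicator function of \<open>V\<close>.\<close>

lemma test_functions_approx_indicator:
 fixes V :: "plane set"
 assumes "open V"
 shows "\<exists>g. (\<forall>n::nat. g n \<in> test_functions V) \<and> (\<forall>n x. 0 \<le> g n x \<and> g n x \<le> (1::real))
  \<and> (\<forall>x. (%n. g n x) \<longlonglongrightarrow> indicator V x)"
proof -
 define eps where "eps n = 1 / real (Suc n)" for n
 have e: "eps n > 0" for n by (simp add: eps_def)
 have el: "eps \<longlonglongrightarrow> 0" unfolding eps_def by (rule LIMSEQ_Suc[OF lim_1_over_n])
 define K where "K n = cball (0::plane) (real n) \<inter> (\<Inter>y\<in>-V. {x. dist x y \<ge> 2 * eps n})" for n
 have cK: "compact (K n)" for n
  unfolding K_def by (intro compact_Int_closed closed_INT ballI closed_Collect_le continuous_intros) simp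
 then have bK [measurable]: "K n \<in> sets borel" for n by (simp add: borel_compact)
 define g where "g n = smear lborel (%y. y) (indicator (K n)) (mollifier (eps n))" for n
 have iK: "integrable lborel (indicator (K n) :: plane => real)" for n
  by (intro integrable_real_indicator) (use emeasure_compact_finite[OF cK] in auto)
 have [measurable]: "mollifier (eps n) \<in> borel_measurable borel" for n using e by simp
 have im: "integrable lborel (%y. mollifier (eps n) (x - y))" for n x
 proof -
  have "integrable lborel (%y. mollifier (eps n) (x - y) * indicator (cball x (eps n)) y)"
   using mollifier_test[OF e, of n] C_k_continuous emeasure_lborel_cball_finite[of x "eps n"]
   by (intro smear_integrable) (auto simp: test_functions_UNIV_iff)
  moreover have "mollifier (eps n) (x - y) * indicator (cball x (eps n)) y = mollifier (eps n) (x - y)" for y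
   using mollifier_supp[OF e, of n "x - y"]
   by (cases "mollifier (eps n) (x - y) = 0") (auto simp: indicator_def dist_norm)
  ultimately show ?thesis by simp
 qed
 have Im: "(LBINT y. mollifier (eps n) (x - y)) = 1" for n x
  using integral_lborel_reflect[of "mollifier (eps n)" x] mollifier_integral[OF e] by simp
 have bd: "0 \<le> g n x \<and> g n x \<le> 1" for n x
 proof
  show "0 \<le> g n x" unfolding g_def smear_def by (intro integral_nonneg) (simp add: mollifier_nonneg)
  have "g n x \<le> (LBINT y. mollifier (eps n) (x - y))"
   unfolding g_def smear_def
  proof (rule integral_mono[OF _ im])
   show "integrable lborel (%y. mollifier (eps n) (x - y) * indicator (K n) y)"
    by (rule integrable_bound[OF im[of n x]]) (auto simp: indicator_def)
  qed (auto simp: indicator_def mollifier_nonneg)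
  then show "g n x \<le> 1" by (simp add: Im)
 qed
 have tf: "g n \<in> test_functions V" for n
 proof -
  let ?C = "{x + y |x y. x \<in> K n \<and> y \<in> cball (0::plane) (eps n)}"
  have cC: "compact ?C" by (rule compact_sums[OF cK]) simp
  have "x \<in> ?C" if "g n x \<noteq> 0" for x
  proof (rule ccontr)
   assume n: "x \<notin> ?C"
   have "mollifier (eps n) (x - y) * indicator (K n) y = 0" for y
   proof (rule ccontr)
    assume "mollifier (eps n) (x - y) * indicator (K n) y \<noteq> 0"
    then have "y \<in> K n" "norm (x - y) < eps n" using mollifier_supp[OF e] by (auto simp: indicator_def split: if_splits)
    moreover have "x = y + (x - y)" by simp
    ultimately have "x \<in> ?C" by (intro CollectI exI[of _ y] exI[of _ "x - y"]) simp
    then show False using n by simp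
   qed
   then have "g n x = (LINT y|(lborel :: plane measure). 0)"
    unfolding g_def smear_def by presburger
   then show False using that by simp
  qed
  then have s: "closure {x. g n x \<noteq> 0} \<subseteq> ?C" using compact_imp_closed[OF cC] by (intro closure_minimal) auto
  have "?C \<subseteq> V"
  proof
   fix z assume "z \<in> ?C"
   then obtain x y where xy: "z = x + y" "x \<in> K n" "norm y \<le> eps n" by auto
   show "z \<in> V"
   proof (rule ccontr)
    assume "z \<notin> V"
    then have "dist x z \<ge> 2 * eps n" using xy(2) by (auto simp: K_def)
    moreover have "dist x z \<le> eps n" using xy by (simp add: dist_norm)
    ultimately show False using e[of n] by simp
   qed
  qed
  moreover have "compact (closure {x. g n x \<noteq> 0})"
   using s cC by (meson bounded_subset closed_closure compact_eq_bounded_closed)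
  moreover have "C_k k (g n)" for k
   unfolding g_def by (rule smear_C_k) (use mollifier_test[OF e] iK in auto)
  ultimately show ?thesis using s unfolding test_functions_def by auto
 qed
 have lim: "(%n. g n x) \<longlonglongrightarrow> indicator V x" for x
 proof (cases "x \<in> V")
  case False
  have "g n x = 0" for n
  proof (rule ccontr)
   assume "g n x \<noteq> 0"
   then have "x \<in> closure {x. g n x \<noteq> 0}" using closure_subset[of "{x. g n x \<noteq> 0}"] by blast
   moreover have "closure {x. g n x \<noteq> 0} \<subseteq> V" using tf[of n] by (simp add: test_functions_def)
   ultimately show False using False by blast
  qed
  then show ?thesis using False by simp
 next
  case True
  then obtain r where r: "r > 0" "ball x r \<subseteq> V" using assms open_contains_ball by blast
  have "\<forall>\<^sub>F n in sequentially. eps n < r / 3" using order_tendstoD(2)[OF el, of "r / 3"] r by simp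
  moreover have "\<forall>\<^sub>F n in sequentially. real n \<ge> norm x + 1"
   using filterlim_real_sequentially by (auto simp: filterlim_at_top)
  ultimately have "\<forall>\<^sub>F n in sequentially. g n x = 1"
  proof eventually_elim
   case (elim n)
   have "mollifier (eps n) (x - y) * indicator (K n) y = mollifier (eps n) (x - y)" for y
   proof (cases "mollifier (eps n) (x - y) = 0")
    case False
    then have d: "norm (x - y) < eps n" using mollifier_supp[OF e] by blast
    have "eps n \<le> 1" by (simp add: eps_def)
    then have "norm y \<le> n" using d elim(2) norm_triangle_ineq2[of y x] by (simp add: norm_minus_commute)
    moreover have "dist y z \<ge> 2 * eps n" if "z \<notin> V" for z
    proof -
     have "dist x z \<ge> r" using r(2) that by (force simp: subset_eq)
     moreover have "dist x z \<le> dist x y + dist y z" by (rule dist_triangle)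
     ultimately show ?thesis using d elim(1) by (simp add: dist_norm)
    qed
    ultimately have "y \<in> K n" by (auto simp: K_def)
    then show ?thesis by simp
   qed simp
   then have "g n x = (LBINT y. mollifier (eps n) (x - y))"
    unfolding g_def smear_def by presburger
   then show ?case using Im by simp
  qed
  then show ?thesis using True by (simp add: tendsto_eventually)
 qed
 show ?thesis using tf bd lim by blast
qed

text \<open>Equality of the integrals passes from test functions to open sets by approximation of their indicator functions,
 and from open sets to Borel sets because these form an intersection-stable generator.\<close>

lemma test_functions_separate:
 assumes O: "open O'" and M: "finite_borel_measure_on O' P" "finite_borel_measure_on O' N"
  "finite_borel_measure_on O' P'" "finite_borel_measure_on O' N'"
  and eq: "!!\<phi>. \<phi> \<in> test_functions O' ==>
   (LINT x|P. \<phi> x) - (LINT x|N. \<phi> x) = (LINT x|P'. \<phi> x) - (LINT x|N'. \<phi> x)"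
  and B: "B \<in> sets borel" "B \<subseteq> O'"
 shows "measure P B - measure N B = measure P' B - measure N' B"
proof -
 have sp: "space M = O'" "sets M = sets (restrict_space borel O')" "finite_measure M" if "finite_borel_measure_on O' M" for M
  using that sets_eq_imp_space_eq[of M "restrict_space borel O'"] unfolding finite_borel_measure_on_def
  by (auto simp: space_restrict_space)
 have ms: "C \<inter> O' \<in> sets M" if "finite_borel_measure_on O' M" "C \<in> sets borel" for M C
  using sp(2)[OF that(1)] that(2) O by (auto simp: sets_restrict_space)
 have lim: "(%n. \<integral>x. g n x \<partial>M) \<longlonglongrightarrow> measure M V"
  if M: "finite_borel_measure_on O' M" and V: "open V" "V \<subseteq> O'"
  and g: "!!n::nat. g n \<in> test_functions V" "!!n x. 0 \<le> g n x \<and> g n x \<le> (1::real)"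
   "!!x. (%n. g n x) \<longlonglongrightarrow> indicator V x" for M V g
 proof -
  interpret finite_measure M using sp(3)[OF M] .
  have VM: "V \<in> sets M" using ms[OF M, of V] V by (simp add: Int_absorb2)
  have gm: "g n \<in> borel_measurable M" for n
  proof -
   have "continuous_on UNIV (g n)" using g(1)[of n] C_k_continuous unfolding test_functions_def by blast
   then have "g n \<in> borel_measurable borel" by (rule borel_measurable_continuous_onI)
   then have "g n \<in> borel_measurable (restrict_space borel O')" by (rule measurable_restrict_space1)
   then show ?thesis using sp(2)[OF M] measurable_cong_sets by blast
  qed
  have "(%n. \<integral>x. g n x \<partial>M) \<longlonglongrightarrow> (LINT x|M. indicator V x)"
   by (rule integral_dominated_convergence[where w="%_. 1"])
     (use g gm VM in "auto")
  then show ?thesis using VM by simp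
 qed
 have op: "measure P V - measure N V = measure P' V - measure N' V" if V: "open V" "V \<subseteq> O'" for V
 proof -
  obtain g where g: "!!n::nat. g n \<in> test_functions V" "!!n x. 0 \<le> g n x \<and> g n x \<le> (1::real)"
   "!!x. (%n. g n x) \<longlonglongrightarrow> indicator V x"
   using test_functions_approx_indicator[OF V(1)] by blast
  have "(%n. (LINT x|P. g n x) - (LINT x|N. g n x)) \<longlonglongrightarrow> measure P V - measure N V"
   by (intro tendsto_diff lim M V g)
  moreover have "(%n. (LINT x|P'. g n x) - (LINT x|N'. g n x)) \<longlonglongrightarrow> measure P' V - measure N' V"
   by (intro tendsto_diff lim M V g)
  moreover have "(LINT x|P. g n x) - (LINT x|N. g n x) = (LINT x|P'. g n x) - (LINT x|N'. g n x)" for n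
   using eq g(1)[of n] test_functions_mono[OF V(2)] by blast
  ultimately show ?thesis using LIMSEQ_unique by fastforce
 qed
 let ?Q = "%B. measure P (B \<inter> O') - measure N (B \<inter> O') = measure P' (B \<inter> O') - measure N' (B \<inter> O')"
 have "?Q B"
 proof (rule sigma_sets_induct_disjoint[of "{S. open S}" UNIV B ?Q])
  show "Int_stable {S :: plane set. open S}" by (auto simp: Int_stable_def)
  show "B \<in> sigma_sets UNIV {S. open S}" using B(1) by (simp add: sets_borel)
 next
  fix A :: "plane set" assume "A \<in> {S. open S}" then show "?Q A" using op[of "A \<inter> O'"] O by auto
 next
  fix A :: "plane set" assume A: "A \<in> sigma_sets UNIV {S. open S}" "?Q A"
  then have Ab: "A \<in> sets borel" by (simp add: sets_borel)
  have "measure M ((UNIV - A) \<inter> O') = measure M O' - measure M (A \<inter> O')" if "finite_borel_measure_on O' M" for M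
  proof -
   interpret finite_measure M using sp(3)[OF that] .
   have "(UNIV - A) \<inter> O' = O' - A \<inter> O'" by auto
   then show ?thesis using finite_measure_Diff[of O' "A \<inter> O'"] ms[OF that Ab] ms[OF that, of UNIV] by auto
  qed
  then show "?Q (UNIV - A)" using A(2) op[OF O] M by auto
 next
  fix A :: "nat => plane set"
  assume A: "disjoint_family A" "range A \<subseteq> sigma_sets UNIV {S. open S}" "!!i. ?Q (A i)"
  have Ab: "A i \<in> sets borel" for i using A(2) by (auto simp: sets_borel)
  have s: "(%i. measure M (A i \<inter> O')) sums measure M (\<Union>(range A) \<inter> O')" if "finite_borel_measure_on O' M" for M
  proof -
   interpret finite_measure M using sp(3)[OF that] .
   have "(%i. measure M (A i \<inter> O')) sums measure M (\<Union>i. A i \<inter> O')"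
    using A(1) ms[OF that Ab] by (intro finite_measure_UNION) (auto simp: disjoint_family_on_def)
   then show ?thesis by (simp add: Int_commute)
  qed
  show "?Q (\<Union>(range A))"
   using sums_diff[OF s[OF M(1)] s[OF M(2)]] sums_diff[OF s[OF M(3)] s[OF M(4)]] A(3) sums_unique2 by fastforce
 qed auto
 then show ?thesis using B(2) by (simp add: Int_absorb2)
qed

section \<open>The two integrands\<close>

locale linear_growth_integrand =
 fixes f1 f1' :: "real => real" and a1 a2 a3 a4 :: real
 assumes f1_convex: "convex_on UNIV f1"
  and f1_deriv: "!!t. (f1 has_real_derivative f1' t) (at t)"
  and f1'_cont: "continuous_on UNIV f1'"
  and a1: "a1 > 0" and a3: "a3 > 0"
  and growth: "!!t. a1 * abs t - a2 \<le> f1 t \<and> f1 t \<le> a3 * abs t + a4"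
begin

lemma f1_tangent: "f1 x + f1' x * (y - x) \<le> f1 y"
 using convex_on_imp_above_tangent[OF f1_convex, of x y "f1' x"] f1_deriv[of x]
 by auto

lemma f1'_bound: "abs (f1' x) \<le> a3"
proof -
 have "e * f1' x \<le> a3" if e: "abs e = 1" for e
 proof (rule ccontr)
  assume n: "\<not> e * f1' x \<le> a3"
  define C where "C = a3 * abs x + a4 - f1 x"
  define s where "s = (abs C + 1) / (e * f1' x - a3)"
  have s: "s > 0" using n by (simp add: s_def)
  have "s * (e * f1' x) \<le> f1 (x + s * e) - f1 x"
   using f1_tangent[of x "x + s * e"] by (simp add: algebra_simps)
  also have "... \<le> a3 * \<bar>x + s * e\<bar> + a4 - f1 x" using growth[of "x + s * e"] by simp
  also have "... \<le> a3 * (abs x + s) + a4 - f1 x"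
   using a3 s e abs_triangle_ineq[of x "s * e"] by (simp add: abs_mult)
  finally have "s * (e * f1' x - a3) \<le> C" by (simp add: C_def algebra_simps)
  moreover have "s * (e * f1' x - a3) = abs C + 1" using n by (simp add: s_def)
  ultimately show False by simp
 qed
 from this[of 1] this[of "-1"] show ?thesis by simp
qed

lemma f1_lipschitz: "abs (f1 x - f1 y) \<le> a3 * abs (x - y)"
proof -
 have "f1 x - f1 y \<le> a3 * abs (x - y)" for x y
 proof -
  have "f1 x - f1 y \<le> f1' x * (x - y)" using f1_tangent[of x y] by (simp add: algebra_simps)
  also have "... \<le> abs (f1' x) * abs (x - y)" by (metis abs_ge_self abs_mult)
  also have "... \<le> a3 * abs (x - y)" using f1'_bound by (intro mult_right_mono) auto
  finally show ?thesis .
 qed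
 from this[of x y] this[of y x] show ?thesis by (simp add: abs_minus_commute abs_le_iff)
qed

lemma f1_cont: "continuous_on UNIV f1"
 using f1_deriv DERIV_isCont continuous_at_imp_continuous_on by blast

text \<open>Difference quotients of a convex function increase, and the linear growth bounds them.\<close>

lemma recession_tendsto: "((%s. f1 (s * t) / s) \<longlongrightarrow> recession f1 t) at_top"
proof -
 define g where "g s = (f1 (s * t) - f1 0) / s" for s
 have mono: "g r \<le> g s" if "0 < r" "r \<le> s" for r s
 proof -
  have "r * t = (1 - r / s) * 0 + (r / s) * (s * t)" using that by simp
  then have "f1 (r * t) \<le> (1 - r / s) * f1 0 + (r / s) * f1 (s * t)"
   using convex_onD[OF f1_convex, of "r / s" 0 "s * t"] that by simp
  then have "f1 (r * t) - f1 0 \<le> (r / s) * (f1 (s * t) - f1 0)" by (simp add: algebra_simps)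
  then have "(f1 (r * t) - f1 0) / r \<le> (r / s) * (f1 (s * t) - f1 0) / r"
   using that by (intro divide_right_mono) auto
  then show ?thesis using that by (simp add: g_def)
 qed
 have bd: "g s \<le> a3 * abs t" if "s > 0" for s
  using f1_lipschitz[of "s * t" 0] that by (simp add: g_def divide_le_eq abs_mult algebra_simps)
 define L where "L = (SUP s\<in>{0<..}. g s)"
 have bdd: "bdd_above (g ` {0<..})" using bd by (auto intro!: bdd_aboveI2)
 have up: "g s \<le> L" if "s > 0" for s unfolding L_def using bdd that by (auto intro: cSUP_upper)
 have "(g \<longlongrightarrow> L) at_top"
 proof (rule order_tendstoI)
  fix y assume "y < L"
  then obtain s0 where s0: "s0 > 0" "y < g s0" unfolding L_def using less_cSUP_iff[of "{0<..}" g y] bdd by auto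
  show "\<forall>\<^sub>F s in at_top. y < g s"
   using eventually_ge_at_top[of s0]
  proof eventually_elim
   case (elim s) then show ?case using mono[OF s0(1) elim] s0(2) by simp
  qed
 next
  fix y assume "L < y"
  show "\<forall>\<^sub>F s in at_top. g s < y"
   using eventually_gt_at_top[of 0]
  proof eventually_elim
   case (elim s) then show ?case using up[of s] \<open>L < y\<close> by simp
  qed
 qed
 moreover have "((%s. f1 0 / s) \<longlongrightarrow> 0) at_top"
  by (rule tendsto_divide_0[OF tendsto_const]) (simp add: filterlim_at_top_imp_at_infinity filterlim_ident)
 ultimately have "((%s. g s + f1 0 / s) \<longlongrightarrow> L + 0) at_top" by (rule tendsto_add)
 then have "((%s. f1 (s * t) / s) \<longlongrightarrow> L) at_top"
  by (simp add: g_def diff_divide_distrib)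
 then show ?thesis unfolding recession_def using tendsto_Lim[OF trivial_limit_at_top_linorder] by metis
qed

lemma recession_scale: assumes "c > 0" shows "recession f1 (c * t) = c * recession f1 t"
proof -
 have "filterlim (%s. s * c) at_top at_top"
  using filterlim_tendsto_pos_mult_at_top[OF tendsto_const assms filterlim_ident] by (simp add: mult.commute)
 from filterlim_compose[OF recession_tendsto[of t] this]
 have "((%s. f1 (s * c * t) / (s * c)) \<longlongrightarrow> recession f1 t) at_top" .
 from tendsto_mult_left[OF this, of c]
 have "((%s. f1 (s * (c * t)) / s) \<longlongrightarrow> c * recession f1 t) at_top"
  using assms by (simp add: mult.assoc)
 then show ?thesis using tendsto_unique[OF _ recession_tendsto[of "c * t"]] by auto
qed

lemma recession_zero: "recession f1 0 = 0"
proof -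
 have "((%s. f1 0 / s) \<longlongrightarrow> 0) at_top"
  by (rule tendsto_divide_0[OF tendsto_const]) (simp add: filterlim_at_top_imp_at_infinity filterlim_ident)
 then show ?thesis using tendsto_unique[OF _ recession_tendsto[of 0]] by auto
qed

lemma recession_nonneg: "recession f1 t \<ge> 0"
proof (cases "t = 0")
 case True then show ?thesis by (simp add: recession_zero)
next
 case False
 show ?thesis
 proof (rule tendsto_lowerbound[OF recession_tendsto])
  show "\<forall>\<^sub>F s in at_top. 0 \<le> f1 (s * t) / s"
   using eventually_gt_at_top[of 0] eventually_ge_at_top[of "abs a2 / (a1 * abs t)"]
  proof eventually_elim
   case (elim s)
   have "a1 * abs t > 0" using False a1 by simp
   then have "abs a2 \<le> s * (a1 * abs t)" using elim by (simp add: divide_le_eq)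
   moreover have "a1 * abs (s * t) = s * (a1 * abs t)" using elim by (simp add: abs_mult)
   ultimately have "0 \<le> f1 (s * t)" using growth[of "s * t"] by linarith
   then show ?case using elim by simp
  qed
 qed simp
qed

lemma recession_eq: "recession f1 t = recession f1 1 * max 0 t + recession f1 (-1) * max 0 (- t)"
proof -
 consider "t > 0" | "t < 0" | "t = 0" by linarith
 then show ?thesis
  by cases (use recession_scale[of t 1] recession_scale[of "- t" "-1"] recession_zero in auto)
qed

text \<open>Along the ray from \<open>x\<close> in direction \<open>t\<close> the difference quotients increase to the
 recession function.\<close>

lemma f1_add_le: "f1 (x + t) \<le> f1 x + recession f1 t"
proof -
 have "((%s. (1 - 1 / s) * f1 x + a3 * abs x / s + f1 (s * t) / s) \<longlongrightarrow> (1 - 0) * f1 x + 0 + recession f1 t) at_top"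
 proof -
  have "((%s::real. c / s) \<longlongrightarrow> 0) at_top" for c
   by (rule tendsto_divide_0[OF tendsto_const]) (simp add: filterlim_at_top_imp_at_infinity filterlim_ident)
  then show ?thesis by (intro tendsto_add tendsto_mult tendsto_diff tendsto_const recession_tendsto)
 qed
 moreover have "\<forall>\<^sub>F s in at_top. f1 (x + t) \<le> (1 - 1 / s) * f1 x + a3 * abs x / s + f1 (s * t) / s"
  using eventually_ge_at_top[of 1]
 proof eventually_elim
  case (elim s)
  have "f1 ((1 - 1 / s) * x + (1 / s) * (x + s * t)) \<le> (1 - 1 / s) * f1 x + (1 / s) * f1 (x + s * t)"
   using convex_onD[OF f1_convex, of "1 / s" x "x + s * t"] elim by simp
  moreover have "(1 - 1 / s) * x + (1 / s) * (x + s * t) = x + t" using elim by (simp add: field_simps)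
  moreover have "f1 (x + s * t) \<le> a3 * abs x + f1 (s * t)" using f1_lipschitz[of "x + s * t" "s * t"] by simp
  then have "(1 / s) * f1 (x + s * t) \<le> (1 / s) * (a3 * abs x + f1 (s * t))" using elim by (intro mult_left_mono) auto
  moreover have "(1 / s) * (a3 * abs x + f1 (s * t)) = a3 * abs x / s + f1 (s * t) / s" by (simp add: add_divide_distrib)
  ultimately show ?case by simp
 qed
 ultimately have "f1 (x + t) \<le> (1 - 0) * f1 x + 0 + recession f1 t"
  by (rule tendsto_lowerbound) simp
 then show ?thesis by simp
qed

lemma conjugate_young: "ereal (s * t - f1 t) \<le> convex_conjugate f1 s"
 unfolding convex_conjugate_def by (rule SUP_upper) simp

text \<open>Equality in Young's inequality at a derivative: the tangent inequality says that the supremum is attained at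
 \<open>x\<close>.\<close>

lemma conjugate_deriv: "convex_conjugate f1 (f1' x) = ereal (f1' x * x - f1 x)"
proof (rule antisym)
 have "f1' x * t - f1 t \<le> f1' x * x - f1 x" for t using f1_tangent[of x t] by (simp add: algebra_simps)
 then show "convex_conjugate f1 (f1' x) \<le> ereal (f1' x * x - f1 x)"
  unfolding convex_conjugate_def by (intro SUP_least) simp
qed (rule conjugate_young)

end

text \<open>The additive bound \<open>A_add\<close> plays the role of the doubling condition at all scales.\<close>

locale delta2_N_function =
 fixes A A' :: "real => real" and c3 c :: real
 assumes N: "N_function A"
  and A_deriv: "!!t. t \<ge> 0 ==> (A has_real_derivative A' t) (at t within {0..})"
  and A'_cont: "continuous_on {0..} A'"
  and c3: "c3 > 0"
  and A_add: "!!s t. A \<bar>s + t\<bar> \<le> c3 * (A \<bar>s\<bar> + A \<bar>t\<bar>)"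
  and conj_bound: "!!t. t \<ge> 0 ==> N_conjugate A (A' t) \<le> c * (A t + 1)"
begin

lemma A_nonneg: "t \<ge> 0 ==> A t \<ge> 0" and A_cont: "continuous_on {0..} A"
 and A_strict: "strict_mono_on {0..} A" and A_convex: "convex_on {0..} A"
 and A_small: "((%t. A t / t) \<longlongrightarrow> 0) (at_right 0)" and A_super: "filterlim (%t. A t / t) at_top at_top"
 using N unfolding N_function_def by auto

lemma A_mono: "0 \<le> s ==> s \<le> t ==> A s \<le> A t"
 using A_strict strict_mono_onD[of "{0..}" A s t] by (cases "s = t") auto

lemma A_zero: "A 0 = 0"
proof -
 have "((%t. A t / t * t) \<longlongrightarrow> 0 * 0) (at_right 0)" by (intro tendsto_mult A_small tendsto_ident_at)
 moreover have "\<forall>\<^sub>F t in at_right 0. A t / t * t = A t" by (auto simp: eventually_at_right_field intro: exI[of _ 1])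
 ultimately have "(A \<longlongrightarrow> 0) (at_right 0)" by (simp add: tendsto_cong)
 moreover have "(A \<longlongrightarrow> A 0) (at_right 0)"
  using A_cont by (auto simp: continuous_on_def intro: tendsto_within_subset)
 ultimately show ?thesis using tendsto_unique[of "at_right 0" A] by force
qed

lemma A'_zero: "A' 0 = 0"
proof -
 have "((%t. (A t - A 0) / (t - 0)) \<longlongrightarrow> A' 0) (at 0 within {0..})"
  using A_deriv[of 0] by (simp add: has_field_derivative_iff)
 then have "((%t. A t / t) \<longlongrightarrow> A' 0) (at_right 0)"
  by (simp add: A_zero) (rule tendsto_within_subset, auto)
 then show ?thesis using A_small tendsto_unique[of "at_right 0"] by force
qed

lemma A_tangent:
 assumes "x \<ge> 0" "y \<ge> 0" shows "A x + A' x * (y - x) \<le> A y"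
proof (cases "x = 0")
 case True then show ?thesis using A'_zero A_zero A_nonneg assms by simp
next
 case False
 then show ?thesis
  using convex_on_imp_above_tangent[OF A_convex, of x y "A' x"] A_deriv[of x] assms
  by auto
qed

lemma A'_nonneg: assumes "x \<ge> 0" shows "A' x \<ge> 0"
proof -
 have "A' x * 1 \<ge> 0" if "x > 0"
  using A_tangent[of x 0] A_zero A_nonneg[of x] assms that mult_neg_pos[of "A' x" x] by (force simp: not_less[symmetric])
 then show ?thesis using A'_zero assms by (cases "x = 0") auto
qed

text \<open>Superlinear growth makes the conjugate finite.\<close>

lemma conj_bdd: "bdd_above ((%t. s * t - A t) ` {0..})"
proof -
 obtain t0 where t0: "!!t. t \<ge> t0 ==> A t / t \<ge> s" using A_super by (auto simp: filterlim_at_top eventually_at_top_linorder)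
 have "s * t - A t \<le> max 0 (abs s * max t0 1)" if t: "t \<ge> 0" for t
 proof (cases "t \<ge> max t0 1")
  case True
  then have "s * t \<le> A t" using t0[of t] by (simp add: le_divide_eq)
  then show ?thesis unfolding le_max_iff_disj by simp
 next
  case False
  then have "s * t \<le> abs s * max t0 1" using t mult_mono[of s "abs s" t "max t0 1"] by auto
  then show ?thesis using A_nonneg[OF t] by simp
 qed
 then show ?thesis by (auto intro!: bdd_aboveI2)
qed

lemma conj_young: "t \<ge> 0 ==> s * t - A t \<le> N_conjugate A s"
 unfolding N_conjugate_def by (rule cSUP_upper[OF _ conj_bdd]) simp

lemma conj_nonneg: "N_conjugate A s \<ge> 0"
 using conj_young[of 0 s] A_zero by simp

lemma conj_mono: "mono (N_conjugate A)"
proof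
 fix x y :: real assume "x \<le> y"
 then show "N_conjugate A x \<le> N_conjugate A y"
  unfolding N_conjugate_def by (intro cSUP_mono conj_bdd) (auto intro!: bexI mult_right_mono)
qed

lemma conj_deriv: assumes "x \<ge> 0" shows "N_conjugate A (A' x) = A' x * x - A x"
proof (rule antisym)
 show "N_conjugate A (A' x) \<le> A' x * x - A x"
  unfolding N_conjugate_def
 proof (rule cSUP_least)
  fix t :: real assume "t \<in> {0..}"
  then show "A' x * t - A t \<le> A' x * x - A x" using A_tangent[of x t] assms by (simp add: algebra_simps)
 qed simp
qed (use conj_young[OF assms] in simp)

definition f2' :: "real => real" where "f2' t = sgn t * A' \<bar>t\<bar>"

text \<open>The even extension of \<open>A\<close> is differentiable at zero because \<open>A\<close> has derivative zero
 there.\<close>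

lemma f2_deriv: "((%t. A \<bar>t\<bar>) has_real_derivative f2' t) (at t)"
proof -
 have int: "(A has_real_derivative A' s) (at s)" if "s > 0" for s
  using A_deriv[of s] that at_within_interior[of s "{0..}"] by (simp add: interior_Ici)
 consider "t > 0" | "t < 0" | "t = 0" by linarith
 then show ?thesis
 proof cases
  case 1
  have "(A has_real_derivative f2' t) (at t)" using int[OF 1] 1 by (simp add: f2'_def)
  then show ?thesis
   by (rule has_field_derivative_transform_within_open[of _ _ _ "{0<..}"]) (use 1 in auto)
 next
  case 2
  have "((%t. A (- t)) has_real_derivative f2' t) (at t)"
   using DERIV_chain2[OF int[of "- t", simplified] DERIV_minus[OF DERIV_ident]] 2
   by (simp add: f2'_def)
  then show ?thesis
   by (rule has_field_derivative_transform_within_open[of _ _ _ "{..<0}"]) (use 2 in auto)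
 next
  case 3
  have r: "((%h. A \<bar>h\<bar> / h) \<longlongrightarrow> 0) (at_right 0)"
   by (rule Lim_transform_eventually[OF A_small]) (auto simp: eventually_at_right_field intro: exI[of _ 1])
  have "((%h. A (- h) / (- h)) \<longlongrightarrow> 0) (at_left 0)"
   using A_small by (simp add: filterlim_at_left_to_right)
  from tendsto_minus[OF this] have "((%h. A (- h) / h) \<longlongrightarrow> 0) (at_left 0)" by simp
  then have l: "((%h. A \<bar>h\<bar> / h) \<longlongrightarrow> 0) (at_left 0)"
   by (rule Lim_transform_eventually) (auto simp: eventually_at_left_field intro: exI[of _ "-1"])
  have "((%h. A \<bar>h\<bar> / h) \<longlongrightarrow> 0) (at 0)" using l r filterlim_split_at by blast
  then show ?thesis using 3 by (simp add: DERIV_def f2'_def A_zero)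
 qed
qed

lemma f2'_abs: "abs (f2' t) = A' \<bar>t\<bar>"
 using A'_nonneg[of "abs t"] A'_zero by (cases "t = 0") (auto simp: f2'_def abs_mult)

lemma f2'_mult: "f2' t * t = A' \<bar>t\<bar> * abs t"
 by (simp add: f2'_def abs_sgn mult.assoc mult.commute mult.left_commute)

lemma f2_tangent: "A \<bar>x\<bar> + f2' x * (y - x) \<le> A \<bar>y\<bar>"
proof -
 have "f2' x * y \<le> A' \<bar>x\<bar> * abs y" using f2'_abs[of x] by (metis abs_ge_self abs_mult)
 then show ?thesis using A_tangent[of "abs x" "abs y"] f2'_mult[of x] by (simp add: algebra_simps)
qed

lemma f2_convex:
 assumes "0 \<le> e" "e \<le> 1" shows "A \<bar>(1 - e) * x + e * y\<bar> \<le> (1 - e) * A \<bar>x\<bar> + e * A \<bar>y\<bar>"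
proof -
 let ?z = "(1 - e) * x + e * y"
 have "(1 - e) * (A \<bar>?z\<bar> + f2' ?z * (x - ?z)) + e * (A \<bar>?z\<bar> + f2' ?z * (y - ?z)) \<le> (1 - e) * A \<bar>x\<bar> + e * A \<bar>y\<bar>"
  using assms f2_tangent by (intro add_mono mult_left_mono) auto
 moreover have "(1 - e) * (A \<bar>?z\<bar> + f2' ?z * (x - ?z)) + e * (A \<bar>?z\<bar> + f2' ?z * (y - ?z)) = A \<bar>?z\<bar>"
  by (simp add: algebra_simps)
 ultimately show ?thesis by simp
qed

lemma f2_cont: "continuous_on UNIV (%t. A \<bar>t\<bar>)"
 using f2_deriv DERIV_isCont continuous_at_imp_continuous_on by blast

lemma f2'_cont: "continuous_on UNIV f2'"
proof -
 have "continuous_on ({0..} \<union> {..0}) (%t. if t \<in> {0..} then A' \<bar>t\<bar> else - A' \<bar>t\<bar>)"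
  by (intro continuous_on_cases continuous_intros continuous_on_compose2[OF A'_cont]) (auto simp: A'_zero)
 moreover have "{0..} \<union> {..0} = (UNIV :: real set)" by auto
 moreover have "(%t. if t \<in> {0..} then A' \<bar>t\<bar> else - A' \<bar>t\<bar>) = f2'"
  using A'_zero by (auto simp: f2'_def fun_eq_iff sgn_if)
 ultimately show ?thesis by (simp only:)
qed

lemma A_double_pow: "A (2 ^ n * abs t) \<le> (2 * c3) ^ n * A \<bar>t\<bar>"
proof (induction n)
 case (Suc n)
 have "A (2 ^ Suc n * abs t) \<le> 2 * c3 * A (2 ^ n * abs t)"
  using A_add[of "2 ^ n * abs t" "2 ^ n * abs t"] by (simp add: abs_mult algebra_simps)
 also have "... \<le> 2 * c3 * ((2 * c3) ^ n * A \<bar>t\<bar>)" using Suc c3 by (intro mult_left_mono) auto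
 finally show ?case by simp
qed simp

text \<open>The doubling condition makes the modular of an Orlicz function finite at every scale.\<close>

lemma A_scale:
 assumes "l \<ge> 0"
 obtains C where "C > 0" and "!!t. A (l * abs t) \<le> C * A \<bar>t\<bar>"
proof -
 obtain n where n: "l < 2 ^ n" using real_arch_pow[of 2 l] by auto
 have "A (l * abs t) \<le> (2 * c3) ^ n * A \<bar>t\<bar>" for t
  using A_mono[of "l * abs t" "2 ^ n * abs t"] A_double_pow[of n t] n assms
  by (meson abs_ge_zero less_imp_le mult_nonneg_nonneg mult_right_mono order_trans)
 then show ?thesis using that[of "(2 * c3) ^ n"] c3 by simp
qed

lemma A_orlicz_scale:
 assumes "l > 0"
 obtains C where "C > 0" and "!!t. A \<bar>t\<bar> \<le> C * A (l * abs t)"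
proof -
 obtain C where C: "C > 0" "!!t. A (inverse l * abs t) \<le> C * A \<bar>t\<bar>" using A_scale[of "inverse l"] assms by auto
 have "A \<bar>t\<bar> \<le> C * A (l * abs t)" for t
  using C(2)[of "l * t"] assms by (simp add: abs_mult mult.assoc[symmetric])
 then show ?thesis using that C by blast
qed

end

section \<open>Finite signed measures\<close>

text \<open>Only measures on the same \<open>\<sigma>\<close>-algebra are added.\<close>

definition msum :: "'a measure => 'a measure => 'a measure" where
 "msum M N = measure_of (space M) (sets M) (%B. emeasure M B + emeasure N B)"

lemma sets_msum [simp, measurable_cong]: "sets (msum M N) = sets M"
 by (simp add: msum_def sets.sigma_sets_eq sets.space_closed)

lemma space_msum [simp]: "space (msum M N) = space M"
 by (simp add: msum_def)

lemma emeasure_msum: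
 assumes "sets N = sets M" and "B \<in> sets M"
 shows "emeasure (msum M N) B = emeasure M B + emeasure N B"
proof (rule emeasure_measure_of[OF msum_def])
 show "countably_additive (sets (msum M N)) (%B. emeasure M B + emeasure N B)"
 proof (unfold countably_additive_def, intro allI impI)
  fix F :: "nat => 'a set"
  assume F: "range F \<subseteq> sets (msum M N)" "disjoint_family F"
  have "(\<Sum>i. emeasure M (F i) + emeasure N (F i)) = (\<Sum>i. emeasure M (F i)) + (\<Sum>i. emeasure N (F i))"
   by (rule suminf_add[symmetric]) auto
  also have "... = emeasure M (\<Union>(range F)) + emeasure N (\<Union>(range F))"
   using F assms(1) by (simp add: suminf_emeasure)
  finally show "(\<Sum>i. emeasure M (F i) + emeasure N (F i)) = emeasure M (\<Union>(range F)) + emeasure N (\<Union>(range F))" .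
 qed
qed (use assms sets.space_closed in "auto simp: positive_def")

lemma nn_integral_msum:
 assumes s: "sets N = sets M" and f: "f \<in> borel_measurable M"
 shows "(\<integral>\<^sup>+x. f x \<partial>msum M N) = (\<integral>\<^sup>+x. f x \<partial>M) + (\<integral>\<^sup>+x. f x \<partial>N)"
 using f
proof (induction rule: borel_measurable_induct)
 case (cong f g)
 have sp: "space N = space M" using s by (rule sets_eq_imp_space_eq)
 have "integral\<^sup>N (msum M N) f = integral\<^sup>N (msum M N) g" "integral\<^sup>N M f = integral\<^sup>N M g" "integral\<^sup>N N f = integral\<^sup>N N g"
  using cong(3) sp by (auto intro!: nn_integral_cong)
 then show ?case using cong by simp
next
 case (set B)
 then show ?case using s by (simp add: emeasure_msum)
next
 case (mult u v)
 have "u \<in> borel_measurable N" using mult(2) s measurable_cong_sets by blast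
 moreover have "u \<in> borel_measurable (msum M N)" using mult(2) by measurable
 ultimately show ?case using mult by (simp add: nn_integral_cmult distrib_left)
next
 case (add u v)
 have "u \<in> borel_measurable N" "v \<in> borel_measurable N" using add s measurable_cong_sets by blast+
 moreover have "u \<in> borel_measurable (msum M N)" "v \<in> borel_measurable (msum M N)" using add by measurable
 ultimately show ?case using add by (simp add: nn_integral_add algebra_simps)
next
 case (seq U)
 have N: "U i \<in> borel_measurable N" for i using seq(1) s measurable_cong_sets by blast
 have S: "U i \<in> borel_measurable (msum M N)" for i using seq(1)[of i] by measurable
 have inc: "incseq (%i. integral\<^sup>N M (U i))" "incseq (%i. integral\<^sup>N N (U i))"
  using \<open>incseq U\<close> by (auto simp: incseq_def le_fun_def intro!: nn_integral_mono)
 have "(\<integral>\<^sup>+x. (SUP i. U i x) \<partial>msum M N) = (SUP i. integral\<^sup>N (msum M N) (U i))"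
  by (rule nn_integral_monotone_convergence_SUP[OF \<open>incseq U\<close> S])
 also have "... = (SUP i. integral\<^sup>N M (U i) + integral\<^sup>N N (U i))" using seq by simp
 also have "... = (SUP i. integral\<^sup>N M (U i)) + (SUP i. integral\<^sup>N N (U i))"
  by (rule ennreal_SUP_add[OF inc])
 also have "... = (\<integral>\<^sup>+x. (SUP i. U i x) \<partial>M) + (\<integral>\<^sup>+x. (SUP i. U i x) \<partial>N)"
  using nn_integral_monotone_convergence_SUP[OF \<open>incseq U\<close> seq(1)] nn_integral_monotone_convergence_SUP[OF \<open>incseq U\<close> N] by simp
 finally show ?case by (simp add: SUP_apply image_comp)
qed

lemma finite_measure_msum:
 assumes "sets N = sets M" and "finite_measure M" and "finite_measure N"
 shows "finite_measure (msum M N)"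
proof (rule finite_measureI)
 interpret M: finite_measure M by fact
 interpret N: finite_measure N by fact
 show "emeasure (msum M N) (space (msum M N)) \<noteq> \<infinity>"
  using assms(1) by (simp add: emeasure_msum)
qed

lemma integral_msum:
 fixes f :: "'a => real"
 assumes s: "sets N = sets M" and f: "integrable M f" and g: "integrable N f"
 shows "(LINT x|msum M N. f x) = (LINT x|M. f x) + (LINT x|N. f x)"
  and "integrable (msum M N) f"
proof -
 have m: "f \<in> borel_measurable M" using f by auto
 then have m': "f \<in> borel_measurable (msum M N)" by measurable
 have fin: "(\<integral>\<^sup>+x. ennreal (f x) \<partial>M) < \<infinity>" "(\<integral>\<^sup>+x. ennreal (f x) \<partial>N) < \<infinity>"
   "(\<integral>\<^sup>+x. ennreal (- f x) \<partial>M) < \<infinity>" "(\<integral>\<^sup>+x. ennreal (- f x) \<partial>N) < \<infinity>"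
  using f g by (auto simp: real_integrable_def less_top)
 have eq: "(\<integral>\<^sup>+x. ennreal (f x) \<partial>msum M N) = (\<integral>\<^sup>+x. ennreal (f x) \<partial>M) + (\<integral>\<^sup>+x. ennreal (f x) \<partial>N)"
  "(\<integral>\<^sup>+x. ennreal (- f x) \<partial>msum M N) = (\<integral>\<^sup>+x. ennreal (- f x) \<partial>M) + (\<integral>\<^sup>+x. ennreal (- f x) \<partial>N)"
  using m by (intro nn_integral_msum[OF s]; measurable)+
 show i: "integrable (msum M N) f" unfolding real_integrable_def using fin m' eq by (auto simp: less_top[symmetric])
 show "(LINT x|msum M N. f x) = (LINT x|M. f x) + (LINT x|N. f x)"
  using fin by (simp add: real_lebesgue_integral_def[OF i] real_lebesgue_integral_def[OF f]
    real_lebesgue_integral_def[OF g] eq enn2real_plus)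
qed

definition bounded_borel_on :: "plane set => (plane => real) => bool" where
 "bounded_borel_on S \<phi> \<longleftrightarrow> \<phi> \<in> borel_measurable borel \<and> (\<exists>C. \<forall>x\<in>S. \<bar>\<phi> x\<bar> \<le> C)"

lemma bounded_borel_on_indicator: "B \<in> sets borel ==> bounded_borel_on S (indicator B)"
 unfolding bounded_borel_on_def by (auto simp: indicator_def intro!: exI[of _ 1])

lemma bounded_borel_on_continuous:
 assumes "continuous_on UNIV \<phi>" and "bounded S" shows "bounded_borel_on S \<phi>"
proof -
 have "compact (\<phi> ` closure S)"
  using assms by (intro compact_continuous_image) (auto intro: continuous_on_subset)
 then obtain C where "\<forall>y\<in>\<phi> ` closure S. norm y \<le> C" by (meson compact_imp_bounded bounded_iff)
 then have "\<forall>x\<in>S. \<bar>\<phi> x\<bar> \<le> C" using closure_subset by force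
 then show ?thesis using assms(1) by (auto simp: bounded_borel_on_def borel_measurable_continuous_onI)
qed

lemma fbm:
 assumes "finite_borel_measure_on S M"
 shows "finite_measure M" and "sets M = sets (restrict_space borel S)" and "space M = S"
 using assms sets_eq_imp_space_eq[of M "restrict_space borel S"] unfolding finite_borel_measure_on_def
 by (auto simp: space_restrict_space)

lemma fbm_measurable:
 assumes "finite_borel_measure_on S M" and "\<phi> \<in> borel_measurable borel"
 shows "\<phi> \<in> borel_measurable M"
 using measurable_restrict_space1[OF assms(2), of S] fbm(2)[OF assms(1)] measurable_cong_sets by blast

lemma fbm_integrable:
 assumes M: "finite_borel_measure_on S M" and \<phi>: "bounded_borel_on S \<phi>"
 shows "integrable M \<phi>"
proof -
 interpret finite_measure M using fbm(1)[OF M] .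
 obtain C where "\<forall>x\<in>S. \<bar>\<phi> x\<bar> \<le> C" using \<phi> by (auto simp: bounded_borel_on_def)
 then show ?thesis
  using \<phi> fbm_measurable[OF M] fbm(3)[OF M]
  by (intro integrable_const_bound[where B=C]) (auto simp: bounded_borel_on_def)
qed

lemma fbm_msum:
 assumes "finite_borel_measure_on S M" and "finite_borel_measure_on S N"
 shows "finite_borel_measure_on S (msum M N)"
 using assms finite_measure_msum[of N M] by (auto simp: finite_borel_measure_on_def)

text \<open>Moving the negative parts to the other side turns the claim into one about the sums \<open>P + N'\<close> and
 \<open>P' + N\<close>, which are positive measures with equal values.\<close>

lemma signed_measure_integral_eq:
 assumes M: "finite_borel_measure_on S P" "finite_borel_measure_on S N" "finite_borel_measure_on S P'" "finite_borel_measure_on S N'"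
  and S: "S \<in> sets borel"
  and eq: "!!B. B \<in> sets borel ==> B \<subseteq> S ==> measure P B - measure N B = measure P' B - measure N' B"
  and \<phi>: "bounded_borel_on S \<phi>"
 shows "(LINT x|P. \<phi> x) - (LINT x|N. \<phi> x) = (LINT x|P'. \<phi> x) - (LINT x|N'. \<phi> x)"
proof -
 have s: "sets N' = sets P" "sets N = sets P'" "sets P = sets P'" using M by (auto simp: finite_borel_measure_on_def)
 have "msum P N' = msum P' N"
 proof (rule measure_eqI)
  fix B assume "B \<in> sets (msum P N')"
  then have B: "B \<in> sets borel" "B \<subseteq> S" and BP: "B \<in> sets P"
   using fbm(2)[OF M(1)] S by (auto simp: sets_restrict_space)
  interpret P: finite_measure P using fbm(1)[OF M(1)] .
  interpret N: finite_measure N using fbm(1)[OF M(2)] .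
  interpret P': finite_measure P' using fbm(1)[OF M(3)] .
  interpret N': finite_measure N' using fbm(1)[OF M(4)] .
  have "measure P B + measure N' B = measure P' B + measure N B" using eq[OF B] by simp
  then have "emeasure P B + emeasure N' B = emeasure P' B + emeasure N B"
   by (simp add: P.emeasure_eq_measure N.emeasure_eq_measure P'.emeasure_eq_measure N'.emeasure_eq_measure
     ennreal_plus[symmetric] del: ennreal_plus)
  then show "emeasure (msum P N') B = emeasure (msum P' N) B"
   using s BP by (simp add: emeasure_msum)
 qed (use s in simp)
 then have "(LINT x|P. \<phi> x) + (LINT x|N'. \<phi> x) = (LINT x|P'. \<phi> x) + (LINT x|N. \<phi> x)"
  using integral_msum(1)[OF s(1)] integral_msum(1)[OF s(2)] fbm_integrable[OF _ \<phi>] M by metis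
 then show ?thesis by simp
qed

lemma fbm_density_lborel:
 assumes S [measurable]: "S \<in> sets borel" and r: "r \<in> borel_measurable borel" "integrable lborel r"
 shows "finite_borel_measure_on S (density (restrict_space lborel S) (%x. ennreal (r x)))"
proof -
 note [measurable] = r(1)
 have "finite_measure (density (restrict_space lborel S) (%x. ennreal (r x)))"
 proof (rule finite_measureI)
  have "emeasure (density (restrict_space lborel S) (%x. ennreal (r x))) S = (\<integral>\<^sup>+x. ennreal (r x) * indicator S x \<partial>restrict_space lborel S)"
   by (rule emeasure_density) (auto intro: measurable_restrict_space1 simp: sets_restrict_space)
  also have "... = (\<integral>\<^sup>+x. ennreal (r x) * indicator S x * indicator S x \<partial>lborel)"
   by (rule nn_integral_restrict_space) simp
  also have "... \<le> (\<integral>\<^sup>+x. ennreal (r x) \<partial>lborel)"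
   by (rule nn_integral_mono) (auto simp: indicator_def)
  also have "... < \<infinity>" using r(2) by (auto simp: real_integrable_def less_top)
  finally show "emeasure (density (restrict_space lborel S) (%x. ennreal (r x))) (space (density (restrict_space lborel S) (%x. ennreal (r x)))) \<noteq> \<infinity>"
   by (simp add: space_restrict_space)
 qed
 moreover have "sets (restrict_space lborel S) = sets (restrict_space borel S)"
  by (rule sets_restrict_space_cong) simp
 ultimately show ?thesis by (simp add: finite_borel_measure_on_def)
qed

lemma integral_density_lborel:
 assumes S [measurable]: "S \<in> sets borel" and r: "r \<in> borel_measurable borel" "!!x. r x \<ge> 0"
  and \<phi>: "\<phi> \<in> borel_measurable borel"
 shows "(LINT x|density (restrict_space lborel S) (%x. ennreal (r x)). \<phi> x) = (LBINT x. indicator S x * (r x * \<phi> x))"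
proof -
 have "(LINT x|density (restrict_space lborel S) (%x. ennreal (r x)). \<phi> x) = (LINT x|restrict_space lborel S. r x * \<phi> x)"
  by (subst integral_real_density) (use r \<phi> in "auto intro: measurable_restrict_space1")
 also have "... = (LBINT x. indicator S x * (r x * \<phi> x))"
  by (subst integral_restrict_space) auto
 finally show ?thesis .
qed

lemma fbm_density:
 assumes M: "finite_borel_measure_on S M" and h: "h \<in> borel_measurable M" "AE x in M. \<bar>h x\<bar> \<le> (1::real)"
 shows "finite_borel_measure_on S (density M (%x. ennreal (h x)))"
proof -
 interpret finite_measure M using fbm(1)[OF M] .
 have "finite_measure (density M (%x. ennreal (h x)))"
 proof (rule finite_measureI)
  have "emeasure (density M (%x. ennreal (h x))) (space M) = (\<integral>\<^sup>+x. ennreal (h x) * indicator (space M) x \<partial>M)"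
   by (rule emeasure_density) (use h in auto)
  also have "... \<le> (\<integral>\<^sup>+x. 1 \<partial>M)"
  proof (rule nn_integral_mono_AE)
   show "AE x in M. ennreal (h x) * indicator (space M) x \<le> 1"
    using h(2) by eventually_elim (auto simp: indicator_def ennreal_le_1)
  qed
  also have "... < \<infinity>" using emeasure_finite by (simp add: less_top[symmetric])
  finally show "emeasure (density M (%x. ennreal (h x))) (space (density M (%x. ennreal (h x)))) \<noteq> \<infinity>" by simp
 qed
 then show ?thesis using M by (simp add: finite_borel_measure_on_def)
qed

text \<open>The functional \<open>\<phi> \<mapsto> \<integral> \<rho> \<phi> dx + \<integral> h \<phi> dS\<close> is the integral against a difference of finite Borel
 measures; this translates between the two ways of writing a distributional derivative.\<close>

lemma signed_measure_of_densities:
 assumes S [measurable]: "S \<in> sets borel" and \<rho>: "integrable (lebesgue_on S) \<rho>"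
  and M: "finite_borel_measure_on S M" and h: "h \<in> borel_measurable M" "AE x in M. \<bar>h x\<bar> \<le> 1"
 shows "\<exists>P N. finite_borel_measure_on S P \<and> finite_borel_measure_on S N \<and>
  (\<forall>\<phi>. bounded_borel_on S \<phi> -->
    (LINT x|P. \<phi> x) - (LINT x|N. \<phi> x) = (LINT x|lebesgue_on S. \<phi> x * \<rho> x) + (LINT x|M. \<phi> x * h x))"
proof -
 obtain r where r [measurable]: "r \<in> borel_measurable borel" and ri: "integrable lborel r"
  and r0: "\<forall>x. x \<notin> S --> r x = 0" and rae: "AE x in lebesgue_on S. \<rho> x = r x"
  using borel_representative_integrable[OF \<rho> S] by blast
 define rp where "rp x = max 0 (r x)" for x
 define rm where "rm x = max 0 (- r x)" for x
 have [measurable]: "rp \<in> borel_measurable borel" "rm \<in> borel_measurable borel" unfolding rp_def rm_def by measurable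
 have ip: "integrable lborel rp" "integrable lborel rm" unfolding rp_def rm_def using ri by auto
 define hp where "hp x = max 0 (h x)" for x
 define hm where "hm x = max 0 (- h x)" for x
 have hm: "hp \<in> borel_measurable M" "hm \<in> borel_measurable M" unfolding hp_def hm_def using h(1) by measurable
 have hb: "AE x in M. \<bar>hp x\<bar> \<le> 1" "AE x in M. \<bar>hm x\<bar> \<le> 1"
  using h(2) by (eventually_elim; auto simp: hp_def hm_def)+
 define L where "L k = density (restrict_space lborel S) (%x. ennreal (k x))" for k :: "plane => real"
 define H where "H k = density M (%x. ennreal (k x))" for k :: "plane => real"
 have fL: "finite_borel_measure_on S (L rp)" "finite_borel_measure_on S (L rm)"
  unfolding L_def using ip by (auto intro!: fbm_density_lborel)
 have fH: "finite_borel_measure_on S (H hp)" "finite_borel_measure_on S (H hm)"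
  unfolding H_def using hm hb by (auto intro!: fbm_density[OF M])
 have s: "sets (H hp) = sets (L rp)" "sets (H hm) = sets (L rm)" using fL fH by (auto simp: finite_borel_measure_on_def)
 show ?thesis
 proof (intro exI conjI allI impI)
  show "finite_borel_measure_on S (msum (L rp) (H hp))" "finite_borel_measure_on S (msum (L rm) (H hm))"
   using fL fH by (auto intro: fbm_msum)
  fix \<phi> assume \<phi>: "bounded_borel_on S \<phi>"
  then have [measurable]: "\<phi> \<in> borel_measurable borel" by (simp add: bounded_borel_on_def)
  obtain C where C: "\<forall>x\<in>S. \<bar>\<phi> x\<bar> \<le> C" using \<phi> by (auto simp: bounded_borel_on_def)
  have iL: "integrable lborel (%x. indicator S x * (k x * \<phi> x))" if "integrable lborel k" "k \<in> borel_measurable borel" for k :: "plane => real"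
  proof -
   have "integrable lborel (%x. (indicator S x * \<phi> x) * k x)"
    by (rule integrable_mult_bounded[OF that(1), of _ "max 0 C"]) (use C in "auto simp: indicator_def le_max_iff_disj")
   then show ?thesis by (simp add: ac_simps)
  qed
  have bm: "\<phi> \<in> borel_measurable M" by (rule fbm_measurable[OF M]) measurable
  have iM: "integrable M (%x. \<phi> x * k x)" if "k \<in> borel_measurable M" "AE x in M. \<bar>k x\<bar> \<le> 1" for k :: "plane => real"
  proof -
   interpret finite_measure M using fbm(1)[OF M] .
   show ?thesis
   proof (rule integrable_const_bound[where B="abs C"])
    have "AE x in M. x \<in> S" using AE_space[of M] fbm(3)[OF M] by simp
    then show "AE x in M. norm (\<phi> x * k x) \<le> abs C"
     using that(2)
    proof eventually_elim
     case (elim x)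
     then have "\<bar>\<phi> x\<bar> \<le> abs C" using C by force
     then have "\<bar>\<phi> x\<bar> * abs (k x) \<le> abs C * 1" using elim by (intro mult_mono) auto
     then show ?case by (simp add: abs_mult)
    qed
   qed (use that bm in measurable)
  qed
  have IL: "(LINT x|L k. \<phi> x) = (LBINT x. indicator S x * (k x * \<phi> x))" if "k \<in> borel_measurable borel" "!!x. k x \<ge> 0" for k
   unfolding L_def using that by (intro integral_density_lborel) auto
  have IH: "(LINT x|H k. \<phi> x) = (LINT x|M. \<phi> x * k x)" if "k \<in> borel_measurable M" "!!x. k x \<ge> 0" for k
   unfolding H_def using that bm by (subst integral_real_density) (auto simp: mult.commute)
  have "(LINT x|msum (L rp) (H hp). \<phi> x) - (LINT x|msum (L rm) (H hm). \<phi> x)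
   = (LINT x|L rp. \<phi> x) + (LINT x|H hp. \<phi> x) - ((LINT x|L rm. \<phi> x) + (LINT x|H hm. \<phi> x))"
   using fL fH fbm_integrable[OF _ \<phi>] by (simp add: integral_msum(1)[OF s(1)] integral_msum(1)[OF s(2)])
  also have "... = ((LBINT x. indicator S x * (rp x * \<phi> x)) - (LBINT x. indicator S x * (rm x * \<phi> x)))
    + ((LINT x|M. \<phi> x * hp x) - (LINT x|M. \<phi> x * hm x))"
  proof -
   have "(LINT x|L rp. \<phi> x) = (LBINT x. indicator S x * (rp x * \<phi> x))"
    "(LINT x|L rm. \<phi> x) = (LBINT x. indicator S x * (rm x * \<phi> x))"
    by (rule IL; simp add: rp_def rm_def)+
   moreover have "(LINT x|H hp. \<phi> x) = (LINT x|M. \<phi> x * hp x)" "(LINT x|H hm. \<phi> x) = (LINT x|M. \<phi> x * hm x)"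
   proof -
    have "hp x \<ge> 0" "hm x \<ge> 0" for x by (auto simp: hp_def hm_def)
    then show "(LINT x|H hp. \<phi> x) = (LINT x|M. \<phi> x * hp x)" "(LINT x|H hm. \<phi> x) = (LINT x|M. \<phi> x * hm x)"
     using IH hm by blast+
   qed
   ultimately show ?thesis by simp
  qed
  also have "... = (LBINT x. indicator S x * (rp x * \<phi> x) - indicator S x * (rm x * \<phi> x)) + (LINT x|M. \<phi> x * hp x - \<phi> x * hm x)"
   using iL[OF ip(1)] iL[OF ip(2)] iM[OF hm(1) hb(1)] iM[OF hm(2) hb(2)] by simp
  also have "(%x. indicator S x * (rp x * \<phi> x) - indicator S x * (rm x * \<phi> x)) = (%x. \<phi> x * r x)"
   using r0 by (auto simp: rp_def rm_def fun_eq_iff indicator_def max_def algebra_simps)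
  also have "(%x. \<phi> x * hp x - \<phi> x * hm x) = (%x. \<phi> x * h x)"
   by (auto simp: hp_def hm_def fun_eq_iff max_def)
  also have "(LBINT x. \<phi> x * r x) = (LINT x|lebesgue_on S. \<phi> x * r x)"
   using r0 by (intro integral_lebesgue_on_eq(1)[symmetric] S) auto
  also have "... = (LINT x|lebesgue_on S. \<phi> x * \<rho> x)"
  proof (rule integral_cong_AE)
   show "(%x. \<phi> x * r x) \<in> borel_measurable (lebesgue_on S)" by (rule borel_measurable_lebesgue_on) simp
   show "(%x. \<phi> x * \<rho> x) \<in> borel_measurable (lebesgue_on S)"
    using \<rho> by (intro borel_measurable_times borel_measurable_lebesgue_on[of \<phi>]) auto
   show "AE x in lebesgue_on S. \<phi> x * r x = \<phi> x * \<rho> x" using rae by eventually_elim simp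
  qed
  finally show "(LINT x|msum (L rp) (H hp). \<phi> x) - (LINT x|msum (L rm) (H hm). \<phi> x)
   = (LINT x|lebesgue_on S. \<phi> x * \<rho> x) + (LINT x|M. \<phi> x * h x)" .
 qed
qed

section \<open>Distributional derivatives that are finite signed measures\<close>

text \<open>The derivative of \<open>u\<close> has density \<open>\<rho>\<close> plus the signed measure with density
 \<open>h\<close> with respect to \<open>S\<close>. In contrast to a Lebesgue decomposition, \<open>S\<close> may charge sets
 of positive Lebesgue measure and \<open>\<bar>h\<bar>\<close> may be less than one, so that this notion is stable under
 linear combinations.\<close>

definition deriv_rep ::
 "plane set => plane => (plane => real) => (plane => real) => plane measure => (plane => real) => bool" where
 "deriv_rep G e u \<rho> S h \<longleftrightarrow>
   integrable (lebesgue_on G) \<rho> \<and> finite_borel_measure_on G S \<and> h \<in> borel_measurable S \<and>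
   (AE x in S. \<bar>h x\<bar> \<le> 1) \<and>
   (\<forall>\<phi>\<in>test_functions G. (LINT x|lebesgue_on G. u x * partial_deriv e \<phi> x)
    = - ((LINT x|lebesgue_on G. \<phi> x * \<rho> x) + (LINT x|S. \<phi> x * h x)))"

text \<open>The zero measure on the Borel subsets of \<open>G\<close>, for derivatives that are functions.\<close>

definition null_measure_on :: "plane set => plane measure" where
 "null_measure_on G = density (restrict_space lborel G) (%_. 0)"

lemma test_bounded_borel: "\<phi> \<in> test_functions G ==> bounded_borel_on S \<phi>"
proof -
 assume "\<phi> \<in> test_functions G"
 then have t: "\<phi> \<in> test_functions UNIV" using test_functions_mono by blast
 then have c: "continuous_on UNIV \<phi>" using C_k_continuous by (auto simp: test_functions_UNIV_iff)
 obtain B where "!!x. \<bar>\<phi> x\<bar> \<le> B" using compact_support_bounded[OF c] t by (metis test_functions_UNIV_iff)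
 then have "\<exists>C. \<forall>x\<in>S. \<bar>\<phi> x\<bar> \<le> C" by blast
 then show ?thesis using c by (simp add: bounded_borel_on_def borel_measurable_continuous_onI)
qed

lemma null_measure_on:
 assumes "S \<in> sets borel"
 shows "finite_borel_measure_on S (null_measure_on S)" and "(LINT x|null_measure_on S. f x) = (0::real)"
  and "AE x in null_measure_on S. P x"
proof -
 have "null_measure_on S = density (restrict_space lborel S) (%x. ennreal ((%_. 0) x))" by (simp add: null_measure_on_def)
 then show "finite_borel_measure_on S (null_measure_on S)" using fbm_density_lborel[OF assms, of "%_. 0"] by simp
 show *: "AE x in null_measure_on S. P x" for P unfolding null_measure_on_def by (simp add: AE_density)
 show "(LINT x|null_measure_on S. f x) = (0::real)"
  using integral_eq_zero_AE[OF *[of "%x. f x = 0"]] .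
qed

lemma deriv_measure_unique:
 assumes G: "open G" and 1: "has_deriv_measure G e u P N" and 2: "has_deriv_measure G e u P' N'"
  and \<phi>: "bounded_borel_on G \<phi>"
 shows "(LINT x|P. \<phi> x) - (LINT x|N. \<phi> x) = (LINT x|P'. \<phi> x) - (LINT x|N'. \<phi> x)"
proof (rule signed_measure_integral_eq[OF _ _ _ _ _ _ \<phi>])
 show "finite_borel_measure_on G P" "finite_borel_measure_on G N" "finite_borel_measure_on G P'"
  "finite_borel_measure_on G N'" using 1 2 by (auto simp: has_deriv_measure_def)
 show "G \<in> sets borel" using G by simp
 fix B assume B: "B \<in> sets borel" "B \<subseteq> G"
 show "measure P B - measure N B = measure P' B - measure N' B"
 proof (rule test_functions_separate[OF G _ _ _ _ _ B])
  fix ps assume "ps \<in> test_functions G"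
  then show "(LINT x|P. ps x) - (LINT x|N. ps x) = (LINT x|P'. ps x) - (LINT x|N'. ps x)"
   using 1 2 unfolding has_deriv_measure_def by (metis neg_equal_iff_equal)
 qed (use 1 2 in "auto simp: has_deriv_measure_def")
qed

lemma deriv_rep_measure:
 assumes G: "open G" and r: "deriv_rep G e u \<rho> S h"
 shows "\<exists>P N. has_deriv_measure G e u P N \<and> (\<forall>\<phi>. bounded_borel_on G \<phi> -->
   (LINT x|P. \<phi> x) - (LINT x|N. \<phi> x) = (LINT x|lebesgue_on G. \<phi> x * \<rho> x) + (LINT x|S. \<phi> x * h x))"
proof -
 have Gb: "G \<in> sets borel" using G by simp
 obtain P N where PN: "finite_borel_measure_on G P" "finite_borel_measure_on G N"
  "\<forall>\<phi>. bounded_borel_on G \<phi> -->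
   (LINT x|P. \<phi> x) - (LINT x|N. \<phi> x) = (LINT x|lebesgue_on G. \<phi> x * \<rho> x) + (LINT x|S. \<phi> x * h x)"
  using signed_measure_of_densities[OF Gb, of \<rho> S h] r unfolding deriv_rep_def by blast
 have "has_deriv_measure G e u P N"
  unfolding has_deriv_measure_def
 proof (intro conjI PN ballI)
  fix \<phi> assume p: "\<phi> \<in> test_functions G"
  then show "(LINT x|lebesgue_on G. u x * partial_deriv e \<phi> x) = - ((LINT x|P. \<phi> x) - (LINT x|N. \<phi> x))"
   using r PN(3)[rule_format, OF test_bounded_borel[OF p]] unfolding deriv_rep_def by simp
 qed
 then show ?thesis using PN by blast
qed

lemma deriv_rep_unique:
 assumes G: "open G" and r: "deriv_rep G e u \<rho> S h" "deriv_rep G e u \<rho>' S' h'" and \<phi>: "bounded_borel_on G \<phi>"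
 shows "(LINT x|lebesgue_on G. \<phi> x * \<rho> x) + (LINT x|S. \<phi> x * h x)
  = (LINT x|lebesgue_on G. \<phi> x * \<rho>' x) + (LINT x|S'. \<phi> x * h' x)"
proof -
 obtain P N where 1: "has_deriv_measure G e u P N" "\<forall>\<phi>. bounded_borel_on G \<phi> -->
   (LINT x|P. \<phi> x) - (LINT x|N. \<phi> x) = (LINT x|lebesgue_on G. \<phi> x * \<rho> x) + (LINT x|S. \<phi> x * h x)"
  using deriv_rep_measure[OF G r(1)] by blast
 obtain P' N' where 2: "has_deriv_measure G e u P' N'" "\<forall>\<phi>. bounded_borel_on G \<phi> -->
   (LINT x|P'. \<phi> x) - (LINT x|N'. \<phi> x) = (LINT x|lebesgue_on G. \<phi> x * \<rho>' x) + (LINT x|S'. \<phi> x * h' x)"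
  using deriv_rep_measure[OF G r(2)] by blast
 show ?thesis
  using deriv_measure_unique[OF G 1(1) 2(1) \<phi>] 1(2)[rule_format, OF \<phi>] 2(2)[rule_format, OF \<phi>] by simp
qed

lemma lebesgue_decomposition_deriv_rep:
 assumes G: "open G" and d: "has_lebesgue_decomposition G e u \<rho> S h"
 shows "deriv_rep G e u \<rho> S h"
proof -
 have Gb: "G \<in> sets borel" using G by simp
 have 1: "integrable (lebesgue_on G) \<rho>" "finite_borel_measure_on G S" "h \<in> borel_measurable S"
  using d unfolding has_lebesgue_decomposition_def L1_def by auto
 have 2: "AE x in S. \<bar>h x\<bar> \<le> 1"
 proof -
  have "AE x in S. \<bar>h x\<bar> = 1" using d unfolding has_lebesgue_decomposition_def by blast
  then show ?thesis by eventually_elim simp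
 qed
 obtain P N where PN: "has_deriv_measure G e u P N"
  "\<forall>B\<in>sets borel. B \<subseteq> G --> measure P B - measure N B
      = (LINT x|lebesgue_on G. indicator B x * \<rho> x) + (LINT x|S. indicator B x * h x)"
  using d unfolding has_lebesgue_decomposition_def by blast
 obtain P' N' where PN': "finite_borel_measure_on G P'" "finite_borel_measure_on G N'"
  "\<forall>\<phi>. bounded_borel_on G \<phi> -->
   (LINT x|P'. \<phi> x) - (LINT x|N'. \<phi> x) = (LINT x|lebesgue_on G. \<phi> x * \<rho> x) + (LINT x|S. \<phi> x * h x)"
  using signed_measure_of_densities[OF Gb 1 2] by blast
 have mi: "(LINT x|M. indicator B x) = measure M B" if "finite_borel_measure_on G M" "B \<subseteq> G" for M and B :: "plane set"
  using fbm(3)[OF that(1)] that(2) by (simp add: Int_absorb2)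
 have "(LINT x|P. \<phi> x) - (LINT x|N. \<phi> x) = (LINT x|P'. \<phi> x) - (LINT x|N'. \<phi> x)" if "bounded_borel_on G \<phi>" for \<phi>
 proof (rule signed_measure_integral_eq[OF _ _ PN'(1,2) Gb _ that])
  show "finite_borel_measure_on G P" "finite_borel_measure_on G N" using PN(1) by (auto simp: has_deriv_measure_def)
  fix B :: "plane set" assume B: "B \<in> sets borel" "B \<subseteq> G"
  show "measure P B - measure N B = measure P' B - measure N' B"
   using PN(2) PN'(3)[rule_format, OF bounded_borel_on_indicator[OF B(1)]] B mi[OF PN'(1) B(2)] mi[OF PN'(2) B(2)] by simp
 qed
 then show ?thesis
  using 1 2 PN(1) PN'(3) test_bounded_borel unfolding deriv_rep_def has_deriv_measure_def by simp
qed

lemma lebesgue_decompositionI: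
 assumes G: "open G" and r: "deriv_rep G e u \<rho> S h"
  and Z: "Z \<in> null_sets lborel" "Z \<subseteq> G" "emeasure S (G - Z) = 0" and h: "AE x in S. \<bar>h x\<bar> = 1"
 shows "has_lebesgue_decomposition G e u \<rho> S h"
proof -
 obtain P N where PN: "has_deriv_measure G e u P N" "\<forall>\<phi>. bounded_borel_on G \<phi> -->
   (LINT x|P. \<phi> x) - (LINT x|N. \<phi> x) = (LINT x|lebesgue_on G. \<phi> x * \<rho> x) + (LINT x|S. \<phi> x * h x)"
  using deriv_rep_measure[OF G r] by blast
 have f: "finite_borel_measure_on G P" "finite_borel_measure_on G N" using PN(1) by (auto simp: has_deriv_measure_def)
 have "measure P B - measure N B
      = (LINT x|lebesgue_on G. indicator B x * \<rho> x) + (LINT x|S. indicator B x * h x)" if "B \<in> sets borel" "B \<subseteq> G" for B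
  using PN(2)[rule_format, OF bounded_borel_on_indicator[OF that(1)]] fbm(3)[OF f(1)] fbm(3)[OF f(2)] that(2)
  by (simp add: Int_absorb2)
 then show ?thesis
  using r Z h PN(1) unfolding has_lebesgue_decomposition_def deriv_rep_def L1_def by blast
qed

lemma integrable_bounded_borel_mult:
 assumes "S \<in> sets borel" and f: "integrable (lebesgue_on S) f" and \<phi>: "bounded_borel_on S \<phi>"
 shows "integrable (lebesgue_on S) (%x. \<phi> x * f x)"
proof -
 obtain C where C: "\<forall>x\<in>S. \<bar>\<phi> x\<bar> \<le> C" using \<phi> by (auto simp: bounded_borel_on_def)
 show ?thesis
  by (rule integrable_mult_bounded[OF f]) (use \<phi> C in "auto simp: bounded_borel_on_def intro!: borel_measurable_lebesgue_on")
qed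

lemma fbm_mult_integrable:
 assumes M: "finite_borel_measure_on S M" and h: "h \<in> borel_measurable M" "AE x in M. \<bar>h x\<bar> \<le> 1" and \<phi>: "bounded_borel_on S \<phi>"
 shows "integrable M (%x. \<phi> x * h x)"
proof (rule integrable_bound[OF fbm_integrable[OF M \<phi>]])
 show "(%x. \<phi> x * h x) \<in> borel_measurable M"
  using \<phi> by (intro borel_measurable_times[OF fbm_measurable[OF M] h(1)]) (simp add: bounded_borel_on_def)
 show "AE x in M. norm (\<phi> x * h x) \<le> norm (\<phi> x)"
  using h(2) by eventually_elim (auto simp: abs_mult mult_left_le)
qed

text \<open>The parts of a Lebesgue decomposition live on complementary sets, so they are determined
 separately; the singular part is compared through its positive and negative mass.\<close>

lemma lebesgue_decomposition_unique:
 assumes G: "open G" and d: "has_lebesgue_decomposition G e u \<rho> S h" and d': "has_lebesgue_decomposition G e u \<rho>' S' h'"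
 shows "AE x in lebesgue_on G. \<rho> x = \<rho>' x"
  and "(LINT x|S. max 0 (h x)) = (LINT x|S'. max 0 (h' x))"
  and "(LINT x|S. max 0 (- h x)) = (LINT x|S'. max 0 (- h' x))"
proof -
 have Gb [measurable]: "G \<in> sets borel" using G by simp
 note r = lebesgue_decomposition_deriv_rep[OF G d] and r' = lebesgue_decomposition_deriv_rep[OF G d']
 obtain Z where Z: "Z \<in> null_sets lborel" "Z \<subseteq> G" "emeasure S (G - Z) = 0"
  using d unfolding has_lebesgue_decomposition_def by blast
 obtain Z' where Z': "Z' \<in> null_sets lborel" "Z' \<subseteq> G" "emeasure S' (G - Z') = 0"
  using d' unfolding has_lebesgue_decomposition_def by blast
 have Zb [measurable]: "Z \<in> sets borel" "Z' \<in> sets borel" using Z Z' by auto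
 have S: "finite_borel_measure_on G S" "finite_borel_measure_on G S'" using r r' by (auto simp: deriv_rep_def)
 have i: "integrable (lebesgue_on G) \<rho>" "integrable (lebesgue_on G) \<rho>'" using r r' by (auto simp: deriv_rep_def)
 let ?Y = "Z \<union> Z'"
 have AEW: "AE x in M. x \<in> W" if "finite_borel_measure_on G M" "emeasure M (G - W) = 0" "W \<in> sets borel" for M W
 proof -
  have "G - W \<in> sets M" using fbm(2)[OF that(1)] that(3) by (auto simp: sets_restrict_space)
  then have "G - W \<in> null_sets M" using that(2) by auto
  from AE_not_in[OF this] have 1: "AE x in M. x \<notin> G - W" .
  have 2: "AE x in M. x \<in> G" using AE_space[of M] fbm(3)[OF that(1)] by simp
  show ?thesis using 1 2 by eventually_elim auto
 qed
 have AEZ: "AE x in S. x \<in> ?Y" "AE x in S'. x \<in> ?Y"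
  using AEW[OF S(1) Z(3) Zb(1)] AEW[OF S(2) Z'(3) Zb(2)] by (auto elim: eventually_mono)
 have AEl: "AE x in lebesgue_on G. x \<notin> ?Y"
 proof -
  have "AE x in lborel. x \<notin> ?Y" using Z(1) Z'(1) by (intro AE_not_in) auto
  then show ?thesis unfolding AE_lebesgue_on_iff[OF Gb] by eventually_elim blast
 qed
 have ac0: "(LINT x|lebesgue_on G. indicator (B \<inter> ?Y) x * k x) = 0" for B and k :: "plane => real"
  by (rule integral_eq_zero_AE, rule AE_mp[OF AEl], rule always_eventually, simp add: indicator_def)
 have s0: "(LINT x|S. indicator (B - ?Y) x * k x) = 0" "(LINT x|S'. indicator (B - ?Y) x * k x) = 0" for B and k :: "plane => real"
  by (rule integral_eq_zero_AE, rule AE_mp[OF AEZ(1)], rule always_eventually, simp add: indicator_def)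
    (rule integral_eq_zero_AE, rule AE_mp[OF AEZ(2)], rule always_eventually, simp add: indicator_def)
 have mle: "(indicator B :: plane => real) \<in> borel_measurable (lebesgue_on G)" if "B \<in> sets borel" for B :: "plane set"
  using that borel_measurable_lebesgue_on[of "indicator B"] by simp
 show "AE x in lebesgue_on G. \<rho> x = \<rho>' x"
 proof (rule AE_eq_if_borel_integrals_eq[OF i Gb])
  fix B :: "plane set" assume B [measurable]: "B \<in> sets borel" and "B \<subseteq> G"
  have cut: "(LINT x|lebesgue_on G. indicator B x * k x) = (LINT x|lebesgue_on G. indicator (B - ?Y) x * k x)"
   if "integrable (lebesgue_on G) k" for k :: "plane => real"
  proof (rule integral_cong_AE)
   show "AE x in lebesgue_on G. indicator B x * k x = indicator (B - ?Y) x * k x"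
    using AEl by eventually_elim (auto simp: indicator_def)
   show "(%x. indicator B x * k x) \<in> borel_measurable (lebesgue_on G)"
    by (intro borel_measurable_times[OF mle[OF B]] borel_measurable_integrable that)
   have "B - ?Y \<in> sets borel" by measurable
   then show "(%x. indicator (B - ?Y) x * k x) \<in> borel_measurable (lebesgue_on G)"
    by (intro borel_measurable_times[OF mle] borel_measurable_integrable that)
  qed
  have "bounded_borel_on G (indicator (B - ?Y))" by (rule bounded_borel_on_indicator) measurable
  from deriv_rep_unique[OF G r r' this]
  show "(LINT x|lebesgue_on G. indicator B x * \<rho> x) = (LINT x|lebesgue_on G. indicator B x * \<rho>' x)"
   unfolding cut[OF i(1)] cut[OF i(2)] by (simp add: s0)
 qed
 have sing: "(LINT x|S. indicator B x * h x) = (LINT x|S'. indicator B x * h' x)" if B [measurable]: "B \<in> sets borel" for B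
 proof -
  have "bounded_borel_on G (indicator (B \<inter> ?Y))" by (rule bounded_borel_on_indicator) measurable
  from deriv_rep_unique[OF G r r' this]
  have 1: "(LINT x|S. indicator (B \<inter> ?Y) x * h x) = (LINT x|S'. indicator (B \<inter> ?Y) x * h' x)" by (simp add: ac0)
  have "(LINT x|M. indicator (B \<inter> ?Y) x * k x) = (LINT x|M. indicator B x * k x)"
   if "AE x in M. x \<in> ?Y" "k \<in> borel_measurable M" "finite_borel_measure_on G M" for M and k :: "plane => real"
  proof (rule integral_cong_AE)
   show "AE x in M. indicator (B \<inter> ?Y) x * k x = indicator B x * k x"
    using that(1) by eventually_elim (auto simp: indicator_def)
   have "(indicator C :: plane => real) \<in> borel_measurable M" if "C \<in> sets borel" for C :: "plane set"
    by (rule fbm_measurable[OF \<open>finite_borel_measure_on G M\<close>]) (use that in simp)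
   then show "(%x. indicator (B \<inter> ?Y) x * k x) \<in> borel_measurable M" "(%x. indicator B x * k x) \<in> borel_measurable M"
    using that(2) by (auto intro!: borel_measurable_times)
  qed
  from this[OF AEZ(1) _ S(1), of h] this[OF AEZ(2) _ S(2), of h'] 1 r r' show ?thesis
   by (simp add: deriv_rep_def)
 qed
 have le: "(LINT x|S. max 0 (s * h x)) \<le> (LINT x|S'. max 0 (s * h' x))"
  if S: "finite_borel_measure_on G S" "finite_borel_measure_on G S'" and hm: "h \<in> borel_measurable S" "h' \<in> borel_measurable S'"
   and hb: "AE x in S. \<bar>h x\<bar> \<le> 1" "AE x in S'. \<bar>h' x\<bar> \<le> 1" and s: "abs s = 1"
   and eq: "!!B. B \<in> sets borel ==> (LINT x|S. indicator B x * h x) = (LINT x|S'. indicator B x * h' x)"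
  for S S' h h' and s :: real
 proof -
  let ?B = "{x \<in> space S. s * h x > 0}"
  have "?B \<in> sets S" using hm(1) by measurable
  then have B: "?B \<in> sets borel" using fbm(2)[OF S(1)] by (auto simp: sets_restrict_space)
  have "(LINT x|S. max 0 (s * h x)) = (LINT x|S. s * (indicator ?B x * h x))"
   by (rule integral_cong) (auto simp: indicator_def max_def)
  also have "... = s * (LINT x|S. indicator ?B x * h x)" by simp
  also have "... = s * (LINT x|S'. indicator ?B x * h' x)" by (simp only: eq[OF B])
  also have "... = (LINT x|S'. s * (indicator ?B x * h' x))" by simp
  also have "... \<le> (LINT x|S'. max 0 (s * h' x))"
  proof (rule integral_mono)
   show "integrable S' (%x. s * (indicator ?B x * h' x))"
    using fbm_mult_integrable[OF S(2) hm(2) hb(2) bounded_borel_on_indicator[OF B]] by simp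
   have "integrable S' (%x. 1 * h' x)"
    by (rule fbm_mult_integrable[OF S(2) hm(2) hb(2)]) (auto simp: bounded_borel_on_def)
   then show "integrable S' (%x. max 0 (s * h' x))" by simp
  qed (auto simp: indicator_def)
  finally show ?thesis .
 qed
 have m: "h \<in> borel_measurable S" "h' \<in> borel_measurable S'" "AE x in S. \<bar>h x\<bar> \<le> 1" "AE x in S'. \<bar>h' x\<bar> \<le> 1"
  using r r' by (auto simp: deriv_rep_def)
 have "(LINT x|S. max 0 (s * h x)) = (LINT x|S'. max 0 (s * h' x))" if "abs s = 1" for s
  by (rule antisym; rule le) (use S m that sing in auto)
 from this[of 1] this[of "-1"] show "(LINT x|S. max 0 (h x)) = (LINT x|S'. max 0 (h' x))"
  "(LINT x|S. max 0 (- h x)) = (LINT x|S'. max 0 (- h' x))" by auto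
qed

text \<open>The densities are real valued because the measures are finite.\<close>

lemma radon_nikodym_real:
 assumes M: "finite_measure M" and P: "finite_measure P" and s: "sets P = sets M"
  and le: "!!B. B \<in> sets M ==> emeasure P B \<le> emeasure M B"
 shows "\<exists>p\<in>borel_measurable M. (\<forall>x. p x \<ge> (0::real)) \<and> integrable M p \<and> P = density M (%x. ennreal (p x))"
proof -
 interpret M: finite_measure M by fact
 interpret P: finite_measure P by fact
 have "absolutely_continuous M P"
  unfolding absolutely_continuous_def
 proof
  fix B assume "B \<in> null_sets M"
  then show "B \<in> null_sets P" using le[of B] s by (auto simp: null_sets_def)
 qed
 then obtain f where f: "f \<in> borel_measurable M" "density M f = P"
  using M.Radon_Nikodym[of P] s by blast
 have "(\<integral>\<^sup>+x. f x \<partial>M) = (\<integral>\<^sup>+x. f x * indicator (space M) x \<partial>M)" by (rule nn_integral_cong) simp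
 also have "... = emeasure P (space M)" using emeasure_density[OF f(1), of "space M"] f(2) by simp
 also have "... < \<infinity>" by (simp add: less_top[symmetric])
 finally have fin: "(\<integral>\<^sup>+x. f x \<partial>M) < \<infinity>" .
 then have "AE x in M. f x \<noteq> \<infinity>" using nn_integral_noteq_infinite[OF f(1)] by simp
 then have ae: "AE x in M. f x = ennreal (enn2real (f x))" by eventually_elim (simp add: less_top)
 have [measurable]: "(%x. enn2real (f x)) \<in> borel_measurable M" using f(1) by simp
 have "P = density M (%x. ennreal (enn2real (f x)))"
  using f(2) density_cong[OF f(1) _ ae] by simp
 moreover have "integrable M (%x. enn2real (f x))"
 proof (rule integrableI_nonneg)
  have "(\<integral>\<^sup>+x. ennreal (enn2real (f x)) \<partial>M) = (\<integral>\<^sup>+x. f x \<partial>M)"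
   by (rule nn_integral_cong_AE) (use ae in eventually_elim, simp)
  then show "(\<integral>\<^sup>+x. ennreal (enn2real (f x)) \<partial>M) < \<infinity>" using fin by simp
 qed auto
 ultimately show ?thesis by (intro bexI[of _ "%x. enn2real (f x)"]) auto
qed

lemma lebesgue_on_restrict_lborel:
 fixes f :: "plane => real"
 assumes S: "S \<in> sets borel" and f: "f \<in> borel_measurable (restrict_space lborel S)"
 shows "(LINT x|lebesgue_on S. f x) = (LINT x|restrict_space lborel S. f x)"
  and "integrable (lebesgue_on S) f \<longleftrightarrow> integrable (restrict_space lborel S) f"
proof -
 have "(%x. indicat_real S x *\<^sub>R f x) \<in> borel_measurable lborel"
  using f S borel_measurable_restrict_space_iff[of S lborel f] by simp
 then show "(LINT x|lebesgue_on S. f x) = (LINT x|restrict_space lborel S. f x)"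
  "integrable (lebesgue_on S) f \<longleftrightarrow> integrable (restrict_space lborel S) f"
  using S by (simp_all add: integral_restrict_space integrable_restrict_space integral_completion integrable_completion)
qed

text \<open>Let \<open>M\<close> be the sum of Lebesgue measure and the two measures \<open>P\<close>, \<open>N\<close>, all
 of which have densities with respect to it. The set where Lebesgue measure has density zero carries the singular part, and
 off this set the other densities can be divided by the Lebesgue density.\<close>

lemma lebesgue_decomposition_exists:
 assumes G: "open G" "bounded G" and d: "has_deriv_measure G e u P N"
 shows "\<exists>\<rho> S h. has_lebesgue_decomposition G e u \<rho> S h"
proof -
 have Gb [measurable]: "G \<in> sets borel" using G by simp
 have fP: "finite_borel_measure_on G P" and fN: "finite_borel_measure_on G N" using d by (auto simp: has_deriv_measure_def)
 define \<Lambda> where "\<Lambda> = restrict_space (lborel :: plane measure) G"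
 have s\<Lambda>: "sets \<Lambda> = sets (restrict_space borel G)" unfolding \<Lambda>_def by (rule sets_restrict_space_cong) simp
 have f\<Lambda>: "finite_borel_measure_on G \<Lambda>"
 proof -
  have "emeasure \<Lambda> (space \<Lambda>) < \<infinity>"
   using emeasure_bounded_finite[OF G(2)] by (simp add: \<Lambda>_def space_restrict_space emeasure_restrict_space)
  then show ?thesis using s\<Lambda> by (auto simp: finite_borel_measure_on_def intro!: finite_measureI)
 qed
 define M where "M = msum (msum P N) \<Lambda>"
 have fM: "finite_borel_measure_on G M" unfolding M_def by (intro fbm_msum fP fN f\<Lambda>)
 have sP: "sets P = sets M" "sets N = sets M" "sets \<Lambda> = sets M"
  using fP fN f\<Lambda> fM by (auto simp: finite_borel_measure_on_def)
 have em: "emeasure M B = emeasure P B + emeasure N B + emeasure \<Lambda> B" if "B \<in> sets M" for B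
 proof -
  have s: "sets N = sets P" "sets \<Lambda> = sets P" using fP fN f\<Lambda> by (auto simp: finite_borel_measure_on_def)
  have "B \<in> sets P" using that by (simp add: M_def)
  then show ?thesis unfolding M_def using s by (simp add: emeasure_msum)
 qed
 have le: "emeasure P B \<le> emeasure M B" "emeasure N B \<le> emeasure M B" "emeasure \<Lambda> B \<le> emeasure M B" if "B \<in> sets M" for B
 proof -
  show "emeasure P B \<le> emeasure M B" unfolding em[OF that] by (intro add_increasing2) auto
  show "emeasure N B \<le> emeasure M B" unfolding em[OF that] by (intro add_increasing2 add_increasing) auto
  show "emeasure \<Lambda> B \<le> emeasure M B" unfolding em[OF that] by (intro add_increasing) auto
 qed
 obtain p where p: "p \<in> borel_measurable M" "\<forall>x. p x \<ge> 0" "integrable M p" "P = density M (%x. ennreal (p x))"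
  using radon_nikodym_real[OF fbm(1)[OF fM] fbm(1)[OF fP] sP(1) le(1)] by blast
 obtain n where n: "n \<in> borel_measurable M" "\<forall>x. n x \<ge> 0" "integrable M n" "N = density M (%x. ennreal (n x))"
  using radon_nikodym_real[OF fbm(1)[OF fM] fbm(1)[OF fN] sP(2) le(2)] by blast
 obtain l where l: "l \<in> borel_measurable M" "\<forall>x. l x \<ge> 0" "integrable M l" "\<Lambda> = density M (%x. ennreal (l x))"
  using radon_nikodym_real[OF fbm(1)[OF fM] fbm(1)[OF f\<Lambda>] sP(3) le(3)] by blast
 note [measurable] = p(1) n(1) l(1)
 define Z where "Z = {x \<in> space M. l x = 0}"
 have ZM [measurable]: "Z \<in> sets M" unfolding Z_def by measurable
 have Zs: "Z \<in> sets (restrict_space borel G)" using ZM fbm(2)[OF fM] by simp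
 have Zb: "Z \<in> sets borel" "Z \<subseteq> G"
  using Zs Gb by (auto simp: sets_restrict_space_iff)
 have "emeasure \<Lambda> Z = (\<integral>\<^sup>+x. ennreal (l x) * indicator Z x \<partial>M)" unfolding l(4) by (rule emeasure_density) measurable
 also have "... = (\<integral>\<^sup>+x. 0 \<partial>M)" by (rule nn_integral_cong) (auto simp: Z_def indicator_def)
 finally have "emeasure \<Lambda> Z = 0" by simp
 then have Z0: "Z \<in> null_sets lborel" using Zb by (auto simp: \<Lambda>_def emeasure_restrict_space null_sets_def)
 define \<rho> where "\<rho> x = (if x \<in> Z then 0 else (p x - n x) / l x)" for x
 define k where "k x = (if x \<in> Z then \<bar>p x - n x\<bar> else 0)" for x
 define h where "h x = (if p x \<ge> n x then 1 else (-1::real))" for x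
 define S where "S = density M (%x. ennreal (k x))"
 have [measurable]: "\<rho> \<in> borel_measurable M" "k \<in> borel_measurable M" "h \<in> borel_measurable M"
  unfolding \<rho>_def k_def h_def by measurable
 have ik: "integrable M k"
  by (rule integrable_bound[of _ "%x. p x - n x"]) (use p n in "auto simp: k_def")
 have fS: "finite_borel_measure_on G S"
 proof -
  have "emeasure S (space M) = (\<integral>\<^sup>+x. ennreal (k x) * indicator (space M) x \<partial>M)" unfolding S_def by (rule emeasure_density) auto
  also have "... \<le> (\<integral>\<^sup>+x. ennreal (k x) \<partial>M)" by (rule nn_integral_mono) (auto simp: indicator_def)
  also have "... < \<infinity>" using ik by (auto simp: real_integrable_def less_top)
  finally have "finite_measure S" by (intro finite_measureI) (simp add: S_def)
  then show ?thesis using fM by (simp add: finite_borel_measure_on_def S_def)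
 qed
 have lpos: "l x > 0" if "x \<in> space M" "x \<notin> Z" for x using that l(2) by (auto simp: Z_def less_le)
 have \<rho>m: "\<rho> \<in> borel_measurable \<Lambda>" using sP(3) measurable_cong_sets[OF sP(3) refl, of borel] by simp
 have i\<rho>: "integrable \<Lambda> \<rho>"
  unfolding l(4)
 proof (subst integrable_density)
  show "integrable M (%x. l x *\<^sub>R \<rho> x)"
  proof (rule integrable_bound[of _ "%x. p x - n x"])
   show "AE x in M. norm (l x *\<^sub>R \<rho> x) \<le> norm (p x - n x)"
    using AE_space by eventually_elim (use lpos in "auto simp: \<rho>_def abs_mult")
  qed (use p n in auto)
 qed (use l in auto)
 have rep: "deriv_rep G e u \<rho> S h"
  unfolding deriv_rep_def
 proof (intro conjI ballI)
  show "integrable (lebesgue_on G) \<rho>"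
   using i\<rho> \<rho>m lebesgue_on_restrict_lborel(2)[OF Gb, of \<rho>] by (simp add: \<Lambda>_def)
  show "h \<in> borel_measurable S" by (simp add: S_def)
  fix \<phi> assume t: "\<phi> \<in> test_functions G"
  have bb: "bounded_borel_on G \<phi>" by (rule test_bounded_borel[OF t])
  have [measurable]: "\<phi> \<in> borel_measurable M" by (rule fbm_measurable[OF fM]) (use bb in "simp add: bounded_borel_on_def")
  have pint: "integrable M (%x. \<phi> x * w x)" if "integrable M w" for w :: "plane => real"
  proof -
   obtain C where C: "\<forall>x\<in>G. \<bar>\<phi> x\<bar> \<le> C" using bb by (auto simp: bounded_borel_on_def)
   show ?thesis by (rule integrable_mult_bounded[OF that]) (use C fbm(3)[OF fM] in auto)
  qed
  have 1: "(LINT x|P. \<phi> x) = (LINT x|M. \<phi> x * p x)" unfolding p(4) by (subst integral_real_density) (use p in "auto simp: mult.commute")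
  have 2: "(LINT x|N. \<phi> x) = (LINT x|M. \<phi> x * n x)" unfolding n(4) by (subst integral_real_density) (use n in "auto simp: mult.commute")
  have "(LINT x|lebesgue_on G. \<phi> x * \<rho> x) = (LINT x|\<Lambda>. \<phi> x * \<rho> x)"
  proof -
   have "(%x. \<phi> x * \<rho> x) \<in> borel_measurable M" by measurable
   then have "(%x. \<phi> x * \<rho> x) \<in> borel_measurable \<Lambda>" unfolding measurable_cong_sets[OF sP(3) refl] .
   then show ?thesis unfolding \<Lambda>_def by (rule lebesgue_on_restrict_lborel(1)[OF Gb])
  qed
  also have "... = (LINT x|M. l x * (\<phi> x * \<rho> x))" unfolding l(4) by (subst integral_real_density) (use l in auto)
  finally have 3: "(LINT x|lebesgue_on G. \<phi> x * \<rho> x) = (LINT x|M. \<phi> x * (l x * \<rho> x))" by (simp add: ac_simps)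
  have 4: "(LINT x|S. \<phi> x * h x) = (LINT x|M. \<phi> x * (k x * h x))"
   unfolding S_def by (subst integral_real_density) (auto simp: k_def ac_simps)
  have ilr: "integrable M (%x. l x * \<rho> x)" using i\<rho> unfolding l(4) by (subst (asm) integrable_density) (use l in auto)
  have ikh: "integrable M (%x. k x * h x)"
   by (rule integrable_bound[OF ik]) (auto simp: h_def)
  have "(LINT x|P. \<phi> x) - (LINT x|N. \<phi> x) = (LINT x|M. \<phi> x * p x - \<phi> x * n x)"
   unfolding 1 2 using pint p(3) n(3) by simp
  also have "... = (LINT x|M. \<phi> x * (l x * \<rho> x) + \<phi> x * (k x * h x))"
  proof (rule integral_cong)
   fix x assume x: "x \<in> space M"
   have "l x * \<rho> x + k x * h x = p x - n x"
   proof (cases "x \<in> Z")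
    case True then show ?thesis by (simp add: \<rho>_def k_def h_def)
   next
    case False then show ?thesis using lpos[OF x False] by (simp add: \<rho>_def k_def)
   qed
   then have "\<phi> x * (p x - n x) = \<phi> x * (l x * \<rho> x + k x * h x)" by simp
   then show "\<phi> x * p x - \<phi> x * n x = \<phi> x * (l x * \<rho> x) + \<phi> x * (k x * h x)"
    by (simp only: distrib_left right_diff_distrib)
  qed simp
  also have "... = (LINT x|M. \<phi> x * (l x * \<rho> x)) + (LINT x|M. \<phi> x * (k x * h x))"
   using pint[OF ilr] pint[OF ikh] by simp
  finally have "(LINT x|P. \<phi> x) - (LINT x|N. \<phi> x) = (LINT x|lebesgue_on G. \<phi> x * \<rho> x) + (LINT x|S. \<phi> x * h x)"
   unfolding 3 4 .
  then show "(LINT x|lebesgue_on G. u x * partial_deriv e \<phi> x)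
    = - ((LINT x|lebesgue_on G. \<phi> x * \<rho> x) + (LINT x|S. \<phi> x * h x))"
   using d t by (simp add: has_deriv_measure_def)
 qed (auto simp: fS h_def)
 have "emeasure S (G - Z) = 0"
 proof -
  have m: "G - Z \<in> sets M" using sets.compl_sets[OF ZM] fbm(3)[OF fM] by simp
  have "emeasure S (G - Z) = (\<integral>\<^sup>+x. ennreal (k x) * indicator (G - Z) x \<partial>M)" unfolding S_def using m by (intro emeasure_density) auto
  also have "... = (\<integral>\<^sup>+x. 0 \<partial>M)" by (rule nn_integral_cong) (auto simp: k_def indicator_def)
  finally show ?thesis by simp
 qed
 then have "has_lebesgue_decomposition G e u \<rho> S h"
  by (intro lebesgue_decompositionI[OF G(1) rep Z0 Zb(2)]) (auto simp: h_def)
 then show ?thesis by blast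
qed

section \<open>One-dimensional Hausdorff measure\<close>

definition hcover :: "real => plane set => (nat => plane set) set" where
 "hcover dl E = {C. E \<subseteq> (\<Union>n. C n) \<and> (\<forall>n. bounded (C n) \<and> diameter (C n) \<le> dl)}"

text \<open>Covers by bounded sets of diameter at most \<open>dl\<close>, and the infimum of the sums of their
 diameters; the outer measure is the limit for small \<open>dl\<close>.\<close>

definition hpre :: "real => plane set => ennreal" where
 "hpre dl E = (INF C \<in> hcover dl E. \<Sum>n. ennreal (diameter (C n)))"

lemma hausdorff1_outer_eq: "hausdorff1_outer E = (SUP dl\<in>{0<..}. hpre dl E)"
 by (simp add: hausdorff1_outer_def hpre_def hcover_def)

lemma hpre_le_outer: "dl > 0 ==> hpre dl E \<le> hausdorff1_outer E"
 unfolding hausdorff1_outer_eq by (rule SUP_upper) simp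

lemma hpre_antimono: "dl \<le> dl' ==> hpre dl' E \<le> hpre dl E"
 unfolding hpre_def by (rule INF_superset_mono) (auto simp: hcover_def intro: order_trans)

lemma hpre_mono: "E \<subseteq> F ==> hpre dl E \<le> hpre dl F"
 unfolding hpre_def by (rule INF_superset_mono) (auto simp: hcover_def intro: order_trans)

lemma outer_mono: "E \<subseteq> F ==> hausdorff1_outer E \<le> hausdorff1_outer F"
 unfolding hausdorff1_outer_eq by (intro SUP_mono) (use hpre_mono in blast)

lemma hpre_empty: "dl > 0 ==> hpre dl {} = 0"
proof -
 assume "dl > 0"
 then have "(%_. {}) \<in> hcover dl {}" by (simp add: hcover_def)
 then have "hpre dl {} \<le> 0" unfolding hpre_def by (rule INF_lower2) simp
 then show ?thesis by simp
qed

lemma hpre_subadditive: "hpre dl (\<Union>i. F i) \<le> (\<Sum>i::nat. hpre dl (F i))"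
proof (rule ennreal_le_epsilon)
 fix e :: real
 assume fin: "(\<Sum>i. hpre dl (F i)) < top" and e: "e > 0"
 have "\<exists>C\<in>hcover dl (F i). (\<Sum>n. ennreal (diameter (C n))) \<le> hpre dl (F i) + ennreal (e * (1/2) ^ Suc i)" for i
 proof -
  have "hpre dl (F i) \<le> (\<Sum>i. hpre dl (F i))" using sum_le_suminf[of "%i. hpre dl (F i)" "{i}"] by simp
  then have "hpre dl (F i) < top" using fin by simp
  then have "hpre dl (F i) < hpre dl (F i) + ennreal (e * (1/2) ^ Suc i)"
   using e by (cases "hpre dl (F i)" rule: ennreal_cases) (auto simp: ennreal_plus[symmetric] ennreal_less_iff simp del: ennreal_plus)
  then obtain C where "C \<in> hcover dl (F i)" "(\<Sum>n. ennreal (diameter (C n))) < hpre dl (F i) + ennreal (e * (1/2) ^ Suc i)"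
   unfolding hpre_def INF_less_iff by blast
  then show ?thesis by (auto intro: less_imp_le)
 qed
 then obtain C where C: "!!i. C i \<in> hcover dl (F i)"
  "!!i. (\<Sum>n. ennreal (diameter (C i n))) \<le> hpre dl (F i) + ennreal (e * (1/2) ^ Suc i)" by metis
 define D where "D m = C (fst (prod_decode m)) (snd (prod_decode m))" for m
 have "D \<in> hcover dl (\<Union>i. F i)"
  unfolding hcover_def
 proof (intro CollectI conjI allI subsetI)
  fix x assume "x \<in> (\<Union>i. F i)"
  then obtain i where "x \<in> F i" by blast
  then obtain n where "x \<in> C i n" using C(1)[of i] by (auto simp: hcover_def)
  then have "x \<in> D (prod_encode (i, n))" by (simp add: D_def)
  then show "x \<in> (\<Union>n. D n)" by blast
 next
  fix n show "bounded (D n)" "diameter (D n) \<le> dl" using C(1) by (auto simp: D_def hcover_def)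
 qed
 then have "hpre dl (\<Union>i. F i) \<le> (\<Sum>m. ennreal (diameter (D m)))" unfolding hpre_def by (rule INF_lower)
 also have "... = (\<Sum>i. \<Sum>n. ennreal (diameter (C i n)))"
  unfolding D_def by (subst suminf_ennreal_2dimen[symmetric, where f="%p. ennreal (diameter (C (fst p) (snd p)))"]) (auto)
 also have "... \<le> (\<Sum>i. hpre dl (F i) + ennreal (e * (1/2) ^ Suc i))" by (intro suminf_le C) auto
 also have "... = (\<Sum>i. hpre dl (F i)) + (\<Sum>i. ennreal (e * (1/2) ^ Suc i))" by (rule suminf_add[symmetric]) auto
 also have "(\<Sum>i. ennreal (e * (1/2) ^ Suc i)) = ennreal e"
 proof (rule suminf_ennreal_eq)
  show "(%i. e * (1/2) ^ Suc i) sums e" using sums_mult[OF power_half_series, of e] by simp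
 qed (use e in simp)
 finally show "hpre dl (\<Union>i. F i) \<le> (\<Sum>i. hpre dl (F i)) + ennreal e" .
qed

lemma outer_subadditive: "hausdorff1_outer (\<Union>i. F i) \<le> (\<Sum>i::nat. hausdorff1_outer (F i))"
 unfolding hausdorff1_outer_eq[of "\<Union>i. F i"]
proof (rule SUP_least)
 fix dl :: real assume "dl \<in> {0<..}"
 then have "(\<Sum>i. hpre dl (F i)) \<le> (\<Sum>i. hausdorff1_outer (F i))" by (intro suminf_le hpre_le_outer) auto
 then show "hpre dl (\<Union>i. F i) \<le> (\<Sum>i. hausdorff1_outer (F i))" using hpre_subadditive order_trans by blast
qed

lemma outer_empty: "hausdorff1_outer {} = 0"
 unfolding hausdorff1_outer_eq by (rule antisym) (auto intro!: SUP_least simp: hpre_empty)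

lemma outer_Un: "hausdorff1_outer (E \<union> F) \<le> hausdorff1_outer E + hausdorff1_outer F"
proof -
 let ?G = "%i::nat. if i = 0 then E else if i = 1 then F else {}"
 have "E \<union> F = (\<Union>i. ?G i)" by (auto split: if_splits intro: exI[of _ "0::nat"] exI[of _ "1::nat"])
 then have "hausdorff1_outer (E \<union> F) \<le> (\<Sum>i. hausdorff1_outer (?G i))" using outer_subadditive[of ?G] by simp
 also have "... = (\<Sum>i\<in>{0,1}. hausdorff1_outer (?G i))" by (rule suminf_finite) (auto simp: outer_empty)
 finally show ?thesis by simp
qed

text \<open>A set of diameter less than the distance of \<open>E\<close> and \<open>F\<close> meets only one of them, so a
 fine cover of the union splits into a cover of each.\<close>

lemma hpre_separated:
 assumes d: "d > 0" "!!x y. x \<in> E ==> y \<in> F ==> dist x y \<ge> d" and dl: "0 < dl" "dl < d"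
 shows "hpre dl E + hpre dl F \<le> hpre dl (E \<union> F)"
 unfolding hpre_def[of dl "E \<union> F"]
proof (rule INF_greatest)
 fix C assume C: "C \<in> hcover dl (E \<union> F)"
 define CE where "CE n = (if C n \<inter> E = {} then {} else C n)" for n
 define CF where "CF n = (if C n \<inter> F = {} then {} else C n)" for n
 have "x \<in> (\<Union>n. CE n)" if x: "x \<in> E" for x
 proof -
  obtain n where "x \<in> C n" using C x unfolding hcover_def by blast
  then have "x \<in> CE n" using x by (auto simp: CE_def)
  then show ?thesis by blast
 qed
 then have "CE \<in> hcover dl E" using C dl by (auto simp: hcover_def CE_def)
 moreover have "x \<in> (\<Union>n. CF n)" if x: "x \<in> F" for x
 proof -
  obtain n where "x \<in> C n" using C x unfolding hcover_def by blast
  then have "x \<in> CF n" using x by (auto simp: CF_def)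
  then show ?thesis by blast
 qed
 then have "CF \<in> hcover dl F" using C dl by (auto simp: hcover_def CF_def)
 ultimately have "hpre dl E + hpre dl F \<le> (\<Sum>n. ennreal (diameter (CE n))) + (\<Sum>n. ennreal (diameter (CF n)))"
  unfolding hpre_def by (intro add_mono INF_lower)
 also have "... = (\<Sum>n. ennreal (diameter (CE n)) + ennreal (diameter (CF n)))" by (rule suminf_add) auto
 also have "... \<le> (\<Sum>n. ennreal (diameter (C n)))"
 proof (rule suminf_le)
  fix n
  have "C n \<inter> E = {} \<or> C n \<inter> F = {}"
  proof (rule ccontr)
   assume "\<not> ?thesis"
   then obtain x y where xy: "x \<in> C n" "x \<in> E" "y \<in> C n" "y \<in> F" by blast
   have "dist x y \<le> diameter (C n)" using C xy by (intro diameter_bounded_bound) (auto simp: hcover_def)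
   also have "... \<le> dl" using C by (auto simp: hcover_def)
   finally show False using d(2)[OF xy(2,4)] dl by simp
  qed
  then show "ennreal (diameter (CE n)) + ennreal (diameter (CF n)) \<le> ennreal (diameter (C n))"
   by (auto simp: CE_def CF_def)
 qed auto
 finally show "hpre dl E + hpre dl F \<le> (\<Sum>n. ennreal (diameter (C n)))" .
qed

lemma outer_separated:
 assumes d: "d > 0" "!!x y. x \<in> E ==> y \<in> F ==> dist x y \<ge> d"
 shows "hausdorff1_outer E + hausdorff1_outer F \<le> hausdorff1_outer (E \<union> F)"
proof -
 have 1: "hpre dl E + hpre dl' F \<le> hausdorff1_outer (E \<union> F)" if "dl > 0" "dl' > 0" for dl dl'
 proof -
  let ?m = "min (min dl dl') (d / 2)"
  have "hpre dl E + hpre dl' F \<le> hpre ?m E + hpre ?m F" by (intro add_mono hpre_antimono) auto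
  also have "... \<le> hpre ?m (E \<union> F)" by (rule hpre_separated[OF d]) (use that d in auto)
  also have "... \<le> hausdorff1_outer (E \<union> F)" by (rule hpre_le_outer) (use that d in auto)
  finally show ?thesis .
 qed
 have 2: "hpre dl E + hausdorff1_outer F \<le> hausdorff1_outer (E \<union> F)" if "dl > 0" for dl
 proof -
  have "(SUP dl'\<in>{0<..}. hpre dl E + hpre dl' F) \<le> hausdorff1_outer (E \<union> F)" by (rule SUP_least) (use 1 that in auto)
  moreover have "(SUP dl'\<in>{0<..}. hpre dl E + hpre dl' F) = hpre dl E + (SUP dl'\<in>{0<..}. hpre dl' F)"
   by (rule ennreal_SUP_add_right[symmetric]) simp
  ultimately show ?thesis by (simp add: hausdorff1_outer_eq[of F])
 qed
 have "(SUP dl\<in>{0<..}. hausdorff1_outer F + hpre dl E) \<le> hausdorff1_outer (E \<union> F)"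
  by (rule SUP_least) (use 2 in "auto simp: add.commute")
 moreover have "(SUP dl\<in>{0<..}. hausdorff1_outer F + hpre dl E) = hausdorff1_outer F + (SUP dl\<in>{0<..}. hpre dl E)"
  by (rule ennreal_SUP_add_right[symmetric]) simp
 ultimately show ?thesis by (simp add: hausdorff1_outer_eq[of E] add.commute)
qed

lemma shell_separated:
 fixes F :: "plane set"
 assumes "x \<in> {x. infdist x F < s}" and "y \<in> {x. infdist x F \<ge> t}"
 shows "dist x y \<ge> t - s"
 using infdist_triangle[of y F x] assms by (simp add: dist_commute)

text \<open>Closed sets are measurable because the outer measure is additive on separated sets: the part of
 \<open>A\<close> near but outside \<open>F\<close> is split into shells, and every other shell is separated, so that the masses
 of the shells are summable.\<close>

lemma outer_closed_split:
 assumes F: "closed F" shows "hausdorff1_outer (F \<inter> A) + hausdorff1_outer (A - F) \<le> hausdorff1_outer A"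
proof (cases "F = {} \<or> hausdorff1_outer A = top")
 case True then show ?thesis by (auto simp: outer_empty)
next
 case False
 let ?H = hausdorff1_outer
 have fin: "?H A < top" and F0: "F \<noteq> {}" using False by (auto simp: less_top)
 define R where "R k = {x \<in> A. 1 / (real k + 2) \<le> infdist x F \<and> infdist x F < 1 / (real k + 1)}" for k
 define B where "B n = {x \<in> A. 1 / (real n + 1) \<le> infdist x F}" for n
 have alt: "(\<Sum>k<m. ?H (R (2 * k + j))) \<le> ?H (\<Union>k<m. R (2 * k + j))" for m j
 proof (induction m)
  case (Suc m)
  have "(\<Sum>k<Suc m. ?H (R (2 * k + j))) \<le> ?H (\<Union>k<m. R (2 * k + j)) + ?H (R (2 * m + j))"
   using Suc by (simp add: add_mono)
  also have "... \<le> ?H ((\<Union>k<m. R (2 * k + j)) \<union> R (2 * m + j))"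
  proof (rule outer_separated)
   let ?N = "real (2 * m + j)"
   show "dist x y \<ge> (if m = 0 then 1 else 1 / ?N - 1 / (?N + 1))" if xy: "x \<in> (\<Union>k<m. R (2 * k + j))" "y \<in> R (2 * m + j)" for x y
   proof -
    obtain k where k: "k < m" "x \<in> R (2 * k + j)" using xy(1) by blast
    have "real (2 * k + j) + 2 \<le> ?N" using k by simp
    then have "1 / ?N \<le> 1 / (real (2 * k + j) + 2)" by (intro divide_left_mono) auto
    then have "1 / ?N \<le> infdist x F" using k by (simp add: R_def)
    moreover have "infdist y F < 1 / (?N + 1)" using xy(2) by (simp add: R_def)
    ultimately have "dist y x \<ge> 1 / ?N - 1 / (?N + 1)" by (intro shell_separated) auto
    then show ?thesis using k by (simp add: dist_commute)
   qed
   have "1 / (?N + 1) < 1 / ?N" if "m \<noteq> 0" using that by (intro divide_strict_left_mono) auto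
   then show "(if m = 0 then 1 else 1 / ?N - 1 / (?N + 1)) > 0" by simp
  qed
  finally show ?case by (simp add: lessThan_Suc Un_commute)
 qed (simp add: outer_empty)
 have RA: "(\<Sum>k<m. ?H (R (2 * k + j))) \<le> ?H A" for m j
  by (rule order_trans[OF alt outer_mono]) (auto simp: R_def)
 have part: "(\<Sum>k<m. ?H (R k)) \<le> 2 * ?H A" for m
 proof -
  have "(\<Sum>k<m. ?H (R k)) \<le> (\<Sum>k<2 * m. ?H (R k))" by (rule sum_mono2) auto
  also have "... = (\<Sum>k<m. ?H (R (2 * k + 0))) + (\<Sum>k<m. ?H (R (2 * k + 1)))"
   by (induction m) (auto simp: algebra_simps)
  also have "... \<le> ?H A + ?H A" by (intro add_mono RA)
  finally show ?thesis by (simp add: mult_2)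
 qed
 have Rfin: "?H (R k) < top" for k
  using outer_mono[of "R k" A] fin by (auto simp: R_def intro: le_less_trans)
 define r where "r k = enn2real (?H (R k))" for k
 have r: "?H (R k) = ennreal (r k)" "r k \<ge> 0" for k using Rfin[of k] by (auto simp: r_def)
 have "summable r"
 proof (rule summableI_nonneg_bounded[where x="enn2real (2 * ?H A)"])
  fix m
  have "ennreal (\<Sum>k<m. r k) \<le> 2 * ?H A" using part[of m] r by (simp add: sum_ennreal)
  then show "(\<Sum>k<m. r k) \<le> enn2real (2 * ?H A)"
   using fin by (cases "?H A" rule: ennreal_cases) (auto simp: ennreal_mult[symmetric] ennreal_numeral[symmetric] simp del: ennreal_numeral)
 qed (use r in auto)
 then have tail: "(%n. \<Sum>k. r (k + n)) \<longlonglongrightarrow> 0" by (rule suminf_exist_split2)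
 have bound: "?H (F \<inter> A) + ?H (A - F) \<le> ?H A + ennreal (\<Sum>k. r (k + n))" for n
 proof -
  have "A - F \<subseteq> B n \<union> (\<Union>k. R (k + n))"
  proof
   fix x assume x: "x \<in> A - F"
   have pos: "infdist x F > 0" using x F F0 in_closed_iff_infdist_zero[of F x] infdist_nonneg[of x F] by (auto simp: less_le)
   show "x \<in> B n \<union> (\<Union>k. R (k + n))"
   proof (cases "x \<in> B n")
    case False
    then have l: "infdist x F < 1 / (real n + 1)" using x by (auto simp: B_def)
    define N where "N = nat \<lfloor>1 / infdist x F\<rfloor>"
    have f: "real N \<le> 1 / infdist x F" "1 / infdist x F < real N + 1"
     using pos by (auto simp: N_def)
    have "1 / infdist x F > real n + 1" using l pos by (simp add: field_simps)
    then have Nn: "N \<ge> n + 1" using f(2) by linarith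
    have "infdist x F \<le> 1 / real N" using f(1) pos Nn by (simp add: field_simps)
    have lo: "1 / (real N + 1) < infdist x F" using f(2) pos by (simp add: field_simps)
    show ?thesis
    proof (cases "infdist x F = 1 / real N")
     case True
     have "N \<noteq> n + 1" using True l Nn by (auto simp: algebra_simps)
     then have "N \<ge> n + 2" using Nn by simp
     then have N2: "real (N - 2 - n) + real n = real N - 2" by (simp add: of_nat_diff)
     have "1 / real N < 1 / (real N - 1)" using \<open>N \<ge> n + 2\<close> by (intro divide_strict_left_mono) auto
     then have "x \<in> R ((N - 2 - n) + n)" using True x unfolding R_def of_nat_add N2 by simp
     then show ?thesis by blast
    next
     case False
     then have "infdist x F < 1 / real N" using \<open>infdist x F \<le> 1 / real N\<close> by simp
     moreover have N1: "real (N - 1 - n) + real n = real N - 1" using Nn by (simp add: of_nat_diff)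
     ultimately have "x \<in> R ((N - 1 - n) + n)" using lo x unfolding R_def of_nat_add N1 by (simp add: add.commute)
     then show ?thesis by blast
    qed
   qed auto
  qed
  then have "?H (A - F) \<le> ?H (B n \<union> (\<Union>k. R (k + n)))" by (rule outer_mono)
  also have "... \<le> ?H (B n) + (\<Sum>k. ?H (R (k + n)))"
   by (rule order_trans[OF outer_Un]) (intro add_mono order_refl outer_subadditive)
  also have "(\<Sum>k. ?H (R (k + n))) = ennreal (\<Sum>k. r (k + n))"
  proof -
   have "summable (%k. r (k + n))" using \<open>summable r\<close> by (simp only: summable_iff_shift)
   then have "(\<Sum>k. ennreal (r (k + n))) = ennreal (\<Sum>k. r (k + n))" using r(2) by (intro suminf_ennreal2)
   then show ?thesis by (simp only: r(1))
  qed
  finally have 1: "?H (A - F) \<le> ?H (B n) + ennreal (\<Sum>k. r (k + n))" .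
  have "?H (F \<inter> A) + ?H (B n) \<le> ?H ((F \<inter> A) \<union> B n)"
  proof (rule outer_separated)
   show "1 / (real n + 1) > 0" by simp
   fix x y assume "x \<in> F \<inter> A" "y \<in> B n"
   then show "dist x y \<ge> 1 / (real n + 1)" using infdist_le[of x F y] by (auto simp: B_def dist_commute)
  qed
  also have "... \<le> ?H A" by (rule outer_mono) (auto simp: B_def)
  finally have "?H (F \<inter> A) + ?H (B n) \<le> ?H A" .
  then have "?H (F \<inter> A) + ?H (B n) + ennreal (\<Sum>k. r (k + n)) \<le> ?H A + ennreal (\<Sum>k. r (k + n))" by (rule add_right_mono)
  moreover have "?H (F \<inter> A) + ?H (A - F) \<le> ?H (F \<inter> A) + (?H (B n) + ennreal (\<Sum>k. r (k + n)))"
   using 1 by (rule add_left_mono)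
  ultimately show ?thesis unfolding add.assoc by (rule order_trans[rotated])
 qed
 have "(%n. ?H A + ennreal (\<Sum>k. r (k + n))) \<longlonglongrightarrow> ?H A + ennreal 0"
  by (intro tendsto_add tendsto_const tendsto_ennrealI tail)
 then show ?thesis
  using bound by (intro tendsto_lowerbound[of _ "?H A" sequentially]) auto
qed

lemma hausdorff1_measure_space:
 "measure_space UNIV (lambda_system UNIV UNIV hausdorff1_outer) hausdorff1_outer"
proof -
 have "outer_measure_space (Pow UNIV) hausdorff1_outer"
  unfolding outer_measure_space_def
 proof (intro conjI)
  show "positive (Pow UNIV) hausdorff1_outer" by (simp add: positive_def outer_empty)
  show "increasing (Pow UNIV) hausdorff1_outer" by (auto simp: increasing_def outer_mono)
  show "countably_subadditive (Pow UNIV) hausdorff1_outer"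
   unfolding countably_subadditive_def using outer_subadditive by blast
 qed
 from sigma_algebra.caratheodory_lemma[OF sigma_algebra_Pow this]
 show ?thesis by (simp add: Pow_UNIV)
qed

lemma hausdorff1_facts:
 shows space_hausdorff1: "space hausdorff1 = UNIV"
  and sets_hausdorff1: "sets hausdorff1 = lambda_system UNIV UNIV hausdorff1_outer"
  and emeasure_hausdorff1: "E \<in> sets hausdorff1 ==> emeasure hausdorff1 E = hausdorff1_outer E"
proof -
 have sa: "sigma_algebra UNIV (lambda_system UNIV UNIV hausdorff1_outer)"
  using hausdorff1_measure_space by (simp add: measure_space_def)
 show "space hausdorff1 = UNIV" by (simp add: hausdorff1_def)
 show s: "sets hausdorff1 = lambda_system UNIV UNIV hausdorff1_outer"
  unfolding hausdorff1_def using sigma_algebra.sigma_sets_eq[OF sa] by simp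
 assume "E \<in> sets hausdorff1"
 then show "emeasure hausdorff1 E = hausdorff1_outer E"
  using hausdorff1_measure_space s unfolding hausdorff1_def
  by (intro emeasure_measure_of_sigma[of UNIV]) (auto simp: measure_space_def)
qed

lemma borel_subset_hausdorff1: "E \<in> sets borel ==> E \<in> sets hausdorff1"
proof -
 have "F \<in> sets hausdorff1" if "closed F" for F
  unfolding sets_hausdorff1 lambda_system_def
 proof (intro CollectI conjI ballI UNIV_I)
  fix A :: "plane set"
  have "(UNIV - F) \<inter> A = A - F" "A = (F \<inter> A) \<union> (A - F)" by auto
  then show "hausdorff1_outer (F \<inter> A) + hausdorff1_outer ((UNIV - F) \<inter> A) = hausdorff1_outer A"
   using outer_closed_split[OF that, of A] outer_Un[of "F \<inter> A" "A - F"] by (metis antisym)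
 qed
 then have "sigma_sets UNIV {F. closed F} \<subseteq> sets hausdorff1"
  using space_hausdorff1 by (intro sets.sigma_sets_subset'[of _ hausdorff1]) auto
 then show "E \<in> sets borel ==> E \<in> sets hausdorff1"
  by (auto simp: borel_eq_closed)
qed

text \<open>Passing to closures does not change the diameters of the sets of a cover. The closures of nearly optimal finer
 and finer covers cover the intersection of their unions as well, and this intersection is Borel.\<close>

lemma hausdorff1_outer_regular:
 "\<exists>G\<in>sets borel. E \<subseteq> G \<and> hausdorff1_outer G = hausdorff1_outer E"
proof (cases "hausdorff1_outer E = top")
 case True
 then have "hausdorff1_outer UNIV = top" using outer_mono[of E UNIV] by (simp add: top_unique)
 then show ?thesis using True by (intro bexI[of _ UNIV]) auto
next
 case False
 define dl where "dl k = 1 / (real k + 1)" for k :: nat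
 have dl: "dl k > 0" for k by (simp add: dl_def)
 have "\<exists>C\<in>hcover (dl k) E. (\<Sum>n. ennreal (diameter (C n))) \<le> hausdorff1_outer E + ennreal (dl k)" for k
 proof -
  have "hpre (dl k) E \<le> hausdorff1_outer E" by (rule hpre_le_outer[OF dl])
  also have "... < hausdorff1_outer E + ennreal (dl k)"
   using False dl[of k] by (cases "hausdorff1_outer E" rule: ennreal_cases) (auto simp: ennreal_plus[symmetric] ennreal_less_iff simp del: ennreal_plus)
  finally show ?thesis unfolding hpre_def INF_less_iff by (auto intro: less_imp_le)
 qed
 then obtain C where C: "!!k. C k \<in> hcover (dl k) E" "!!k. (\<Sum>n. ennreal (diameter (C k n))) \<le> hausdorff1_outer E + ennreal (dl k)"
  by metis
 define G where "G = (\<Inter>k. \<Union>n. closure (C k n))"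
 have "G \<in> sets borel" unfolding G_def by (auto intro!: sets.countable_INT sets.countable_UN)
 moreover have EG: "E \<subseteq> G"
 proof
  fix x assume x: "x \<in> E"
  have "x \<in> (\<Union>n. closure (C k n))" for k
  proof -
   have "E \<subseteq> (\<Union>n. C k n)" using C(1)[of k] unfolding hcover_def by blast
   then obtain n where "x \<in> C k n" using x by blast
   then have "x \<in> closure (C k n)" using closure_subset[of "C k n"] by blast
   then show ?thesis by blast
  qed
  then show "x \<in> G" unfolding G_def by blast
 qed
 moreover have "hausdorff1_outer G \<le> hausdorff1_outer E"
  unfolding hausdorff1_outer_eq[of G]
 proof (rule SUP_least)
  fix d :: real assume d: "d \<in> {0<..}"
  have "hpre d G \<le> hausdorff1_outer E + ennreal (dl k)" if k: "dl k \<le> d" for k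
  proof -
   have b: "bounded (C k n)" "diameter (C k n) \<le> dl k" for n using C(1)[of k] unfolding hcover_def by auto
   have "G \<subseteq> (\<Union>n. closure (C k n))" unfolding G_def by blast
   then have "(%n. closure (C k n)) \<in> hcover (dl k) G"
    using b unfolding hcover_def by (simp add: diameter_closure bounded_closure)
   then have "hpre (dl k) G \<le> (\<Sum>n. ennreal (diameter (closure (C k n))))" unfolding hpre_def by (rule INF_lower)
   also have "... = (\<Sum>n. ennreal (diameter (C k n)))" using C(1)[of k] by (auto simp: hcover_def diameter_closure)
   also have "... \<le> hausdorff1_outer E + ennreal (dl k)" by (rule C(2))
   finally show ?thesis using hpre_antimono[OF k] order_trans by blast
  qed
  moreover have dl: "dl \<longlonglongrightarrow> 0" unfolding dl_def using LIMSEQ_inverse_real_of_nat by (simp add: inverse_eq_divide add.commute)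
  then have "\<forall>\<^sub>F k in sequentially. dl k \<le> d" using order_tendstoD(2)[OF dl, of d] d by (auto elim: eventually_mono)
  ultimately have ev: "\<forall>\<^sub>F k in sequentially. hpre d G \<le> hausdorff1_outer E + ennreal (dl k)" by (auto elim: eventually_mono)
  have "(%k. hausdorff1_outer E + ennreal (dl k)) \<longlonglongrightarrow> hausdorff1_outer E + ennreal 0"
   by (intro tendsto_add tendsto_const tendsto_ennrealI dl)
  from tendsto_lowerbound[OF this ev] show "hpre d G \<le> hausdorff1_outer E" by simp
 qed
 ultimately show ?thesis using outer_mono[OF EG] by (intro bexI[of _ G] conjI antisym)
qed

section \<open>The normal and functions on the boundary\<close>

text \<open>Otherwise a direction that has a negative product with one normal and a positive product with the other would
 lead both into the set and out of it.\<close>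

lemma outward_normal_unique:
 assumes n: "is_outward_normal G x n" and m: "is_outward_normal G x m" shows "n = m"
proof (rule ccontr)
 assume ne: "n \<noteq> m"
 have nm: "norm n = 1" "norm m = 1" using n m by (auto simp: is_outward_normal_def)
 have "(norm (m - n))^2 = 2 - 2 * (n \<bullet> m)"
  using nm by (simp add: power2_norm_eq_inner inner_diff inner_commute norm_eq_1)
 moreover have dpos: "norm (m - n) > 0" using ne by simp
 ultimately have c: "n \<bullet> m < 1" by (smt (verit) zero_less_power)
 define d where "d = m - n"
 have nd: "n \<bullet> d = n \<bullet> m - 1" "m \<bullet> d = 1 - n \<bullet> m"
  using nm by (simp_all add: d_def inner_diff inner_commute norm_eq_1)
 define eps where "eps = (1 - n \<bullet> m) / (2 * norm d)"
 have e: "eps > 0" using c dpos by (simp add: eps_def d_def)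
 have ed: "eps * norm d = (1 - n \<bullet> m) / 2" using dpos by (simp add: eps_def d_def)
 obtain d1 where d1: "d1 > 0" "!!y. y \<in> ball x d1 ==> n \<bullet> (y - x) < - eps * norm (y - x) ==> y \<in> G"
  using n e unfolding is_outward_normal_def by meson
 obtain d2 where d2: "d2 > 0" "!!y. y \<in> ball x d2 ==> m \<bullet> (y - x) > eps * norm (y - x) ==> y \<notin> G"
  using m e unfolding is_outward_normal_def by meson
 define t where "t = min d1 d2 / (2 * norm d)"
 have t: "t > 0" using d1 d2 dpos by (simp add: t_def d_def)
 let ?y = "x + t *\<^sub>R d"
 have "norm (t *\<^sub>R d) = min d1 d2 / 2" using t dpos d1(1) d2(1) by (simp add: t_def d_def)
 then have b: "?y \<in> ball x d1" "?y \<in> ball x d2" using d1(1) d2(1) by (auto simp: dist_norm)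
 have "r - 1 < - ((1 - r) / 2)" if "r < 1" for r :: real using that by (simp add: field_simps)
 from this[OF c] have "n \<bullet> m - 1 < - ((1 - n \<bullet> m) / 2)" .
 then have "t * (n \<bullet> m - 1) < t * (- ((1 - n \<bullet> m) / 2))" using t by (rule mult_strict_left_mono)
 moreover have n1: "n \<bullet> (?y - x) = t * (n \<bullet> m - 1)" "m \<bullet> (?y - x) = t * (1 - n \<bullet> m)" by (simp_all add: nd)
 moreover have "eps * norm (?y - x) = t * (eps * norm d)" using t by simp
 then have n2: "eps * norm (?y - x) = t * ((1 - n \<bullet> m) / 2)" by (simp only: ed)
 ultimately have "n \<bullet> (?y - x) < - eps * norm (?y - x)" by (simp only: minus_mult_left[symmetric] minus_mult_right)
 moreover have "t * ((1 - n \<bullet> m) / 2) < t * (1 - n \<bullet> m)" using t c by (intro mult_strict_left_mono) auto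
 then have "m \<bullet> (?y - x) > eps * norm (?y - x)" unfolding n1 n2 .
 ultimately show False using d1(2)[OF b(1)] d2(2)[OF b(2)] by blast
qed

text \<open>Quantitative normality at scale \<open>dl\<close> and aperture \<open>eps\<close> is a closed condition, and by compactness
 of the circle the normal vectors obtained for smaller and smaller apertures accumulate at a normal.\<close>

lemma closed_approximate_normals:
 fixes F :: "plane set"
 assumes F: "closed F"
 shows "closed {x \<in> frontier G. \<exists>n\<in>F. norm n = 1 \<and> (\<forall>y\<in>ball x dl.
    (n \<bullet> (y - x) < - eps * norm (y - x) --> y \<in> G) \<and> (n \<bullet> (y - x) > eps * norm (y - x) --> y \<notin> G))}"
  (is "closed ?E")
 unfolding closed_sequential_limits
proof (intro allI impI, elim conjE)
 fix X x assume X: "\<forall>m. X m \<in> ?E" and lim: "X \<longlonglongrightarrow> x"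
 have fr: "x \<in> frontier G"
  using X lim frontier_closed[of G] unfolding closed_sequential_limits by blast
 from X have "\<forall>m. \<exists>n. n \<in> F \<and> norm n = 1 \<and> (\<forall>y\<in>ball (X m) dl.
    (n \<bullet> (y - X m) < - eps * norm (y - X m) --> y \<in> G) \<and> (n \<bullet> (y - X m) > eps * norm (y - X m) --> y \<notin> G))" by blast
 then obtain N where N: "!!m. N m \<in> F" "!!m. norm (N m) = 1"
  "!!m y. y \<in> ball (X m) dl ==> N m \<bullet> (y - X m) < - eps * norm (y - X m) ==> y \<in> G"
  "!!m y. y \<in> ball (X m) dl ==> N m \<bullet> (y - X m) > eps * norm (y - X m) ==> y \<notin> G" by metis
 have "compact (F \<inter> sphere 0 1)" using F by (intro closed_Int_compact) auto
 then have "seq_compact (F \<inter> sphere 0 1)" by (simp add: compact_eq_seq_compact_metric)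
 moreover have "\<forall>m. N m \<in> F \<inter> sphere 0 1" using N by simp
 ultimately obtain n r where n: "n \<in> F \<inter> sphere 0 1" "strict_mono (r :: nat => nat)" "(N \<circ> r) \<longlonglongrightarrow> n"
  unfolding seq_compact_def by blast
 have limr: "(%k. X (r k)) \<longlonglongrightarrow> x" using LIMSEQ_subseq_LIMSEQ[OF lim n(2)] by (simp add: o_def)
 have limN: "(%k. N (r k)) \<longlonglongrightarrow> n" using n(3) by (simp add: o_def)
 have "(n \<bullet> (y - x) < - eps * norm (y - x) --> y \<in> G) \<and> (n \<bullet> (y - x) > eps * norm (y - x) --> y \<notin> G)"
  if y: "y \<in> ball x dl" for y
 proof -
  have "(%k. dist (X (r k)) y) \<longlonglongrightarrow> dist x y" by (intro tendsto_dist limr tendsto_const)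
  then have ev: "\<forall>\<^sub>F k in sequentially. dist (X (r k)) y < dl" using y by (intro order_tendstoD(2)) auto
  have L: "(%k. N (r k) \<bullet> (y - X (r k)) + eps * norm (y - X (r k))) \<longlonglongrightarrow> n \<bullet> (y - x) + eps * norm (y - x)"
   "(%k. N (r k) \<bullet> (y - X (r k)) - eps * norm (y - X (r k))) \<longlonglongrightarrow> n \<bullet> (y - x) - eps * norm (y - x)"
   by (intro tendsto_intros limr limN)+
  show ?thesis
  proof (intro conjI impI)
   assume "n \<bullet> (y - x) < - eps * norm (y - x)"
   then have "\<forall>\<^sub>F k in sequentially. N (r k) \<bullet> (y - X (r k)) + eps * norm (y - X (r k)) < 0"
    by (intro order_tendstoD(2)[OF L(1)]) simp
   with ev have "\<forall>\<^sub>F k in sequentially. y \<in> G"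
    by eventually_elim (rule N(3), auto)
   then show "y \<in> G" by simp
  next
   assume "n \<bullet> (y - x) > eps * norm (y - x)"
   then have "\<forall>\<^sub>F k in sequentially. 0 < N (r k) \<bullet> (y - X (r k)) - eps * norm (y - X (r k))"
    by (intro order_tendstoD(1)[OF L(2)]) simp
   with ev have "\<forall>\<^sub>F k in sequentially. y \<notin> G"
    by eventually_elim (rule N(4), auto)
   then show "y \<notin> G" by simp
  qed
 qed
 then show "x \<in> ?E" using n(1) fr by auto
qed

lemma borel_normals_in_closed:
 fixes F :: "plane set"
 assumes F: "closed F"
 shows "{x \<in> frontier G. \<exists>n\<in>F. is_outward_normal G x n} \<in> sets borel"
proof -
 define P where "P i j x n \<longleftrightarrow> norm n = 1 \<and> (\<forall>y\<in>ball x (1 / real (Suc j)).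
    (n \<bullet> (y - x) < - (1 / real (Suc i)) * norm (y - x) --> y \<in> G) \<and>
    (n \<bullet> (y - x) > (1 / real (Suc i)) * norm (y - x) --> y \<notin> G))" for i j :: nat and x n
 have cl: "closed {x \<in> frontier G. \<exists>n\<in>F. P i j x n}" for i j
  unfolding P_def by (rule closed_approximate_normals[OF F])
 have "{x \<in> frontier G. \<exists>n\<in>F. is_outward_normal G x n} = (\<Inter>i. \<Union>j. {x \<in> frontier G. \<exists>n\<in>F. P i j x n})"
 proof (intro subset_antisym subsetI)
  fix x assume "x \<in> {x \<in> frontier G. \<exists>n\<in>F. is_outward_normal G x n}"
  then obtain n where n: "x \<in> frontier G" "n \<in> F" "is_outward_normal G x n" by blast
  have "\<exists>j. P i j x n" for i
  proof -
   obtain d where d: "d > 0" "\<forall>y\<in>ball x d. (n \<bullet> (y - x) < - (1 / real (Suc i)) * norm (y - x) --> y \<in> G) \<and>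
    (n \<bullet> (y - x) > (1 / real (Suc i)) * norm (y - x) --> y \<notin> G)"
   proof -
    have "1 / real (Suc i) > 0" by simp
    moreover have "\<forall>eps>0. \<exists>dl>0. \<forall>y\<in>ball x dl. (n \<bullet> (y - x) < - eps * norm (y - x) --> y \<in> G) \<and>
     (n \<bullet> (y - x) > eps * norm (y - x) --> y \<notin> G)"
     using n(3) unfolding is_outward_normal_def by (rule conjunct2)
    ultimately have "\<exists>d>0. \<forall>y\<in>ball x d. (n \<bullet> (y - x) < - (1 / real (Suc i)) * norm (y - x) --> y \<in> G) \<and>
     (n \<bullet> (y - x) > (1 / real (Suc i)) * norm (y - x) --> y \<notin> G)"
     by (elim allE impE)
    then show ?thesis using that by blast
   qed
   obtain j where j: "1 / real (Suc j) < d" using d(1) nat_approx_posE by blast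
   then have "ball x (1 / real (Suc j)) \<subseteq> ball x d" by auto
   then have "P i j x n" using d(2) n(3) unfolding P_def is_outward_normal_def by blast
   then show ?thesis by blast
  qed
  then show "x \<in> (\<Inter>i. \<Union>j. {x \<in> frontier G. \<exists>n\<in>F. P i j x n})" using n by blast
 next
  fix x assume x: "x \<in> (\<Inter>i. \<Union>j. {x \<in> frontier G. \<exists>n\<in>F. P i j x n})"
  then have "\<forall>i. \<exists>j n. n \<in> F \<and> P i j x n" by blast
  then obtain J N where JN: "!!i. N i \<in> F" "!!i. P i (J i) x (N i)" by metis
  have "compact (F \<inter> sphere 0 1)" using F by (intro closed_Int_compact) auto
  then have "seq_compact (F \<inter> sphere 0 1)" by (simp add: compact_eq_seq_compact_metric)
  moreover have "\<forall>m. N m \<in> F \<inter> sphere 0 1" using JN by (auto simp: P_def)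
  ultimately obtain n r where n: "n \<in> F \<inter> sphere 0 1" "strict_mono (r :: nat => nat)" "(N \<circ> r) \<longlonglongrightarrow> n"
   unfolding seq_compact_def by blast
  have "is_outward_normal G x n"
   unfolding is_outward_normal_def
  proof (intro conjI allI impI)
   show "norm n = 1" using n(1) by simp
   fix eps :: real assume e: "eps > 0"
   have "(%k. norm (N (r k) - n)) \<longlonglongrightarrow> 0" using n(3) tendsto_norm_zero LIM_zero by (fastforce simp: o_def)
   then have 1: "\<forall>\<^sub>F k in sequentially. norm (N (r k) - n) < eps / 2" using e by (intro order_tendstoD(2)) auto
   have "(%k. 1 / real (Suc (r k))) \<longlonglongrightarrow> 0"
    using LIMSEQ_subseq_LIMSEQ[OF LIMSEQ_Suc[OF lim_1_over_n] n(2)] by (simp add: o_def)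
   then have 2: "\<forall>\<^sub>F k in sequentially. 1 / real (Suc (r k)) < eps / 2" using e by (intro order_tendstoD(2)) auto
   obtain k where k: "norm (N (r k) - n) < eps / 2" "1 / real (Suc (r k)) < eps / 2"
    using eventually_happens[OF eventually_conj[OF 1 2]] by auto
   let ?i = "r k"
   show "\<exists>dl>0. \<forall>y\<in>ball x dl. (n \<bullet> (y - x) < - eps * norm (y - x) --> y \<in> G) \<and> (eps * norm (y - x) < n \<bullet> (y - x) --> y \<notin> G)"
   proof (intro exI[of _ "1 / real (Suc (J ?i))"] conjI ballI)
    show "1 / real (Suc (J ?i)) > 0" by simp
    fix y assume y: "y \<in> ball x (1 / real (Suc (J ?i)))"
    have "\<bar>(N ?i - n) \<bullet> (y - x)\<bar> \<le> norm (N ?i - n) * norm (y - x)" by (rule Cauchy_Schwarz_ineq2)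
    also have "... \<le> (eps / 2) * norm (y - x)" using k(1) by (intro mult_right_mono) auto
    finally have a: "\<bar>N ?i \<bullet> (y - x) - n \<bullet> (y - x)\<bar> \<le> (eps / 2) * norm (y - x)" by (simp add: inner_diff_left)
    have b: "(1 / real (Suc ?i)) * norm (y - x) \<le> (eps / 2) * norm (y - x)" using k(2) by (intro mult_right_mono) auto
    have P: "N ?i \<bullet> (y - x) < - (1 / real (Suc ?i)) * norm (y - x) ==> y \<in> G"
     "N ?i \<bullet> (y - x) > (1 / real (Suc ?i)) * norm (y - x) ==> y \<notin> G"
     using JN(2)[of ?i] y unfolding P_def by blast+
    show "n \<bullet> (y - x) < - eps * norm (y - x) --> y \<in> G"
    proof
     assume "n \<bullet> (y - x) < - eps * norm (y - x)"
     then have "N ?i \<bullet> (y - x) < - (1 / real (Suc ?i)) * norm (y - x)" using a b by argo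
     then show "y \<in> G" by (rule P(1))
    qed
    show "eps * norm (y - x) < n \<bullet> (y - x) --> y \<notin> G"
    proof
     assume "eps * norm (y - x) < n \<bullet> (y - x)"
     then have "N ?i \<bullet> (y - x) > (1 / real (Suc ?i)) * norm (y - x)" using a b by argo
     then show "y \<notin> G" by (rule P(2))
    qed
   qed
  qed
  then show "x \<in> {x \<in> frontier G. \<exists>n\<in>F. is_outward_normal G x n}" using x n(1) by blast
 qed
 also have "... \<in> sets borel" using cl by (intro sets.countable_INT sets.countable_UN) auto
 finally show ?thesis .
qed

lemma space_boundary_measure: "space (boundary_measure G) = frontier G"
 by (simp add: boundary_measure_def space_restrict_space space_hausdorff1)

lemma frontier_hausdorff1: "frontier G \<inter> space hausdorff1 \<in> sets hausdorff1"
 by (simp add: space_hausdorff1 borel_subset_hausdorff1)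

lemma sets_boundary_measure:
 assumes "B \<in> sets borel" and "B \<subseteq> frontier G" shows "B \<in> sets (boundary_measure G)"
 unfolding boundary_measure_def sets_restrict_space_iff[OF frontier_hausdorff1]
 using assms borel_subset_hausdorff1 by blast

lemma borel_measurable_boundary_measure:
 fixes \<phi> :: "plane => 'a::topological_space"
 shows "\<phi> \<in> borel_measurable borel ==> \<phi> \<in> borel_measurable (boundary_measure G)"
proof -
 assume "\<phi> \<in> borel_measurable borel"
 note \<phi> = this
 have "\<phi> \<in> borel_measurable hausdorff1"
 proof (rule measurableI)
  fix B :: "'a set" assume "B \<in> sets borel"
  from measurable_sets[OF \<phi> this] have "\<phi> -` B \<in> sets borel" by simp
  then show "\<phi> -` B \<inter> space hausdorff1 \<in> sets hausdorff1"
   using borel_subset_hausdorff1 by (simp add: space_hausdorff1)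
 qed simp
 then show ?thesis unfolding boundary_measure_def by (rule measurable_restrict_space1)
qed

text \<open>The preimage of a closed set consists of the boundary points with a normal in this set, which is Borel, and
 possibly of the points without a normal, at which the definite description has one fixed value.\<close>

lemma outward_normal_measurable: "outward_normal G \<in> borel_measurable (boundary_measure G)"
 unfolding borel_eq_closed
proof (rule measurable_measure_of)
 fix F :: "plane set" assume "F \<in> Collect closed"
 then have F: "closed F" by simp
 let ?no = "THE n::plane. False"
 let ?D = "{x \<in> frontier G. \<exists>n\<in>UNIV. is_outward_normal G x n}"
 have N: "outward_normal G x = n" if "is_outward_normal G x n" for x n
  unfolding outward_normal_def using that outward_normal_unique by blast
 have U: "outward_normal G x = ?no" if "!!n. \<not> is_outward_normal G x n" for x
 proof -
  have "is_outward_normal G x = (%n. False)" using that by blast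
  then show ?thesis unfolding outward_normal_def by simp
 qed
 have "outward_normal G -` F \<inter> space (boundary_measure G) =
  {x \<in> frontier G. \<exists>n\<in>F. is_outward_normal G x n} \<union> (if ?no \<in> F then frontier G - ?D else {})"
  (is "?L = ?R")
 proof (rule set_eqI)
  fix x
  show "x \<in> ?L \<longleftrightarrow> x \<in> ?R"
  proof (cases "\<exists>n. is_outward_normal G x n")
   case True
   then obtain n where n: "is_outward_normal G x n" by blast
   have "(\<exists>k\<in>F. is_outward_normal G x k) \<longleftrightarrow> n \<in> F" using n outward_normal_unique by blast
   then show ?thesis using N[OF n] n by (auto simp: space_boundary_measure)
  next
   case False
   then have "outward_normal G x = ?no" using U by blast
   then show ?thesis using False by (auto simp: space_boundary_measure)
  qed
 qed
 moreover have "?R \<in> sets borel"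
 proof -
  have D: "frontier G - ?D \<in> sets borel"
   by (rule sets.Diff[OF _ borel_normals_in_closed[OF closed_UNIV]]) simp
  have "(if ?no \<in> F then frontier G - ?D else {}) \<in> sets borel"
   by (cases "?no \<in> F", use D in presburger) (simp only: if_False sets.empty_sets)
  then show ?thesis by (rule sets.Un[OF borel_normals_in_closed[OF F]])
 qed
 moreover have "?R \<subseteq> frontier G" by (cases "?no \<in> F") (simp_all only: if_True if_False, blast+)
 ultimately show "outward_normal G -` F \<inter> space (boundary_measure G) \<in> sets (boundary_measure G)"
  using sets_boundary_measure by presburger
qed auto

lemma outward_normal_bounded: "\<exists>C. \<forall>x. norm (outward_normal G x) \<le> C"
proof (intro exI allI)
 fix x
 show "norm (outward_normal G x) \<le> max 1 (norm (THE n::plane. False))"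
 proof (cases "\<exists>n. is_outward_normal G x n")
  case True
  then obtain n where n: "is_outward_normal G x n" by blast
  then have "outward_normal G x = n" unfolding outward_normal_def using outward_normal_unique by blast
  then show ?thesis using n by (simp add: is_outward_normal_def)
 next
  case False
  then show ?thesis by (simp add: outward_normal_def)
 qed
qed

lemma integrable_normal_component:
 assumes g: "integrable (boundary_measure G) g"
 shows "integrable (boundary_measure G) (%x. (outward_normal G x \<bullet> e) * g x)"
proof -
 obtain C where C: "!!x. norm (outward_normal G x) \<le> C" using outward_normal_bounded by blast
 show ?thesis
 proof (rule integrable_mult_bounded[OF g])
  show "(%x. outward_normal G x \<bullet> e) \<in> borel_measurable (boundary_measure G)"
   using outward_normal_measurable by (intro borel_measurable_inner) auto
  show "\<bar>outward_normal G x \<bullet> e\<bar> \<le> C * norm e" for x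
   using Cauchy_Schwarz_ineq2 mult_right_mono[OF C norm_ge_zero] by (rule order_trans)
 qed
qed

text \<open>The positive part of an integrable density, as a Borel measure on the plane. This turns densities
 with respect to measures on subsets or on larger \<open>\<sigma>\<close>-algebras into measures of one kind.\<close>

definition plane_density :: "plane measure => (plane => real) => plane measure" where
 "plane_density M b = distr (density M (%x. ennreal (b x))) borel (%x. x)"

lemma plane_density:
 assumes id: "(%x. x) \<in> measurable M borel" and b: "integrable M b"
 shows "finite_measure (plane_density M b)" and "sets (plane_density M b) = sets borel"
  and "\<phi> \<in> borel_measurable borel ==> (LINT x|plane_density M b. \<phi> x) = (LINT x|M. \<phi> x * max 0 (b x))"
  and "measure (plane_density M b) UNIV = (LINT x|M. max 0 (b x))"
proof -
 let ?D = "density M (%x. ennreal (b x))"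
 have id': "(%x. x) \<in> measurable ?D borel" using id by simp
 show "sets (plane_density M b) = sets borel" by (simp add: plane_density_def)
 show "finite_measure (plane_density M b)"
 proof (rule finite_measureI)
  have "emeasure (plane_density M b) UNIV = emeasure ?D (space M)"
   unfolding plane_density_def by (subst emeasure_distr[OF id']) auto
  also have "... = (\<integral>\<^sup>+x. ennreal (b x) * indicator (space M) x \<partial>M)" using b by (intro emeasure_density) auto
  also have "... \<le> (\<integral>\<^sup>+x. ennreal (b x) \<partial>M)" by (rule nn_integral_mono) (auto simp: indicator_def)
  also have "... < \<infinity>" using b by (auto simp: real_integrable_def less_top)
  finally show "emeasure (plane_density M b) (space (plane_density M b)) \<noteq> \<infinity>" by (simp add: plane_density_def)
 qed
 show int: "(LINT x|plane_density M b. \<phi> x) = (LINT x|M. \<phi> x * max 0 (b x))" if \<phi>: "\<phi> \<in> borel_measurable borel" for \<phi>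
 proof -
  have "?D = density M (%x. ennreal (max 0 (b x)))" by (intro density_cong) (use b in "auto simp: ennreal_max_0")
  moreover have "(LINT x|plane_density M b. \<phi> x) = (LINT x|?D. \<phi> x)"
   unfolding plane_density_def by (rule integral_distr[OF id' \<phi>])
  moreover have "\<phi> \<in> borel_measurable M" using measurable_compose[OF id \<phi>] by simp
  ultimately show ?thesis using b by (simp add: integral_real_density mult.commute)
 qed
 have "(LINT x|plane_density M b. 1) = (LINT x|M. 1 * max 0 (b x))" by (rule int) simp
 then show "measure (plane_density M b) UNIV = (LINT x|M. max 0 (b x))" by (simp add: plane_density_def)
qed

abbreviation boundary_density :: "plane set => (plane => real) => plane measure" where
 "boundary_density G \<equiv> plane_density (boundary_measure G)"

lemmas boundary_density = plane_density[OF borel_measurable_boundary_measure[OF measurable_ident[of borel, unfolded id_def]]]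

text \<open>A set where \<open>b\<close> exceeds a positive number has finite Hausdorff measure, so by regularity it is a
 Borel set up to a null set and has measure zero by assumption.\<close>

lemma AE_nonpos_if_borel_integrals_zero:
 fixes b :: "plane => real"
 assumes b: "integrable (boundary_measure G) b"
  and z: "!!B. B \<in> sets borel ==> (LINT x|boundary_measure G. indicator B x * b x) = 0"
 shows "AE x in boundary_measure G. b x \<le> 0"
proof -
 let ?M = "boundary_measure G"
 have [measurable]: "b \<in> borel_measurable ?M" using b by auto
 have em: "emeasure ?M E = hausdorff1_outer E" if "E \<in> sets ?M" for E
 proof -
  have "E \<in> sets hausdorff1" "E \<subseteq> frontier G"
   using that frontier_hausdorff1[of G] by (auto simp: boundary_measure_def sets_restrict_space_iff)
  then show ?thesis using frontier_hausdorff1[of G]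
   by (simp add: boundary_measure_def emeasure_restrict_space emeasure_hausdorff1)
 qed
 have null: "{x \<in> space ?M. b x \<ge> 1 / real (Suc n)} \<in> null_sets ?M" for n
 proof -
  let ?E = "{x \<in> space ?M. b x \<ge> 1 / real (Suc n)}"
  have E: "?E \<in> sets ?M" by measurable
  have iE: "integrable ?M (%x. indicator ?E x * b x)"
   by (rule integrable_bound[OF b]) (auto simp: indicator_def)
  have "(\<integral>\<^sup>+x. ennreal (1 / real (Suc n)) * indicator ?E x \<partial>?M) \<le> (\<integral>\<^sup>+x. ennreal (indicator ?E x * b x) \<partial>?M)"
   by (rule nn_integral_mono) (auto simp: indicator_def intro!: ennreal_leI)
  also have "... = ennreal (LINT x|?M. indicator ?E x * b x)"
  proof (rule nn_integral_eq_integral[OF iE])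
   have "0 \<le> indicator ?E x * b x" for x
   proof (cases "x \<in> ?E")
    case True
    then have "b x \<ge> 1 / real (Suc n)" by simp
    moreover have "1 / real (Suc n) > 0" by simp
    ultimately have "b x \<ge> 0" by linarith
    then show ?thesis by (simp add: indicator_def)
   qed simp
   then show "AE x in ?M. 0 \<le> indicator ?E x * b x" by simp
  qed
  finally have le: "ennreal (1 / real (Suc n)) * emeasure ?M ?E \<le> ennreal (LINT x|?M. indicator ?E x * b x)"
   using E by (simp add: nn_integral_cmult_indicator)
  then have fin: "emeasure ?M ?E < top"
   by (cases "emeasure ?M ?E = top") (auto simp: ennreal_mult_top less_top top_unique)
  obtain Gv where Gv: "Gv \<in> sets borel" "?E \<subseteq> Gv" "hausdorff1_outer Gv = hausdorff1_outer ?E"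
   using hausdorff1_outer_regular[of ?E] by blast
  define G' where "G' = Gv \<inter> frontier G"
  have G': "G' \<in> sets borel" "?E \<subseteq> G'" using Gv by (auto simp: G'_def space_boundary_measure)
  have G'M: "G' \<in> sets ?M"
   unfolding boundary_measure_def using frontier_hausdorff1[of G] borel_subset_hausdorff1[OF G'(1)]
   by (simp add: sets_restrict_space_iff G'_def)
  have eqm: "emeasure ?M G' = emeasure ?M ?E"
  proof (rule antisym)
   have "hausdorff1_outer G' \<le> hausdorff1_outer Gv" by (rule outer_mono) (simp add: G'_def)
   then show "emeasure ?M G' \<le> emeasure ?M ?E" using Gv em[OF E] em[OF G'M] by simp
   show "emeasure ?M ?E \<le> emeasure ?M G'" by (rule emeasure_mono[OF G'(2) G'M])
  qed
  have "emeasure ?M (G' - ?E) = emeasure ?M G' - emeasure ?M ?E"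
   by (rule emeasure_Diff) (use E G'M G' fin in auto)
  then have "G' - ?E \<in> null_sets ?M" using eqm fin E G'M by auto
  then have "AE x in ?M. x \<notin> G' - ?E" by (rule AE_not_in)
  then have ae: "AE x in ?M. indicator G' x * b x = indicator ?E x * b x"
  proof eventually_elim
   case (elim x)
   then have "x \<in> G' \<longleftrightarrow> x \<in> ?E" using G'(2) by blast
   then show ?case by (simp only: indicator_def)
  qed
  have "(LINT x|?M. indicator ?E x * b x) = (LINT x|?M. indicator G' x * b x)"
  proof (rule integral_cong_AE)
   show "(%x. indicator ?E x * b x) \<in> borel_measurable ?M" using E by measurable
   show "(%x. indicator G' x * b x) \<in> borel_measurable ?M" using G'M by measurable
   show "AE x in ?M. indicator ?E x * b x = indicator G' x * b x" using ae by eventually_elim (rule sym)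
  qed
  also have "... = 0" by (rule z[OF G'(1)])
  finally have "ennreal (1 / real (Suc n)) * emeasure ?M ?E = 0" using le by simp
  then have "emeasure ?M ?E = 0" by (auto simp: ennreal_eq_0_iff)
  then show ?thesis using E by auto
 qed
 have "AE x in ?M. \<forall>n. x \<notin> {x \<in> space ?M. b x \<ge> 1 / real (Suc n)}"
  unfolding AE_all_countable using AE_not_in[OF null] by blast
 then show ?thesis
  using AE_space[of ?M]
 proof eventually_elim
  case (elim x)
  show ?case
  proof (rule ccontr)
   assume "\<not> b x \<le> 0"
   then obtain n where "1 / real (Suc n) < b x" using nat_approx_posE[of "b x"] by auto
   then show False using elim by (auto intro: less_imp_le)
  qed
 qed
qed

text \<open>Positive and negative part of the density are finite Borel measures on the plane and agree on test functions,
 hence on Borel sets.\<close>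

lemma boundary_function_unique:
 fixes b :: "plane => real"
 assumes b: "integrable (boundary_measure G) b"
  and z: "!!\<phi>. \<phi> \<in> test_functions UNIV ==> (LINT x|boundary_measure G. \<phi> x * b x) = 0"
 shows "AE x in boundary_measure G. b x = 0"
proof -
 let ?M = "boundary_measure G"
 have nb: "integrable ?M (%x. - b x)" using b by simp
 let ?P = "boundary_density G b" and ?N = "boundary_density G (%x. - b x)"
 have f: "finite_borel_measure_on UNIV ?P" "finite_borel_measure_on UNIV ?N"
  using boundary_density[OF b] boundary_density[OF nb] by (auto simp: finite_borel_measure_on_def sets_restrict_space)
 have ib: "integrable ?M (%x. \<phi> x * k x)" if kp: "integrable ?M k" "bounded_borel_on UNIV \<phi>" for \<phi> and k :: "plane => real"
 proof -
  obtain C where C: "\<forall>x. \<bar>\<phi> x\<bar> \<le> C" using kp(2) unfolding bounded_borel_on_def by blast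
  have "\<phi> \<in> borel_measurable ?M" using kp(2) by (intro borel_measurable_boundary_measure) (simp add: bounded_borel_on_def)
  then show ?thesis using C by (intro integrable_mult_bounded[OF kp(1)]) blast+
 qed
 have diff: "(LINT x|?P. \<phi> x) - (LINT x|?N. \<phi> x) = (LINT x|?M. \<phi> x * b x)" if "bounded_borel_on UNIV \<phi>" for \<phi>
 proof -
  have \<phi>: "\<phi> \<in> borel_measurable borel" using that by (simp add: bounded_borel_on_def)
  have "(LINT x|?P. \<phi> x) - (LINT x|?N. \<phi> x) = (LINT x|?M. \<phi> x * max 0 (b x)) - (LINT x|?M. \<phi> x * max 0 (- b x))"
   using boundary_density(3)[OF b \<phi>] boundary_density(3)[OF nb \<phi>] by simp
  also have "... = (LINT x|?M. \<phi> x * max 0 (b x) - \<phi> x * max 0 (- b x))"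
  proof (rule integral_diff[symmetric])
   show "integrable ?M (%x. \<phi> x * max 0 (b x))" "integrable ?M (%x. \<phi> x * max 0 (- b x))"
    using b by (auto intro!: ib that)
  qed
  also have "(%x. \<phi> x * max 0 (b x) - \<phi> x * max 0 (- b x)) = (%x. \<phi> x * b x)"
   by (auto simp: fun_eq_iff max_def)
  finally show ?thesis .
 qed
 have 0: "(LINT x|?M. indicator B x * b x) = 0" if B: "B \<in> sets borel" for B
 proof -
  have "measure ?P B - measure ?N B = measure ?P B - measure ?P B"
   by (rule test_functions_separate[OF open_UNIV f(1,2) f(1) f(1) _ B])
     (use diff test_bounded_borel z in auto)
  moreover have "(LINT x|?P. indicator B x) = measure ?P B" "(LINT x|?N. indicator B x) = measure ?N B"
   using fbm(3)[OF f(1)] fbm(3)[OF f(2)] by simp_all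
  ultimately show ?thesis using diff[OF bounded_borel_on_indicator[OF B]] by simp
 qed
 have "AE x in ?M. b x \<le> 0" by (rule AE_nonpos_if_borel_integrals_zero[OF b 0])
 moreover have "AE x in ?M. - b x \<le> 0" by (rule AE_nonpos_if_borel_integrals_zero[OF nb]) (use 0 in simp)
 ultimately show ?thesis by eventually_elim simp
qed

section \<open>Smearing and approximate identities\<close>

lemma abs_component_le_norm: "abs (fst z) \<le> norm z" "abs (snd z) \<le> norm z" for z :: plane
 using norm_fst_le[of "fst z" "snd z"] norm_snd_le[of "snd z" "fst z"] by auto

lemma mollifier_integrable_translate: "eps > 0 ==> integrable lborel (%x. mollifier eps (x - z))"
 and mollifier_nn_integral: "eps > 0 ==> (\<integral>\<^sup>+x. ennreal (mollifier eps (x - z)) \<partial>lborel) = 1"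
proof -
 assume e: "eps > 0"
 note [measurable] = mollifier_measurable[OF e]
 show i: "integrable lborel (%x. mollifier eps (x - z))"
 proof (rule integrable_lborel_compact_support)
  have "continuous_on UNIV (mollifier eps)" using mollifier_test[OF e] C_k_continuous by (auto simp: test_functions_UNIV_iff)
  then show "continuous_on UNIV (%x. mollifier eps (x - z))"
   by (rule continuous_on_compose2) (auto intro: continuous_intros)
  have "{x. mollifier eps (x - z) \<noteq> 0} \<subseteq> ball z eps"
  proof
   fix x assume "x \<in> {x. mollifier eps (x - z) \<noteq> 0}"
   then have "norm (x - z) < eps" using mollifier_supp[OF e, of "x - z"] by simp
   then show "x \<in> ball z eps" by (simp add: dist_norm norm_minus_commute)
  qed
  then show "bounded {x. mollifier eps (x - z) \<noteq> 0}" using bounded_subset bounded_ball by blast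
 qed
 have "(LBINT x. mollifier eps (x - z)) = 1"
  using integral_lborel_translate[of "mollifier eps" "- z"] mollifier_integral[OF e] by simp
 then show "(\<integral>\<^sup>+x. ennreal (mollifier eps (x - z)) \<partial>lborel) = 1"
  using nn_integral_eq_integral[OF i] mollifier_nonneg by simp
qed

lemma smear_kernel_integrable:
 assumes M: "sigma_finite_measure M" and e: "eps > 0"
  and T [measurable]: "T \<in> borel_measurable M" and g: "integrable M g"
 shows "integrable (lborel \<Otimes>\<^sub>M M) (%(x, y). mollifier eps (x - T y) * g y)"
proof -
 interpret M: sigma_finite_measure M by fact
 interpret P: pair_sigma_finite lborel M ..
 note [measurable] = mollifier_measurable[OF e]
 have [measurable]: "g \<in> borel_measurable M" using g by auto
 show ?thesis
 proof (rule integrableI_bounded)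
  show "(%(x, y). mollifier eps (x - T y) * g y) \<in> borel_measurable (lborel \<Otimes>\<^sub>M M)" by measurable
  have "(\<integral>\<^sup>+z. ennreal (norm (case z of (x, y) => mollifier eps (x - T y) * g y)) \<partial>(lborel \<Otimes>\<^sub>M M))
   = (\<integral>\<^sup>+y. \<integral>\<^sup>+x. ennreal (norm (mollifier eps (x - T y) * g y)) \<partial>lborel \<partial>M)"
   by (subst P.nn_integral_snd[symmetric]) (auto)
  also have "... = (\<integral>\<^sup>+y. ennreal \<bar>g y\<bar> \<partial>M)"
  proof (rule nn_integral_cong)
   fix y
   have "(\<integral>\<^sup>+x. ennreal (norm (mollifier eps (x - T y) * g y)) \<partial>lborel) = (\<integral>\<^sup>+x. ennreal (mollifier eps (x - T y)) * ennreal \<bar>g y\<bar> \<partial>lborel)"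
    by (rule nn_integral_cong) (simp add: abs_mult mollifier_nonneg ennreal_mult)
   also have "... = ennreal \<bar>g y\<bar>" using mollifier_nn_integral[OF e, of "T y"] by (subst nn_integral_multc) auto
   finally show "(\<integral>\<^sup>+x. ennreal (norm (mollifier eps (x - T y) * g y)) \<partial>lborel) = ennreal \<bar>g y\<bar>" .
  qed
  also have "... < \<infinity>" using g by (simp add: integrable_iff_bounded)
  finally show "(\<integral>\<^sup>+z. ennreal (norm (case z of (x, y) => mollifier eps (x - T y) * g y)) \<partial>(lborel \<Otimes>\<^sub>M M)) < \<infinity>" .
 qed
qed

text \<open>By Fubini's theorem, as the kernel has mass one in its first variable.\<close>

lemma smear_L1:
 assumes M: "sigma_finite_measure M" and e: "eps > 0" and T: "T \<in> borel_measurable M" and g: "integrable M g"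
 shows "integrable lborel (smear M T g (mollifier eps))"
  and "(LBINT x. smear M T g (mollifier eps) x) = (LINT y|M. g y)"
  and "(LBINT x. \<bar>smear M T g (mollifier eps) x\<bar>) \<le> (LINT y|M. \<bar>g y\<bar>)"
proof -
 interpret M: sigma_finite_measure M by fact
 interpret P: pair_sigma_finite lborel M ..
 have main: "integrable lborel (smear M T g (mollifier eps)) \<and> (LBINT x. smear M T g (mollifier eps) x) = (LINT y|M. g y)"
  if g: "integrable M g" for g
 proof -
  note i = smear_kernel_integrable[OF M e T g]
  have "integrable lborel (smear M T g (mollifier eps))" unfolding smear_def using P.integrable_fst[OF i] by simp
  moreover have "(LBINT x. smear M T g (mollifier eps) x) = (LINT y|M. (LBINT x. mollifier eps (x - T y) * g y))"
   unfolding smear_def using P.Fubini_integral[OF i] by simp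
  moreover have "(LBINT x. mollifier eps (x - T y)) = 1" for y
   using integral_lborel_translate[of "mollifier eps" "- T y"] mollifier_integral[OF e] mollifier_measurable[OF e] by simp
  ultimately show ?thesis by simp
 qed
 show "integrable lborel (smear M T g (mollifier eps))" "(LBINT x. smear M T g (mollifier eps) x) = (LINT y|M. g y)"
  using main[OF g] by auto
 have ga: "integrable M (%y. \<bar>g y\<bar>)" using g by simp
 have "(LBINT x. \<bar>smear M T g (mollifier eps) x\<bar>) \<le> (LBINT x. smear M T (%y. \<bar>g y\<bar>) (mollifier eps) x)"
 proof (rule integral_mono)
  show "\<bar>smear M T g (mollifier eps) x\<bar> \<le> smear M T (%y. \<bar>g y\<bar>) (mollifier eps) x" for x
   unfolding smear_def by (rule order_trans[OF integral_abs_bound]) (simp add: abs_mult mollifier_nonneg)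
 qed (use main[OF g] main[OF ga] in auto)
 also have "... = (LINT y|M. \<bar>g y\<bar>)" using main[OF ga] by simp
 finally show "(LBINT x. \<bar>smear M T g (mollifier eps) x\<bar>) \<le> (LINT y|M. \<bar>g y\<bar>)" .
qed

lemma smear_mollifier_kernel_integrable:
 assumes e: "eps > 0" and T: "T \<in> borel_measurable M" and g: "integrable M g"
 shows "integrable M (%y. mollifier eps (x - T y) * g y)"
 by (rule smear_integrable[OF _ _ T g]) (use mollifier_test[OF e] C_k_continuous in "auto simp: test_functions_UNIV_iff")

lemma smear_add:
 assumes e: "eps > 0" and T: "T \<in> borel_measurable M" and f: "integrable M f" and g: "integrable M g"
 shows "smear M T (%y. f y + g y) (mollifier eps) x = smear M T f (mollifier eps) x + smear M T g (mollifier eps) x"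
 unfolding smear_def distrib_left
 by (rule integral_add; rule smear_mollifier_kernel_integrable[OF e T]; fact)

lemma smear_cmult: "smear M T (%y. c * f y) k x = c * smear M T f k x"
proof -
 have "(%y. k (x - T y) * (c * f y)) = (%y. c * (k (x - T y) * f y))" by auto
 then show ?thesis unfolding smear_def by simp
qed

lemma smear_diff:
 assumes e: "eps > 0" and T: "T \<in> borel_measurable M" and f: "integrable M f" and g: "integrable M g"
 shows "smear M T (%y. f y - g y) (mollifier eps) x = smear M T f (mollifier eps) x - smear M T g (mollifier eps) x"
 unfolding smear_def right_diff_distrib
 by (rule integral_diff; rule smear_mollifier_kernel_integrable[OF e T]; fact)

text \<open>The maps along which mass is moved: a translation together with a vertical contraction. Their first
 component depends on \<open>y\<^sub>1\<close> only, so that a smeared function has a vertical derivative that involves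
 only the vertical derivative of the original one.\<close>

definition push :: "real => real => real => real => plane => plane" where
 "push p q c s y = (fst y + s * p, snd y + s * (q - c * snd y))"

lemma push_measurable [measurable]: "push p q c s \<in> borel_measurable borel"
 unfolding push_def[abs_def] by (intro borel_measurable_continuous_onI continuous_intros)

text \<open>Integrating in the other variable gives the Jacobian of the push instead of one.\<close>

lemma mollifier_push_integral:
 assumes e: "eps > 0" and sc: "s * c < 1"
 shows "(LBINT y. mollifier eps (x - push p q c s y)) = 1 / (1 - s * c)"
  and "integrable lborel (%y. mollifier eps (x - push p q c s y))"
proof -
 note [measurable] = mollifier_measurable[OF e]
 define cc where "cc j = (if j = e1 then - 1 else - (1 - s * c))" for j :: plane
 define t where "t = x - (s * p, s * q)"
 have cc: "cc j \<noteq> 0" if "j \<in> Basis" for j using sc by (auto simp: cc_def)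
 have Tx: "t + (\<Sum>j\<in>Basis. (cc j * (y \<bullet> j)) *\<^sub>R j) = x - push p q c s y" for y
  by (cases x; cases y) (simp add: Basis_prod_def cc_def t_def push_def algebra_simps)
 have prod: "(\<Prod>j\<in>Basis. \<bar>cc j\<bar>) = 1 - s * c"
  using sc by (simp add: Basis_prod_def cc_def)
 have m: "(%y. x - push p q c s y) \<in> borel_measurable lborel" by measurable
 have L: "(lborel :: plane measure) = density (distr lborel borel (%y. x - push p q c s y)) (%_. ennreal (1 - s * c))"
  using lborel_affine_euclidean[of cc t, OF cc] unfolding Tx prod by simp
 have i: "integrable lborel (mollifier eps)" by (rule mollifier_integrable[OF e])
 then have "integrable (density (distr lborel borel (%y. x - push p q c s y)) (%_. ennreal (1 - s * c))) (mollifier eps)"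
  using L by simp
 then show "integrable lborel (%y. mollifier eps (x - push p q c s y))"
  using sc by (subst (asm) integrable_density) (auto simp: integrable_distr_eq)
 have "1 = (LBINT y. mollifier eps y)" using mollifier_integral[OF e] by simp
 also have "... = (LINT y|density (distr lborel borel (%y. x - push p q c s y)) (%_. ennreal (1 - s * c)). mollifier eps y)"
  using L by simp
 also have "... = (1 - s * c) * (LBINT y. mollifier eps (x - push p q c s y))"
  using sc by (subst integral_real_density) (auto simp: integral_distr)
 finally show "(LBINT y. mollifier eps (x - push p q c s y)) = 1 / (1 - s * c)"
  using sc by (simp add: field_simps)
qed

context
 fixes p q c r :: real and s :: "nat => real"
 assumes c: "c \<ge> 0" and r: "r > 0" and s: "!!n. s n > 0" and sl: "s \<longlonglongrightarrow> 0"
begin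

definition app :: "nat => (plane => real) => plane => real" where
 "app n g = smear lborel (push p q c (s n)) g (mollifier (r * s n))"

lemma app_pos: "r * s n > 0" using r s by simp

lemma app_L1:
 assumes "integrable lborel g"
 shows "integrable lborel (app n g)" "(LBINT x. app n g x) = (LBINT x. g x)"
  "(LBINT x. \<bar>app n g x\<bar>) \<le> (LBINT x. \<bar>g x\<bar>)"
 unfolding app_def
 using smear_L1[OF lborel.sigma_finite_measure_axioms app_pos _ assms, of "push p q c (s n)"] by auto

lemma app_add: "integrable lborel f ==> integrable lborel g ==> app n (%y. f y + g y) x = app n f x + app n g x"
 unfolding app_def by (intro smear_add app_pos) auto

lemma app_diff: "integrable lborel f ==> integrable lborel g ==> app n (%y. f y - g y) x = app n f x - app n g x"
 unfolding app_def by (intro smear_diff app_pos) auto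

definition good :: "(plane => real) => bool" where
 "good g \<longleftrightarrow> integrable lborel g \<and> (%n. \<integral>x. \<bar>app n g x - g x\<bar> \<partial>lborel) \<longlonglongrightarrow> 0"

text \<open>Smearing is a contraction of the space of integrable functions, so convergence passes to limits in the
 mean.\<close>

lemma good_closed:
 assumes g: "integrable lborel g"
  and ap: "!!eps. eps > 0 ==> \<exists>h. good h \<and> (LBINT x. \<bar>g x - h x\<bar>) < eps"
 shows "good g"
 unfolding good_def
proof (intro conjI g LIMSEQ_I)
 fix eps :: real assume e: "eps > 0"
 obtain h where h: "good h" "(LBINT x. \<bar>g x - h x\<bar>) < eps / 3" using ap[of "eps / 3"] e by auto
 have ih: "integrable lborel h" using h by (simp add: good_def)
 have "\<forall>\<^sub>F n in sequentially. (LBINT x. \<bar>app n h x - h x\<bar>) < eps / 3"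
  using h(1) e unfolding good_def by (intro order_tendstoD(2)) auto
 then obtain N where N: "!!n. n \<ge> N ==> (LBINT x. \<bar>app n h x - h x\<bar>) < eps / 3"
  unfolding eventually_sequentially by blast
 have "norm ((LBINT x. \<bar>app n g x - g x\<bar>) - 0) < eps" if n: "n \<ge> N" for n
 proof -
  have id: "integrable lborel (%x. g x - h x)" using g ih by simp
  have 1: "integrable lborel (%x. \<bar>app n (%x. g x - h x) x\<bar>)" "integrable lborel (%x. \<bar>app n h x - h x\<bar>)"
   "integrable lborel (%x. \<bar>g x - h x\<bar>)"
   using app_L1[OF id] app_L1[OF ih] ih g by auto
  have "(LBINT x. \<bar>app n g x - g x\<bar>) \<le> (LBINT x. \<bar>app n (%x. g x - h x) x\<bar> + abs (app n h x - h x) + abs (g x - h x))"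
  proof (rule integral_mono)
   show "integrable lborel (%x. \<bar>app n g x - g x\<bar>)" using app_L1[OF g] g by auto
   show "integrable lborel (%x. \<bar>app n (%x. g x - h x) x\<bar> + abs (app n h x - h x) + abs (g x - h x))" using 1 by simp
   fix x show "abs (app n g x - g x) \<le> \<bar>app n (%x. g x - h x) x\<bar> + abs (app n h x - h x) + abs (g x - h x)"
    unfolding app_diff[OF g ih] by linarith
  qed
  also have "... = (LBINT x. \<bar>app n (%x. g x - h x) x\<bar>) + (LBINT x. \<bar>app n h x - h x\<bar>) + (LBINT x. \<bar>g x - h x\<bar>)"
   using 1 by simp
  also have "... < eps / 3 + eps / 3 + eps / 3" using N[OF n] h(2) app_L1(3)[OF id, of n] by linarith
  finally show ?thesis by simp
 qed
 then show "\<exists>no. \<forall>n\<ge>no. norm ((LBINT x. \<bar>app n g x - g x\<bar>) - 0) < eps" by blast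
qed

text \<open>For the indicator function of an open set the smeared functions converge to one inside; as their
 integrals agree with the measure of the set, no mass can be left outside.\<close>

lemma app_open_pointwise:
 assumes V: "open V" "x \<in> V" and fin: "emeasure lborel V < \<infinity>"
 shows "(%n. app n (indicator V) x) \<longlonglongrightarrow> 1"
proof -
 obtain d where d: "d > 0" "ball x d \<subseteq> V" using V open_contains_ball by blast
 define R where "R = 2 * (norm x + r + abs q)"
 define D where "D = r + abs p + abs q + c * R"
 have R: "R \<ge> 0" using r by (simp add: R_def)
 have D: "D > 0" using r c R by (simp add: D_def add_pos_nonneg)
 have ev1: "\<forall>\<^sub>F n in sequentially. s n < 1" using order_tendstoD(2)[OF sl, of 1] by simp
 have ev2: "\<forall>\<^sub>F n in sequentially. s n < d / D" using order_tendstoD(2)[OF sl, of "d / D"] d D by simp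
 have ev3: "\<forall>\<^sub>F n in sequentially. s n < 1 / (2 * c + 1)" using order_tendstoD(2)[OF sl, of "1 / (2 * c + 1)"] c by simp
 have ev: "\<forall>\<^sub>F n in sequentially. 1 / (1 - s n * c) = app n (indicator V) x"
  using ev1 ev2 ev3
 proof eventually_elim
  case (elim n)
  have sn: "s n > 0" by (rule s)
  have sc2: "s n * c \<le> 1 / 2" using elim(3) c sn by (simp add: field_simps)
  have "mollifier (r * s n) (x - push p q c (s n) y) * indicator V y = mollifier (r * s n) (x - push p q c (s n) y)" for y
  proof (cases "mollifier (r * s n) (x - push p q c (s n) y) = 0")
   case False
   then have b: "norm (x - push p q c (s n) y) < r * s n" using mollifier_supp[OF app_pos] by blast
   have "\<bar>snd (x - push p q c (s n) y)\<bar> \<le> norm (x - push p q c (s n) y)"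
    by (rule abs_component_le_norm)
   then have b2: "\<bar>snd x - snd y - s n * (q - c * snd y)\<bar> < r * s n" using b by (simp add: push_def algebra_simps)
   have x2: "abs (snd x) \<le> norm x" by (rule abs_component_le_norm)
   have rs: "r * s n \<le> r * 1" using elim(1) r by (intro mult_left_mono) auto
   have qs: "abs (s n * q) \<le> 1 * abs q" unfolding abs_mult using elim(1) sn by (intro mult_right_mono) auto
   have cs: "\<bar>s n * c * snd y\<bar> \<le> 1 / 2 * abs (snd y)"
    unfolding abs_mult[of "s n * c"] using sc2 sn c by (intro mult_right_mono) auto
   have "abs (snd y) \<le> abs (snd x) + \<bar>snd x - snd y - s n * (q - c * snd y)\<bar> + abs (s n * q) + \<bar>s n * c * snd y\<bar>"
    by (simp add: algebra_simps)
   moreover have "Y \<le> 2 * (N' + r + Q)" if "Y \<le> a + b' + c' + d'" "b' < rs'" "a \<le> N'" "rs' \<le> r * 1" "c' \<le> 1 * Q" "d' \<le> 1 / 2 * Y"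
    for Y N' Q a b' c' d' rs' :: real using that by simp
   ultimately have "abs (snd y) \<le> R" unfolding R_def using b2 x2 rs qs cs by blast
   then have cy: "abs (c * snd y) \<le> c * R" using c by (simp add: abs_mult mult_left_mono)
   have "norm (push p q c (s n) y - y) \<le> abs (s n * p) + \<bar>s n * (q - c * snd y)\<bar>"
    using norm_Pair_le[of "s n * p" "s n * (q - c * snd y)"] by (cases y) (simp add: push_def)
   also have "... = s n * (abs p + \<bar>q - c * snd y\<bar>)" using sn unfolding abs_mult distrib_left by simp
   also have "... \<le> s n * (abs p + (abs q + c * R))" using sn cy by (intro mult_left_mono) auto
   finally have "norm (x - y) < r * s n + s n * (abs p + (abs q + c * R))"
    using b norm_triangle_ineq[of "x - push p q c (s n) y" "push p q c (s n) y - y"] by simp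
   also have "... = s n * D" by (simp add: D_def algebra_simps)
   also have "... < d" using elim(2) D by (simp add: field_simps)
   finally have "y \<in> V" using d by (auto simp: dist_norm subset_eq)
   then show ?thesis by simp
  qed simp
  then have "app n (indicator V) x = (LBINT y. mollifier (r * s n) (x - push p q c (s n) y))"
   unfolding app_def smear_def by presburger
  also have "... = 1 / (1 - s n * c)" by (rule mollifier_push_integral(1)[OF app_pos]) (use sc2 in simp)
  finally show ?case by simp
 qed
 have "(%n. 1 / (1 - s n * c)) \<longlonglongrightarrow> 1 / (1 - 0 * c)" by (intro tendsto_intros sl) simp
 then have "(%n. 1 / (1 - s n * c)) \<longlonglongrightarrow> 1" by simp
 then show ?thesis using ev by (rule Lim_transform_eventually)
qed

text \<open>The integral of \<open>\<bar>a - b\<bar>\<close> is twice the integral of the positive part of \<open>b -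
 a\<close> when \<open>a\<close> and \<open>b\<close> have equal integrals, and that part is dominated by the indicator
 function.\<close>

lemma good_open:
 assumes V: "open V" and fin: "emeasure lborel V < \<infinity>"
 shows "good (indicator V)"
proof -
 have iV: "integrable lborel (indicator V :: plane => real)" using V fin by (intro integrable_real_indicator) auto
 have nn: "app n (indicator V) x \<ge> 0" for n x
  unfolding app_def smear_def by (rule integral_nonneg) (simp add: mollifier_nonneg)
 have "(%n. \<integral>x. max 0 (indicator V x - app n (indicator V) x) \<partial>lborel) \<longlonglongrightarrow> (LINT x|(lborel :: plane measure). 0)"
 proof (rule integral_dominated_convergence[where w="indicator V"])
  show "AE x in lborel. (%n. max 0 (indicator V x - app n (indicator V) x)) \<longlonglongrightarrow> 0"
  proof (rule always_eventually, rule allI)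
   fix x show "(%n. max 0 (indicator V x - app n (indicator V) x)) \<longlonglongrightarrow> 0"
   proof (cases "x \<in> V")
    case True
    have "(%n. max 0 (1 - app n (indicator V) x)) \<longlonglongrightarrow> max 0 (1 - 1)"
     by (intro tendsto_max tendsto_diff tendsto_const app_open_pointwise[OF V True fin])
    then show ?thesis using True by simp
   next
    case False
    then have "max 0 (indicator V x - app n (indicator V) x) = 0" for n using nn[of n x] by simp
    then show ?thesis by (simp only: tendsto_const)
   qed
  qed
  show "AE x in lborel. norm (max 0 (indicator V x - app n (indicator V) x)) \<le> indicator V x" for n
   by (rule always_eventually, rule allI) (use nn in "auto simp: indicator_def max_def")
 qed (use iV app_L1(1)[OF iV] in auto)
 then have l: "(%n. 2 * (LBINT x. max 0 (indicator V x - app n (indicator V) x))) \<longlonglongrightarrow> 0"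
  using tendsto_mult_right_zero by (simp add: tendsto_mult_right_zero)
 have "(LBINT x. \<bar>app n (indicator V) x - indicator V x\<bar>) = 2 * (LBINT x. max 0 (indicator V x - app n (indicator V) x))" for n
 proof -
  have i1: "integrable lborel (%x. max 0 (indicator V x - app n (indicator V) x))" "integrable lborel (%x. indicator V x - app n (indicator V) x)"
   using iV app_L1(1)[OF iV, of n] by auto
  have "(LBINT x. \<bar>app n (indicator V) x - indicator V x\<bar>)
   = (LBINT x. 2 * max 0 (indicator V x - app n (indicator V) x) - (indicator V x - app n (indicator V) x))"
   by (rule integral_cong) (auto simp: max_def)
  also have "... = 2 * (LBINT x. max 0 (indicator V x - app n (indicator V) x))
    - ((LBINT x. indicator V x) - (LBINT x. app n (indicator V) x))"
   using i1 iV app_L1(1)[OF iV, of n] by (simp add: integral_diff)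
  finally show ?thesis using app_L1(2)[OF iV, of n] by simp
 qed
 then show ?thesis using l iV unfolding good_def by simp
qed

lemma good_set:
 assumes A: "A \<in> sets borel" and fin: "emeasure lborel A < \<infinity>"
 shows "good (indicator A)"
proof (rule good_closed)
 show "integrable lborel (indicator A :: plane => real)" using A fin by (intro integrable_real_indicator) auto
 fix eps :: real assume e: "eps > 0"
 obtain V where V: "open V" "A \<subseteq> V" "emeasure lborel (V - A) < ennreal eps"
  using outer_regular_lborel[of A eps] A e by auto
 have "emeasure lborel V \<le> emeasure lborel A + emeasure lborel (V - A)"
  using emeasure_subadditive[of A lborel "V - A"] V A by (simp add: Un_absorb1)
 also have "... < \<infinity>" using fin V(3) by (auto simp: less_top[symmetric])
 finally have fV: "emeasure lborel V < \<infinity>" .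
 have "(LBINT x. \<bar>indicator A x - indicator V x\<bar>) = (LBINT x. (indicator (V - A) x :: real))"
 proof (rule integral_cong)
  fix x show "abs (indicator A x - indicator V x) = (indicator (V - A) x :: real)"
   using V(2) by (cases "x \<in> A"; cases "x \<in> V") auto
 qed simp
 also have "... = measure lborel (V - A)" by simp
 also have "... < eps"
 proof -
  have "emeasure lborel (V - A) = ennreal (measure lborel (V - A))"
   using V(3) by (intro emeasure_eq_ennreal_measure) (auto simp: top_unique)
  then show ?thesis using V(3) e by (simp add: ennreal_less_iff)
 qed
 finally show "\<exists>h. good h \<and> (LBINT x. \<bar>indicator A x - h x\<bar>) < eps" using good_open[OF V(1) fV] by blast
qed

lemma good_all: "integrable lborel g ==> good g"
proof (induct rule: integrable_induct)
 case (base A k)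
 have gA: "good (indicator A)" using base by (intro good_set) auto
 have "app n (%x. indicator A x *\<^sub>R k) x - indicator A x *\<^sub>R k = k * (app n (indicator A) x - indicator A x)" for n x
  unfolding app_def using smear_cmult[of lborel _ k "indicator A" _ x] by (simp add: algebra_simps)
 then have eq: "(LBINT x. \<bar>app n (%x. indicator A x *\<^sub>R k) x - indicator A x *\<^sub>R k\<bar>)
  = abs k * (LBINT x. \<bar>app n (indicator A) x - indicator A x\<bar>)" for n
  by (simp only: abs_mult integral_mult_right_zero)
 have gz: "(%n. \<integral>x. \<bar>app n (indicator A) x - indicator A x\<bar> \<partial>lborel) \<longlonglongrightarrow> 0"
  and gi: "integrable lborel (indicator A :: plane => real)" using gA unfolding good_def by (rule conjunct2, rule conjunct1)
 have "(%n. \<bar>k\<bar> * (LBINT x. \<bar>app n (indicator A) x - indicator A x\<bar>)) \<longlonglongrightarrow> 0"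
  by (rule tendsto_mult_right_zero[OF gz])
 moreover have "integrable lborel (%x. indicator A x *\<^sub>R k)" by (rule integrable_scaleR_left[OF gi])
 ultimately show ?case unfolding good_def eq by (rule conjI[rotated])
next
 case (add f g)
 have "(%n. (LBINT x. \<bar>app n f x - f x\<bar>) + (LBINT x. \<bar>app n g x - g x\<bar>)) \<longlonglongrightarrow> 0 + 0"
  using add unfolding good_def by (intro tendsto_add) auto
 then have "(%n. (LBINT x. \<bar>app n f x - f x\<bar>) + (LBINT x. \<bar>app n g x - g x\<bar>)) \<longlonglongrightarrow> 0" by simp
 note up = this
 have le: "(LBINT x. \<bar>app n (%x. f x + g x) x - (f x + g x)\<bar>)
   \<le> (LBINT x. \<bar>app n f x - f x\<bar>) + (LBINT x. \<bar>app n g x - g x\<bar>)" for n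
 proof -
  have i: "integrable lborel (%x. \<bar>app n f x - f x\<bar>)" "integrable lborel (%x. \<bar>app n g x - g x\<bar>)"
   using app_L1(1)[OF add(1)] app_L1(1)[OF add(3)] add by auto
  have "(LBINT x. \<bar>app n (%x. f x + g x) x - (f x + g x)\<bar>) \<le> (LBINT x. \<bar>app n f x - f x\<bar> + abs (app n g x - g x))"
  proof (rule integral_mono)
   show "integrable lborel (%x. \<bar>app n (%x. f x + g x) x - (f x + g x)\<bar>)"
    using app_L1(1)[of "%x. f x + g x" n] add by auto
   fix x show "\<bar>app n (%x. f x + g x) x - (f x + g x)\<bar> \<le> abs (app n f x - f x) + abs (app n g x - g x)"
    unfolding app_add[OF add(1) add(3)] by linarith
  qed (use i in auto)
  also have "... = (LBINT x. \<bar>app n f x - f x\<bar>) + (LBINT x. \<bar>app n g x - g x\<bar>)" using i by simp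
  finally show ?thesis .
 qed
 have "(%n. \<integral>x. \<bar>app n (%x. f x + g x) x - (f x + g x)\<bar> \<partial>lborel) \<longlonglongrightarrow> 0"
  by (rule tendsto_sandwich[OF always_eventually always_eventually tendsto_const up])
    (use le in "simp_all only: integral_nonneg abs_ge_zero simp_thms")
 with integrable_add[OF add(1) add(3)] show ?case unfolding good_def by (rule conjI)
next
 case (lim f g)
 show ?case
 proof (rule good_closed[OF lim(5)])
  fix eps :: real assume e: "eps > 0"
  have "(%i. \<integral>x. \<bar>f x - g i x\<bar> \<partial>lborel) \<longlonglongrightarrow> (LINT x|(lborel :: plane measure). 0)"
  proof (rule integral_dominated_convergence[where w="%x. 3 * abs (f x)"])
   show "AE x in lborel. (%i. \<bar>f x - g i x\<bar>) \<longlonglongrightarrow> 0"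
   proof (rule always_eventually, rule allI)
    fix x
    have "(%i. g i x) \<longlonglongrightarrow> f x" using lim(3) by simp
    then have "(%i. \<bar>f x - g i x\<bar>) \<longlonglongrightarrow> \<bar>f x - f x\<bar>" by (intro tendsto_intros)
    then show "(%i. \<bar>f x - g i x\<bar>) \<longlonglongrightarrow> 0" by simp
   qed
   show "AE x in lborel. norm \<bar>f x - g i x\<bar> \<le> 3 * abs (f x)" for i
   proof (rule always_eventually, rule allI)
    fix x show "norm \<bar>f x - g i x\<bar> \<le> 3 * abs (f x)" using lim(4)[of x i] by simp
   qed
  qed (use lim in auto)
  then have "\<forall>\<^sub>F i in sequentially. (LBINT x. \<bar>f x - g i x\<bar>) < eps" using e by (intro order_tendstoD(2)) auto
  then obtain i where "(LBINT x. \<bar>f x - g i x\<bar>) < eps" using eventually_happens[of _ sequentially] by auto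
  then show "\<exists>h. good h \<and> (LBINT x. \<bar>f x - h x\<bar>) < eps" using lim(2) by blast
 qed
qed

end

lemma approximate_identity_L1:
 assumes "c \<ge> 0" and "r > 0" and "!!n. s n > 0" and "s \<longlonglongrightarrow> 0" and "integrable lborel g"
 shows "(%n. \<integral>x. \<bar>smear lborel (push p q c (s n)) g (mollifier (r * s n)) x - g x\<bar> \<partial>lborel) \<longlonglongrightarrow> 0"
 using good_all[OF assms] assms(1-4) unfolding good_def[OF assms(1-4)] app_def[OF assms(1-4)] by simp

section \<open>Pushing the domain into itself\<close>

text \<open>The push moves the part of the closure above \<open>J\<close> into \<open>G\<close>, with a margin
 proportional to the size \<open>s\<close> of the push. The margin leaves room for mollification at scale \<open>r
 s\<close>.\<close>

definition pushes_inside :: "plane set => real set => real => real => real => real => real => bool" where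
 "pushes_inside G J p q c r s0 \<longleftrightarrow> c \<ge> 0 \<and> r > 0 \<and> s0 > 0 \<and> s0 * c \<le> 1/2 \<and>
   (\<forall>s y. 0 < s --> s < s0 --> y \<in> closure G --> fst y \<in> J --> cball (push p q c s y) (r * s) \<subseteq> G)"

text \<open>Data of a domain between two Lipschitz graphs, with the graphs continued to the closed interval.\<close>

locale graph_domain =
 fixes G :: "plane set" and a b L :: real and K1 K2 :: "real => real"
 assumes ab: "a < b" and L0: "L \<ge> 0"
  and K1_lip: "!!x y. x \<in> {a..b} ==> y \<in> {a..b} ==> \<bar>K1 x - K1 y\<bar> \<le> L * abs (x - y)"
  and K2_lip: "!!x y. x \<in> {a..b} ==> y \<in> {a..b} ==> \<bar>K2 x - K2 y\<bar> \<le> L * abs (x - y)"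
  and Om: "G = {x. fst x \<in> {a<..<b} \<and> K1 (fst x) < snd x \<and> snd x < K2 (fst x)}"
  and K12: "!!t. t \<in> {a<..<b} ==> K1 t < K2 t"
begin

lemma closure_bounds:
 assumes x: "x \<in> closure G"
 shows "fst x \<in> {a..b}" and "K1 (fst x) \<le> snd x" and "snd x \<le> K2 (fst x)"
proof -
 obtain y where y: "\<forall>n. y n \<in> G" "y \<longlonglongrightarrow> x" using x closure_sequential by blast
 have l: "(%n. fst (y n)) \<longlonglongrightarrow> fst x" "(%n. snd (y n)) \<longlonglongrightarrow> snd x" using y(2) by (intro tendsto_intros; assumption)+
 have yO: "fst (y n) \<in> {a..b}" "K1 (fst (y n)) \<le> snd (y n)" "snd (y n) \<le> K2 (fst (y n))" for n
  using y(1) by (auto simp: Om less_imp_le)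
 show f: "fst x \<in> {a..b}" by (rule closed_sequentially[OF closed_atLeastAtMost _ l(1)]) (use yO(1) in blast)
 have "continuous_on {a..b} K1" "continuous_on {a..b} K2"
  by (rule lipschitz_on_continuous_on[of L], rule lipschitz_onI, simp add: dist_real_def K1_lip K2_lip, rule L0)+
 note c = this[THEN continuous_on_tendsto_compose, OF l(1) f always_eventually, OF allI, OF yO(1)]
 show "K1 (fst x) \<le> snd x" by (rule LIMSEQ_le[OF c(1) l(2)]) (use yO(2) in blast)
 show "snd x \<le> K2 (fst x)" by (rule LIMSEQ_le[OF l(2) c(2)]) (use yO(3) in blast)
qed

text \<open>Near an end point of the base interval move inwards by \<open>s\<close>, elsewhere do not move; both leave room
 for an error \<open>s / 2\<close>.\<close>

lemma horizontal_push:
 assumes t: "t \<in> {a..b}"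
 shows "\<exists>p dl s1. \<bar>p\<bar> \<le> 1 \<and> dl > 0 \<and> s1 > 0 \<and> (\<forall>s y e. 0 < s --> s < s1 --> y \<in> {a..b} --> \<bar>y - t\<bar> \<le> dl --> \<bar>e\<bar> \<le> s / 2
  --> a < y + s * p + e \<and> y + s * p + e < b)"
proof -
 consider "t = a" | "t = b" | "a < t" "t < b" using t by force
 then show ?thesis
 proof cases
  case 1
  show ?thesis
   by (rule exI[of _ 1], rule exI[of _ "(b - a) / 2"], rule exI[of _ "(b - a) / 4"]) (use 1 ab in "auto simp: abs_le_iff")
 next
  case 2
  show ?thesis
   by (rule exI[of _ "-1"], rule exI[of _ "(b - a) / 2"], rule exI[of _ "(b - a) / 4"]) (use 2 ab in "auto simp: abs_le_iff")
 next
  case 3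
  define m where "m = min (t - a) (b - t)"
  have m: "m > 0" "m \<le> t - a" "m \<le> b - t" using 3 by (auto simp: m_def)
  show ?thesis
   by (rule exI[of _ 0], rule exI[of _ "m / 2"], rule exI[of _ "m / 2"]) (use m in "auto simp: abs_le_iff abs_real_def split: if_splits")
 qed
qed

text \<open>Where the two graphs are apart, contracting vertically towards the middle of a fibre gains a
 multiple of \<open>s\<close> over the slopes; at the end points of the interval a horizontal translation is added.\<close>

lemma local_push_fat:
 assumes t: "t \<in> {a..b}" and fat: "K1 t < K2 t"
 shows "\<exists>dl p q c r s0. dl > 0 \<and> pushes_inside G (cball t dl) p q c r s0"
proof -
 obtain p dl1 s1 where p: "abs p \<le> 1" "dl1 > 0" "s1 > 0" and
  hp: "!!s y e. 0 < s ==> s < s1 ==> y \<in> {a..b} ==> \<bar>y - t\<bar> \<le> dl1 ==> \<bar>e\<bar> \<le> s / 2 ==> a < y + s * p + e \<and> y + s * p + e < b"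
  using horizontal_push[OF t] by blast
 define w where "w = K2 t - K1 t"
 define m where "m = (K1 t + K2 t) / 2"
 define C where "C = 4 * (2 * L + 1) / w"
 define dl where "dl = min dl1 (w / (4 * L + 4))"
 define s0 where "s0 = min s1 (1 / (2 * C))"
 have w: "w > 0" using fat by (simp add: w_def)
 have C: "C > 0" using w L0 by (simp add: C_def)
 have Cw: "C * (w / 4) = 2 * L + 1" using w by (simp add: C_def)
 have dl: "dl > 0" "dl \<le> dl1" using p w L0 by (auto simp: dl_def)
 have Ldl: "L * dl \<le> w / 4"
 proof -
  have "L * dl \<le> L * (w / (4 * L + 4))" using L0 by (intro mult_left_mono) (auto simp: dl_def)
  also have "... \<le> w / 4" using L0 w by (simp add: field_simps)
  finally show ?thesis .
 qed
 have s0: "s0 > 0" "s0 \<le> s1" "s0 * C \<le> 1 / 2"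
 proof -
  show "s0 > 0" "s0 \<le> s1" using p C by (auto simp: s0_def)
  have "s0 * C \<le> 1 / (2 * C) * C" using C by (intro mult_right_mono) (auto simp: s0_def)
  then show "s0 * C \<le> 1 / 2" using C by simp
 qed
 have "cball (push p (C * m) C s y) (1/2 * s) \<subseteq> G"
  if s: "0 < s" "s < s0" and y: "y \<in> closure G" "fst y \<in> cball t dl" for s y
 proof
  fix z assume "z \<in> cball (push p (C * m) C s y) (1/2 * s)"
  then have nz: "norm (z - push p (C * m) C s y) \<le> s / 2" by (simp add: dist_norm norm_minus_commute)
  define e where "e = z - push p (C * m) C s y"
  have e: "abs (fst e) \<le> s / 2" "abs (snd e) \<le> s / 2"
   using nz abs_component_le_norm[of e] unfolding e_def by linarith+
  have z: "fst z = fst y + s * p + fst e" "snd z = snd y + s * C * (m - snd y) + snd e"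
   by (simp_all add: e_def push_def algebra_simps)
  have y1: "fst y \<in> {a..b}" by (rule closure_bounds(1)[OF y(1)])
  have yt: "abs (fst y - t) \<le> dl" using y(2) by (simp add: dist_real_def abs_minus_commute)
  have fz: "a < fst z \<and> fst z < b" unfolding z by (rule hp) (use s s0 y1 yt dl e in auto)
  have sp: "abs (s * p) \<le> s" using s p(1) by (simp add: abs_mult mult_left_le)
  have d: "abs (fst z - fst y) \<le> 3 / 2 * s" unfolding z using sp e(1) by linarith
  then have Ld: "L * abs (fst z - fst y) \<le> L * (3 / 2 * s)" using L0 by (intro mult_left_mono)
  have Lt: "L * abs (fst y - t) \<le> w / 4" using mult_left_mono[OF yt L0] Ldl by linarith
  have "s * C < s0 * C" using s(2) C by (rule mult_strict_right_mono)
  with s0(3) have "0 \<le> 1 - s * C" by linarith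
  moreover have "s * C > 0" using s(1) C by (rule mult_pos_pos)
  ultimately have sC: "0 \<le> 1 - s * C" "s * C > 0" by blast+
  have k2: "\<bar>K2 (fst z) - K2 (fst y)\<bar> \<le> L * (3 / 2 * s)" "\<bar>K2 (fst y) - K2 t\<bar> \<le> w / 4"
   using K2_lip[of "fst z" "fst y"] K2_lip[of "fst y" t] fz y1 t Ld Lt by auto
  have k1: "\<bar>K1 (fst z) - K1 (fst y)\<bar> \<le> L * (3 / 2 * s)" "\<bar>K1 (fst y) - K1 t\<bar> \<le> w / 4"
   using K1_lip[of "fst z" "fst y"] K1_lip[of "fst y" t] fz y1 t Ld Lt by auto
  have mw: "K2 t - m = w / 2" "m - K1 t = w / 2" by (simp_all add: m_def w_def field_simps)
  have gain: "s * C * (w / 4) = s * (2 * L + 1)" using Cw by (simp add: mult.assoc)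
  have Ls: "L * s \<ge> 0" using L0 s by simp
  have Le: "L * (3 / 2 * s) = 3 / 2 * (L * s)" "s * (2 * L + 1) = 2 * (L * s) + s" by (simp_all add: algebra_simps)
  have "snd z < K2 (fst z)"
  proof -
   have "(1 - s * C) * snd y \<le> (1 - s * C) * K2 (fst y)" using closure_bounds(3)[OF y(1)] sC by (intro mult_left_mono)
   then have 1: "snd y + s * C * (m - snd y) \<le> K2 (fst y) - s * C * (K2 (fst y) - m)" by (simp add: algebra_simps)
   have "w / 4 \<le> K2 (fst y) - m" using k2(2) mw by linarith
   then have "s * C * (w / 4) \<le> s * C * (K2 (fst y) - m)" using sC by (intro mult_left_mono) auto
   then have "snd z \<le> K2 (fst y) - s * (2 * L + 1) + s / 2" using 1 gain e(2) z(2) by linarith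
   then show ?thesis using k2(1) Ls s(1) unfolding Le by linarith
  qed
  moreover have "K1 (fst z) < snd z"
  proof -
   have "(1 - s * C) * K1 (fst y) \<le> (1 - s * C) * snd y" using closure_bounds(2)[OF y(1)] sC by (intro mult_left_mono)
   then have 1: "K1 (fst y) + s * C * (m - K1 (fst y)) \<le> snd y + s * C * (m - snd y)" by (simp add: algebra_simps)
   have "w / 4 \<le> m - K1 (fst y)" using k1(2) mw by linarith
   then have "s * C * (w / 4) \<le> s * C * (m - K1 (fst y))" using sC by (intro mult_left_mono) auto
   then have "snd z \<ge> K1 (fst y) + s * (2 * L + 1) - s / 2" using 1 gain e(2) z(2) by linarith
   then show ?thesis using k1(1) Ls s(1) unfolding Le by linarith
  qed
  ultimately show "z \<in> G" using fz by (simp add: Om)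
 qed
 then have "pushes_inside G (cball t dl) p (C * m) C (1/2) s0"
  unfolding pushes_inside_def using s0 C by auto
 then show ?thesis using dl(1) by blast
qed

text \<open>Where the graphs meet, the domain has a corner. The Lipschitz chart at the corner provides a
 direction that enters the domain from every nearby point of the closure.\<close>

lemma local_push_corner:
 assumes lip: "bounded_lipschitz_domain G" and t: "t \<in> {a..b}" and meet: "K2 t \<le> K1 t"
 shows "\<exists>dl p q c r s0. dl > 0 \<and> pushes_inside G (cball t dl) p q c r s0"
proof -
 define P where "P = (t, K1 t)"
 have cl: "P \<in> closure G"
  unfolding closure_approachable
 proof (intro allI impI)
  fix e :: real assume e: "e > 0"
  have "t \<in> closure {a<..<b}" using t ab by simp
  moreover have "e / (2 * L + 2) > 0" using e L0 by simp
  ultimately obtain x where x: "x \<in> {a<..<b}" "dist x t < e / (2 * L + 2)" using closure_approachable by blast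
  define z where "z = (x, (K1 x + K2 x) / 2)"
  have "z \<in> G" using x K12[OF x(1)] by (simp add: z_def Om)
  moreover have "dist z P < e"
  proof -
   have xt: "x \<in> {a..b}" using x by auto
   have lt: "abs (K1 x - K1 t) \<le> L * abs (x - t)" "abs (K2 x - K2 t) \<le> L * abs (x - t)" using K1_lip K2_lip xt t by auto
   have "K1 x < K2 x" by (rule K12[OF x(1)])
   then have m: "\<bar>(K1 x + K2 x) / 2 - K1 t\<bar> \<le> L * abs (x - t)" using lt meet by (auto simp: abs_le_iff field_simps)
   have "norm (z - P) \<le> abs (x - t) + \<bar>(K1 x + K2 x) / 2 - K1 t\<bar>"
    using norm_Pair_le[of "x - t" "(K1 x + K2 x) / 2 - K1 t"] by (simp add: z_def P_def)
   also have "... \<le> (L + 1) * abs (x - t)" using m by (simp add: algebra_simps)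
   also have "... \<le> (L + 1) * (e / (2 * L + 2))" using x(2) L0 by (intro mult_left_mono) (auto simp: dist_real_def)
   also have "... = e / 2" using L0 by (simp add: field_simps)
   finally show ?thesis using e by (simp add: dist_norm)
  qed
  ultimately show "\<exists>y\<in>G. dist y P < e" by blast
 qed
 have "P \<notin> G" using meet by (auto simp: P_def Om)
 then have "P \<in> frontier G" using cl interior_subset by (auto simp: frontier_def)
 then obtain r0 Q g Lg where r0: "r0 > 0" and Q: "orthogonal_transformation (Q :: plane => plane)"
  and g: "Lg-lipschitz_on UNIV (g :: real => real)"
  and ch: "G \<inter> ball P r0 = {x \<in> ball P r0. snd (Q x) < g (fst (Q x))}"
  using lip unfolding bounded_lipschitz_domain_def by blast
 have Lg: "Lg \<ge> 0" using g lipschitz_on_nonneg by blast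
 have gl: "abs (g x - g y) \<le> Lg * abs (x - y)" for x y using lipschitz_onD[OF g, of x y] by (simp add: dist_real_def)
 have lin: "linear Q" and nQ: "!!x. norm (Q x) = norm x"
  using Q by (auto simp: orthogonal_transformation)
 obtain d where d: "Q d = (0, -1)" using orthogonal_transformation_surj[OF Q] by (metis surjD)
 have nd: "norm d = 1" using nQ[of d] d by simp
 define r where "r = 1 / (Lg + 2)"
 have r: "r > 0" "r \<le> 1/2" "(Lg + 1) * r < 1" using Lg by (auto simp: r_def field_simps)
 define dl where "dl = r0 / (2 * (L + 2))"
 have dl: "dl > 0" using r0 L0 by (simp add: dl_def)
 have below: "snd (Q y) \<le> g (fst (Q y))" if y: "y \<in> closure G" "dist P y < r0" for y
 proof (rule field_le_epsilon)
  fix e :: real assume e: "e > 0"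
  define h where "h = min (e / (Lg + 1)) (r0 - dist P y)"
  have h: "h > 0" using e Lg y(2) by (simp add: h_def)
  obtain y' where y': "y' \<in> G" "dist y' y < h" using y(1) h closure_approachable by blast
  have "dist P y' < r0" using y'(2) dist_triangle[of P y' y] by (simp add: h_def dist_commute)
  then have "y' \<in> G \<inter> ball P r0" using y'(1) by simp
  then have 1: "snd (Q y') < g (fst (Q y'))" unfolding ch by simp
  have "norm (Q (y' - y)) < h" using y'(2) nQ by (simp add: dist_norm)
  then have "\<bar>fst (Q y' - Q y)\<bar> < h" "\<bar>snd (Q y' - Q y)\<bar> < h"
   using abs_component_le_norm[of "Q y' - Q y"] by (auto simp: linear_diff[OF lin])
  then have f: "\<bar>fst (Q y') - fst (Q y)\<bar> \<le> e / (Lg + 1)" "\<bar>snd (Q y') - snd (Q y)\<bar> \<le> e / (Lg + 1)"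
   by (auto simp: h_def)
  have "g (fst (Q y')) - g (fst (Q y)) \<le> Lg * (e / (Lg + 1))"
   using gl[of "fst (Q y')" "fst (Q y)"] mult_left_mono[OF f(1) Lg] by linarith
  moreover have "Lg * (e / (Lg + 1)) + e / (Lg + 1) = (Lg + 1) * (e / (Lg + 1))" by (simp only: distrib_right mult_1)
  moreover have "(Lg + 1) * (e / (Lg + 1)) = e" using Lg by simp
  ultimately show "snd (Q y) \<le> g (fst (Q y)) + e" using 1 f(2) by linarith
 qed
 have "cball (push (fst d) (snd d) 0 s y) (r * s) \<subseteq> G"
  if s: "0 < s" "s < r0 / 4" and y: "y \<in> closure G" "fst y \<in> cball t dl" for s y
 proof
  fix z assume "z \<in> cball (push (fst d) (snd d) 0 s y) (r * s)"
  moreover have "push (fst d) (snd d) 0 s y = y + s *\<^sub>R d" by (cases y; cases d) (simp add: push_def)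
  ultimately have nz: "norm (z - (y + s *\<^sub>R d)) \<le> r * s" by (simp add: dist_norm norm_minus_commute)
  define e where "e = z - (y + s *\<^sub>R d)"
  have e: "norm e \<le> r * s" using nz by (simp add: e_def)
  have ze: "z = y + s *\<^sub>R d + e" by (simp add: e_def)
  have y1: "fst y \<in> {a..b}" by (rule closure_bounds(1)[OF y(1)])
  have yt: "abs (fst y - t) \<le> dl" using y(2) by (simp add: dist_real_def abs_minus_commute)
  have "\<bar>K1 (fst y) - K1 t\<bar> \<le> L * dl" "\<bar>K2 (fst y) - K2 t\<bar> \<le> L * dl"
   using K1_lip[OF y1 t] K2_lip[OF y1 t] mult_left_mono[OF yt L0] by linarith+
  then have "abs (snd y - K1 t) \<le> L * dl" using closure_bounds(2,3)[OF y(1)] meet by (auto simp: abs_le_iff)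
  then have "norm (y - P) \<le> dl + L * dl"
   using norm_Pair_le[of "fst y - t" "snd y - K1 t"] yt by (cases y) (simp add: P_def)
  also have "... < (L + 2) * dl" using dl by (simp add: algebra_simps)
  also have "... = r0 / 2" using L0 by (simp add: dl_def divide_simps)
  finally have yP: "norm (y - P) < r0 / 2" .
  have rs: "r * s \<le> s / 2" using r(2) s(1) mult_right_mono[of r "1/2" s] by simp
  have "norm (z - P) \<le> norm (y - P) + norm (s *\<^sub>R d) + norm e"
   using norm_triangle_ineq[of "y - P + s *\<^sub>R d" e] norm_triangle_ineq[of "y - P" "s *\<^sub>R d"]
   by (simp add: ze algebra_simps)
  moreover have "norm (s *\<^sub>R d) = s" using s(1) nd by simp
  ultimately have "norm (z - P) < r0" using yP s(2) e rs r0 by linarith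
  then have zP: "dist P z < r0" by (simp add: dist_norm norm_minus_commute)
  have Qz: "Q z = Q y + s *\<^sub>R (0, -1) + Q e" by (simp only: ze linear_add[OF lin] linear_cmul[OF lin] d)
  have Qe: "\<bar>fst (Q e)\<bar> \<le> r * s" "\<bar>snd (Q e)\<bar> \<le> r * s" using abs_component_le_norm[of "Q e"] nQ[of e] e by auto
  have fsQ: "fst (Q z) = fst (Q y) + fst (Q e)" "snd (Q z) = snd (Q y) - s + snd (Q e)" by (simp_all add: Qz)
  have yb: "snd (Q y) \<le> g (fst (Q y))" using below[OF y(1)] yP r0 by (simp add: dist_norm norm_minus_commute)
  have "g (fst (Q y)) - g (fst (Q z)) \<le> Lg * (r * s)"
   using gl[of "fst (Q y)" "fst (Q z)"] mult_left_mono[OF Qe(1) Lg] fsQ by simp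
  moreover have "s * ((Lg + 1) * r) < s * 1" using r(3) s(1) by (rule mult_strict_left_mono)
  then have "Lg * (r * s) + r * s < s" by (simp add: algebra_simps)
  ultimately have "snd (Q z) < g (fst (Q z))" using yb Qe(2) fsQ(2) by linarith
  then have "z \<in> G \<inter> ball P r0" unfolding ch using zP by simp
  then show "z \<in> G" by simp
 qed
 then have "pushes_inside G (cball t dl) (fst d) (snd d) 0 r (r0 / 4)"
  unfolding pushes_inside_def using r r0 by auto
 then show ?thesis using dl by blast
qed

end

text \<open>The projection of the domain is an open interval, and Lipschitz functions extend to its closure.\<close>

lemma graph_domain_exists:
 assumes lip: "bounded_lipschitz_domain G" and nor: "normal_wrt_x2_axis G"
 shows "\<exists>a b L K1 K2. graph_domain G a b L K1 K2"
proof -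
 obtain a0 b0 \<kappa>1 \<kappa>2 l1 l2 where k: "l1-lipschitz_on {a0<..<b0} \<kappa>1" "l2-lipschitz_on {a0<..<b0} \<kappa>2"
  and Om: "G = {x. fst x \<in> {a0<..<b0} \<and> \<kappa>1 (fst x) < snd x \<and> snd x < \<kappa>2 (fst x)}"
  using nor unfolding normal_wrt_x2_axis_def by blast
 define P where "P = fst ` G"
 have op: "open P" unfolding P_def using lip by (intro open_image_fst) (simp add: bounded_lipschitz_domain_def)
 have co: "connected P" unfolding P_def using lip
  by (intro connected_continuous_image) (auto simp: bounded_lipschitz_domain_def intro: continuous_intros)
 have ne: "P \<noteq> {}" using lip by (auto simp: P_def bounded_lipschitz_domain_def)
 have sub: "P \<subseteq> {a0<..<b0}" by (auto simp: P_def Om)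
 have bd: "bdd_below P" "bdd_above P" using sub by (auto intro!: bdd_belowI2[of _ a0 id, simplified] bdd_aboveI2[of _ id b0, simplified] less_imp_le)
 define a where "a = Inf P"
 define b where "b = Sup P"
 have P: "P = {a<..<b}"
 proof (intro set_eqI iffI)
  fix x assume x: "x \<in> P"
  obtain e where e: "e > 0" "ball x e \<subseteq> P" using op x open_contains_ball by blast
  have "x - e / 2 \<in> P" "x + e / 2 \<in> P" using e by (auto simp: subset_eq dist_real_def)
  then have "a \<le> x - e / 2" "x + e / 2 \<le> b" unfolding a_def b_def using bd by (auto intro: cInf_lower cSup_upper)
  then show "x \<in> {a<..<b}" using e by auto
 next
  fix x assume "x \<in> {a<..<b}"
  then obtain y z where "y \<in> P" "y < x" "z \<in> P" "x < z"
   unfolding a_def b_def using cInf_less_iff[OF ne bd(1)] less_cSup_iff[OF ne bd(2)] by auto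
  then show "x \<in> P" using co unfolding is_interval_connected_1[symmetric] is_interval_1 by (meson less_imp_le)
 qed
 have ab: "a < b" using P ne by auto
 have cl: "closure P = {a..b}" using P ab by simp
 obtain K1 where K1: "l1-lipschitz_on {a..b} K1" "\<forall>x\<in>P. K1 x = \<kappa>1 x"
  using lipschitz_extend_closure[OF lipschitz_on_subset[OF k(1) sub]] unfolding cl by blast
 obtain K2 where K2: "l2-lipschitz_on {a..b} K2" "\<forall>x\<in>P. K2 x = \<kappa>2 x"
  using lipschitz_extend_closure[OF lipschitz_on_subset[OF k(2) sub]] unfolding cl by blast
 have Om': "G = {x. fst x \<in> {a<..<b} \<and> K1 (fst x) < snd x \<and> snd x < K2 (fst x)}"
 proof (intro set_eqI iffI)
  fix x assume x: "x \<in> G"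
  then have f: "fst x \<in> P" by (simp add: P_def)
  then show "x \<in> {x. fst x \<in> {a<..<b} \<and> K1 (fst x) < snd x \<and> snd x < K2 (fst x)}" using x K1(2) K2(2) P by (simp add: Om)
 next
  fix x assume x: "x \<in> {x. fst x \<in> {a<..<b} \<and> K1 (fst x) < snd x \<and> snd x < K2 (fst x)}"
  then have f: "fst x \<in> P" by (simp add: P)
  then show "x \<in> G" using x K1(2) K2(2) sub by (auto simp: Om)
 qed
 have "graph_domain G a b (max l1 l2) K1 K2"
 proof
  show "max l1 l2 \<ge> 0" using lipschitz_on_nonneg[OF k(1)] by simp
  fix x y assume xy: "x \<in> {a..b}" "y \<in> {a..b}"
  have "l1 * abs (x - y) \<le> max l1 l2 * abs (x - y)" "l2 * abs (x - y) \<le> max l1 l2 * abs (x - y)" by (intro mult_right_mono; simp)+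
  then show "abs (K1 x - K1 y) \<le> max l1 l2 * abs (x - y)" "abs (K2 x - K2 y) \<le> max l1 l2 * abs (x - y)"
   using lipschitz_onD[OF K1(1) xy] lipschitz_onD[OF K2(1) xy] by (auto simp: dist_real_def)
 next
  fix t assume "t \<in> {a<..<b}"
  then have "t \<in> P" by (simp add: P)
  then obtain x where "x \<in> G" "t = fst x" by (auto simp: P_def)
  then show "K1 t < K2 t" by (auto simp: Om')
 qed (use ab Om' in auto)
 then show ?thesis by blast
qed

text \<open>A quadratic spline that is a continuously differentiable step from zero to one.\<close>

definition smooth_step :: "real => real" where
 "smooth_step x = 2 * ((max 0 x)^2 - 2 * (max 0 (x - 1/2))^2 + (max 0 (x - 1))^2)"

definition smooth_step' :: "real => real" where
 "smooth_step' x = 4 * (max 0 x - 2 * max 0 (x - 1/2) + max 0 (x - 1))"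

lemma max_square_deriv: "((%x::real. (max 0 x)^2) has_real_derivative 2 * max 0 x) (at x)"
proof -
 consider "x < 0" | "x > 0" | "x = 0" by linarith
 then show ?thesis
 proof cases
  case 1
  have "((%_. 0) has_real_derivative 2 * max 0 x) (at x)" using 1 by simp
  then show ?thesis
   by (rule has_field_derivative_transform_within_open[of _ _ _ "{..<0}"]) (use 1 in auto)
 next
  case 2
  have "((%x. x^2) has_real_derivative 2 * max 0 x) (at x)" using 2 by (auto intro!: derivative_eq_intros)
  then show ?thesis
   by (rule has_field_derivative_transform_within_open[of _ _ _ "{0<..}"]) (use 2 in auto)
 next
  case 3
  have "(%h::real. (max 0 h)^2 / h) \<midarrow>0\<rightarrow> 0"
  proof (rule Lim_null_comparison)
   show "\<forall>\<^sub>F h in at 0. norm ((max 0 h)^2 / h) \<le> abs h"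
    by (rule always_eventually) (auto simp: max_def power2_eq_square)
   show "(%h::real. \<bar>h\<bar>) \<midarrow>0\<rightarrow> 0" by (rule tendsto_rabs_zero[OF tendsto_ident_at])
  qed
  then show ?thesis using 3 by (simp add: DERIV_def)
 qed
qed

lemma smooth_step_deriv: "(smooth_step has_real_derivative smooth_step' x) (at x)"
proof -
 have "((%x. (max 0 (x - k))^2) has_real_derivative 2 * max 0 (x - k)) (at x)" for k :: real
  using DERIV_chain2[of "%x. (max 0 x)^2" "2 * max 0 (x - k)" "%x. x - k" x 1 UNIV] max_square_deriv[of "x - k"]
   DERIV_diff[OF DERIV_ident DERIV_const[of k]] by simp
 note d = max_square_deriv[of x] this[of "1/2"] this[of 1]
 have "((%x. 2 * ((max 0 x)^2 - 2 * (max 0 (x - 1/2))^2 + (max 0 (x - 1))^2)) has_real_derivative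
  2 * (2 * max 0 x - 2 * (2 * max 0 (x - 1/2)) + 2 * max 0 (x - 1))) (at x)"
  by (intro DERIV_cmult DERIV_add DERIV_diff d)
 then show ?thesis by (simp add: smooth_step_def[abs_def] smooth_step'_def algebra_simps)
qed

lemma smooth_step'_nonneg: "smooth_step' x \<ge> 0"
 by (auto simp: smooth_step'_def max_def)

lemma smooth_step'_continuous: "continuous_on UNIV smooth_step'"
 unfolding smooth_step'_def[abs_def] by (intro continuous_intros)

lemma smooth_step_mono: "x \<le> y ==> smooth_step x \<le> smooth_step y"
 by (rule DERIV_nonneg_imp_nondecreasing) (use smooth_step_deriv smooth_step'_nonneg in blast)+

lemma smooth_step_0: "x \<le> 0 ==> smooth_step x = 0"
 by (simp add: smooth_step_def max_def)

lemma smooth_step_1: "x \<ge> 1 ==> smooth_step x = 1"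
 by (simp add: smooth_step_def max_def power2_eq_square algebra_simps)

lemma smooth_step_bounds: "0 \<le> smooth_step x" "smooth_step x \<le> 1"
 using smooth_step_mono[of "min x 0" x] smooth_step_0[of "min x 0"] smooth_step_mono[of x "max x 1"] smooth_step_1[of "max x 1"] by auto

text \<open>A partition of unity in the horizontal variable, each piece of which comes with a push that
 moves the part of the closure over its support into the domain.\<close>

lemma strip_partition:
 assumes lip: "bounded_lipschitz_domain G" and nor: "normal_wrt_x2_axis G"
 shows "\<exists>(N::nat) \<eta> \<eta>' J p q c r s0.
  (\<forall>i t. (\<eta> i has_real_derivative \<eta>' i t) (at t)) \<and> (\<forall>i. continuous_on UNIV (\<eta>' i)) \<and>
  (\<forall>i t. 0 \<le> \<eta> i t \<and> \<eta> i t \<le> (1::real)) \<and> (\<forall>t. (\<Sum>i<N. \<eta> i t) \<le> 1) \<and>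
  (\<forall>x\<in>closure G. (\<Sum>i<N. \<eta> i (fst x)) = 1) \<and>
  (\<forall>i. compact (J i)) \<and> (\<forall>i. \<forall>x\<in>closure G. \<eta> i (fst x) \<noteq> 0 --> fst x \<in> J i) \<and>
  (\<forall>i<N. pushes_inside G (J i) (p i) (q i) (c i) r s0)"
proof -
 obtain a b L K1 K2 where "graph_domain G a b L K1 K2" using graph_domain_exists[OF assms] by blast
 then interpret graph_domain G a b L K1 K2 .
 have loc: "\<exists>dl p q c r s0. dl > 0 \<and> pushes_inside G (cball t dl) p q c r s0" if "t \<in> {a..b}" for t
  using local_push_fat[OF that] local_push_corner[OF lip that] by (cases "K1 t < K2 t") auto
 then obtain D where D: "!!t. t \<in> {a..b} ==> D t > 0"
  "!!t. t \<in> {a..b} ==> \<exists>p q c r s0. pushes_inside G (cball t (D t)) p q c r s0" by metis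
 obtain e where e: "e > 0" "!!T. T \<subseteq> {a..b} ==> diameter T < e ==> \<exists>B\<in>(%t. ball t (D t)) ` {a..b}. T \<subseteq> B"
 proof (rule Lebesgue_number_lemma[of "{a..b}" "(%t. ball t (D t)) ` {a..b}"])
  show "(%t. ball t (D t)) ` {a..b} \<noteq> {}" using ab by simp
  show "{a..b} \<subseteq> \<Union> ((%t. ball t (D t)) ` {a..b})" using D(1) by (auto intro!: bexI)
 qed auto
 define dl where "dl = e / 3"
 have dl: "dl > 0" "2 * dl < e" using e by (auto simp: dl_def)
 define \<tau> where "\<tau> i = a + (real i - 1) * dl" for i :: nat
 have \<tau>S: "\<tau> (Suc i) = \<tau> i + dl" for i by (simp add: \<tau>_def algebra_simps)
 define J where "J i = {\<tau> i..\<tau> i + 2 * dl} \<inter> {a..b}" for i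
 obtain N0 :: nat where N0: "(b - a) / dl < real N0" using reals_Archimedean2 by blast
 define N where "N = Suc N0"
 have \<tau>N: "\<tau> N \<ge> b" using N0 dl by (simp add: \<tau>_def N_def divide_less_eq)
 define k where "k i t = smooth_step ((t - \<tau> i) / dl)" for i t
 define k' where "k' i t = smooth_step' ((t - \<tau> i) / dl) / dl" for i t
 define \<eta> where "\<eta> i t = k i t - k (Suc i) t" for i t
 define \<eta>' where "\<eta>' i t = k' i t - k' (Suc i) t" for i t
 have kd: "(k i has_real_derivative k' i t) (at t)" for i t
 proof -
  have "((%t. (t - \<tau> i) / dl) has_real_derivative 1 / dl) (at t)" using dl by (auto intro!: derivative_eq_intros)
  from DERIV_chain2[OF smooth_step_deriv this] show ?thesis unfolding k_def k'_def by simp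
 qed
 have 1: "(\<eta> i has_real_derivative \<eta>' i t) (at t)" for i t
  unfolding \<eta>_def \<eta>'_def by (rule DERIV_diff[OF kd kd])
 have "continuous_on UNIV (k' i)" for i
  unfolding k'_def using dl(1) by (intro continuous_intros continuous_on_compose2[OF smooth_step'_continuous]) auto
 then have 2: "continuous_on UNIV (\<eta>' i)" for i unfolding \<eta>'_def by (intro continuous_on_diff)
 have kb: "0 \<le> k i t" "k i t \<le> 1" "k (Suc i) t \<le> k i t" for i t
  using dl(1) by (auto simp: k_def smooth_step_bounds \<tau>S intro!: smooth_step_mono divide_right_mono)
 have 3: "0 \<le> \<eta> i t \<and> \<eta> i t \<le> 1" for i t using kb[of i t] kb[of "Suc i" t] by (simp add: \<eta>_def)
 have tel: "(\<Sum>i<N. \<eta> i t) = k 0 t - k N t" for t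
  unfolding \<eta>_def by (rule sum_lessThan_telescope')
 have 4: "(\<Sum>i<N. \<eta> i t) \<le> 1" for t using kb[of 0 t] kb[of N t] by (simp add: tel)
 have 5: "(\<Sum>i<N. \<eta> i (fst x)) = 1" if x: "x \<in> closure G" for x
 proof -
  have t: "a \<le> fst x" "fst x \<le> b" using closure_bounds(1)[OF x] by auto
  have "k 0 (fst x) = 1" unfolding k_def using t dl(1) by (intro smooth_step_1) (simp add: \<tau>_def le_divide_eq)
  moreover have "k N (fst x) = 0" unfolding k_def using t \<tau>N dl(1) by (intro smooth_step_0) (simp add: divide_le_0_iff)
  ultimately show ?thesis by (simp add: tel)
 qed
 have 6: "compact (J i)" for i unfolding J_def by (intro compact_Int) auto
 have 7: "fst x \<in> J i" if x: "x \<in> closure G" and n: "\<eta> i (fst x) \<noteq> 0" for x i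
 proof (rule ccontr)
  assume "fst x \<notin> J i"
  then consider "fst x \<le> \<tau> i" | "fst x \<ge> \<tau> i + 2 * dl" using closure_bounds(1)[OF x] unfolding J_def by force
  then show False
  proof cases
   case 1
   then have "(fst x - \<tau> i) / dl \<le> 0" "(fst x - \<tau> (Suc i)) / dl \<le> 0" using dl(1) by (auto simp: \<tau>S divide_le_0_iff)
   then show False using n by (simp add: \<eta>_def k_def smooth_step_0)
  next
   case 2
   then have "(fst x - \<tau> i) / dl \<ge> 1" "(fst x - \<tau> (Suc i)) / dl \<ge> 1" using dl(1) by (auto simp: \<tau>S le_divide_eq)
   then show False using n by (simp add: \<eta>_def k_def smooth_step_1)
  qed
 qed
 have "\<exists>p q c r s0. pushes_inside G (J i) p q c r s0" for i
 proof -
  have "diameter (J i) \<le> 2 * dl" by (rule diameter_le) (use dl(1) in "auto simp: J_def")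
  then have "diameter (J i) < e" using dl(2) by simp
  moreover have "J i \<subseteq> {a..b}" by (simp add: J_def)
  ultimately obtain t where t: "t \<in> {a..b}" "J i \<subseteq> ball t (D t)" using e(2) by blast
  obtain p q c r s0 where "pushes_inside G (cball t (D t)) p q c r s0" using D(2)[OF t(1)] by blast
  moreover have "J i \<subseteq> cball t (D t)" using t(2) ball_subset_cball by blast
  ultimately have "pushes_inside G (J i) p q c r s0" unfolding pushes_inside_def by blast
  then show ?thesis by blast
 qed
 then have "\<exists>p q c r s0. \<forall>i. pushes_inside G (J i) (p i) (q i) (c i) (r i) (s0 i)" by metis
 then obtain p q c R S0 where pi: "!!i. pushes_inside G (J i) (p i) (q i) (c i) (R i) (S0 i)" by blast
 define r where "r = Min (R ` {..<N})"
 define s0 where "s0 = Min (S0 ` {..<N})"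
 have fin: "finite (R ` {..<N})" "R ` {..<N} \<noteq> {}" "finite (S0 ` {..<N})" "S0 ` {..<N} \<noteq> {}" by (auto simp: N_def)
 have rpos: "r > 0" "s0 > 0"
  using Min_in[OF fin(1,2)] Min_in[OF fin(3,4)] pi unfolding r_def s0_def pushes_inside_def by fastforce+
 have le: "r \<le> R i" "s0 \<le> S0 i" if "i < N" for i using fin that by (auto simp: r_def s0_def intro!: Min_le)
 have 8: "pushes_inside G (J i) (p i) (q i) (c i) r s0" if i: "i < N" for i
  unfolding pushes_inside_def
 proof (intro conjI allI impI)
  show "c i \<ge> 0" using pi[of i] by (simp add: pushes_inside_def)
  then have "s0 * c i \<le> S0 i * c i" using le[OF i] by (intro mult_right_mono)
  then show "s0 * c i \<le> 1/2" using pi[of i] by (simp add: pushes_inside_def)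
  fix s y assume sy: "0 < s" "s < s0" "y \<in> closure G" "fst y \<in> J i"
  have "r * s \<le> R i * s" using le(1)[OF i] sy(1) by (intro mult_right_mono) auto
  then have "cball (push (p i) (q i) (c i) s y) (r * s) \<subseteq> cball (push (p i) (q i) (c i) s y) (R i * s)" by (rule subset_cball)
  also have "... \<subseteq> G" using pi[of i] sy le(2)[OF i] unfolding pushes_inside_def by auto
  finally show "cball (push (p i) (q i) (c i) s y) (r * s) \<subseteq> G" .
 qed (use rpos in auto)
 show ?thesis
  by (rule exI[of _ N], rule exI[of _ \<eta>], rule exI[of _ \<eta>'], rule exI[of _ J], rule exI[of _ p], rule exI[of _ q],
    rule exI[of _ c], rule exI[of _ r], rule exI[of _ s0]) (use 1 2 3 4 5 6 7 8 in blast)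
qed

section \<open>Convergence in the mean\<close>

definition L1_tendsto :: "(nat => plane => real) => (plane => real) => bool" where
 "L1_tendsto f g \<longleftrightarrow> (\<forall>n. integrable lborel (f n)) \<and> integrable lborel g \<and> (%n. \<integral>x. \<bar>f n x - g x\<bar> \<partial>lborel) \<longlonglongrightarrow> 0"

lemma L1_tendstoI:
 assumes "!!n. integrable lborel (f n)" and "integrable lborel g"
  and "!!n. (LBINT x. \<bar>f n x - g x\<bar>) \<le> h n" and "h \<longlonglongrightarrow> 0"
 shows "L1_tendsto f g"
proof -
 have "(%n. \<integral>x. \<bar>f n x - g x\<bar> \<partial>lborel) \<longlonglongrightarrow> 0"
  by (rule tendsto_sandwich[OF always_eventually always_eventually tendsto_const assms(4)])
    (use assms(3) in "simp_all only: integral_nonneg abs_ge_zero simp_thms")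
 then show ?thesis using assms(1,2) unfolding L1_tendsto_def by blast
qed

lemma L1_tendsto_add:
 assumes "L1_tendsto f g" and "L1_tendsto f' g'"
 shows "L1_tendsto (%n x. f n x + f' n x) (%x. g x + g' x)"
proof (rule L1_tendstoI)
 have i: "integrable lborel (f n)" "integrable lborel (f' n)" "integrable lborel g" "integrable lborel g'" for n
  using assms unfolding L1_tendsto_def by auto
 show "integrable lborel (%x. f n x + f' n x)" "integrable lborel (%x. g x + g' x)" for n using i by auto
 show "(%n. (LBINT x. \<bar>f n x - g x\<bar>) + (LBINT x. \<bar>f' n x - g' x\<bar>)) \<longlonglongrightarrow> 0"
  using tendsto_add[of "%n. \<integral>x. \<bar>f n x - g x\<bar> \<partial>lborel" 0 sequentially "%n. \<integral>x. \<bar>f' n x - g' x\<bar> \<partial>lborel" 0] assms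
  unfolding L1_tendsto_def by simp
 show "(LBINT x. \<bar>f n x + f' n x - (g x + g' x)\<bar>) \<le> (LBINT x. \<bar>f n x - g x\<bar>) + (LBINT x. \<bar>f' n x - g' x\<bar>)" for n
 proof -
  have "(LBINT x. \<bar>f n x + f' n x - (g x + g' x)\<bar>) \<le> (LBINT x. \<bar>f n x - g x\<bar> + abs (f' n x - g' x))"
   by (rule integral_mono) (use i in auto)
  then show ?thesis using i by simp
 qed
qed

lemma L1_tendsto_zero: "L1_tendsto (%n x. 0) (%x. 0)"
 by (simp add: L1_tendsto_def)

lemma L1_tendsto_sum:
 assumes "!!i. i \<in> I ==> L1_tendsto (f i) (g i)"
 shows "L1_tendsto (%n x. \<Sum>i\<in>I. f i n x) (%x. \<Sum>i\<in>I. g i x)"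
 using assms
proof (induction I rule: infinite_finite_induct)
 case (insert i I)
 have "L1_tendsto (%n x. f i n x + (\<Sum>i\<in>I. f i n x)) (%x. g i x + (\<Sum>i\<in>I. g i x))"
  by (rule L1_tendsto_add) (use insert in auto)
 then show ?case using insert by simp
qed (simp_all add: L1_tendsto_zero)

lemma L1_tendsto_scale:
 assumes f: "L1_tendsto f g" and a: "a \<longlonglongrightarrow> 1"
 shows "L1_tendsto (%n x. a n * f n x) g"
proof (rule L1_tendstoI)
 have i: "integrable lborel (f n)" "integrable lborel g" for n using f unfolding L1_tendsto_def by auto
 show "integrable lborel (%x. a n * f n x)" "integrable lborel g" for n using i by auto
 let ?d = "%n. \<integral>x. \<bar>f n x - g x\<bar> \<partial>lborel"
 have d: "?d \<longlonglongrightarrow> 0" using f unfolding L1_tendsto_def by blast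
 have "(%n. \<bar>a n\<bar> * ?d n + abs (a n - 1) * (LBINT x. \<bar>g x\<bar>)) \<longlonglongrightarrow> \<bar>1\<bar> * 0 + abs (1 - 1) * (LBINT x. \<bar>g x\<bar>)"
  by (intro tendsto_intros a d)
 then show "(%n. \<bar>a n\<bar> * ?d n + abs (a n - 1) * (LBINT x. \<bar>g x\<bar>)) \<longlonglongrightarrow> 0" by simp
 show "(LBINT x. \<bar>a n * f n x - g x\<bar>) \<le> abs (a n) * ?d n + abs (a n - 1) * (LBINT x. \<bar>g x\<bar>)" for n
 proof -
  have "(LBINT x. \<bar>a n * f n x - g x\<bar>) \<le> (LBINT x. \<bar>a n\<bar> * abs (f n x - g x) + abs (a n - 1) * abs (g x))"
  proof (rule integral_mono)
   fix x
   have "a n * f n x - g x = a n * (f n x - g x) + (a n - 1) * g x" by (simp add: algebra_simps)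
   then show "\<bar>a n * f n x - g x\<bar> \<le> abs (a n) * abs (f n x - g x) + abs (a n - 1) * abs (g x)"
    by (metis abs_mult abs_triangle_ineq)
  qed (use i in auto)
  then show ?thesis using i by simp
 qed
qed

text \<open>A version of dominated convergence in which the majorants converge in the mean. The
 conclusion is drawn along an almost everywhere convergent subsequence.\<close>

lemma L1_majorant_limsup:
 fixes F :: "real => real" and f :: "nat => 'a => real"
 assumes F: "continuous_on UNIV F" "!!t. F t \<ge> 0"
  and f: "!!n. integrable M (f n)" "integrable M g" "(%n. \<integral>x. \<bar>f n x - g x\<bar> \<partial>M) \<longlonglongrightarrow> 0"
  and D: "!!n. integrable M (D n)" "integrable M D0" "(%n. \<integral>x. \<bar>D n x - D0 x\<bar> \<partial>M) \<longlonglongrightarrow> 0"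
  and le: "!!n. AE x in M. F (f n x) \<le> D n x" and Fg: "integrable M (%x. F (g x))"
  and e: "eps > 0"
 shows "\<exists>n\<ge>n0. (LINT x|M. F (f n x)) \<le> (LINT x|M. F (g x)) + eps"
proof -
 have Fm [measurable]: "F \<in> borel_measurable borel" using F(1) by (rule borel_measurable_continuous_onI)
 have [measurable]: "f n \<in> borel_measurable M" "g \<in> borel_measurable M" "D n \<in> borel_measurable M" "D0 \<in> borel_measurable M" for n
  using f D by auto
 have "(%n. \<integral>x. norm (f n x - g x) \<partial>M) \<longlonglongrightarrow> 0" using f(3) by simp
 then obtain r where r: "strict_mono (r :: nat => nat)" "AE x in M. (%n. f (r n) x - g x) \<longlonglongrightarrow> 0"
  using tendsto_L1_AE_subseq[of M "%n x. f n x - g x"] f by auto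
 let ?h = "%n x. min (F (f (r n) x)) \<bar>D0 x\<bar>"
 have "(%n. \<integral>x. ?h n x \<partial>M) \<longlonglongrightarrow> (LINT x|M. min (F (g x)) \<bar>D0 x\<bar>)"
 proof (rule integral_dominated_convergence[where w="%x. \<bar>D0 x\<bar>"])
  show "AE x in M. (%n. ?h n x) \<longlonglongrightarrow> min (F (g x)) \<bar>D0 x\<bar>"
   using r(2)
  proof eventually_elim
   case (elim x)
   then have "(%n. f (r n) x) \<longlonglongrightarrow> g x" by (rule LIM_zero_cancel)
   then have "(%n. F (f (r n) x)) \<longlonglongrightarrow> F (g x)"
    by (rule continuous_on_tendsto_compose[OF F(1)]) auto
   then show ?case by (intro tendsto_min tendsto_const)
  qed
  show "AE x in M. norm (?h n x) \<le> abs (D0 x)" for n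
   using F(2) by (auto simp: min_def)
 qed (use D in auto)
 moreover have "(%n. \<integral>x. \<bar>D (r n) x - D0 x\<bar> \<partial>M) \<longlonglongrightarrow> 0"
  using LIMSEQ_subseq_LIMSEQ[OF D(3) r(1)] by (simp add: o_def)
 ultimately have l: "(%n. (LINT x|M. ?h n x) + (LINT x|M. \<bar>D (r n) x - D0 x\<bar>)) \<longlonglongrightarrow> (LINT x|M. min (F (g x)) \<bar>D0 x\<bar>) + 0"
  by (rule tendsto_add)
 have le0: "(LINT x|M. min (F (g x)) \<bar>D0 x\<bar>) \<le> (LINT x|M. F (g x))"
 proof (rule integral_mono[OF _ Fg])
  show "integrable M (%x. min (F (g x)) \<bar>D0 x\<bar>)"
   by (rule integrable_bound[OF Fg]) (use F(2) in "auto simp: min_def")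
 qed simp
 have "\<forall>\<^sub>F n in sequentially. (LINT x|M. ?h n x) + (LINT x|M. \<bar>D (r n) x - D0 x\<bar>) < (LINT x|M. F (g x)) + eps"
  using l le0 e by (intro order_tendstoD(2)[OF l]) simp
 then obtain n1 where n1: "!!n. n \<ge> n1 ==> (LINT x|M. ?h n x) + (LINT x|M. \<bar>D (r n) x - D0 x\<bar>) < (LINT x|M. F (g x)) + eps"
  unfolding eventually_sequentially by blast
 define n where "n = max n0 n1"
 have rn: "r n \<ge> n0" using seq_suble[OF r(1), of n] by (simp add: n_def)
 have "(LINT x|M. F (f (r n) x)) \<le> (LINT x|M. ?h n x + \<bar>D (r n) x - D0 x\<bar>)"
 proof (rule integral_mono_AE)
  show "integrable M (%x. F (f (r n) x))"
  proof (rule integrable_bound[OF D(1)[of "r n"]])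
   show "AE x in M. norm (F (f (r n) x)) \<le> norm (D (r n) x)" using le[of "r n"] by eventually_elim (use F(2) in auto)
  qed measurable
  have "integrable M (?h n)"
   by (rule integrable_bound[OF D(2)]) (use F(2) in "auto simp: min_def")
  then show "integrable M (%x. ?h n x + \<bar>D (r n) x - D0 x\<bar>)" using D by auto
  show "AE x in M. F (f (r n) x) \<le> ?h n x + \<bar>D (r n) x - D0 x\<bar>"
   using le[of "r n"] by eventually_elim (auto simp: min_def)
 qed
 also have "... = (LINT x|M. ?h n x) + (LINT x|M. \<bar>D (r n) x - D0 x\<bar>)"
 proof (rule integral_add)
  show "integrable M (?h n)"
   by (rule integrable_bound[OF D(2)]) (use F(2) in "auto simp: min_def")
 qed (use D in auto)
 also have "... \<le> (LINT x|M. F (g x)) + eps" using n1[of n] by (simp add: n_def)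
 finally show ?thesis using rn by blast
qed

context linear_growth_integrand begin

lemma recession_add: "recession f1 (s + t) \<le> recession f1 s + recession f1 t"
proof -
 have n: "recession f1 1 \<ge> 0" "recession f1 (-1) \<ge> 0" by (rule recession_nonneg)+
 have "recession f1 1 * max 0 (s + t) \<le> recession f1 1 * (max 0 s + max 0 t)" using n by (intro mult_left_mono) auto
 moreover have "recession f1 (-1) * max 0 (- (s + t)) \<le> recession f1 (-1) * (max 0 (- s) + max 0 (- t))" using n by (intro mult_left_mono) auto
 ultimately show ?thesis unfolding recession_eq[of "s + t"] recession_eq[of s] recession_eq[of t] by (simp add: algebra_simps)
qed

lemma recession_sum_le:
 assumes "!!k. k \<in> I ==> m k \<ge> 0"
 shows "recession f1 (\<Sum>k\<in>I. m k * sg k) \<le> (\<Sum>k\<in>I. m k * recession f1 (sg k))"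
 using assms
proof (induction I rule: infinite_finite_induct)
 case (insert k I)
 have "recession f1 (m k * sg k) = m k * recession f1 (sg k)"
  using insert.prems[of k] recession_scale[of "m k" "sg k"] recession_zero by (cases "m k = 0") auto
 then show ?case using insert recession_add[of "m k * sg k" "\<Sum>k\<in>I. m k * sg k"] by fastforce
qed (simp_all add: recession_zero)

lemma f1_integrable:
 assumes "finite_measure M" and g: "integrable M g"
 shows "integrable M (%x. f1 (g x))"
proof -
 interpret finite_measure M by fact
 have [measurable]: "f1 \<in> borel_measurable borel" using f1_cont by (rule borel_measurable_continuous_onI)
 have [measurable]: "g \<in> borel_measurable M" using g by auto
 show ?thesis
 proof (rule integrable_abs_le)
  show "integrable M (%x. a3 * abs (g x) + abs (f1 0))" using g by auto
  show "\<bar>f1 (g x)\<bar> \<le> a3 * abs (g x) + abs (f1 0)" for x using f1_lipschitz[of "g x" 0] by simp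
 qed simp
qed

end

context delta2_N_function begin

text \<open>Jensen's inequality for a total weight of at most \<open>C\<close> instead of one: integrate the tangent of
 \<open>A\<close> at the weighted integral.\<close>

lemma A_jensen:
 assumes W: "integrable M W" "!!y. W y \<ge> 0" "(LINT y|M. W y) \<le> C" and C: "C > 0"
  and g: "integrable M (%y. W y * g y)" "!!y. g y \<ge> 0" and Ag: "integrable M (%y. W y * A (C * g y))"
 shows "A (LINT y|M. W y * g y) \<le> (1 / C) * (LINT y|M. W y * A (C * g y))"
proof -
 define t where "t = (LINT y|M. W y * g y)"
 have t: "t \<ge> 0" unfolding t_def using W g by (intro integral_nonneg) simp
 have "(LINT y|M. W y * (A t - A' t * t) + (A' t * C) * (W y * g y)) \<le> (LINT y|M. W y * A (C * g y))"
 proof (rule integral_mono)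
  show "integrable M (%y. W y * (A t - A' t * t) + (A' t * C) * (W y * g y))" using W g by auto
  fix y
  have "A t + A' t * (C * g y - t) \<le> A (C * g y)" using C g(2)[of y] t by (intro A_tangent) auto
  then have "W y * (A t + A' t * (C * g y - t)) \<le> W y * A (C * g y)" using W(2) by (rule mult_left_mono)
  then show "W y * (A t - A' t * t) + (A' t * C) * (W y * g y) \<le> W y * A (C * g y)" by (simp add: algebra_simps)
 qed (use Ag in auto)
 then have 1: "(LINT y|M. W y) * (A t - A' t * t) + A' t * C * t \<le> (LINT y|M. W y * A (C * g y))"
  using W g by (simp add: t_def)
 have "A t - A' t * t \<le> 0" using A_tangent[OF t, of 0] A_zero by simp
 then have "C * (A t - A' t * t) \<le> (LINT y|M. W y) * (A t - A' t * t)" using W(3) by (rule mult_right_mono_neg[rotated])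
 with 1 have "C * A t \<le> (LINT y|M. W y * A (C * g y))" by (simp add: algebra_simps)
 then show ?thesis using C by (simp add: t_def field_simps)
qed

end

section \<open>Smooth competitors of almost the same energy\<close>

text \<open>The weights \<open>\<eta> i\<close> are functions of the first coordinate and sum to one on the closure; the
 \<open>i\<close>-th piece is moved by its own push.\<close>

locale pushed_partition =
 fixes G :: "plane set" and N :: nat and \<eta> \<eta>' :: "nat => real => real" and J :: "nat => real set"
  and p q c :: "nat => real" and r s0 :: real
 assumes op: "open G" and bd: "bounded G"
  and \<eta>_deriv: "!!i t. (\<eta> i has_real_derivative \<eta>' i t) (at t)" and \<eta>'_cont: "!!i. continuous_on UNIV (\<eta>' i)"
  and \<eta>_bounds: "!!i t. 0 \<le> \<eta> i t" "!!i t. \<eta> i t \<le> 1" and \<eta>_sum_le: "!!t. (\<Sum>i<N. \<eta> i t) \<le> 1"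
  and \<eta>_sum: "!!x. x \<in> closure G ==> (\<Sum>i<N. \<eta> i (fst x)) = 1"
  and J: "!!i. compact (J i)" and \<eta>_J: "!!i x. x \<in> closure G ==> \<eta> i (fst x) \<noteq> 0 ==> fst x \<in> J i"
  and push: "!!i. i < N ==> pushes_inside G (J i) (p i) (q i) (c i) r s0"
  and rs0: "r > 0" "s0 > 0"
begin

abbreviation T :: "real => nat => plane => plane" where "T s i \<equiv> push (p i) (q i) (c i) s"

lemma c_nonneg: "i < N ==> c i \<ge> 0" and sc: "i < N ==> 0 < s ==> s < s0 ==> s * c i \<le> 1 / 2"
proof -
 assume i: "i < N"
 show c: "c i \<ge> 0" using push[OF i] by (simp add: pushes_inside_def)
 assume "0 < s" "s < s0"
 then have "s * c i \<le> s0 * c i" using c by (intro mult_right_mono) auto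
 then show "s * c i \<le> 1 / 2" using push[OF i] by (simp add: pushes_inside_def)
qed

lemma \<eta>_cont: "continuous_on UNIV (\<eta> i)"
 using \<eta>_deriv DERIV_isCont continuous_at_imp_continuous_on by blast

lemma \<eta>_measurable [measurable]: "(%y. \<eta> i (fst y)) \<in> borel_measurable (borel :: plane measure)"
 by (intro borel_measurable_continuous_onI continuous_on_compose2[OF \<eta>_cont]) (auto intro: continuous_intros)

lemma \<eta>'_measurable [measurable]: "(%y. \<eta>' i (fst y)) \<in> borel_measurable (borel :: plane measure)"
 by (intro borel_measurable_continuous_onI continuous_on_compose2[OF \<eta>'_cont]) (auto intro: continuous_intros)

lemma G_borel: "G \<in> sets borel" using op by simp

lemma \<eta>'_sum: assumes "x \<in> G" shows "(\<Sum>i<N. \<eta>' i (fst x)) = 0"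
proof -
 have "((%t. \<Sum>i<N. \<eta> i t) has_real_derivative (\<Sum>i<N. \<eta>' i (fst x))) (at (fst x))"
  by (intro DERIV_sum \<eta>_deriv)
 moreover have "((%t. \<Sum>i<N. \<eta> i t) has_real_derivative 0) (at (fst x))"
 proof (rule has_field_derivative_transform_within_open[of "%_. 1"])
  show "open (fst ` G)" using op by (rule open_image_fst)
  show "fst x \<in> fst ` G" using assms by simp
  fix t assume "t \<in> fst ` G"
  then obtain y where "y \<in> G" "t = fst y" by blast
  then show "1 = (\<Sum>i<N. \<eta> i t)" using \<eta>_sum[of y] closure_subset[of G] by auto
 qed simp
 ultimately show ?thesis by (rule DERIV_unique)
qed

lemma bounded_weight_integrable:
 fixes g :: "plane => real"
 assumes w: "(%y. w (fst y)) \<in> borel_measurable (borel :: plane measure)" "continuous_on UNIV w"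
  and g: "integrable lborel g" "!!x. x \<notin> G ==> g x = 0"
 shows "integrable lborel (%y. w (fst y) * g y)"
proof -
 have "compact (w ` closure (fst ` G))"
  using w(2) bounded_fst[OF bd] by (intro compact_continuous_image) (auto intro: continuous_on_subset simp: compact_closure)
 then obtain C where C: "\<forall>y\<in>w ` closure (fst ` G). norm y \<le> C" by (meson compact_imp_bounded bounded_iff)
 have Cx: "\<bar>w (fst x)\<bar> * abs (g x) \<le> C * abs (g x)" for x
 proof (cases "x \<in> G")
  case True
  then have "fst x \<in> closure (fst ` G)" using closure_subset[of "fst ` G"] by blast
  then show ?thesis using C by (intro mult_right_mono) auto
 qed (simp add: g)
 show ?thesis
  by (rule integrable_abs_le[of _ "%x. C * abs (g x)"]) (use w(1) g(1) Cx in "auto simp: abs_mult")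
qed

lemmas \<eta>_integrable = bounded_weight_integrable[OF \<eta>_measurable \<eta>_cont]
lemmas \<eta>'_integrable = bounded_weight_integrable[OF \<eta>'_measurable \<eta>'_cont]

text \<open>In \<open>y\<close>, the weighted kernel is an admissible \<open>C\<^sup>1\<close> test function.\<close>

lemma kernel_C1:
 assumes k: "k \<in> test_functions UNIV"
 shows "C_k (Suc 0) (%y. \<eta> i (fst y) * k (x - T s i y))" (is "C_k _ ?ps")
  and "partial_deriv e1 (%y. \<eta> i (fst y) * k (x - T s i y)) y = \<eta>' i (fst y) * k (x - T s i y) - \<eta> i (fst y) * partial_deriv e1 k (x - T s i y)"
  and "partial_deriv e2 (%y. \<eta> i (fst y) * k (x - T s i y)) y = - ((1 - s * c i) * (\<eta> i (fst y) * partial_deriv e2 k (x - T s i y)))"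
proof -
 have ck: "C_k (Suc 0) k" using k by (simp add: test_functions_UNIV_iff)
 let ?z = "%y. x - T s i y"
 let ?d1 = "%y. \<eta>' i (fst y) * k (?z y) - \<eta> i (fst y) * partial_deriv e1 k (?z y)"
 let ?d2 = "%y. - ((1 - s * c i) * (\<eta> i (fst y) * partial_deriv e2 k (?z y)))"
 have d: "(?ps has_derivative (%h. fst h * ?d1 y + snd h * ?d2 y)) (at y)" for y
 proof -
  have z: "(?z has_derivative (%h. (- fst h, - ((1 - s * c i) * snd h)))) (at y)"
  proof -
   have "?z = (%y. (fst x - (fst y + s * p i), snd x - (snd y + s * (q i - c i * snd y))))"
    by (auto simp: push_def fun_eq_iff minus_prod_def)
   moreover have "((%y. (fst x - (fst y + s * p i), snd x - (snd y + s * (q i - c i * snd y)))) has_derivative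
     (%h. (- fst h, - ((1 - s * c i) * snd h)))) (at y)"
    by (auto intro!: derivative_eq_intros simp: algebra_simps)
   ultimately show ?thesis by simp
  qed
  have kz: "((%y. k (?z y)) has_derivative (%h. - fst h * partial_deriv e1 k (?z y) - (1 - s * c i) * snd h * partial_deriv e2 k (?z y))) (at y)"
   using has_derivative_compose[OF z C_k_has_derivative[OF ck]] by simp
  have e: "((%y. \<eta> i (fst y)) has_derivative (%h. \<eta>' i (fst y) * fst h)) (at y)"
   using has_derivative_compose[OF has_derivative_fst[OF has_derivative_ident], of "\<eta> i" "(*) (\<eta>' i (fst y))" y UNIV]
    \<eta>_deriv[of i "fst y"] by (simp add: has_field_derivative_def)
  show ?thesis using has_derivative_mult[OF e kz] by (simp add: algebra_simps)
 qed
 have Tc: "continuous_on UNIV ?z" unfolding push_def by (intro continuous_intros)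
 have cc: "continuous_on UNIV (%y. h (?z y))" if "continuous_on UNIV h" for h :: "plane => real"
  by (rule continuous_on_compose2[OF that Tc]) simp
 have ce: "continuous_on UNIV (%y::plane. \<eta> i (fst y))" "continuous_on UNIV (%y::plane. \<eta>' i (fst y))"
  by (intro continuous_on_compose2[OF \<eta>_cont] continuous_on_compose2[OF \<eta>'_cont] continuous_intros; simp)+
 have kc: "continuous_on UNIV k" "continuous_on UNIV (partial_deriv e1 k)" "continuous_on UNIV (partial_deriv e2 k)"
  using C_k_continuous[OF ck] ck by (blast, simp_all)
 show "C_k (Suc 0) ?ps"
 proof (rule C_k_SucI[OF d])
  show "C_k 0 ?d1" unfolding C_k.simps by (intro continuous_intros cc ce kc)
  show "C_k 0 ?d2" unfolding C_k.simps by (intro continuous_intros cc ce kc)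
 qed
 show "partial_deriv e1 ?ps y = ?d1 y" using partial_deriv_eq[OF d, of e1 y] by simp
 show "partial_deriv e2 ?ps y = ?d2 y" using partial_deriv_eq[OF d, of e2 y] by simp
qed

text \<open>The competitor: every weighted piece is pushed and mollified at a scale proportional to the size of the
 push.\<close>

definition comp :: "(plane => real) => real => plane => real" where
 "comp U s x = (\<Sum>i<N. smear lborel (T s i) (%y. \<eta> i (fst y) * U y) (mollifier (r * s)) x)"

text \<open>The support lies in the image of the closure under the pushes, enlarged by the radius of the mollifier, which is
 a compact subset of \<open>G\<close>.\<close>

lemma comp_test:
 assumes U: "integrable lborel U" "!!x. x \<notin> G ==> U x = 0" and s: "0 < s" "s < s0"
 shows "comp U s \<in> test_functions G"
proof -
 have e: "r * s > 0" using rs0 s by simp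
 have ck: "C_k k (comp U s)" for k
  unfolding comp_def[abs_def]
  by (intro C_k_sum smear_C_k mollifier_test[OF e] \<eta>_integrable[OF U]) simp
 define B where "B i = {z + w | z w. z \<in> T s i ` (closure G \<inter> fst -` J i) \<and> w \<in> cball 0 (r * s)}" for i
 have cB: "compact (B i)" for i
 proof -
  have "compact (closure G \<inter> fst -` J i)"
   using bd J[of i] by (intro compact_Int_closed closed_vimage) (auto simp: compact_closure compact_imp_closed intro: continuous_intros)
  moreover have "continuous_on (closure G \<inter> fst -` J i) (T s i)" unfolding push_def by (intro continuous_intros)
  ultimately have "compact (T s i ` (closure G \<inter> fst -` J i))" by (rule compact_continuous_image[rotated])
  then show ?thesis unfolding B_def by (intro compact_sums) auto
 qed
 have BO: "B i \<subseteq> G" if i: "i < N" for i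
 proof
  fix x assume "x \<in> B i"
  then obtain z w where zw: "x = z + w" "z \<in> T s i ` (closure G \<inter> fst -` J i)" "w \<in> cball 0 (r * s)"
   unfolding B_def by blast
  then obtain y where "z = T s i y" "y \<in> closure G" "fst y \<in> J i" by blast
  then have yw: "x = T s i y + w" "y \<in> closure G" "fst y \<in> J i" "norm w \<le> r * s" using zw by simp_all
  then have "x \<in> cball (T s i y) (r * s)" by (simp add: dist_norm)
  then show "x \<in> G" using push[OF i] s yw unfolding pushes_inside_def by blast
 qed
 have sub: "{x. comp U s x \<noteq> 0} \<subseteq> (\<Union>i<N. B i)"
 proof
  fix x assume "x \<in> {x. comp U s x \<noteq> 0}"
  then have "comp U s x \<noteq> 0" by simp
  have "\<exists>i<N. smear lborel (T s i) (%y. \<eta> i (fst y) * U y) (mollifier (r * s)) x \<noteq> 0"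
  proof (rule ccontr)
   assume "\<not> ?thesis"
   then have "comp U s x = 0" unfolding comp_def by (intro sum.neutral) blast
   with \<open>comp U s x \<noteq> 0\<close> show False by blast
  qed
  then obtain i where i: "i < N" "smear lborel (T s i) (%y. \<eta> i (fst y) * U y) (mollifier (r * s)) x \<noteq> 0"
   by blast
  have "\<exists>y. mollifier (r * s) (x - T s i y) * (\<eta> i (fst y) * U y) \<noteq> 0"
  proof (rule ccontr)
   assume "\<nexists>y. mollifier (r * s) (x - T s i y) * (\<eta> i (fst y) * U y) \<noteq> 0"
   then have z: "mollifier (r * s) (x - T s i y) * (\<eta> i (fst y) * U y) = 0" for y by blast
   have "smear lborel (T s i) (%y. \<eta> i (fst y) * U y) (mollifier (r * s)) x = 0"
    unfolding smear_def by (subst z) (rule integral_zero)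
   then show False using i(2) by (rule notE[rotated])
  qed
  then obtain y where y0: "mollifier (r * s) (x - T s i y) * (\<eta> i (fst y) * U y) \<noteq> 0" by (rule exE)
  have y: "mollifier (r * s) (x - T s i y) \<noteq> 0" "\<eta> i (fst y) \<noteq> 0" "U y \<noteq> 0"
   using y0 unfolding mult_eq_0_iff de_Morgan_disj by (rule conjunct1 conjunct1[OF conjunct2] conjunct2[OF conjunct2])+
  have n: "norm (x - T s i y) < r * s" by (rule mollifier_supp[OF e y(1)])
  have "y \<in> G" using y(3) U(2) by blast
  then have yc: "y \<in> closure G" using closure_subset by blast
  have "x = T s i y + (x - T s i y)" by simp
  moreover have "T s i y \<in> T s i ` (closure G \<inter> fst -` J i)" using yc \<eta>_J[OF yc y(2)] by blast
  moreover have "x - T s i y \<in> cball 0 (r * s)" using n by simp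
  ultimately have "x \<in> B i" unfolding B_def by blast
  then show "x \<in> (\<Union>i<N. B i)" using i(1) by blast
 qed
 have cU: "compact (\<Union>i<N. B i)" using cB by (intro compact_UN) auto
 have cl: "closure {x. comp U s x \<noteq> 0} \<subseteq> (\<Union>i<N. B i)" by (rule closure_minimal[OF sub compact_imp_closed[OF cU]])
 moreover have "compact (closure {x. comp U s x \<noteq> 0})"
  using cl cU by (meson bounded_subset closed_closure compact_eq_bounded_closed)
 moreover have "(\<Union>i<N. B i) \<subseteq> G" using BO by blast
 ultimately show ?thesis using ck unfolding test_functions_def by blast
qed

text \<open>The first derivative of the competitor is the smeared derivative up to a term with the derivatives
 of the weights; the second derivative is the smeared second derivative.\<close>

lemma comp_partial1:
 assumes U: "integrable lborel U" "!!x. x \<notin> G ==> U x = 0" and \<rho>: "integrable lborel \<rho>" "!!x. x \<notin> G ==> \<rho> x = 0"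
  and D1: "!!\<phi>. C_k (Suc 0) \<phi> ==> (LBINT x. U x * partial_deriv e1 \<phi> x)
    = - ((LBINT x. \<phi> x * \<rho> x) + (\<Sum>k\<in>I. sg k * (LINT x|M k. \<phi> x)))"
  and s: "0 < s" "s < s0"
 shows "partial_deriv e1 (comp U s) x = (\<Sum>i<N. smear lborel (T s i) (%y. \<eta>' i (fst y) * U y) (mollifier (r * s)) x)
  + (\<Sum>i<N. smear lborel (T s i) (%y. \<eta> i (fst y) * \<rho> y) (mollifier (r * s)) x)
  + (\<Sum>k\<in>I. (\<Sum>i<N. smear (M k) (T s i) (%y. \<eta> i (fst y)) (mollifier (r * s)) x) * sg k)"
proof -
 have e: "r * s > 0" using rs0 s by simp
 let ?k = "mollifier (r * s)"
 have k: "?k \<in> test_functions UNIV" by (rule mollifier_test[OF e])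
 have pk: "partial_deriv e1 ?k \<in> test_functions UNIV" using test_partial[OF k] by blast
 have Tm: "T s i \<in> borel_measurable lborel" for i by simp
 have i1: "integrable lborel (%y. partial_deriv e1 ?k (x - T s i y) * (\<eta> i (fst y) * U y))" for i
  using pk C_k_continuous by (intro smear_integrable Tm \<eta>_integrable[OF U]) (auto simp: test_functions_UNIV_iff)
 have i2: "integrable lborel (%y. ?k (x - T s i y) * (\<eta>' i (fst y) * U y))" for i
  by (intro smear_mollifier_kernel_integrable[OF e Tm] \<eta>'_integrable[OF U])
 have part: "smear lborel (T s i) (%y. \<eta> i (fst y) * U y) (partial_deriv e1 ?k) x
  = smear lborel (T s i) (%y. \<eta>' i (fst y) * U y) ?k x + smear lborel (T s i) (%y. \<eta> i (fst y) * \<rho> y) ?k x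
   + (\<Sum>k\<in>I. sg k * smear (M k) (T s i) (%y. \<eta> i (fst y)) ?k x)" for i
 proof -
  let ?ps = "%y. \<eta> i (fst y) * ?k (x - T s i y)"
  have "(LBINT y. U y * partial_deriv e1 ?ps y)
   = (LBINT y. ?k (x - T s i y) * (\<eta>' i (fst y) * U y) - partial_deriv e1 ?k (x - T s i y) * (\<eta> i (fst y) * U y))"
   unfolding kernel_C1(2)[OF k] by (rule integral_cong) (simp_all add: algebra_simps)
  also have "... = smear lborel (T s i) (%y. \<eta>' i (fst y) * U y) ?k x - smear lborel (T s i) (%y. \<eta> i (fst y) * U y) (partial_deriv e1 ?k) x"
   unfolding smear_def by (rule integral_diff[OF i2 i1])
  finally have 1: "(LBINT y. U y * partial_deriv e1 ?ps y) = ..." .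
  have 2: "(LBINT y. ?ps y * \<rho> y) = smear lborel (T s i) (%y. \<eta> i (fst y) * \<rho> y) ?k x"
   unfolding smear_def by (rule integral_cong) (simp_all add: algebra_simps)
  have 3: "(LINT y|M k. ?ps y) = smear (M k) (T s i) (%y. \<eta> i (fst y)) ?k x" for k
   unfolding smear_def by (rule integral_cong) (simp_all add: algebra_simps)
  show ?thesis using D1[OF kernel_C1(1)[OF k, of i x s]] unfolding 1 2 3 by simp
 qed
 have "partial_deriv e1 (comp U s) x = (\<Sum>i<N. smear lborel (T s i) (%y. \<eta> i (fst y) * U y) (partial_deriv e1 ?k) x)"
 proof -
  have "(comp U s has_derivative (%h. \<Sum>i<N. fst h * smear lborel (T s i) (%y. \<eta> i (fst y) * U y) (partial_deriv e1 ?k) x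
    + snd h * smear lborel (T s i) (%y. \<eta> i (fst y) * U y) (partial_deriv e2 ?k) x)) (at x)"
   unfolding comp_def[abs_def] by (intro has_derivative_sum smear_has_derivative[OF k Tm] \<eta>_integrable[OF U])
  from partial_deriv_eq[OF this] show ?thesis by simp
 qed
 also have "... = (\<Sum>i<N. smear lborel (T s i) (%y. \<eta>' i (fst y) * U y) ?k x) + (\<Sum>i<N. smear lborel (T s i) (%y. \<eta> i (fst y) * \<rho> y) ?k x)
   + (\<Sum>i<N. \<Sum>k\<in>I. sg k * smear (M k) (T s i) (%y. \<eta> i (fst y)) ?k x)"
  unfolding part by (simp only: sum.distrib)
 also have "(\<Sum>i<N. \<Sum>k\<in>I. sg k * smear (M k) (T s i) (%y. \<eta> i (fst y)) ?k x)
  = (\<Sum>k\<in>I. (\<Sum>i<N. smear (M k) (T s i) (%y. \<eta> i (fst y)) ?k x) * sg k)"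
  by (subst sum.swap) (simp add: sum_distrib_left mult.commute)
 finally show ?thesis .
qed

lemma comp_partial2:
 assumes U: "integrable lborel U" "!!x. x \<notin> G ==> U x = 0"
  and D2: "!!\<phi>. C_k (Suc 0) \<phi> ==> (LBINT x. U x * partial_deriv e2 \<phi> x) = - (LBINT x. \<phi> x * \<gamma> x)"
  and s: "0 < s" "s < s0"
 shows "partial_deriv e2 (comp U s) x = (\<Sum>i<N. 1 / (1 - s * c i) * smear lborel (T s i) (%y. \<eta> i (fst y) * \<gamma> y) (mollifier (r * s)) x)"
proof -
 have e: "r * s > 0" using rs0 s by simp
 let ?k = "mollifier (r * s)"
 have k: "?k \<in> test_functions UNIV" by (rule mollifier_test[OF e])
 have Tm: "T s i \<in> borel_measurable lborel" for i by simp
 have part: "smear lborel (T s i) (%y. \<eta> i (fst y) * U y) (partial_deriv e2 ?k) x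
  = 1 / (1 - s * c i) * smear lborel (T s i) (%y. \<eta> i (fst y) * \<gamma> y) ?k x" if i: "i < N" for i
 proof -
  let ?ps = "%y. \<eta> i (fst y) * ?k (x - T s i y)"
  have "(LBINT y. U y * partial_deriv e2 ?ps y) = (LBINT y. - (1 - s * c i) * (partial_deriv e2 ?k (x - T s i y) * (\<eta> i (fst y) * U y)))"
   unfolding kernel_C1(3)[OF k] by (rule integral_cong) (simp_all add: algebra_simps)
  also have "... = - (1 - s * c i) * smear lborel (T s i) (%y. \<eta> i (fst y) * U y) (partial_deriv e2 ?k) x"
   unfolding smear_def by (rule integral_mult_right_zero)
  finally have 1: "(LBINT y. U y * partial_deriv e2 ?ps y) = ..." .
  have 2: "(LBINT y. ?ps y * \<gamma> y) = smear lborel (T s i) (%y. \<eta> i (fst y) * \<gamma> y) ?k x"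
   unfolding smear_def by (rule integral_cong) (simp_all add: algebra_simps)
  have "1 - s * c i \<noteq> 0" using sc[OF i s] by simp
  then show ?thesis using D2[OF kernel_C1(1)[OF k, of i x s]] unfolding 1 2 by (simp add: field_simps)
 qed
 have "partial_deriv e2 (comp U s) x = (\<Sum>i<N. smear lborel (T s i) (%y. \<eta> i (fst y) * U y) (partial_deriv e2 ?k) x)"
 proof -
  have "(comp U s has_derivative (%h. \<Sum>i<N. fst h * smear lborel (T s i) (%y. \<eta> i (fst y) * U y) (partial_deriv e1 ?k) x
    + snd h * smear lborel (T s i) (%y. \<eta> i (fst y) * U y) (partial_deriv e2 ?k) x)) (at x)"
   unfolding comp_def[abs_def] by (intro has_derivative_sum smear_has_derivative[OF k Tm] \<eta>_integrable[OF U])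
  from partial_deriv_eq[OF this] show ?thesis by simp
 qed
 then show ?thesis by (simp add: part)
qed

definition st :: "nat => real" where "st n = s0 / real (n + 2)"

lemma st: "0 < st n" "st n < s0" "st \<longlonglongrightarrow> 0"
proof -
 show "0 < st n" "st n < s0" using rs0 by (auto simp: st_def divide_less_eq)
 have "(%n. s0 * (1 / real (n + 2))) \<longlonglongrightarrow> s0 * 0"
  by (intro tendsto_mult tendsto_const LIMSEQ_ignore_initial_segment[OF lim_1_over_n])
 then show "st \<longlonglongrightarrow> 0" by (simp add: st_def[abs_def])
qed

lemma smear_L1_tendsto:
 assumes "i < N" and g: "integrable lborel g"
 shows "L1_tendsto (%n. smear lborel (T (st n) i) g (mollifier (r * st n))) g"
proof -
 have e: "r * st n > 0" for n using rs0 st by simp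
 have "integrable lborel (smear lborel (T (st n) i) g (mollifier (r * st n)))" for n
  by (rule smear_L1(1)[OF lborel.sigma_finite_measure_axioms e _ g]) simp
 then show ?thesis unfolding L1_tendsto_def
  using approximate_identity_L1[OF c_nonneg[OF assms(1)] rs0(1) st(1) st(3) g] g by blast
qed

lemma sum_\<eta>_mult:
 assumes "!!x. x \<notin> G ==> g x = (0::real)" shows "(%x. \<Sum>i<N. \<eta> i (fst x) * g x) = g"
proof
 fix x show "(\<Sum>i<N. \<eta> i (fst x) * g x) = g x"
 proof (cases "x \<in> G")
  case True
  then have "x \<in> closure G" using closure_subset by blast
  then show ?thesis using \<eta>_sum by (simp add: sum_distrib_right[symmetric])
 qed (simp add: assms)
qed

lemma weighted_L1_tendsto:
 assumes g: "integrable lborel g" "!!x. x \<notin> G ==> g x = 0"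
 shows "L1_tendsto (%n x. \<Sum>i<N. smear lborel (T (st n) i) (%y. \<eta> i (fst y) * g y) (mollifier (r * st n)) x) g"
proof -
 have "L1_tendsto (%n x. \<Sum>i<N. smear lborel (T (st n) i) (%y. \<eta> i (fst y) * g y) (mollifier (r * st n)) x) (%x. \<Sum>i<N. \<eta> i (fst x) * g x)"
  by (rule L1_tendsto_sum, rule smear_L1_tendsto) (auto intro: \<eta>_integrable[OF g])
 then show ?thesis using sum_\<eta>_mult[OF g(2)] by (rule back_subst[where P="L1_tendsto _"])
qed

text \<open>In the limit the terms with the derivatives of the weights add up to the derivative of the constant one, times
 \<open>U\<close>.\<close>

lemma weight_error_L1_tendsto:
 assumes U: "integrable lborel U" "!!x. x \<notin> G ==> U x = 0"
 shows "L1_tendsto (%n x. \<Sum>i<N. smear lborel (T (st n) i) (%y. \<eta>' i (fst y) * U y) (mollifier (r * st n)) x) (%x. 0)"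
proof -
 have "L1_tendsto (%n x. \<Sum>i<N. smear lborel (T (st n) i) (%y. \<eta>' i (fst y) * U y) (mollifier (r * st n)) x) (%x. \<Sum>i<N. \<eta>' i (fst x) * U x)"
  by (rule L1_tendsto_sum, rule smear_L1_tendsto) (auto intro: \<eta>'_integrable[OF U])
 moreover have "(%x. \<Sum>i<N. \<eta>' i (fst x) * U x) = (%x. 0)"
 proof
  fix x show "(\<Sum>i<N. \<eta>' i (fst x) * U x) = 0"
   by (cases "x \<in> G") (use \<eta>'_sum U(2) in "simp_all add: sum_distrib_right[symmetric]")
 qed
 ultimately show ?thesis by simp
qed

lemma scaled_weighted_L1_tendsto:
 assumes g: "integrable lborel g" "!!x. x \<notin> G ==> g x = 0"
 shows "L1_tendsto (%n x. \<Sum>i<N. 1 / (1 - st n * c i) * smear lborel (T (st n) i) (%y. \<eta> i (fst y) * g y) (mollifier (r * st n)) x) g"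
proof -
 have "L1_tendsto (%n x. \<Sum>i<N. 1 / (1 - st n * c i) * smear lborel (T (st n) i) (%y. \<eta> i (fst y) * g y) (mollifier (r * st n)) x) (%x. \<Sum>i<N. \<eta> i (fst x) * g x)"
 proof (rule L1_tendsto_sum)
  fix i assume i: "i \<in> {..<N}"
  have "(%n. 1 / (1 - st n * c i)) \<longlonglongrightarrow> 1 / (1 - 0 * c i)" by (intro tendsto_intros st(3)) simp
  then have "(%n. 1 / (1 - st n * c i)) \<longlonglongrightarrow> 1" by simp
  then show "L1_tendsto (%n x. 1 / (1 - st n * c i) * smear lborel (T (st n) i) (%y. \<eta> i (fst y) * g y) (mollifier (r * st n)) x) (%x. \<eta> i (fst x) * g x)"
   using i by (intro L1_tendsto_scale smear_L1_tendsto \<eta>_integrable[OF g]) auto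
 qed
 then show ?thesis using sum_\<eta>_mult[OF g(2)] by (rule back_subst[where P="L1_tendsto _"])
qed

text \<open>The mass of a measure is not increased, as the weights sum to at most one everywhere.\<close>

lemma measure_smear:
 assumes M: "finite_measure M" "sets M = sets borel" and s: "0 < s" "s < s0"
 shows "0 \<le> (\<Sum>i<N. smear M (T s i) (%y. \<eta> i (fst y)) (mollifier (r * s)) x)"
  and "integrable lborel (%x. \<Sum>i<N. smear M (T s i) (%y. \<eta> i (fst y)) (mollifier (r * s)) x)"
  and "(LBINT x. (\<Sum>i<N. smear M (T s i) (%y. \<eta> i (fst y)) (mollifier (r * s)) x)) \<le> measure M UNIV"
proof -
 interpret finite_measure M by fact
 have e: "r * s > 0" using rs0 s by simp
 have sp: "space M = UNIV" using sets_eq_imp_space_eq[OF M(2)] by simp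
 have sf: "sigma_finite_measure M" by (rule sigma_finite_measure_axioms)
 have Tm: "T s i \<in> borel_measurable M" for i using push_measurable measurable_cong_sets[OF M(2) refl, of borel] by blast
 have em: "(%y. \<eta> i (fst y)) \<in> borel_measurable M" for i using \<eta>_measurable measurable_cong_sets[OF M(2) refl, of borel] by blast
 have ei: "integrable M (%y. \<eta> i (fst y))" for i
  by (rule integrable_const_bound[where B=1]) (use \<eta>_bounds em in auto)
 show "0 \<le> (\<Sum>i<N. smear M (T s i) (%y. \<eta> i (fst y)) (mollifier (r * s)) x)"
  unfolding smear_def by (intro sum_nonneg integral_nonneg mult_nonneg_nonneg mollifier_nonneg \<eta>_bounds)
 note L = smear_L1[OF sf e Tm ei]
 show "integrable lborel (%x. \<Sum>i<N. smear M (T s i) (%y. \<eta> i (fst y)) (mollifier (r * s)) x)"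
  by (intro integrable_sum L(1))
 have "(LBINT x. (\<Sum>i<N. smear M (T s i) (%y. \<eta> i (fst y)) (mollifier (r * s)) x)) = (\<Sum>i<N. \<integral>y. \<eta> i (fst y) \<partial>M)"
  by (subst integral_sum) (use L in auto)
 also have "... = (LINT y|M. (\<Sum>i<N. \<eta> i (fst y)))" by (rule integral_sum[symmetric]) (rule ei)
 also have "... \<le> (LINT y|M. 1)" by (rule integral_mono) (use ei \<eta>_sum_le in auto)
 also have "... = measure M UNIV" using sp by simp
 finally show "(LBINT x. (\<Sum>i<N. smear M (T s i) (%y. \<eta> i (fst y)) (mollifier (r * s)) x)) \<le> measure M UNIV" .
qed

lemma lebesgue_on_le_lborel:
 fixes f :: "plane => real"
 assumes "integrable lborel f" and "!!x. f x \<ge> 0"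
 shows "integrable (lebesgue_on G) f" and "(LINT x|lebesgue_on G. f x) \<le> (LBINT x. f x)"
proof -
 have S: "G \<inter> space lebesgue \<in> sets lebesgue" using G_borel by simp
 have fm: "f \<in> borel_measurable lborel" using assms(1) by auto
 have i: "integrable lborel (%x. indicat_real G x *\<^sub>R f x)"
  by (rule integrable_bound[OF assms(1)]) (use fm G_borel in "auto simp: indicator_def")
 then have m: "(%x. indicat_real G x *\<^sub>R f x) \<in> borel_measurable lborel" by auto
 show "integrable (lebesgue_on G) f" unfolding integrable_restrict_space[OF S] integrable_completion[OF m] by (rule i)
 have "(LINT x|lebesgue_on G. f x) = (LBINT x. indicat_real G x *\<^sub>R f x)"
  unfolding integral_restrict_space[OF S] by (rule integral_completion[OF m])
 also have "... \<le> (LBINT x. f x)" by (rule integral_mono[OF i assms(1)]) (use assms(2) in "auto simp: indicator_def")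
 finally show "(LINT x|lebesgue_on G. f x) \<le> (LBINT x. f x)" .
qed

lemma lebesgue_on_integrable: "integrable lborel f ==> integrable (lebesgue_on G) f" for f :: "plane => real"
proof -
 assume f: "integrable lborel f"
 have "integrable (lebesgue_on G) (%x. \<bar>f x\<bar>)" using lebesgue_on_le_lborel(1)[of "%x. \<bar>f x\<bar>"] f by simp
 moreover have "f \<in> borel_measurable (lebesgue_on G)" by (rule borel_measurable_lebesgue_on) (use f in auto)
 ultimately show ?thesis by (rule_tac integrable_bound[of _ "%x. \<bar>f x\<bar>"]) auto
qed

lemma finite_lebesgue_on: "finite_measure (lebesgue_on G)"
proof (rule finite_measureI)
 show "emeasure (lebesgue_on G) (space (lebesgue_on G)) \<noteq> \<infinity>"
  using emeasure_bounded_finite[OF bd] G_borel by (simp add: space_restrict_space emeasure_restrict_space emeasure_completion less_top)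
qed

end

context pushed_partition begin

text \<open>The constant exceeds the total weight of the smearing integrals: each of the \<open>N\<close> pieces contributes
 at most \<open>4\<close>, a factor \<open>2\<close> from the chain rule and a factor \<open>2\<close> from the
 Jacobian.\<close>

lemma vertical_majorant:
 assumes A: "delta2_N_function A A' c3 cA"
  and \<gamma>: "integrable lborel \<gamma>" "!!x. x \<notin> G ==> \<gamma> x = 0" and A\<gamma>: "integrable lborel (%y. A (C * \<bar>\<gamma> y\<bar>))"
  and C: "C = 4 * real N + 1" and s: "0 < s" "s < s0"
 shows "A \<bar>\<Sum>i<N. 1 / (1 - s * c i) * smear lborel (T s i) (%y. \<eta> i (fst y) * \<gamma> y) (mollifier (r * s)) x\<bar>
  \<le> (1 / C) * (\<Sum>i<N. 1 / (1 - s * c i) * smear lborel (T s i) (%y. \<eta> i (fst y) * A (C * \<bar>\<gamma> y\<bar>)) (mollifier (r * s)) x)"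
proof -
 interpret delta2_N_function A A' c3 cA by fact
 have e: "r * s > 0" using rs0 s by simp
 have Tm: "T s i \<in> borel_measurable lborel" for i by simp
 define w where "w i = 1 / (1 - s * c i)" for i
 have w: "0 \<le> w i" "w i \<le> 2" if "i < N" for i using sc[OF that s] by (auto simp: w_def divide_le_eq)
 let ?k = "%i y. mollifier (r * s) (x - T s i y)"
 define W where "W y = (\<Sum>i<N. w i * (?k i y * \<eta> i (fst y)))" for y
 have A0: "A (C * \<bar>\<gamma> x\<bar>) = 0" if "x \<notin> G" for x using \<gamma>(2)[OF that] A_zero by simp
 have i\<gamma>: "integrable lborel (%y. \<bar>\<gamma> y\<bar>)" "!!x. x \<notin> G ==> \<bar>\<gamma> x\<bar> = 0" using \<gamma> by auto
 have ki: "integrable lborel (?k i)" "(LBINT y. ?k i y) = w i" if "i < N" for i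
  using mollifier_push_integral[OF e, of s "c i" x "p i" "q i"] sc[OF that s] by (auto simp: w_def)
 have kei: "integrable lborel (%y. ?k i y * \<eta> i (fst y))" if "i < N" for i
 proof (rule integrable_bound[OF ki(1)[OF that]])
  have "?k i \<in> borel_measurable lborel" using ki(1)[OF that] by auto
  then show "(%y. ?k i y * \<eta> i (fst y)) \<in> borel_measurable lborel" by (intro borel_measurable_times) auto
  show "AE y in lborel. norm (?k i y * \<eta> i (fst y)) \<le> norm (?k i y)"
   using \<eta>_bounds by (intro always_eventually allI) (simp add: abs_mult mult_left_le)
 qed
 have Wn: "W y \<ge> 0" for y unfolding W_def using w mollifier_nonneg \<eta>_bounds by (intro sum_nonneg mult_nonneg_nonneg) auto
 have Wi: "integrable lborel W" unfolding W_def using kei by (intro integrable_sum integrable_mult_right) auto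
 have Wm: "(LBINT y. W y) \<le> C"
 proof -
  have "(LBINT y. W y) = (\<Sum>i<N. w i * (LBINT y. ?k i y * \<eta> i (fst y)))"
   unfolding W_def using kei by (subst integral_sum) auto
  also have "... \<le> (\<Sum>i<N. 2 * 2)"
  proof (rule sum_mono)
   fix i assume "i \<in> {..<N}"
   then have i: "i < N" by simp
   have "(LBINT y. ?k i y * \<eta> i (fst y)) \<le> (LBINT y. ?k i y)"
    by (rule integral_mono[OF kei[OF i] ki(1)[OF i]]) (simp add: mult_left_le mollifier_nonneg \<eta>_bounds)
   also have "... \<le> 2" using ki(2)[OF i] w(2)[OF i] by simp
   finally have "(LBINT y. ?k i y * \<eta> i (fst y)) \<le> 2" .
   moreover have "0 \<le> (LBINT y. ?k i y * \<eta> i (fst y))"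
    by (intro integral_nonneg mult_nonneg_nonneg mollifier_nonneg \<eta>_bounds)
   ultimately show "w i * (LBINT y. ?k i y * \<eta> i (fst y)) \<le> 2 * 2" using w[OF i] by (intro mult_mono) auto
  qed
  also have "... \<le> C" by (simp add: C)
  finally show ?thesis .
 qed
 have Wg: "integrable lborel (%y. W y * g y) \<and> (LBINT y. W y * g y)
   = (\<Sum>i<N. w i * smear lborel (T s i) (%y. \<eta> i (fst y) * g y) (mollifier (r * s)) x)"
  if g: "integrable lborel g" "!!x. x \<notin> G ==> g x = 0" for g
 proof -
  have i: "integrable lborel (%y. ?k i y * (\<eta> i (fst y) * g y))" for i
   by (intro smear_mollifier_kernel_integrable[OF e Tm] \<eta>_integrable g)
  have eq: "W y * g y = (\<Sum>i<N. w i * (?k i y * (\<eta> i (fst y) * g y)))" for y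
   unfolding W_def sum_distrib_right by (rule sum.cong) (simp_all add: mult.assoc)
  show ?thesis unfolding eq smear_def using i by (subst integral_sum) auto
 qed
 have C0: "C > 0" by (simp add: C)
 have "\<bar>\<integral>y. W y * \<gamma> y \<partial>lborel\<bar> \<le> (LBINT y. \<bar>W y * \<gamma> y\<bar>)" by (rule integral_abs_bound)
 also have "... = (LBINT y. W y * \<bar>\<gamma> y\<bar>)" using Wn by (simp add: abs_mult)
 finally have "A \<bar>\<integral>y. W y * \<gamma> y \<partial>lborel\<bar> \<le> A (LBINT y. W y * \<bar>\<gamma> y\<bar>)" by (intro A_mono) auto
 also have "... \<le> (1 / C) * (LBINT y. W y * A (C * \<bar>\<gamma> y\<bar>))"
  by (rule A_jensen[OF Wi Wn Wm C0]) (use Wg[OF i\<gamma>] Wg[OF A\<gamma> A0] in auto)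
 finally show ?thesis using Wg[OF \<gamma>] Wg[OF A\<gamma> A0] by (simp add: w_def)
qed

text \<open>The \<open>f1\<close>-part converges by Lipschitz continuity after the measures have been split off by
 subadditivity of the recession function; the \<open>A\<close>-part has a majorant that converges in the mean. A sufficiently
 late member of the sequence of competitors serves both.\<close>

lemma smooth_competitor:
 assumes f1: "linear_growth_integrand f1 f1' a1 a2 a3 a4" and A: "delta2_N_function A A' c3 cA"
  and U: "integrable lborel U" "!!x. x \<notin> G ==> U x = 0" and \<rho>: "integrable lborel \<rho>" "!!x. x \<notin> G ==> \<rho> x = 0"
  and \<gamma>: "integrable lborel \<gamma>" "!!x. x \<notin> G ==> \<gamma> x = 0"
  and D1: "!!\<phi>. C_k (Suc 0) \<phi> ==> (LBINT x. U x * partial_deriv e1 \<phi> x)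
    = - ((LBINT x. \<phi> x * \<rho> x) + (\<Sum>k\<in>I. sg k * (LINT x|M k. \<phi> x)))"
  and D2: "!!\<phi>. C_k (Suc 0) \<phi> ==> (LBINT x. U x * partial_deriv e2 \<phi> x) = - (LBINT x. \<phi> x * \<gamma> x)"
  and M: "!!k. k \<in> I ==> finite_measure (M k)" "!!k. k \<in> I ==> sets (M k) = sets borel"
  and v1: "integrable (lebesgue_on G) v1" and v2: "v2 \<in> borel_measurable (lebesgue_on G)" "AE x in lebesgue_on G. \<bar>v2 x\<bar> \<le> B"
  and A\<gamma>: "integrable lborel (%x. A \<bar>\<gamma> x\<bar>)" and eps: "eps > 0"
 shows "\<exists>\<phi>\<in>test_functions G.
  (LINT x|lebesgue_on G. f1 (v1 x + partial_deriv e1 \<phi> x)) + (LINT x|lebesgue_on G. A \<bar>v2 x + partial_deriv e2 \<phi> x\<bar>)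
  \<le> (LINT x|lebesgue_on G. f1 (v1 x + \<rho> x)) + (\<Sum>k\<in>I. recession f1 (sg k) * measure (M k) UNIV)
   + (LINT x|lebesgue_on G. A \<bar>v2 x + \<gamma> x\<bar>) + eps"
proof -
 interpret f1: linear_growth_integrand f1 f1' a1 a2 a3 a4 by fact
 interpret A: delta2_N_function A A' c3 cA by fact
 interpret L: finite_measure "lebesgue_on G" by (rule finite_lebesgue_on)
 define E where "E n x = (\<Sum>i<N. smear lborel (T (st n) i) (%y. \<eta>' i (fst y) * U y) (mollifier (r * st n)) x)" for n x
 define R where "R n x = (\<Sum>i<N. smear lborel (T (st n) i) (%y. \<eta> i (fst y) * \<rho> y) (mollifier (r * st n)) x)" for n x
 define m where "m n k x = (\<Sum>i<N. smear (M k) (T (st n) i) (%y. \<eta> i (fst y)) (mollifier (r * st n)) x)" for n k x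
 define Gv where "Gv n x = (\<Sum>i<N. 1 / (1 - st n * c i) * smear lborel (T (st n) i) (%y. \<eta> i (fst y) * \<gamma> y) (mollifier (r * st n)) x)" for n x
 define \<phi> where "\<phi> n = comp U (st n)" for n
 have \<phi>t: "\<phi> n \<in> test_functions G" for n unfolding \<phi>_def by (rule comp_test[OF U st(1,2)])
 have p1: "partial_deriv e1 (\<phi> n) x = E n x + R n x + (\<Sum>k\<in>I. m n k x * sg k)" for n x
  unfolding \<phi>_def E_def R_def m_def by (rule comp_partial1[OF U \<rho> D1 st(1,2)])
 have p2: "partial_deriv e2 (\<phi> n) x = Gv n x" for n x
  unfolding \<phi>_def Gv_def by (rule comp_partial2[OF U D2 st(1,2)])
 have EL: "L1_tendsto E (%x. 0)" unfolding E_def[abs_def] by (rule weight_error_L1_tendsto[OF U])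
 have RL: "L1_tendsto R \<rho>" unfolding R_def[abs_def] by (rule weighted_L1_tendsto[OF \<rho>])
 have GL: "L1_tendsto Gv \<gamma>" unfolding Gv_def[abs_def] by (rule scaled_weighted_L1_tendsto[OF \<gamma>])
 have iE: "integrable lborel (E n)" and iR: "integrable lborel (R n)" and iG: "integrable lborel (Gv n)" for n
  using EL RL GL unfolding L1_tendsto_def by blast+
 have mn: "m n k x \<ge> 0" and mi: "integrable lborel (m n k)" and mm: "(LBINT x. m n k x) \<le> measure (M k) UNIV" if "k \<in> I" for n k x
  unfolding m_def using measure_smear[OF M(1)[OF that] M(2)[OF that] st(1,2)] by blast+
 let ?S = "\<Sum>k\<in>I. recession f1 (sg k) * measure (M k) UNIV"
 let ?L = "lebesgue_on G"
 have pi: "integrable ?L (%x. partial_deriv e1 (\<phi> n) x)" for n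
 proof -
  have "\<phi> n \<in> test_functions UNIV" using \<phi>t test_functions_mono by blast
  then show ?thesis using test_partial test_integrable lebesgue_on_integrable by blast
 qed
 have f1part: "(LINT x|?L. f1 (v1 x + partial_deriv e1 (\<phi> n) x))
  \<le> (LINT x|?L. f1 (v1 x + \<rho> x)) + ?S + a3 * ((LBINT x. \<bar>R n x - \<rho> x\<bar>) + (LBINT x. \<bar>E n x - 0\<bar>))" for n
 proof -
  have pt: "f1 (v1 x + partial_deriv e1 (\<phi> n) x) \<le> f1 (v1 x + \<rho> x) + (\<Sum>k\<in>I. m n k x * recession f1 (sg k)) + a3 * (\<bar>R n x - \<rho> x\<bar> + \<bar>E n x\<bar>)" for x
  proof -
   let ?m = "\<Sum>k\<in>I. m n k x * sg k"
   have "f1 (v1 x + partial_deriv e1 (\<phi> n) x) - f1 (v1 x + \<rho> x + ?m) \<le> a3 * \<bar>v1 x + partial_deriv e1 (\<phi> n) x - (v1 x + \<rho> x + ?m)\<bar>"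
    using f1.f1_lipschitz abs_ge_self order_trans by blast
   also have "... \<le> a3 * (\<bar>R n x - \<rho> x\<bar> + \<bar>E n x\<bar>)"
    unfolding p1 using f1.a3 by (intro mult_left_mono) auto
   finally have 1: "f1 (v1 x + partial_deriv e1 (\<phi> n) x) - f1 (v1 x + \<rho> x + ?m) \<le> a3 * (\<bar>R n x - \<rho> x\<bar> + \<bar>E n x\<bar>)" .
   have "f1 (v1 x + \<rho> x + ?m) \<le> f1 (v1 x + \<rho> x) + recession f1 ?m" by (rule f1.f1_add_le)
   also have "... \<le> f1 (v1 x + \<rho> x) + (\<Sum>k\<in>I. m n k x * recession f1 (sg k))"
    using f1.recession_sum_le[of I "%k. m n k x" sg] mn by simp
   finally show ?thesis using 1 by linarith
  qed
  have i1: "integrable ?L (%x. f1 (v1 x + \<rho> x))"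
   using v1 lebesgue_on_integrable[OF \<rho>(1)] by (intro f1.f1_integrable finite_lebesgue_on) auto
  have i2: "integrable lborel (%x. (\<Sum>k\<in>I. m n k x * recession f1 (sg k)))"
   using mi by (intro integrable_sum integrable_mult_left) auto
  have i3: "integrable lborel (%x. a3 * (\<bar>R n x - \<rho> x\<bar> + \<bar>E n x\<bar>))" using iR iE \<rho> by auto
  have n2: "(\<Sum>k\<in>I. m n k x * recession f1 (sg k)) \<ge> 0" for x using mn f1.recession_nonneg by (intro sum_nonneg mult_nonneg_nonneg) auto
  have n3: "a3 * (\<bar>R n x - \<rho> x\<bar> + \<bar>E n x\<bar>) \<ge> 0" for x using f1.a3 by simp
  note l2 = lebesgue_on_le_lborel[OF i2 n2] and l3 = lebesgue_on_le_lborel[OF i3 n3]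
  have "(LINT x|?L. f1 (v1 x + partial_deriv e1 (\<phi> n) x))
   \<le> (LINT x|?L. f1 (v1 x + \<rho> x) + (\<Sum>k\<in>I. m n k x * recession f1 (sg k)) + a3 * (\<bar>R n x - \<rho> x\<bar> + \<bar>E n x\<bar>))"
  proof (rule integral_mono[OF _ _ pt])
   show "integrable ?L (%x. f1 (v1 x + partial_deriv e1 (\<phi> n) x))"
    using v1 pi by (intro f1.f1_integrable finite_lebesgue_on) auto
  qed (use i1 l2 l3 in auto)
  also have "... = (LINT x|?L. f1 (v1 x + \<rho> x)) + (LINT x|?L. (\<Sum>k\<in>I. m n k x * recession f1 (sg k))) + (LINT x|?L. a3 * (\<bar>R n x - \<rho> x\<bar> + \<bar>E n x\<bar>))"
   using i1 l2(1) l3(1) by (simp add: integral_add)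
  also have "... \<le> (LINT x|?L. f1 (v1 x + \<rho> x)) + ?S + a3 * ((LBINT x. \<bar>R n x - \<rho> x\<bar>) + (LBINT x. \<bar>E n x - 0\<bar>))"
  proof -
   have "(LBINT x. (\<Sum>k\<in>I. m n k x * recession f1 (sg k))) = (\<Sum>k\<in>I. (LBINT x. m n k x) * recession f1 (sg k))"
    using mi by (subst integral_sum) auto
   also have "... \<le> (\<Sum>k\<in>I. measure (M k) UNIV * recession f1 (sg k))"
    using mm f1.recession_nonneg by (intro sum_mono mult_right_mono) auto
   finally have "(LINT x|?L. (\<Sum>k\<in>I. m n k x * recession f1 (sg k))) \<le> ?S" using l2(2) by (simp add: mult.commute)
   moreover have "(LBINT x. a3 * (\<bar>R n x - \<rho> x\<bar> + \<bar>E n x\<bar>)) = a3 * ((LBINT x. \<bar>R n x - \<rho> x\<bar>) + (LBINT x. \<bar>E n x - 0\<bar>))"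
    using iR iE \<rho> by simp
   ultimately show ?thesis using l3(2) by linarith
  qed
  finally show ?thesis .
 qed
 have "(%n. a3 * ((LBINT x. \<bar>R n x - \<rho> x\<bar>) + (LBINT x. \<bar>E n x - 0\<bar>))) \<longlonglongrightarrow> a3 * (0 + 0)"
  using RL EL unfolding L1_tendsto_def by (intro tendsto_mult tendsto_add tendsto_const) blast+
 then have "\<forall>\<^sub>F n in sequentially. a3 * ((LBINT x. \<bar>R n x - \<rho> x\<bar>) + (LBINT x. \<bar>E n x - 0\<bar>)) < eps / 2"
  using eps by (intro order_tendstoD(2)) auto
 then obtain n0 where n0: "!!n. n \<ge> n0 ==> a3 * ((LBINT x. \<bar>R n x - \<rho> x\<bar>) + (LBINT x. \<bar>E n x - 0\<bar>)) < eps / 2"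
  unfolding eventually_sequentially by blast
 define C where "C = 4 * real N + 1"
 have C: "C > 0" by (simp add: C_def)
 have Am: "(%t. A \<bar>t\<bar>) \<in> borel_measurable borel" using A.f2_cont by (rule borel_measurable_continuous_onI)
 have AC: "integrable lborel (%y. A (C * \<bar>\<gamma> y\<bar>))"
 proof -
  obtain C' where C': "C' > 0" "!!t. A (C * abs t) \<le> C' * A \<bar>t\<bar>" using A.A_scale[of C] C by auto
  show ?thesis
  proof (rule integrable_bound[of _ "%y. C' * A \<bar>\<gamma> y\<bar>"])
   have "(%y. A \<bar>C * \<gamma> y\<bar>) \<in> borel_measurable lborel" using \<gamma>(1) by (intro measurable_compose[OF _ Am]) auto
   then show "(%y. A (C * \<bar>\<gamma> y\<bar>)) \<in> borel_measurable lborel" using C by (simp add: abs_mult)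
   show "AE y in lborel. norm (A (C * \<bar>\<gamma> y\<bar>)) \<le> norm (C' * A \<bar>\<gamma> y\<bar>)"
   proof (rule always_eventually, rule allI)
    fix y
    have "0 \<le> A (C * \<bar>\<gamma> y\<bar>)" using C by (intro A.A_nonneg) simp
    then show "norm (A (C * \<bar>\<gamma> y\<bar>)) \<le> norm (C' * A \<bar>\<gamma> y\<bar>)" using C'(2)[of "\<gamma> y"] by simp
   qed
  qed (use A\<gamma> in simp)
 qed
 have A0: "A (C * \<bar>\<gamma> x\<bar>) = 0" if "x \<notin> G" for x using \<gamma>(2)[OF that] A.A_zero by simp
 define D where "D n x = (\<Sum>i<N. 1 / (1 - st n * c i) * smear lborel (T (st n) i) (%y. \<eta> i (fst y) * A (C * \<bar>\<gamma> y\<bar>)) (mollifier (r * st n)) x)" for n x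
 have DL: "L1_tendsto D (%y. A (C * \<bar>\<gamma> y\<bar>))" unfolding D_def[abs_def] by (rule scaled_weighted_L1_tendsto[OF AC A0])
 have iD: "integrable lborel (D n)" for n using DL unfolding L1_tendsto_def by blast
 define B' where "B' = max B 0"
 have v2B: "AE x in ?L. \<bar>v2 x\<bar> \<le> B'" using v2(2) by eventually_elim (simp add: B'_def)
 have iv2: "integrable ?L v2" by (rule L.integrable_const_bound[where B=B']) (use v2B v2(1) in auto)
 have iG': "integrable ?L (Gv n)" and iD': "integrable ?L (D n)" and i\<gamma>': "integrable ?L \<gamma>" and iAC': "integrable ?L (%y. A (C * \<bar>\<gamma> y\<bar>))" for n
  using lebesgue_on_integrable iG iD \<gamma>(1) AC by blast+
 let ?major = "%n x. c3 * A B' + c3 / C * D n x"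
 let ?limit = "%x. c3 * A B' + c3 / C * A (C * \<bar>\<gamma> x\<bar>)"
 have "\<exists>n\<ge>n0. (LINT x|?L. A \<bar>v2 x + Gv n x\<bar>) \<le> (LINT x|?L. A \<bar>v2 x + \<gamma> x\<bar>) + eps / 2"
 proof (rule L1_majorant_limsup[where F="%t. A \<bar>t\<bar>" and D="?major" and ?D0.0="?limit"])
  show "continuous_on UNIV (%t. A \<bar>t\<bar>)" by (rule A.f2_cont)
  show "A \<bar>t\<bar> \<ge> 0" for t by (rule A.A_nonneg) simp
  show "integrable ?L (%x. v2 x + Gv n x)" "integrable ?L (%x. v2 x + \<gamma> x)" for n using iv2 iG' i\<gamma>' by auto
  show "(%n. \<integral>x. \<bar>v2 x + Gv n x - (v2 x + \<gamma> x)\<bar> \<partial>?L) \<longlonglongrightarrow> 0"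
  proof (rule tendsto_sandwich[OF always_eventually always_eventually tendsto_const])
   show "(%n. \<integral>x. \<bar>Gv n x - \<gamma> x\<bar> \<partial>lborel) \<longlonglongrightarrow> 0" using GL unfolding L1_tendsto_def by blast
   show "\<forall>n. (LINT x|?L. \<bar>v2 x + Gv n x - (v2 x + \<gamma> x)\<bar>) \<le> (LBINT x. \<bar>Gv n x - \<gamma> x\<bar>)"
    using lebesgue_on_le_lborel(2)[of "%x. \<bar>Gv n x - \<gamma> x\<bar>" for n] iG \<gamma>(1) by simp
  qed simp
  show "integrable ?L (?major n)" "integrable ?L ?limit" for n using iD' iAC' by auto
  show "(%n. \<integral>x. \<bar>?major n x - ?limit x\<bar> \<partial>?L) \<longlonglongrightarrow> 0"
  proof (rule tendsto_sandwich[OF always_eventually always_eventually tendsto_const])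
   have "(%n. c3 / C * (LBINT x. \<bar>D n x - A (C * \<bar>\<gamma> x\<bar>)\<bar>)) \<longlonglongrightarrow> c3 / C * 0"
    using DL unfolding L1_tendsto_def by (intro tendsto_mult tendsto_const) blast
   then show "(%n. c3 / C * (LBINT x. \<bar>D n x - A (C * \<bar>\<gamma> x\<bar>)\<bar>)) \<longlonglongrightarrow> 0" by simp
   show "\<forall>n. (LINT x|?L. \<bar>?major n x - ?limit x\<bar>) \<le> c3 / C * (LBINT x. \<bar>D n x - A (C * \<bar>\<gamma> x\<bar>)\<bar>)"
   proof
    fix n
    have "abs (?major n x - ?limit x) = c3 / C * \<bar>D n x - A (C * \<bar>\<gamma> x\<bar>)\<bar>" for x
    proof -
     have "?major n x - ?limit x = c3 / C * (D n x - A (C * \<bar>\<gamma> x\<bar>))" by (simp add: right_diff_distrib)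
     moreover have "c3 / C > 0" using A.c3 C by simp
     ultimately show ?thesis by (simp only: abs_mult abs_of_pos)
    qed
    then have "(LINT x|?L. \<bar>?major n x - ?limit x\<bar>) = c3 / C * (LINT x|?L. \<bar>D n x - A (C * \<bar>\<gamma> x\<bar>)\<bar>)" by simp
    also have "... \<le> c3 / C * (LBINT x. \<bar>D n x - A (C * \<bar>\<gamma> x\<bar>)\<bar>)"
     using A.c3 C iD AC by (intro mult_left_mono lebesgue_on_le_lborel(2)) auto
    finally show "(LINT x|?L. \<bar>?major n x - ?limit x\<bar>) \<le> c3 / C * (LBINT x. \<bar>D n x - A (C * \<bar>\<gamma> x\<bar>)\<bar>)" .
   qed
  qed simp
  show "AE x in ?L. A \<bar>v2 x + Gv n x\<bar> \<le> ?major n x" for n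
   using v2B
  proof eventually_elim
   case (elim x)
   have "A \<bar>v2 x + Gv n x\<bar> \<le> c3 * (A \<bar>v2 x\<bar> + A \<bar>Gv n x\<bar>)" by (rule A.A_add)
   also have "... \<le> c3 * (A B' + 1 / C * D n x)"
   proof (intro mult_left_mono add_mono)
    show "A \<bar>v2 x\<bar> \<le> A B'" using elim by (intro A.A_mono) auto
    show "A \<bar>Gv n x\<bar> \<le> 1 / C * D n x"
     unfolding Gv_def D_def by (rule vertical_majorant[OF A \<gamma> AC C_def st(1,2)])
   qed (use A.c3 in simp)
   finally show ?case by (simp add: algebra_simps)
  qed
  show "integrable ?L (%x. A \<bar>v2 x + \<gamma> x\<bar>)"
  proof (rule integrable_bound[of _ "%x. c3 * (A B' + A \<bar>\<gamma> x\<bar>)"])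
   show "integrable ?L (%x. c3 * (A B' + A \<bar>\<gamma> x\<bar>))" using lebesgue_on_integrable[OF A\<gamma>] by auto
   show "(%x. A \<bar>v2 x + \<gamma> x\<bar>) \<in> borel_measurable ?L" using iv2 i\<gamma>' by (intro measurable_compose[OF _ Am]) auto
   show "AE x in ?L. norm (A \<bar>v2 x + \<gamma> x\<bar>) \<le> norm (c3 * (A B' + A \<bar>\<gamma> x\<bar>))"
    using v2B
   proof eventually_elim
    case (elim x)
    have "A \<bar>v2 x\<bar> \<le> A B'" using elim by (intro A.A_mono) auto
    then have "c3 * (A \<bar>v2 x\<bar> + A \<bar>\<gamma> x\<bar>) \<le> c3 * (A B' + A \<bar>\<gamma> x\<bar>)" using A.c3 by (intro mult_left_mono) auto
    moreover have "0 \<le> A \<bar>v2 x + \<gamma> x\<bar>" by (rule A.A_nonneg) simp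
    ultimately show ?case using A.A_add[of "v2 x" "\<gamma> x"] by simp
   qed
  qed
  show "eps / 2 > 0" using eps by simp
 qed
 then obtain n where n: "n \<ge> n0" "(LINT x|?L. A \<bar>v2 x + Gv n x\<bar>) \<le> (LINT x|?L. A \<bar>v2 x + \<gamma> x\<bar>) + eps / 2" by blast
 show ?thesis
  by (rule bexI[OF _ \<phi>t[of n]]) (use f1part[of n] n0[OF n(1)] n(2) in "simp add: p2")
qed

end

section \<open>Weak derivatives and traces\<close>

lemma borel_measurable_lebesgue_on_AE:
 fixes f g :: "plane => real"
 assumes S: "S \<in> sets borel" and f: "f \<in> borel_measurable (lebesgue_on S)" and ae: "AE x in lebesgue_on S. f x = g x"
 shows "g \<in> borel_measurable (lebesgue_on S)"
proof -
 have S': "S \<inter> space lebesgue \<in> sets lebesgue" using S by simp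
 have "(%x. indicat_real S x *\<^sub>R f x) \<in> borel_measurable lebesgue" using f borel_measurable_restrict_space_iff[OF S'] by blast
 moreover have "AE x in lebesgue. indicat_real S x *\<^sub>R f x = indicat_real S x *\<^sub>R g x"
 proof -
  have "AE x in lborel. x \<in> S --> f x = g x" using ae unfolding AE_lebesgue_on_iff[OF S] .
  then have "AE x in lborel. indicat_real S x *\<^sub>R f x = indicat_real S x *\<^sub>R g x" by eventually_elim (auto simp: indicator_def)
  then show ?thesis by (rule AE_completion)
 qed
 ultimately have "(%x. indicat_real S x *\<^sub>R g x) \<in> borel_measurable lebesgue" by (rule borel_measurable_AE)
 then show ?thesis using borel_measurable_restrict_space_iff[OF S'] by blast
qed

lemma integrable_lebesgue_on_AE:
 fixes f g :: "plane => real"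
 assumes S: "S \<in> sets borel" and f: "integrable (lebesgue_on S) f" and ae: "AE x in lebesgue_on S. f x = g x"
 shows "integrable (lebesgue_on S) g" and "(LINT x|lebesgue_on S. g x) = (LINT x|lebesgue_on S. f x)"
proof -
 have fm: "f \<in> borel_measurable (lebesgue_on S)" using f by auto
 have m: "g \<in> borel_measurable (lebesgue_on S)" by (rule borel_measurable_lebesgue_on_AE[OF S fm ae])
 show "integrable (lebesgue_on S) g" by (rule integrable_cong_AE_imp[OF f m ae])
 show "(LINT x|lebesgue_on S. g x) = (LINT x|lebesgue_on S. f x)"
  by (rule integral_cong_AE[OF m fm]) (use ae in eventually_elim, simp)
qed

lemma integrable_lebesgue_on_subset:
 fixes f :: "plane => real"
 assumes S: "S \<in> sets borel" and C: "C \<in> sets borel" "C \<subseteq> S" and f: "integrable (lebesgue_on S) f"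
 shows "integrable (lebesgue_on C) f"
proof -
 have S': "S \<inter> space lebesgue \<in> sets lebesgue" "C \<inter> space lebesgue \<in> sets lebesgue" using S C by auto
 have 1: "integrable lebesgue (%x. indicat_real S x *\<^sub>R f x)" using f integrable_restrict_space[OF S'(1)] by blast
 have "integrable lebesgue (%x. indicat_real C x *\<^sub>R (indicat_real S x *\<^sub>R f x))"
  by (rule integrable_mult_indicator[OF _ 1]) (use C in simp)
 moreover have "(%x. indicat_real C x *\<^sub>R (indicat_real S x *\<^sub>R f x)) = (%x. indicat_real C x *\<^sub>R f x)"
 proof (rule ext)
  fix x show "indicat_real C x *\<^sub>R (indicat_real S x *\<^sub>R f x) = indicat_real C x *\<^sub>R f x"
   using C(2) by (cases "x \<in> C") (simp_all add: subsetD)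
 qed
 ultimately have "integrable lebesgue (%x. indicat_real C x *\<^sub>R f x)" by (simp only:)
 then show ?thesis using integrable_restrict_space[OF S'(2)] by blast
qed

lemma L1_locally_integrable:
 assumes "open G" and "integrable (lebesgue_on G) f" shows "locally_integrable G f"
 unfolding locally_integrable_def
 using integrable_lebesgue_on_subset[OF _ _ _ assms(2)] assms(1) by (auto simp: borel_compact)

lemma integral_lebesgue_on_test:
 fixes f :: "plane => real"
 assumes V: "open V" "V \<subseteq> G" and G: "open G" and \<phi>: "!!x. x \<notin> V ==> \<phi> x = 0"
 shows "(LINT x|lebesgue_on G. f x * \<phi> x) = (LINT x|lebesgue_on V. f x * \<phi> x)"
proof -
 have S: "V \<inter> space lebesgue \<in> sets lebesgue" "G \<inter> space lebesgue \<in> sets lebesgue" using V G by auto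
 have "indicat_real G x *\<^sub>R (f x * \<phi> x) = indicat_real V x *\<^sub>R (f x * \<phi> x)" for x
  using V(2) \<phi>[of x] by (cases "x \<in> V") (auto simp: indicator_def)
 then show ?thesis unfolding integral_restrict_space[OF S(1)] integral_restrict_space[OF S(2)] by presburger
qed

lemma test_zero_outside: "\<phi> \<in> test_functions V ==> x \<notin> V ==> \<phi> x = 0"
 using closure_subset[of "{x. \<phi> x \<noteq> 0}"] unfolding test_functions_def by blast

lemma test_partial_zero_outside: "\<phi> \<in> test_functions V ==> x \<notin> V ==> partial_deriv e \<phi> x = 0"
 using partial_support[of e \<phi>] unfolding test_functions_def by blast

lemma AE_eq_if_test_integrals_eq:
 fixes f g :: "plane => real"
 assumes V: "open V" and f: "integrable (lebesgue_on V) f" and g: "integrable (lebesgue_on V) g"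
  and eq: "!!\<phi>. \<phi> \<in> test_functions V ==> (LINT x|lebesgue_on V. f x * \<phi> x) = (LINT x|lebesgue_on V. g x * \<phi> x)"
 shows "AE x in lebesgue_on V. f x = g x"
proof (rule AE_eq_if_borel_integrals_eq[OF f g])
 show Vb: "V \<in> sets borel" using V by simp
 note nm = null_measure_on[OF Vb]
 have one: "(%_. 1) \<in> borel_measurable (null_measure_on V)" "AE x in null_measure_on V. \<bar>1\<bar> \<le> (1::real)" by auto
 obtain P N where P: "finite_borel_measure_on V P" "finite_borel_measure_on V N"
  "\<forall>\<phi>. bounded_borel_on V \<phi> --> (LINT x|P. \<phi> x) - (LINT x|N. \<phi> x) = (LINT x|lebesgue_on V. \<phi> x * f x) + (LINT x|null_measure_on V. \<phi> x * 1)"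
  using signed_measure_of_densities[OF Vb f nm(1) one] by blast
 obtain P' N' where P': "finite_borel_measure_on V P'" "finite_borel_measure_on V N'"
  "\<forall>\<phi>. bounded_borel_on V \<phi> --> (LINT x|P'. \<phi> x) - (LINT x|N'. \<phi> x) = (LINT x|lebesgue_on V. \<phi> x * g x) + (LINT x|null_measure_on V. \<phi> x * 1)"
  using signed_measure_of_densities[OF Vb g nm(1) one] by blast
 fix B :: "plane set" assume B: "B \<in> sets borel" "B \<subseteq> V"
 have m: "measure P B - measure N B = measure P' B - measure N' B"
 proof (rule test_functions_separate[OF V P(1,2) P'(1,2) _ B])
  fix \<phi> assume t: "\<phi> \<in> test_functions V"
  have bb: "bounded_borel_on V \<phi>" by (rule test_bounded_borel[OF t])
  show "(LINT x|P. \<phi> x) - (LINT x|N. \<phi> x) = (LINT x|P'. \<phi> x) - (LINT x|N'. \<phi> x)"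
   using P(3)[rule_format, OF bb] P'(3)[rule_format, OF bb] eq[OF t] by (simp add: nm(2) mult.commute)
 qed
 have ind: "(LINT x|M. indicator B x) = measure M B" if "finite_borel_measure_on V M" for M
  using fbm(3)[OF that] B(2) by (simp add: Int_absorb2)
 have bB: "bounded_borel_on V (indicator B)" by (rule bounded_borel_on_indicator[OF B(1)])
 have "measure P B - measure N B = (LINT x|lebesgue_on V. indicator B x * f x)"
  using P(3)[rule_format, OF bB] unfolding nm(2) ind[OF P(1)] ind[OF P(2)] by linarith
 moreover have "measure P' B - measure N' B = (LINT x|lebesgue_on V. indicator B x * g x)"
  using P'(3)[rule_format, OF bB] unfolding nm(2) ind[OF P'(1)] ind[OF P'(2)] by linarith
 ultimately show "(LINT x|lebesgue_on V. indicator B x * f x) = (LINT x|lebesgue_on V. indicator B x * g x)"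
  using m by linarith
qed

text \<open>Weak derivatives are only locally integrable, so uniqueness is proved on countably many balls that cover the open
 set.\<close>

lemma weak_deriv_unique:
 assumes G: "open G" and f: "has_weak_deriv G e u f" and g: "has_weak_deriv G e u g"
 shows "AE x in lebesgue_on G. f x = g x"
proof -
 define \<B> where "\<B> = {ball x r | x r. cball x r \<subseteq> G}"
 have "!!S. S \<in> \<B> ==> open S" by (auto simp: \<B>_def)
 then obtain \<C> where C: "\<C> \<subseteq> \<B>" "countable \<C>" "\<Union>\<C> = \<Union>\<B>" using Lindelof[of \<B>] by blast
 have "\<Union>\<B> = G"
 proof
  show "\<Union>\<B> \<subseteq> G" using ball_subset_cball by (fastforce simp: \<B>_def)
  show "G \<subseteq> \<Union>\<B>"
  proof
   fix x assume "x \<in> G"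
   then obtain r where "r > 0" "cball x r \<subseteq> G" using G open_contains_cball by blast
   then show "x \<in> \<Union>\<B>" unfolding \<B>_def by (intro UnionI[of "ball x r"]) auto
  qed
 qed
 have loc: "AE x in lborel. x \<in> V --> f x = g x" if V: "V \<in> \<C>" for V
 proof -
  obtain x r where xr: "V = ball x r" "cball x r \<subseteq> G" using V C(1) unfolding \<B>_def by blast
  have V': "open V" "V \<subseteq> G" "V \<in> sets borel" using xr ball_subset_cball by auto
  have i: "integrable (lebesgue_on V) k" if "locally_integrable G k" for k :: "plane => real"
   using that xr ball_subset_cball[of x r]
   by (intro integrable_lebesgue_on_subset[of "cball x r" V]) (auto simp: locally_integrable_def)
  have "AE x in lebesgue_on V. f x = g x"
  proof (rule AE_eq_if_test_integrals_eq[OF V'(1)])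
   show "integrable (lebesgue_on V) f" "integrable (lebesgue_on V) g" using i f g by (auto simp: has_weak_deriv_def)
   fix \<phi> assume t: "\<phi> \<in> test_functions V"
   then have t': "\<phi> \<in> test_functions G" using test_functions_mono[OF V'(2)] by blast
   have z: "!!x. x \<notin> V ==> \<phi> x = 0" using test_zero_outside[OF t] by blast
   have "(LINT x|lebesgue_on G. f x * \<phi> x) = (LINT x|lebesgue_on G. g x * \<phi> x)"
    using f[unfolded has_weak_deriv_def, THEN conjunct2, THEN conjunct2, rule_format, OF t']
     g[unfolded has_weak_deriv_def, THEN conjunct2, THEN conjunct2, rule_format, OF t'] by linarith
   then show "(LINT x|lebesgue_on V. f x * \<phi> x) = (LINT x|lebesgue_on V. g x * \<phi> x)"
    using integral_lebesgue_on_test[where f = f and \<phi> = \<phi>, OF V'(1,2) G z] integral_lebesgue_on_test[where f = g and \<phi> = \<phi>, OF V'(1,2) G z] by linarith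
  qed
  then show ?thesis unfolding AE_lebesgue_on_iff[OF V'(3)] .
 qed
 have "AE x in lborel. \<forall>V\<in>\<C>. x \<in> V --> f x = g x" by (rule iffD2[OF AE_ball_countable[OF C(2)]]) (rule ballI, rule loc)
 then have "AE x in lborel. x \<in> G --> f x = g x"
 proof eventually_elim
  case (elim x)
  show ?case
  proof
   assume "x \<in> G"
   then obtain V where "V \<in> \<C>" "x \<in> V" using C(3) \<open>\<Union>\<B> = G\<close> by blast
   then show "f x = g x" using elim by blast
  qed
 qed
 then show ?thesis using G by (subst AE_lebesgue_on_iff) auto
qed

lemma weak_deriv_AE:
 assumes "open G" and "has_weak_deriv G e u g"
 shows "AE x in lebesgue_on G. g x = weak_deriv G e u x"
proof -
 have "has_weak_deriv G e u (weak_deriv G e u)" unfolding weak_deriv_def by (rule someI[of "has_weak_deriv G e u", OF assms(2)])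
 then show ?thesis by (rule weak_deriv_unique[OF assms(1,2)])
qed

lemma weak_deriv_deriv_rep:
 assumes G: "open G" and g: "has_weak_deriv G e u g" "integrable (lebesgue_on G) g"
 shows "deriv_rep G e u g (null_measure_on G) (%_. 1)"
proof -
 have Gb: "G \<in> sets borel" using G by simp
 show ?thesis
  unfolding deriv_rep_def using g null_measure_on(1)[OF Gb]
  by (simp add: has_weak_deriv_def null_measure_on(2)[OF Gb] mult.commute)
qed

text \<open>The common part of two computations: with \<open>R = 0\<close> for test functions, and with a boundary integral
 \<open>R\<close> for smooth functions on the plane.\<close>

lemma green_identity_comb:
 assumes Gb: "G \<in> sets borel" and v: "integrable (lebesgue_on G) v" "integrable (lebesgue_on G) \<rho>"
  and z: "integrable (lebesgue_on G) z" "integrable (lebesgue_on G) \<zeta>"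
  and bb: "bounded_borel_on G \<phi>" "bounded_borel_on G \<phi>'"
  and gv: "(LINT x|lebesgue_on G. v x * \<phi>' x) = - ((LINT x|lebesgue_on G. \<phi> x * \<rho> x) + (LINT x|S. \<phi> x * h x)) + R"
  and gz: "(LINT x|lebesgue_on G. z x * \<phi>' x) = - (LINT x|lebesgue_on G. \<phi> x * \<zeta> x)"
 shows "(LINT x|lebesgue_on G. (a * v x + b * z x) * \<phi>' x)
   = - ((LINT x|lebesgue_on G. \<phi> x * (a * \<rho> x + b * \<zeta> x)) + (LINT x|S. \<phi> x * (a * h x))) + a * R"
proof -
 note i = integrable_bounded_borel_mult[OF Gb v(1) bb(2)] integrable_bounded_borel_mult[OF Gb z(1) bb(2)]
  integrable_bounded_borel_mult[OF Gb v(2) bb(1)] integrable_bounded_borel_mult[OF Gb z(2) bb(1)]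
 have "(%x. (a * v x + b * z x) * \<phi>' x) = (%x. a * (\<phi>' x * v x) + b * (\<phi>' x * z x))"
  "(%x. \<phi> x * (a * \<rho> x + b * \<zeta> x)) = (%x. a * (\<phi> x * \<rho> x) + b * (\<phi> x * \<zeta> x))"
  "(%x. \<phi> x * (a * h x)) = (%x. a * (\<phi> x * h x))"
  by (rule ext, simp add: algebra_simps)+
 moreover have "R = (LINT x|lebesgue_on G. \<phi>' x * v x) + ((LINT x|lebesgue_on G. \<phi> x * \<rho> x) + (LINT x|S. \<phi> x * h x))"
  using gv by (simp add: mult.commute)
 moreover have "(LINT x|lebesgue_on G. \<phi>' x * z x) = - (LINT x|lebesgue_on G. \<phi> x * \<zeta> x)"
  using gz by (simp only: mult.commute)
 ultimately show ?thesis using i by (simp add: algebra_simps)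
qed

lemma deriv_rep_comb:
 assumes G: "open G" and e: "e = e1 \<or> e = e2" and v: "integrable (lebesgue_on G) v" "deriv_rep G e v \<rho> S h"
  and z: "integrable (lebesgue_on G) z" "has_weak_deriv G e z \<zeta>" "integrable (lebesgue_on G) \<zeta>" and a: "abs a \<le> 1"
 shows "deriv_rep G e (%x. a * v x + b * z x) (%x. a * \<rho> x + b * \<zeta> x) S (%x. a * h x)"
proof -
 have Gb: "G \<in> sets borel" using G by simp
 have r: "integrable (lebesgue_on G) \<rho>" "finite_borel_measure_on G S" "h \<in> borel_measurable S" "AE x in S. \<bar>h x\<bar> \<le> 1"
  using v(2) by (auto simp: deriv_rep_def)
 show ?thesis
  unfolding deriv_rep_def
 proof (intro conjI ballI)
  show "integrable (lebesgue_on G) (%x. a * \<rho> x + b * \<zeta> x)" using r z by auto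
  show "AE x in S. \<bar>a * h x\<bar> \<le> 1" using r(4) by eventually_elim (use a in "simp add: abs_mult mult_le_one")
  fix \<phi> assume t: "\<phi> \<in> test_functions G"
  have t': "\<phi> \<in> test_functions UNIV" using t test_functions_mono by blast
  have bp: "bounded_borel_on G (partial_deriv e \<phi>)" using test_partial[OF t' e] test_bounded_borel by blast
  have gv: "(LINT x|lebesgue_on G. v x * partial_deriv e \<phi> x) = - ((LINT x|lebesgue_on G. \<phi> x * \<rho> x) + (LINT x|S. \<phi> x * h x)) + 0"
   using v(2) t by (simp add: deriv_rep_def)
  have gz: "(LINT x|lebesgue_on G. z x * partial_deriv e \<phi> x) = - (LINT x|lebesgue_on G. \<phi> x * \<zeta> x)"
   using z(2) t by (simp add: has_weak_deriv_def mult.commute)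
  show "(LINT x|lebesgue_on G. (a * v x + b * z x) * partial_deriv e \<phi> x)
   = - ((LINT x|lebesgue_on G. \<phi> x * (a * \<rho> x + b * \<zeta> x)) + (LINT x|S. \<phi> x * (a * h x)))"
   using green_identity_comb[OF Gb v(1) r(1) z(1,3) test_bounded_borel[OF t] bp gv gz, of a b] by (simp only: mult_zero_right add_0_right)
 qed (use r in auto)
qed

text \<open>The Gauss-Green formula does not depend on how the derivative measure is represented.\<close>

lemma gauss_green_iff:
 assumes G: "open G" "bounded G" and r: "deriv_rep G e v \<rho> S h"
 shows "gauss_green G e v t \<longleftrightarrow> (\<forall>\<phi>. C_k (Suc 0) \<phi> --> (LINT x|lebesgue_on G. v x * partial_deriv e \<phi> x)
   = - ((LINT x|lebesgue_on G. \<phi> x * \<rho> x) + (LINT x|S. \<phi> x * h x))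
    + (LINT x|boundary_measure G. \<phi> x * (outward_normal G x \<bullet> e) * t x))" (is "_ \<longleftrightarrow> ?R")
proof -
 obtain P N where PN: "has_deriv_measure G e v P N" "\<forall>\<phi>. bounded_borel_on G \<phi> -->
   (LINT x|P. \<phi> x) - (LINT x|N. \<phi> x) = (LINT x|lebesgue_on G. \<phi> x * \<rho> x) + (LINT x|S. \<phi> x * h x)"
  using deriv_rep_measure[OF G(1) r] by blast
 have bb: "bounded_borel_on G \<phi>" if "C_k (Suc 0) \<phi>" for \<phi>
  using C_k_continuous[OF that] G(2) by (rule bounded_borel_on_continuous)
 show ?thesis
 proof
  assume "gauss_green G e v t"
  then obtain P' N' where P': "has_deriv_measure G e v P' N'" "\<forall>\<phi>. C_k (Suc 0) \<phi> -->
      (LINT x|lebesgue_on G. v x * partial_deriv e \<phi> x)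
      = - ((LINT x|P'. \<phi> x) - (LINT x|N'. \<phi> x))
       + (LINT x|boundary_measure G. \<phi> x * (outward_normal G x \<bullet> e) * t x)"
   unfolding gauss_green_def One_nat_def by blast
  show ?R
  proof (intro allI impI)
   fix \<phi> assume c: "C_k (Suc 0) \<phi>"
   show "(LINT x|lebesgue_on G. v x * partial_deriv e \<phi> x)
    = - ((LINT x|lebesgue_on G. \<phi> x * \<rho> x) + (LINT x|S. \<phi> x * h x))
    + (LINT x|boundary_measure G. \<phi> x * (outward_normal G x \<bullet> e) * t x)"
    using P'(2)[rule_format, OF c] PN(2)[rule_format, OF bb[OF c]] deriv_measure_unique[OF G(1) P'(1) PN(1) bb[OF c]] by simp
  qed
 next
  assume R: ?R
  show "gauss_green G e v t"
   unfolding gauss_green_def One_nat_def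
  proof (intro exI conjI allI impI)
   show "has_deriv_measure G e v P N" by (rule PN(1))
   fix \<phi> assume c: "C_k (Suc 0) \<phi>"
   show "(LINT x|lebesgue_on G. v x * partial_deriv e \<phi> x)
      = - ((LINT x|P. \<phi> x) - (LINT x|N. \<phi> x))
       + (LINT x|boundary_measure G. \<phi> x * (outward_normal G x \<bullet> e) * t x)"
    using R[rule_format, OF c] PN(2)[rule_format, OF bb[OF c]] by simp
  qed
 qed
qed

lemma deriv_rep_BV:
 assumes "open G" and "integrable (lebesgue_on G) v" and "deriv_rep G e1 v \<rho>1 S1 h1" and "deriv_rep G e2 v \<rho>2 S2 h2"
 shows "v \<in> BV G"
 using assms(2) deriv_rep_measure[OF assms(1,3)] deriv_rep_measure[OF assms(1,4)] unfolding BV_def L1_def by blast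

lemma W11_weak_derivs:
 assumes G: "open G" and v: "v \<in> W11 G" and e: "e = e1 \<or> e = e2"
 shows "has_weak_deriv G e v (weak_deriv G e v)" and "integrable (lebesgue_on G) (weak_deriv G e v)" and "integrable (lebesgue_on G) v"
proof -
 obtain g where g: "integrable (lebesgue_on G) g" "has_weak_deriv G e v g" using v e unfolding W11_def L1_def by blast
 show "has_weak_deriv G e v (weak_deriv G e v)" unfolding weak_deriv_def by (rule someI[of "has_weak_deriv G e v", OF g(2)])
 show "integrable (lebesgue_on G) (weak_deriv G e v)"
  by (rule integrable_lebesgue_on_AE(1)[OF _ g(1) weak_deriv_AE[OF G g(2)]]) (use G in simp)
 show "integrable (lebesgue_on G) v" using v by (simp add: W11_def L1_def)
qed

lemma test_by_parts_lebesgue_on: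
 assumes G: "open G" and ps: "ps \<in> test_functions G" and \<phi>: "C_k (Suc 0) \<phi>" and e: "e = e1 \<or> e = e2"
 shows "(LINT x|lebesgue_on G. ps x * partial_deriv e \<phi> x) = - (LINT x|lebesgue_on G. \<phi> x * partial_deriv e ps x)"
proof -
 have ps': "ps \<in> test_functions UNIV" using ps test_functions_mono by blast
 have c: "C_k (Suc 0) ps" "bounded {x. ps x \<noteq> 0}" using ps' unfolding test_functions_UNIV_iff by blast+
 have cc: "continuous_on UNIV ps" "continuous_on UNIV \<phi>" using C_k_continuous c \<phi> by blast+
 have cp: "continuous_on UNIV (partial_deriv e ps)" "continuous_on UNIV (partial_deriv e \<phi>)" using c(1) \<phi> e by auto
 have Gb: "G \<in> sets borel" using G by simp
 have 1: "(LINT x|lebesgue_on G. ps x * partial_deriv e \<phi> x) = (LBINT x. ps x * partial_deriv e \<phi> x)"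
  by (rule integral_lebesgue_on_eq(1)[OF Gb])
    (use cc cp test_zero_outside[OF ps] in "auto intro!: borel_measurable_continuous_onI continuous_intros")
 have 2: "(LINT x|lebesgue_on G. \<phi> x * partial_deriv e ps x) = (LBINT x. \<phi> x * partial_deriv e ps x)"
  by (rule integral_lebesgue_on_eq(1)[OF Gb])
    (use cc cp test_partial_zero_outside[OF ps] in "auto intro!: borel_measurable_continuous_onI continuous_intros")
 show ?thesis unfolding 1 2 using integral_by_parts[OF c(1) \<phi> c(2) e] by (simp add: mult.commute)
qed

lemma test_has_weak_deriv:
 assumes G: "open G" and \<phi>: "\<phi> \<in> test_functions G" and e: "e = e1 \<or> e = e2"
 shows "integrable (lebesgue_on G) \<phi>" and "integrable (lebesgue_on G) (partial_deriv e \<phi>)"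
  and "has_weak_deriv G e \<phi> (partial_deriv e \<phi>)"
proof -
 have Gb: "G \<in> sets borel" using G by simp
 have \<phi>': "\<phi> \<in> test_functions UNIV" using \<phi> test_functions_mono by blast
 have iT: "integrable (lebesgue_on G) q" if "q \<in> test_functions UNIV" "!!x. x \<notin> G ==> q x = 0" for q
 proof -
  have "integrable lborel q" by (rule test_integrable[OF that(1)])
  then show ?thesis using integral_lebesgue_on_eq(2)[OF Gb _ that(2)] by auto
 qed
 show i: "integrable (lebesgue_on G) \<phi>" using iT[OF \<phi>'] test_zero_outside[OF \<phi>] by blast
 show i': "integrable (lebesgue_on G) (partial_deriv e \<phi>)"
  using iT[OF test_partial[OF \<phi>' e]] test_partial_zero_outside[OF \<phi>] by blast
 show "has_weak_deriv G e \<phi> (partial_deriv e \<phi>)"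
  unfolding has_weak_deriv_def
 proof (intro conjI ballI)
  fix ps assume "ps \<in> test_functions G"
  then have "ps \<in> test_functions UNIV" using test_functions_mono by blast
  then have "C_k (Suc 0) ps" unfolding test_functions_UNIV_iff by blast
  from test_by_parts_lebesgue_on[OF G \<phi> this e]
  show "(LINT x|lebesgue_on G. \<phi> x * partial_deriv e ps x) = - (LINT x|lebesgue_on G. partial_deriv e \<phi> x * ps x)"
   by (simp add: mult.commute)
 qed (use L1_locally_integrable[OF G] i i' in blast)+
qed

text \<open>Functions in the closure of the test functions have trace zero: integration by parts passes to the limit.\<close>

lemma W11_0_by_parts:
 assumes G: "open G" "bounded G" and v: "v \<in> W11_0 G" and \<phi>: "C_k (Suc 0) \<phi>" and e: "e = e1 \<or> e = e2"
 shows "(LINT x|lebesgue_on G. v x * partial_deriv e \<phi> x) = - (LINT x|lebesgue_on G. \<phi> x * weak_deriv G e v x)"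
proof -
 let ?L = "lebesgue_on G"
 have Gb: "G \<in> sets borel" using G by simp
 have vW: "v \<in> W11 G" using v by (simp add: W11_0_def)
 note wd = W11_weak_derivs[OF G(1) vW]
 have bb: "bounded_borel_on G \<phi>" "bounded_borel_on G (partial_deriv e \<phi>)"
  using C_k_continuous[OF \<phi>] \<phi> e G(2) by (auto intro!: bounded_borel_on_continuous)
 obtain C1 C2 where C: "\<forall>x\<in>G. \<bar>\<phi> x\<bar> \<le> C1" "\<forall>x\<in>G. \<bar>partial_deriv e \<phi> x\<bar> \<le> C2" using bb unfolding bounded_borel_on_def by blast
 define C where "C = max 1 (max C1 C2)"
 have CC: "C > 0" "!!x. x \<in> G ==> \<bar>\<phi> x\<bar> \<le> C" "!!x. x \<in> G ==> \<bar>partial_deriv e \<phi> x\<bar> \<le> C"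
  using C by (auto simp: C_def le_max_iff_disj)
 let ?d = "(LINT x|?L. v x * partial_deriv e \<phi> x) + (LINT x|?L. \<phi> x * weak_deriv G e v x)"
 have "abs ?d \<le> eps" if eps: "eps > 0" for eps
 proof -
  obtain ps where ps: "ps \<in> test_functions G"
   "(LINT x|?L. \<bar>v x - ps x\<bar>) + (LINT x|?L. norm (weak_gradient G v x - gradient ps x)) < eps / C"
   using v eps CC(1) unfolding W11_0_def by (auto dest!: spec[of _ "eps / C"])
  have ps': "ps \<in> test_functions UNIV" using ps(1) test_functions_mono by blast
  note ips = test_has_weak_deriv(1)[OF G(1) ps(1) e] and ip = test_has_weak_deriv(2)[OF G(1) ps(1)]
  have ig: "integrable ?L (%x. norm (weak_gradient G v x - gradient ps x))"
  proof (rule integrable_abs_le)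
   show "integrable ?L (%x. \<bar>weak_deriv G e1 v x - partial_deriv e1 ps x\<bar> + \<bar>weak_deriv G e2 v x - partial_deriv e2 ps x\<bar>)"
    using wd ip by auto
   have "(%x. (weak_deriv G e1 v x - partial_deriv e1 ps x, weak_deriv G e2 v x - partial_deriv e2 ps x)) \<in> borel_measurable ?L"
    using wd ip by (intro borel_measurable_Pair borel_measurable_diff) auto
   then show "(%x. norm (weak_gradient G v x - gradient ps x)) \<in> borel_measurable ?L"
    by (simp add: weak_gradient_def gradient_def)
   show "\<bar>norm (weak_gradient G v x - gradient ps x)\<bar> \<le> \<bar>weak_deriv G e1 v x - partial_deriv e1 ps x\<bar> + \<bar>weak_deriv G e2 v x - partial_deriv e2 ps x\<bar>" for x
    using norm_Pair_le[of "weak_deriv G e1 v x - partial_deriv e1 ps x" "weak_deriv G e2 v x - partial_deriv e2 ps x"]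
    by (simp add: weak_gradient_def gradient_def)
  qed
  have i4: "integrable ?L (%x. partial_deriv e \<phi> x * v x)" "integrable ?L (%x. partial_deriv e \<phi> x * ps x)"
   "integrable ?L (%x. \<phi> x * weak_deriv G e v x)" "integrable ?L (%x. \<phi> x * partial_deriv e ps x)"
   by (rule integrable_bounded_borel_mult[OF Gb wd(3)[OF e] bb(2)] integrable_bounded_borel_mult[OF Gb ips bb(2)]
    integrable_bounded_borel_mult[OF Gb wd(2)[OF e] bb(1)] integrable_bounded_borel_mult[OF Gb ip[OF e] bb(1)])+
  have "?d = (LINT x|?L. partial_deriv e \<phi> x * v x) - (LINT x|?L. partial_deriv e \<phi> x * ps x)
    + ((LINT x|?L. \<phi> x * weak_deriv G e v x) - (LINT x|?L. \<phi> x * partial_deriv e ps x))"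
   using test_by_parts_lebesgue_on[OF G(1) ps(1) \<phi> e] by (simp add: mult.commute)
  also have "... = (LINT x|?L. (partial_deriv e \<phi> x * v x - partial_deriv e \<phi> x * ps x) + (\<phi> x * weak_deriv G e v x - \<phi> x * partial_deriv e ps x))"
   using i4 by simp
  finally have "abs ?d \<le> (LINT x|?L. \<bar>(partial_deriv e \<phi> x * v x - partial_deriv e \<phi> x * ps x) + (\<phi> x * weak_deriv G e v x - \<phi> x * partial_deriv e ps x)\<bar>)"
   by (simp only: integral_abs_bound)
  also have "... \<le> (LINT x|?L. C * \<bar>v x - ps x\<bar> + C * norm (weak_gradient G v x - gradient ps x))"
  proof (rule integral_mono)
   show "integrable ?L (%x. \<bar>(partial_deriv e \<phi> x * v x - partial_deriv e \<phi> x * ps x) + (\<phi> x * weak_deriv G e v x - \<phi> x * partial_deriv e ps x)\<bar>)"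
    using i4 by auto
   show "integrable ?L (%x. C * \<bar>v x - ps x\<bar> + C * norm (weak_gradient G v x - gradient ps x))" using wd(3)[OF e] ips ig by auto
   fix x assume "x \<in> space ?L"
   then have x: "x \<in> G" by simp
   have g: "\<bar>weak_deriv G e v x - partial_deriv e ps x\<bar> \<le> norm (weak_gradient G v x - gradient ps x)"
    using e norm_fst_le[of "fst (weak_gradient G v x - gradient ps x)" "snd (weak_gradient G v x - gradient ps x)"]
     norm_snd_le[of "snd (weak_gradient G v x - gradient ps x)" "fst (weak_gradient G v x - gradient ps x)"]
    by (auto simp: weak_gradient_def gradient_def)
   have "\<bar>partial_deriv e \<phi> x * (v x - ps x)\<bar> \<le> C * \<bar>v x - ps x\<bar>"
    unfolding abs_mult using CC(3)[OF x] by (rule mult_right_mono) simp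
   moreover have "\<bar>\<phi> x * (weak_deriv G e v x - partial_deriv e ps x)\<bar> \<le> C * norm (weak_gradient G v x - gradient ps x)"
    unfolding abs_mult by (rule mult_mono[OF CC(2)[OF x] g]) (use CC in auto)
   ultimately show "\<bar>(partial_deriv e \<phi> x * v x - partial_deriv e \<phi> x * ps x) + (\<phi> x * weak_deriv G e v x - \<phi> x * partial_deriv e ps x)\<bar>
     \<le> C * \<bar>v x - ps x\<bar> + C * norm (weak_gradient G v x - gradient ps x)"
    unfolding right_diff_distrib[symmetric] by linarith
  qed
  also have "... = C * ((LINT x|?L. \<bar>v x - ps x\<bar>) + (LINT x|?L. norm (weak_gradient G v x - gradient ps x)))"
   using wd(3)[OF e] ips ig by (simp add: distrib_left)
  also have "... \<le> C * (eps / C)" using ps(2) CC(1) by (intro mult_left_mono) auto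
  also have "... = eps" using CC(1) by simp
  finally show ?thesis .
 qed
 then have "abs ?d \<le> 0 + eps" if "eps > 0" for eps using that by (simp only: add_0)
 then have "abs ?d \<le> 0" by (rule field_le_epsilon)
 then show ?thesis by linarith
qed

section \<open>The primal functional\<close>

lemma enn2ereal_enn2real: "x < \<infinity> ==> enn2ereal x = ereal (enn2real x)"
 by (cases x rule: ennreal_cases) (auto simp: enn2ereal_ennreal)

text \<open>The lower bound makes the negative part of the integral finite, so no indeterminate difference occurs.\<close>

lemma ext_integral_ge:
 assumes g: "integrable M g" and F: "AE x in M. ereal (g x) \<le> F x"
 shows "ereal (LINT x|M. g x) \<le> ext_integral M F"
proof -
 have fin: "(\<integral>\<^sup>+x. ennreal (g x) \<partial>M) < \<infinity>" "(\<integral>\<^sup>+x. ennreal (- g x) \<partial>M) < \<infinity>"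
  using g unfolding real_integrable_def by (auto simp: less_top)
 have "ereal (LINT x|M. g x) = enn2ereal (\<integral>\<^sup>+x. ennreal (g x) \<partial>M) - enn2ereal (\<integral>\<^sup>+x. ennreal (- g x) \<partial>M)"
  unfolding real_lebesgue_integral_def[OF g] enn2ereal_enn2real[OF fin(1)] enn2ereal_enn2real[OF fin(2)] by simp
 also have "... \<le> ext_integral M F"
  unfolding ext_integral_def
 proof (rule ereal_minus_mono)
  have "(\<integral>\<^sup>+x. ennreal (g x) \<partial>M) \<le> (\<integral>\<^sup>+x. e2ennreal (F x) \<partial>M)"
  proof (rule nn_integral_mono_AE)
   show "AE x in M. ennreal (g x) \<le> e2ennreal (F x)"
    using F
   proof eventually_elim
    case (elim x)
    show ?case using e2ennreal_mono[OF elim] by simp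
   qed
  qed
  then show "enn2ereal (\<integral>\<^sup>+x. ennreal (g x) \<partial>M) \<le> enn2ereal (\<integral>\<^sup>+x. e2ennreal (F x) \<partial>M)"
   by (simp add: less_eq_ennreal.rep_eq)
  have "(\<integral>\<^sup>+x. e2ennreal (- F x) \<partial>M) \<le> (\<integral>\<^sup>+x. ennreal (- g x) \<partial>M)"
  proof (rule nn_integral_mono_AE)
   show "AE x in M. e2ennreal (- F x) \<le> ennreal (- g x)"
    using F
   proof eventually_elim
    case (elim x)
    have "- F x \<le> - ereal (g x)" using elim by (simp only: ereal_minus_le_minus)
    from e2ennreal_mono[OF this] show ?case by simp
   qed
  qed
  then show "enn2ereal (\<integral>\<^sup>+x. e2ennreal (- F x) \<partial>M) \<le> enn2ereal (\<integral>\<^sup>+x. ennreal (- g x) \<partial>M)"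
   by (simp add: less_eq_ennreal.rep_eq)
 qed
 finally show ?thesis .
qed

lemma ext_integral_integrable:
 assumes f: "integrable M f" and F: "AE x in M. F x = ereal (f x)"
 shows "ext_integral M F = ereal (LINT x|M. f x)"
proof -
 have fin: "(\<integral>\<^sup>+x. ennreal (f x) \<partial>M) < \<infinity>" "(\<integral>\<^sup>+x. ennreal (- f x) \<partial>M) < \<infinity>"
  using f unfolding real_integrable_def by (auto simp: less_top)
 have 1: "(\<integral>\<^sup>+x. e2ennreal (F x) \<partial>M) = (\<integral>\<^sup>+x. ennreal (f x) \<partial>M)"
  by (rule nn_integral_cong_AE) (use F in eventually_elim, simp)
 have 2: "(\<integral>\<^sup>+x. e2ennreal (- F x) \<partial>M) = (\<integral>\<^sup>+x. ennreal (- f x) \<partial>M)"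
  by (rule nn_integral_cong_AE) (use F in eventually_elim, simp)
 show ?thesis
  unfolding ext_integral_def 1 2 real_lebesgue_integral_def[OF f] enn2ereal_enn2real[OF fin(1)] enn2ereal_enn2real[OF fin(2)] by simp
qed

lemma integrable_test_mult:
 assumes "integrable M f" and "\<phi> \<in> test_functions UNIV" and "\<phi> \<in> borel_measurable M"
 shows "integrable M (%x. \<phi> x * f x)"
 using test_bounded_borel[OF assms(2), of UNIV] integrable_mult_bounded[OF assms(1,3)] unfolding bounded_borel_on_def by blast

lemma deriv_measure_rep:
 assumes "open G" "bounded G" and "v \<in> BV G" and "e = e1 \<or> e = e2"
 shows "\<exists>\<rho> S h. has_lebesgue_decomposition G e v \<rho> S h"
proof -
 obtain P N where "has_deriv_measure G e v P N" using assms(3,4) unfolding BV_def by blast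
 then show ?thesis by (rule lebesgue_decomposition_exists[OF assms(1,2)])
qed

text \<open>Although the trace is only determined up to null sets, its product with the normal is all
 that the Gauss-Green formula sees.\<close>

lemma has_trace_unique:
 assumes G: "open G" "bounded G" and t: "has_trace G v t" and t': "has_trace G v t'" and e: "e = e1 \<or> e = e2"
 shows "AE x in boundary_measure G. (outward_normal G x \<bullet> e) * t x = (outward_normal G x \<bullet> e) * t' x"
proof -
 have v: "v \<in> BV G" using t by (simp add: has_trace_def)
 obtain \<rho> S h where d: "has_lebesgue_decomposition G e v \<rho> S h" using deriv_measure_rep[OF G v e] by blast
 have r: "deriv_rep G e v \<rho> S h" by (rule lebesgue_decomposition_deriv_rep[OF G(1) d])
 have gg: "gauss_green G e v t" "gauss_green G e v t'" using t t' e by (auto simp: has_trace_def)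
 have i: "integrable (boundary_measure G) t" "integrable (boundary_measure G) t'" using t t' by (simp_all add: has_trace_def)
 note ii = integrable_normal_component[OF i(1), of e] integrable_normal_component[OF i(2), of e]
 have "AE x in boundary_measure G. (outward_normal G x \<bullet> e) * t x - (outward_normal G x \<bullet> e) * t' x = 0"
 proof (rule boundary_function_unique)
  show "integrable (boundary_measure G) (%x. (outward_normal G x \<bullet> e) * t x - (outward_normal G x \<bullet> e) * t' x)"
   by (rule integrable_diff[OF ii])
  fix \<phi> assume \<phi>: "\<phi> \<in> test_functions UNIV"
  then have c: "C_k (Suc 0) \<phi>" unfolding test_functions_UNIV_iff by blast
  have m: "\<phi> \<in> borel_measurable (boundary_measure G)"
   using C_k_continuous[OF c] by (intro borel_measurable_boundary_measure borel_measurable_continuous_onI)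
  have "(LINT x|boundary_measure G. \<phi> x * (outward_normal G x \<bullet> e) * t x) = (LINT x|boundary_measure G. \<phi> x * (outward_normal G x \<bullet> e) * t' x)"
   using gg[unfolded gauss_green_iff[OF G r], THEN spec, THEN mp, OF c] by linarith
  then show "(LINT x|boundary_measure G. \<phi> x * ((outward_normal G x \<bullet> e) * t x - (outward_normal G x \<bullet> e) * t' x)) = 0"
   using integrable_test_mult[OF ii(1) \<phi> m] integrable_test_mult[OF ii(2) \<phi> m]
   by (simp add: right_diff_distrib mult.assoc)
 qed
 then show ?thesis by eventually_elim simp
qed

text \<open>The setting of the problem: the two integrands and the open bounded set on which they are integrated.\<close>

locale dirichlet_problem = linear_growth_integrand f1 f1' a1 a2 a3 a4 + delta2_N_function A A' c3 c
 for f1 f1' :: "real => real" and a1 a2 a3 a4 :: real and A A' :: "real => real" and c3 c :: real +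
 fixes G :: "plane set"
 assumes op: "open G" and bd: "bounded G"
begin

lemma Gb: "G \<in> sets borel" using op by simp

lemma finite_G: "finite_measure (lebesgue_on G)"
proof -
 have "G \<in> lmeasurable" using bd op by (intro bounded_set_imp_lmeasurable) auto
 then show ?thesis by (rule finite_measure_lebesgue_on)
qed

lemma const_integrable: "integrable (lebesgue_on G) (%x. k :: real)"
proof -
 interpret finite_measure "lebesgue_on G" by (rule finite_G)
 show ?thesis by simp
qed

lemma A_measurable: "g \<in> borel_measurable M ==> (%x. A \<bar>g x\<bar>) \<in> borel_measurable M"
 using borel_measurable_continuous_onI[OF f2_cont] by (rule measurable_compose[rotated])

text \<open>By the doubling property the scale in the definition of the Orlicz space can be taken to be one.\<close>

lemma orlicz_iff: "g \<in> orlicz A G \<longleftrightarrow> g \<in> borel_measurable (lebesgue_on G) \<and> integrable (lebesgue_on G) (%x. A \<bar>g x\<bar>)"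
proof
 assume g: "g \<in> orlicz A G"
 then obtain l where l: "l > 0" "(\<integral>\<^sup>+ x. ennreal (A (l * abs (g x))) \<partial>lebesgue_on G) < \<infinity>" and m: "g \<in> borel_measurable (lebesgue_on G)"
  unfolding orlicz_def by blast
 obtain C where C: "C > 0" "!!t. A \<bar>t\<bar> \<le> C * A (l * abs t)" using A_orlicz_scale[OF l(1)] by blast
 have eq: "A (l * abs t) = A \<bar>l * t\<bar>" for t using l(1) by (simp add: abs_mult)
 have m': "(%x. l * g x) \<in> borel_measurable (lebesgue_on G)" using m by (intro borel_measurable_times borel_measurable_const)
 have "integrable (lebesgue_on G) (%x. A (l * abs (g x)))"
  unfolding eq by (rule integrableI_nonneg[OF A_measurable[OF m']]) (use l(2) A_nonneg in "auto simp: eq")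
 then have i: "integrable (lebesgue_on G) (%x. C * A (l * abs (g x)))" by simp
 have "integrable (lebesgue_on G) (%x. A \<bar>g x\<bar>)"
  by (rule integrable_abs_le[OF i A_measurable[OF m]]) (use C(2) A_nonneg in simp)
 with m show "g \<in> borel_measurable (lebesgue_on G) \<and> integrable (lebesgue_on G) (%x. A \<bar>g x\<bar>)" by blast
next
 assume g: "g \<in> borel_measurable (lebesgue_on G) \<and> integrable (lebesgue_on G) (%x. A \<bar>g x\<bar>)"
 then have "(\<integral>\<^sup>+ x. ennreal (A \<bar>g x\<bar>) \<partial>lebesgue_on G) < \<infinity>" unfolding real_integrable_def by (auto simp: less_top)
 then show "g \<in> orlicz A G" unfolding orlicz_def using g by (auto intro!: exI[of _ "1::real"])
qed

lemma orlicz_integrable: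
 assumes "g \<in> orlicz A G" shows "integrable (lebesgue_on G) (%x. A \<bar>g x\<bar>)" and "integrable (lebesgue_on G) g"
proof -
 have m: "g \<in> borel_measurable (lebesgue_on G)" and i: "integrable (lebesgue_on G) (%x. A \<bar>g x\<bar>)"
  using assms unfolding orlicz_iff by blast+
 show "integrable (lebesgue_on G) (%x. A \<bar>g x\<bar>)" by (rule i)
 have "integrable (lebesgue_on G) (%x. A \<bar>g x\<bar> + N_conjugate A 1)" using i const_integrable by auto
 then show "integrable (lebesgue_on G) g"
 proof (rule integrable_abs_le[OF _ m])
  show "abs (g x) \<le> A \<bar>g x\<bar> + N_conjugate A 1" for x using conj_young[of "abs (g x)" 1] by simp
 qed
qed

lemma f1_comp_integrable:
 assumes g: "integrable (lebesgue_on G) g" shows "integrable (lebesgue_on G) (%x. f1 (g x))"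
 by (rule f1_integrable[OF finite_G g])

lemma recession_integral:
 assumes h: "integrable M h"
 shows "integrable M (%x. recession f1 (h x))"
  and "(LINT x|M. recession f1 (h x)) = recession f1 1 * (LINT x|M. max 0 (h x)) + recession f1 (-1) * (LINT x|M. max 0 (- h x))"
proof -
 have i: "integrable M (%x. max 0 (h x))" "integrable M (%x. max 0 (- h x))" using h by auto
 have eq: "(%x. recession f1 (h x)) = (%x. recession f1 1 * max 0 (h x) + recession f1 (-1) * max 0 (- h x))"
  by (rule ext) (rule recession_eq)
 show "integrable M (%x. recession f1 (h x))" unfolding eq using i by simp
 show "(LINT x|M. recession f1 (h x)) = recession f1 1 * (LINT x|M. max 0 (h x)) + recession f1 (-1) * (LINT x|M. max 0 (- h x))"
  unfolding eq using i by simp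
qed

lemma sing_density_integrable:
 assumes "has_lebesgue_decomposition G e v \<rho> S h" shows "integrable S h"
proof -
 have f: "finite_measure S" and m: "h \<in> borel_measurable S" and a: "AE x in S. \<bar>h x\<bar> = 1"
  using assms fbm(1) unfolding has_lebesgue_decomposition_def by blast+
 interpret finite_measure S by fact
 show ?thesis by (rule integrable_const_bound[of h 1, OF _ m]) (use a in eventually_elim, simp)
qed

text \<open>The definition of the functional chooses derivative parts, trace and weak derivative arbitrarily; by uniqueness
 any other choice gives the same value. The recession integrals depend on \<open>h\<close> only through its positive and
 negative mass.\<close>

lemma K_functional_eq:
 assumes d: "has_lebesgue_decomposition G e1 v \<rho> S h" and t: "has_trace G (%y. u0 y - v y) t"
  and g: "has_weak_deriv G e2 v g" "g \<in> orlicz A G"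
 shows "K_functional G f1 A u0 v = ereal ((LINT x|lebesgue_on G. f1 (\<rho> x)) + (LINT x|S. recession f1 (h x))
  + (LINT x|boundary_measure G. recession f1 (t x * fst (outward_normal G x))) + (LINT x|lebesgue_on G. A \<bar>g x\<bar>))"
proof -
 have d1: "\<exists>S h. has_lebesgue_decomposition G e1 v (ac_deriv G e1 v) S h"
  unfolding ac_deriv_def by (rule someI[of "%\<rho>. \<exists>S h. has_lebesgue_decomposition G e1 v \<rho> S h" \<rho>]) (use d in blast)
 then obtain S1 h1 where d1: "has_lebesgue_decomposition G e1 v (ac_deriv G e1 v) S1 h1" by blast
 have "\<exists>\<rho> h. has_lebesgue_decomposition G e1 v \<rho> (sing_variation G e1 v) h"
  unfolding sing_variation_def by (rule someI[of "%S. \<exists>\<rho> h. has_lebesgue_decomposition G e1 v \<rho> S h" S]) (use d in blast)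
 then obtain \<rho>2 h2 where d2: "has_lebesgue_decomposition G e1 v \<rho>2 (sing_variation G e1 v) h2" by blast
 have "\<exists>\<rho>. has_lebesgue_decomposition G e1 v \<rho> (sing_variation G e1 v) (sing_density G e1 v)"
  unfolding sing_density_def
  by (rule someI[of "%h. \<exists>\<rho>. has_lebesgue_decomposition G e1 v \<rho> (sing_variation G e1 v) h" h2]) (use d2 in blast)
 then obtain \<rho>3 where d3: "has_lebesgue_decomposition G e1 v \<rho>3 (sing_variation G e1 v) (sing_density G e1 v)" by blast
 have t': "has_trace G (%y. u0 y - v y) (bv_trace G (%y. u0 y - v y))"
  unfolding bv_trace_def by (rule someI[of _ t]) (rule t)
 let ?t = "bv_trace G (%y. u0 y - v y)" and ?n = "outward_normal G" and ?bm = "boundary_measure G"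
 have \<rho>i: "integrable (lebesgue_on G) \<rho>" using d by (simp add: has_lebesgue_decomposition_def L1_def)
 have 1: "ext_integral (lebesgue_on G) (%x. f1 (ac_deriv G e1 v x)) = ereal (LINT x|lebesgue_on G. f1 (\<rho> x))"
 proof (rule ext_integral_integrable[OF f1_comp_integrable[OF \<rho>i]])
  show "AE x in lebesgue_on G. ereal (f1 (ac_deriv G e1 v x)) = ereal (f1 (\<rho> x))"
   using lebesgue_decomposition_unique(1)[OF op d d1] by eventually_elim simp
 qed
 have hi: "integrable S h" "integrable (sing_variation G e1 v) (sing_density G e1 v)"
  using sing_density_integrable d d3 by blast+
 have 2: "ext_integral (sing_variation G e1 v) (%x. recession f1 (sing_density G e1 v x)) = ereal (LINT x|S. recession f1 (h x))"
  unfolding recession_integral(2)[OF hi(1)] lebesgue_decomposition_unique(2,3)[OF op d d3] recession_integral(2)[OF hi(2), symmetric]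
  by (rule ext_integral_integrable[OF recession_integral(1)[OF hi(2)]]) simp
 have n1: "t x * fst (?n x) = (?n x \<bullet> e1) * t x" for t :: "plane => real" and x by (cases "?n x") (simp add: mult.commute)
 have ti: "integrable ?bm t" using t by (simp add: has_trace_def)
 have 3: "ext_integral ?bm (%x. recession f1 (?t x * fst (?n x))) = ereal (LINT x|?bm. recession f1 (t x * fst (?n x)))"
  unfolding n1
 proof (rule ext_integral_integrable[OF recession_integral(1)[OF integrable_normal_component[OF ti]]])
  show "AE x in ?bm. ereal (recession f1 ((?n x \<bullet> e1) * ?t x)) = ereal (recession f1 ((?n x \<bullet> e1) * t x))"
   using has_trace_unique[OF op bd t' t disjI1[OF refl]] by eventually_elim presburger
 qed
 have 4: "ext_integral (lebesgue_on G) (%x. A \<bar>weak_deriv G e2 v x\<bar>) = ereal (LINT x|lebesgue_on G. A \<bar>g x\<bar>)"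
 proof (rule ext_integral_integrable[OF orlicz_integrable(1)[OF g(2)]])
  show "AE x in lebesgue_on G. ereal (A \<bar>weak_deriv G e2 v x\<bar>) = ereal (A \<bar>g x\<bar>)"
   using weak_deriv_AE[OF op g(1)] by eventually_elim simp
 qed
 show ?thesis unfolding K_functional_def 1 2 3 4 by simp
qed

end

section \<open>Varying the minimizer towards a Sobolev competitor\<close>

lemma has_weak_derivI_rep:
 assumes G: "open G" and v: "integrable (lebesgue_on G) v" and r: "deriv_rep G e v g (null_measure_on G) h"
 shows "has_weak_deriv G e v g"
proof -
 have Gb: "G \<in> sets borel" using G by simp
 show ?thesis
  using r L1_locally_integrable[OF G] v unfolding has_weak_deriv_def deriv_rep_def
  by (simp add: null_measure_on(2)[OF Gb] mult.commute)
qed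

lemma test_W11_0:
 assumes G: "open G" and \<phi>: "\<phi> \<in> test_functions G"
 shows "\<phi> \<in> W11_0 G"
proof -
 note t = test_has_weak_deriv[OF G \<phi>]
 have W: "\<phi> \<in> W11 G" unfolding W11_def L1_def using t by blast
 have ae: "AE x in lebesgue_on G. norm (weak_gradient G \<phi> x - gradient \<phi> x) = 0"
  using weak_deriv_AE[OF G t(3)[of e1, OF disjI1[OF refl]]] weak_deriv_AE[OF G t(3)[of e2, OF disjI2[OF refl]]]
  by eventually_elim (simp add: weak_gradient_def gradient_def zero_prod_def)
 have z: "(LINT x|lebesgue_on G. norm (weak_gradient G \<phi> x - gradient \<phi> x)) = 0"
  by (rule integral_eq_zero_AE[OF ae])
 show ?thesis
  unfolding W11_0_def
 proof (intro CollectI conjI allI impI W bexI[OF _ \<phi>])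
  fix eps :: real assume "eps > 0"
  then show "(LINT x|lebesgue_on G. \<bar>\<phi> x - \<phi> x\<bar>) + (LINT x|lebesgue_on G. norm (weak_gradient G \<phi> x - gradient \<phi> x)) < eps"
   unfolding z by simp
 qed
qed

text \<open>Adding a function with trace zero does not change the boundary integral in the Gauss-Green formula.\<close>

lemma has_trace_comb:
 assumes G: "open G" "bounded G" and t: "has_trace G v t" and z: "z \<in> W11_0 G" and a: "abs a \<le> 1"
 shows "has_trace G (%x. a * v x + b * z x) (%x. a * t x)"
proof -
 have Gb: "G \<in> sets borel" using G by simp
 let ?L = "lebesgue_on G"
 have vB: "v \<in> BV G" using t by (simp add: has_trace_def)
 then have v: "integrable ?L v" by (simp add: BV_def L1_def)
 have zW: "z \<in> W11 G" using z by (simp add: W11_0_def)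
 note wz = W11_weak_derivs[OF G(1) zW]
 have key: "\<exists>\<rho> S h. deriv_rep G e (%x. a * v x + b * z x) \<rho> S h \<and> gauss_green G e (%x. a * v x + b * z x) (%x. a * t x)"
  if e: "e = e1 \<or> e = e2" for e
 proof -
  obtain \<rho> S h where d: "has_lebesgue_decomposition G e v \<rho> S h" using deriv_measure_rep[OF G vB e] by blast
  have r: "deriv_rep G e v \<rho> S h" by (rule lebesgue_decomposition_deriv_rep[OF G(1) d])
  have r': "deriv_rep G e (%x. a * v x + b * z x) (%x. a * \<rho> x + b * weak_deriv G e z x) S (%x. a * h x)"
   by (rule deriv_rep_comb[OF G(1) e v r wz(3)[OF e] wz(1)[OF e] wz(2)[OF e] a])
  have ge: "gauss_green G e v t" using t e by (auto simp: has_trace_def)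
  have \<rho>: "integrable ?L \<rho>" using r by (simp add: deriv_rep_def)
  have "gauss_green G e (%x. a * v x + b * z x) (%x. a * t x)"
   unfolding gauss_green_iff[OF G r']
  proof (intro allI impI)
   fix \<phi> assume c: "C_k (Suc 0) \<phi>"
   have bb: "bounded_borel_on G \<phi>" "bounded_borel_on G (partial_deriv e \<phi>)"
    using C_k_continuous[OF c] c e G(2) by (auto intro!: bounded_borel_on_continuous)
   have "(LINT x|boundary_measure G. \<phi> x * (outward_normal G x \<bullet> e) * (a * t x)) = a * (LINT x|boundary_measure G. \<phi> x * (outward_normal G x \<bullet> e) * t x)"
    unfolding integral_mult_right_zero[symmetric] by (simp add: ac_simps)
   then show "(LINT x|?L. (a * v x + b * z x) * partial_deriv e \<phi> x)
    = - ((LINT x|?L. \<phi> x * (a * \<rho> x + b * weak_deriv G e z x)) + (LINT x|S. \<phi> x * (a * h x)))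
     + (LINT x|boundary_measure G. \<phi> x * (outward_normal G x \<bullet> e) * (a * t x))"
    using green_identity_comb[OF Gb v \<rho> wz(3,2)[OF e] bb ge[unfolded gauss_green_iff[OF G r], THEN spec, THEN mp, OF c] W11_0_by_parts[OF G z c e], of a b]
    by (simp only:)
  qed
  with r' show ?thesis by blast
 qed
 have i: "integrable ?L (%x. a * v x + b * z x)" using v wz(3)[of e1] by simp
 have "(%x. a * v x + b * z x) \<in> BV G" using key[of e1] key[of e2] deriv_rep_BV[OF G(1) i] by blast
 moreover have "integrable (boundary_measure G) (%x. a * t x)" using t by (simp add: has_trace_def)
 moreover have "gauss_green G e1 (%x. a * v x + b * z x) (%x. a * t x)" using key[of e1] by blast
 moreover have "gauss_green G e2 (%x. a * v x + b * z x) (%x. a * t x)" using key[of e2] by blast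
 ultimately show ?thesis unfolding has_trace_def by blast
qed

lemma zero_test: "(%x. 0) \<in> test_functions G"
proof -
 have "C_k k (%x. 0)" for k by (rule C_k_const)
 then show ?thesis by (simp add: test_functions_def)
qed

lemma has_trace_uminus:
 assumes G: "open G" "bounded G" and t: "has_trace G (%x. v x - w x) t"
 shows "has_trace G (%x. w x - v x) (%x. - t x)"
 using has_trace_comb[OF G t test_W11_0[OF G(1) zero_test], of "-1" 0] by simp

text \<open>A Lebesgue decomposition demands \<open>\<bar>h\<bar> = 1\<close>, so the factor has to be moved from the density
 into the measure.\<close>

lemma has_lebesgue_decomposition_scale:
 assumes G: "open G" and d: "has_lebesgue_decomposition G e v \<rho> S h" and r: "deriv_rep G e v' \<rho>' S (%x. a * h x)" and a: "a \<ge> 0"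
 shows "has_lebesgue_decomposition G e v' \<rho>' (density S (%_. ennreal a)) h"
  and "f \<in> borel_measurable S ==> (LINT x|density S (%_. ennreal a). f x) = a * (LINT x|S. f x)"
proof -
 have S: "finite_borel_measure_on G S" and h: "h \<in> borel_measurable S" "AE x in S. \<bar>h x\<bar> = 1"
  and Z: "\<exists>Z \<in> null_sets lborel. Z \<subseteq> G \<and> emeasure S (G - Z) = 0"
  using d unfolding has_lebesgue_decomposition_def by blast+
 let ?D = "density S (%_. ennreal a)"
 interpret S: finite_measure S by (rule fbm(1)[OF S])
 show int: "(LINT x|?D. f x) = a * (LINT x|S. f x)" if "f \<in> borel_measurable S" for f
  using integral_density[of f S "%_. a"] that a by simp
 have em: "emeasure ?D B = ennreal a * emeasure S B" if "B \<in> sets S" for B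
  using that by (subst emeasure_density) (auto simp: nn_integral_cmult_indicator)
 have "finite_measure ?D"
  by (rule finite_measureI) (simp add: em ennreal_mult_eq_top_iff S.emeasure_eq_measure)
 then have D: "finite_borel_measure_on G ?D" using S by (simp add: finite_borel_measure_on_def)
 obtain Z where Z: "Z \<in> null_sets lborel" "Z \<subseteq> G" "emeasure S (G - Z) = 0" using Z by blast
 have "G - Z \<in> sets S" using Z(1) fbm(2)[OF S] G by (auto simp: sets_restrict_space_iff)
 then have Z': "emeasure ?D (G - Z) = 0" using Z(3) em by simp
 have AE: "AE x in ?D. P x" if "AE x in S. P x" for P
  using that by (subst AE_density) (auto elim: eventually_mono)
 have r': "deriv_rep G e v' \<rho>' ?D h"
  unfolding deriv_rep_def
 proof (intro conjI ballI)
  show "integrable (lebesgue_on G) \<rho>'" using r by (simp add: deriv_rep_def)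
  show "h \<in> borel_measurable ?D" using h by simp
  show "AE x in ?D. \<bar>h x\<bar> \<le> 1" using AE[OF h(2)] by eventually_elim simp
  fix \<phi> assume t: "\<phi> \<in> test_functions G"
  have m: "\<phi> \<in> borel_measurable S" using fbm_measurable[OF S] test_bounded_borel[OF t, of G] unfolding bounded_borel_on_def by blast
  have "(LINT x|?D. \<phi> x * h x) = a * (LINT x|S. \<phi> x * h x)" by (rule int) (use m h in simp)
  also have "... = (LINT x|S. \<phi> x * (a * h x))" unfolding integral_mult_right_zero[symmetric] by (simp add: ac_simps)
  finally show "(LINT x|lebesgue_on G. v' x * partial_deriv e \<phi> x) = - ((LINT x|lebesgue_on G. \<phi> x * \<rho>' x) + (LINT x|?D. \<phi> x * h x))"
   using r t by (simp add: deriv_rep_def)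
 qed (rule D)
 show "has_lebesgue_decomposition G e v' \<rho>' ?D h"
  by (rule lebesgue_decompositionI[OF G r' Z(1,2) Z' AE[OF h(2)]])
qed

text \<open>Convexity places the difference quotients between the derivative at the starting point and the increment, which
 gives the dominating function.\<close>

lemma difference_quotient_integral:
 fixes F F' :: "real => real" and a b :: "'a => real"
 assumes deriv: "!!x. (F has_real_derivative F' x) (at x)"
  and tangent: "!!x y. F x + F' x * (y - x) \<le> F y"
  and convex: "!!e x y. 0 \<le> e ==> e \<le> 1 ==> F ((1 - e) * x + e * y) \<le> (1 - e) * F x + e * F y"
  and ab: "a \<in> borel_measurable M" "b \<in> borel_measurable M"
  and i: "integrable M (%x. F (a x))" "integrable M (%x. F (b x))" "integrable M (%x. F' (a x) * (b x - a x))"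
 shows "(%n. \<integral>x. (F ((1 - 1 / real (n + 2)) * a x + 1 / real (n + 2) * b x) - F (a x)) / (1 / real (n + 2)) \<partial>M)
  \<longlonglongrightarrow> (LINT x|M. F' (a x) * (b x - a x))"
proof (rule integral_dominated_convergence[where w = "%x. \<bar>F' (a x) * (b x - a x)\<bar> + \<bar>F (b x) - F (a x)\<bar>"])
 define e where "e n = 1 / real (n + 2)" for n
 have e: "0 < e n" "e n \<le> 1" for n by (auto simp: e_def)
 have e0: "e \<longlonglongrightarrow> 0" unfolding e_def[abs_def] by (rule LIMSEQ_ignore_initial_segment[of "%n. 1 / real n" 0 2]) (rule lim_const_over_n)
 have Fc: "continuous_on UNIV F" using deriv by (meson DERIV_isCont continuous_at_imp_continuous_on)
 have Fm: "F \<in> borel_measurable borel" by (rule borel_measurable_continuous_onI[OF Fc])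
 show "(%x. F' (a x) * (b x - a x)) \<in> borel_measurable M" using i by auto
 show "(%x. (F ((1 - 1 / real (n + 2)) * a x + 1 / real (n + 2) * b x) - F (a x)) / (1 / real (n + 2))) \<in> borel_measurable M" for n
  using ab Fm by measurable
 show "integrable M (%x. \<bar>F' (a x) * (b x - a x)\<bar> + \<bar>F (b x) - F (a x)\<bar>)" using i by auto
 have pt: "(1 - t) * x + t * y = x + t * (y - x)" for t x y :: real by (simp add: algebra_simps)
 show "AE x in M. (%n. (F ((1 - 1 / real (n + 2)) * a x + 1 / real (n + 2) * b x) - F (a x)) / (1 / real (n + 2))) \<longlonglongrightarrow> F' (a x) * (b x - a x)"
 proof (rule always_eventually, rule allI)
  fix x
  have "((%t. a x + t * (b x - a x)) has_real_derivative (b x - a x)) (at 0)" by (auto intro!: derivative_eq_intros)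
  then have "((%t. F (a x + t * (b x - a x))) has_real_derivative F' (a x) * (b x - a x)) (at 0)"
   using DERIV_chain2[of F "F' (a x)" "%t. a x + t * (b x - a x)" 0 "b x - a x" UNIV] deriv[of "a x"] by simp
  then have "((%t. (F (a x + t * (b x - a x)) - F (a x)) / t) \<longlongrightarrow> F' (a x) * (b x - a x)) (at 0)"
   unfolding DERIV_def by simp
  moreover have "filterlim e (at 0) sequentially"
   unfolding filterlim_at using e0 e(1) by (auto intro!: always_eventually simp: less_imp_neq[symmetric])
  ultimately have "(%n. (F (a x + e n * (b x - a x)) - F (a x)) / e n) \<longlonglongrightarrow> F' (a x) * (b x - a x)"
   by (rule filterlim_compose)
  then show "(%n. (F ((1 - 1 / real (n + 2)) * a x + 1 / real (n + 2) * b x) - F (a x)) / (1 / real (n + 2))) \<longlonglongrightarrow> F' (a x) * (b x - a x)"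
   unfolding pt e_def .
 qed
 show "AE x in M. norm ((F ((1 - 1 / real (n + 2)) * a x + 1 / real (n + 2) * b x) - F (a x)) / (1 / real (n + 2)))
   \<le> \<bar>F' (a x) * (b x - a x)\<bar> + \<bar>F (b x) - F (a x)\<bar>" for n
 proof (rule always_eventually, rule allI)
  fix x
  let ?q = "(F ((1 - e n) * a x + e n * b x) - F (a x)) / e n"
  have "F (a x) + F' (a x) * (e n * (b x - a x)) \<le> F ((1 - e n) * a x + e n * b x)"
   using tangent[of "a x" "(1 - e n) * a x + e n * b x"] unfolding pt by simp
  then have "F' (a x) * (b x - a x) * e n \<le> F ((1 - e n) * a x + e n * b x) - F (a x)" by (simp add: algebra_simps)
  then have 1: "F' (a x) * (b x - a x) \<le> ?q" using e(1)[of n] by (simp add: pos_le_divide_eq)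
  have "F ((1 - e n) * a x + e n * b x) - F (a x) \<le> (F (b x) - F (a x)) * e n"
   using convex[of "e n" "a x" "b x"] e[of n] by (simp add: algebra_simps)
  then have 2: "?q \<le> F (b x) - F (a x)" using e(1)[of n] by (simp add: pos_divide_le_eq)
  show "norm ((F ((1 - 1 / real (n + 2)) * a x + 1 / real (n + 2) * b x) - F (a x)) / (1 / real (n + 2)))
   \<le> \<bar>F' (a x) * (b x - a x)\<bar> + \<bar>F (b x) - F (a x)\<bar>"
   using 1 2 unfolding e_def real_norm_def by linarith
 qed
qed

context dirichlet_problem begin

lemma f1_convex_comb: "0 \<le> e ==> e \<le> 1 ==> f1 ((1 - e) * x + e * y) \<le> (1 - e) * f1 x + e * f1 y"
 using convex_onD[OF f1_convex, of e x y] by simp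

lemma f1'_mult_integrable:
 assumes a: "a \<in> borel_measurable (lebesgue_on G)" and b: "integrable (lebesgue_on G) b"
 shows "integrable (lebesgue_on G) (%x. f1' (a x) * b x)"
 by (rule integrable_mult_bounded[OF b measurable_compose[OF a borel_measurable_continuous_onI[OF f1'_cont]] f1'_bound])

lemma f2'_measurable: "g \<in> borel_measurable M ==> (%x. f2' (g x)) \<in> borel_measurable M"
 using borel_measurable_continuous_onI[OF f2'_cont] by (rule measurable_compose[rotated])

text \<open>Young's inequality, with the growth condition on the conjugate applied to the derivative of
 \<open>A\<close>.\<close>

lemma f2'_mult_integrable:
 assumes g: "g \<in> orlicz A G" and b: "b \<in> orlicz A G"
 shows "integrable (lebesgue_on G) (%x. f2' (g x) * b x)"
proof (rule integrable_abs_le)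
 have i: "integrable (lebesgue_on G) (%x. A \<bar>g x\<bar>)" "integrable (lebesgue_on G) (%x. A \<bar>b x\<bar>)"
  and m: "g \<in> borel_measurable (lebesgue_on G)" "b \<in> borel_measurable (lebesgue_on G)"
  using g b orlicz_iff by blast+
 show "integrable (lebesgue_on G) (%x. c * (A \<bar>g x\<bar> + 1) + A \<bar>b x\<bar>)" using i const_integrable by auto
 show "(%x. f2' (g x) * b x) \<in> borel_measurable (lebesgue_on G)"
  using f2'_measurable[OF m(1)] m(2) by (rule borel_measurable_times)
 show "\<bar>f2' (g x) * b x\<bar> \<le> c * (A \<bar>g x\<bar> + 1) + A \<bar>b x\<bar>" for x
  using conj_young[of "abs (b x)" "A' \<bar>g x\<bar>"] conj_bound[of "abs (g x)"] by (simp add: abs_mult f2'_abs)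
qed

text \<open>The stress tensor pairs with every Sobolev competitor to at least the minimal value: this is
 the Euler inequality for the segment from the minimizer to the competitor, combined with equality
 in Young's inequality. The singular and boundary terms are positively homogeneous along the segment.\<close>

lemma lagrangian_stress_ge:
 assumes u: "u \<in> C_BV G A u0" and min: "!!w. w \<in> C_BV G A u0 ==> K_functional G f1 A u0 u \<le> K_functional G f1 A u0 w"
  and w: "w \<in> C_Sob G A u0" and \<rho>: "\<exists>S h. has_lebesgue_decomposition G e1 u \<rho> S h"
  and g: "g \<in> orlicz A G" "has_weak_deriv G e2 u g"
  and s1: "AE x in lebesgue_on G. fst (\<sigma> x) = f1' (\<rho> x)" and s2: "AE x in lebesgue_on G. snd (\<sigma> x) = f2' (g x)"
 shows "K_functional G f1 A u0 u \<le> lagrangian G f1 A w \<sigma>"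
proof -
 let ?L = "lebesgue_on G" and ?n = "outward_normal G" and ?bm = "boundary_measure G"
 obtain S h where d: "has_lebesgue_decomposition G e1 u \<rho> S h" using \<rho> by blast
 obtain t0 where t0: "has_trace G (%x. u x - u0 x) t0" "AE x in ?bm. t0 x * snd (?n x) = 0"
  using u unfolding C_BV_def by blast
 have t: "has_trace G (%x. u0 x - u x) (%x. - t0 x)" by (rule has_trace_uminus[OF op bd t0(1)])
 have wW: "w \<in> W11 G" and w2: "weak_deriv G e2 w \<in> orlicz A G" and z: "(%x. w x - u0 x) \<in> W11_0 G"
  using w by (simp_all add: C_Sob_def)
 note ww = W11_weak_derivs[OF op wW]
 let ?w1 = "weak_deriv G e1 w" and ?w2 = "weak_deriv G e2 w"
 have uB: "u \<in> BV G" using u by (simp add: C_BV_def)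
 then have ui: "integrable ?L u" by (simp add: BV_def L1_def)
 have r1: "deriv_rep G e1 u \<rho> S h" by (rule lebesgue_decomposition_deriv_rep[OF op d])
 have gi: "integrable ?L g" "integrable ?L (%x. A \<bar>g x\<bar>)" using orlicz_integrable[OF g(1)] by blast+
 have w2i: "integrable ?L ?w2" "integrable ?L (%x. A \<bar>?w2 x\<bar>)" using orlicz_integrable[OF w2] by blast+
 have r2: "deriv_rep G e2 u g (null_measure_on G) (%_. 1)" by (rule weak_deriv_deriv_rep[OF op g(2) gi(1)])
 have \<rho>i: "integrable ?L \<rho>" using r1 by (simp add: deriv_rep_def)
 have w1i: "integrable ?L ?w1" using ww(2)[of e1] by simp
 define H where "H = (LINT x|S. recession f1 (h x))"
 define T where "T = (LINT x|?bm. recession f1 (- t0 x * fst (?n x)))"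
 define F where "F = (LINT x|?L. f1 (\<rho> x))"
 define Gv where "Gv = (LINT x|?L. A \<bar>g x\<bar>)"
 have Ku: "K_functional G f1 A u0 u = ereal (F + H + T + Gv)"
  unfolding F_def H_def T_def Gv_def by (rule K_functional_eq[OF d t g(2,1)])
 have f1i: "integrable ?L (%x. f1 (\<rho> x))" "integrable ?L (%x. f1 (?w1 x))"
  using f1_comp_integrable \<rho>i w1i by blast+
 define e where "e n = 1 / real (n + 2)" for n
 have e: "0 < e n" "e n < 1" for n by (auto simp: e_def)
 have step: "H + T \<le> (LINT x|?L. (f1 ((1 - e n) * \<rho> x + e n * ?w1 x) - f1 (\<rho> x)) / e n)
   + (LINT x|?L. (A \<bar>(1 - e n) * g x + e n * ?w2 x\<bar> - A \<bar>g x\<bar>) / e n)" for n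
 proof -
  have a: "abs (1 - e n) \<le> 1" "1 - e n > 0" using e[of n] by auto
  let ?v = "%x. (1 - e n) * u x + e n * w x"
  have q1: "deriv_rep G e1 ?v (%x. (1 - e n) * \<rho> x + e n * ?w1 x) S (%x. (1 - e n) * h x)"
   by (rule deriv_rep_comb[OF op _ ui r1 ww(3)[of e1] ww(1)[of e1] w1i a(1)]) simp_all
  have q2: "deriv_rep G e2 ?v (%x. (1 - e n) * g x + e n * ?w2 x) (null_measure_on G) (%x. (1 - e n) * 1)"
   by (rule deriv_rep_comb[OF op _ ui r2 ww(3)[of e2] ww(1)[of e2] w2i(1) a(1)]) simp_all
  have vi: "integrable ?L ?v" using ui ww(3)[of e1] by simp
  have vB: "?v \<in> BV G" by (rule deriv_rep_BV[OF op vi q1 q2])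
  have vg: "has_weak_deriv G e2 ?v (%x. (1 - e n) * g x + e n * ?w2 x)" by (rule has_weak_derivI_rep[OF op vi q2])
  have mg: "(%x. (1 - e n) * g x + e n * ?w2 x) \<in> borel_measurable ?L" using gi(1) w2i(1) by auto
  have Ai: "integrable ?L (%x. A \<bar>(1 - e n) * g x + e n * ?w2 x\<bar>)"
  proof (rule integrable_abs_le[OF _ A_measurable[OF mg]])
   show "integrable ?L (%x. (1 - e n) * A \<bar>g x\<bar> + e n * A \<bar>?w2 x\<bar>)" using gi(2) w2i(2) by simp
   show "\<bar>A \<bar>(1 - e n) * g x + e n * ?w2 x\<bar>\<bar> \<le> (1 - e n) * A \<bar>g x\<bar> + e n * A \<bar>?w2 x\<bar>" for x
    using f2_convex[of "e n" "g x" "?w2 x"] e[of n] A_nonneg[of "\<bar>(1 - e n) * g x + e n * ?w2 x\<bar>"] by simp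
  qed
  have vo: "(%x. (1 - e n) * g x + e n * ?w2 x) \<in> orlicz A G" unfolding orlicz_iff using mg Ai by blast
  have veq: "(%x. (1 - e n) * (u x - u0 x) + e n * (w x - u0 x)) = (%x. ?v x - u0 x)" by (rule ext) (simp add: algebra_simps)
  have vt: "has_trace G (%x. ?v x - u0 x) (%x. (1 - e n) * t0 x)"
   using has_trace_comb[OF op bd t0(1) z a(1), of "e n"] unfolding veq .
  have vn: "AE x in ?bm. (1 - e n) * t0 x * snd (?n x) = 0" using t0(2) by eventually_elim simp
  have vC: "?v \<in> C_BV G A u0" unfolding C_BV_def using vB vg vo vt vn by blast
  note vd = has_lebesgue_decomposition_scale[OF op d q1]
  have vt': "has_trace G (%x. u0 x - ?v x) (%x. - ((1 - e n) * t0 x))" by (rule has_trace_uminus[OF op bd vt])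
  have hm: "(%x. recession f1 (h x)) \<in> borel_measurable S"
   using recession_integral(1)[OF sing_density_integrable[OF d]] by auto
  have "(LINT x|density S (%_. ennreal (1 - e n)). recession f1 (h x)) = (1 - e n) * H"
   unfolding H_def by (rule vd(2)[OF _ hm]) (use a in simp)
  moreover have "(LINT x|?bm. recession f1 (- ((1 - e n) * t0 x) * fst (?n x))) = (1 - e n) * T"
  proof -
   have "recession f1 (- ((1 - e n) * t0 x) * fst (?n x)) = (1 - e n) * recession f1 (- t0 x * fst (?n x))" for x
    using recession_scale[OF a(2), of "- t0 x * fst (?n x)"] by (simp add: mult.assoc)
   then show ?thesis unfolding T_def by simp
  qed
  ultimately have Kv: "K_functional G f1 A u0 ?v = ereal ((LINT x|?L. f1 ((1 - e n) * \<rho> x + e n * ?w1 x)) + (1 - e n) * H + (1 - e n) * T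
    + (LINT x|?L. A \<bar>(1 - e n) * g x + e n * ?w2 x\<bar>))"
   using K_functional_eq[OF vd(1) vt' vg vo] a(2) by simp
  have vf: "integrable ?L (%x. f1 ((1 - e n) * \<rho> x + e n * ?w1 x))"
   by (rule f1_comp_integrable) (use \<rho>i w1i in simp)
  have "F + H + T + Gv \<le> (LINT x|?L. f1 ((1 - e n) * \<rho> x + e n * ?w1 x)) + (1 - e n) * H + (1 - e n) * T
    + (LINT x|?L. A \<bar>(1 - e n) * g x + e n * ?w2 x\<bar>)"
   using min[OF vC] unfolding Ku Kv by simp
  then have "(H + T) * e n \<le> ((LINT x|?L. f1 ((1 - e n) * \<rho> x + e n * ?w1 x)) - F) + ((LINT x|?L. A \<bar>(1 - e n) * g x + e n * ?w2 x\<bar>) - Gv)"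
   by (simp add: algebra_simps)
  then have "H + T \<le> (((LINT x|?L. f1 ((1 - e n) * \<rho> x + e n * ?w1 x)) - F) + ((LINT x|?L. A \<bar>(1 - e n) * g x + e n * ?w2 x\<bar>) - Gv)) / e n"
   using e(1)[of n] by (simp only: pos_le_divide_eq)
  also have "... = (LINT x|?L. (f1 ((1 - e n) * \<rho> x + e n * ?w1 x) - f1 (\<rho> x)) / e n)
   + (LINT x|?L. (A \<bar>(1 - e n) * g x + e n * ?w2 x\<bar> - A \<bar>g x\<bar>) / e n)"
   unfolding F_def Gv_def using vf f1i(1) Ai gi(2) by (simp add: add_divide_distrib)
  finally show ?thesis .
 qed
 have mg: "g \<in> borel_measurable ?L" "?w2 \<in> borel_measurable ?L" using gi(1) w2i(1) by auto
 have m\<rho>: "\<rho> \<in> borel_measurable ?L" "?w1 \<in> borel_measurable ?L" using \<rho>i w1i by auto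
 have i1: "integrable ?L (%x. f1' (\<rho> x) * ?w1 x)" "integrable ?L (%x. f1' (\<rho> x) * \<rho> x)"
  using f1'_mult_integrable[OF m\<rho>(1)] w1i \<rho>i by blast+
 have i2: "integrable ?L (%x. f2' (g x) * ?w2 x)" "integrable ?L (%x. f2' (g x) * g x)"
  using f2'_mult_integrable[OF g(1)] w2 g(1) by blast+
 have lim: "(%n. (LINT x|?L. (f1 ((1 - e n) * \<rho> x + e n * ?w1 x) - f1 (\<rho> x)) / e n)
   + (LINT x|?L. (A \<bar>(1 - e n) * g x + e n * ?w2 x\<bar> - A \<bar>g x\<bar>) / e n))
   \<longlonglongrightarrow> (LINT x|?L. f1' (\<rho> x) * (?w1 x - \<rho> x)) + (LINT x|?L. f2' (g x) * (?w2 x - g x))"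
  unfolding e_def
 proof (rule tendsto_add)
  show "(%n. \<integral>x. (f1 ((1 - 1 / real (n + 2)) * \<rho> x + 1 / real (n + 2) * ?w1 x) - f1 (\<rho> x)) / (1 / real (n + 2)) \<partial>?L)
   \<longlonglongrightarrow> (LINT x|?L. f1' (\<rho> x) * (?w1 x - \<rho> x))"
   by (rule difference_quotient_integral[OF f1_deriv f1_tangent f1_convex_comb m\<rho> f1i])
     (use i1 in "simp_all add: right_diff_distrib")
  show "(%n. \<integral>x. (A \<bar>(1 - 1 / real (n + 2)) * g x + 1 / real (n + 2) * ?w2 x\<bar> - A \<bar>g x\<bar>) / (1 / real (n + 2)) \<partial>?L)
   \<longlonglongrightarrow> (LINT x|?L. f2' (g x) * (?w2 x - g x))"
   by (rule difference_quotient_integral[where F = "%t. A \<bar>t\<bar>", OF f2_deriv f2_tangent f2_convex mg gi(2) w2i(2)])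
     (use i2 in "simp_all add: right_diff_distrib")
 qed
 have "H + T \<le> (LINT x|?L. f1' (\<rho> x) * (?w1 x - \<rho> x)) + (LINT x|?L. f2' (g x) * (?w2 x - g x))"
  by (rule LIMSEQ_le_const[OF lim]) (use step in blast)
 also have "... = (LINT x|?L. f1' (\<rho> x) * ?w1 x) - (LINT x|?L. f1' (\<rho> x) * \<rho> x) + ((LINT x|?L. f2' (g x) * ?w2 x) - (LINT x|?L. f2' (g x) * g x))"
  using i1 i2 by (simp add: right_diff_distrib)
 finally have HT: "H + T \<le> (LINT x|?L. f1' (\<rho> x) * ?w1 x) - (LINT x|?L. f1' (\<rho> x) * \<rho> x) + ((LINT x|?L. f2' (g x) * ?w2 x) - (LINT x|?L. f2' (g x) * g x))" .
 have c1: "ext_integral ?L (%x. convex_conjugate f1 (fst (\<sigma> x))) = ereal (LINT x|?L. f1' (\<rho> x) * \<rho> x - f1 (\<rho> x))"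
 proof (rule ext_integral_integrable)
  show "integrable ?L (%x. f1' (\<rho> x) * \<rho> x - f1 (\<rho> x))" using i1 f1i by simp
  show "AE x in ?L. convex_conjugate f1 (fst (\<sigma> x)) = ereal (f1' (\<rho> x) * \<rho> x - f1 (\<rho> x))"
   using s1 by eventually_elim (simp only: conjugate_deriv)
 qed
 have c2: "ext_integral ?L (%x. N_conjugate A \<bar>snd (\<sigma> x)\<bar>) = ereal (LINT x|?L. f2' (g x) * g x - A \<bar>g x\<bar>)"
 proof (rule ext_integral_integrable)
  show "integrable ?L (%x. f2' (g x) * g x - A \<bar>g x\<bar>)" using i2 gi by simp
  show "AE x in ?L. ereal (N_conjugate A \<bar>snd (\<sigma> x)\<bar>) = ereal (f2' (g x) * g x - A \<bar>g x\<bar>)"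
   using s2 by eventually_elim (simp add: f2'_abs conj_deriv f2'_mult)
 qed
 have ae: "AE x in ?L. f1' (\<rho> x) * ?w1 x + f2' (g x) * ?w2 x = \<sigma> x \<bullet> weak_gradient G w x"
  using s1 s2
 proof eventually_elim
  case (elim x)
  then show ?case unfolding weak_gradient_def by (cases "\<sigma> x") simp
 qed
 have i3: "integrable ?L (%x. f1' (\<rho> x) * ?w1 x + f2' (g x) * ?w2 x)" using i1 i2 by simp
 have "(LINT x|?L. \<sigma> x \<bullet> weak_gradient G w x) = (LINT x|?L. f1' (\<rho> x) * ?w1 x + f2' (g x) * ?w2 x)"
  by (rule integrable_lebesgue_on_AE(2)[OF Gb i3 ae])
 also have "... = (LINT x|?L. f1' (\<rho> x) * ?w1 x) + (LINT x|?L. f2' (g x) * ?w2 x)" using i1 i2 by simp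
 finally have "lagrangian G f1 A w \<sigma> = ereal ((LINT x|?L. f1' (\<rho> x) * ?w1 x) + (LINT x|?L. f2' (g x) * ?w2 x)
   - ((LINT x|?L. f1' (\<rho> x) * \<rho> x) - F) - ((LINT x|?L. f2' (g x) * g x) - Gv))"
  unfolding lagrangian_def c1 c2 F_def Gv_def using i1 i2 f1i gi by simp
 then show ?thesis unfolding Ku using HT by simp
qed

end

section \<open>The upper bound for the dual functional\<close>

lemma plane_density_diff:
 assumes id: "(%x. x) \<in> measurable M borel" and b: "integrable M b" and bd: "bounded (space M)" and \<phi>: "continuous_on UNIV \<phi>"
 shows "(LINT x|M. \<phi> x * b x) = (LINT x|plane_density M b. \<phi> x) - (LINT x|plane_density M (%x. - b x). \<phi> x)"
proof -
 have \<phi>b: "\<phi> \<in> borel_measurable borel" by (rule borel_measurable_continuous_onI[OF \<phi>])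
 have nb: "integrable M (%x. - b x)" using b by simp
 have \<phi>M: "\<phi> \<in> borel_measurable M" using measurable_compose[OF id \<phi>b] .
 obtain C where C: "\<forall>x\<in>space M. \<bar>\<phi> x\<bar> \<le> C" using bounded_borel_on_continuous[OF \<phi> bd] unfolding bounded_borel_on_def by blast
 have i: "integrable M (%x. \<phi> x * max 0 (b x))" "integrable M (%x. \<phi> x * max 0 (- b x))"
  by (rule integrable_mult_bounded[OF _ \<phi>M C[rule_format]]; use b in simp)+
 have "(%x. \<phi> x * b x) = (%x. \<phi> x * max 0 (b x) - \<phi> x * max 0 (- b x))" by (rule ext) (simp add: max_def)
 then show ?thesis unfolding plane_density(3)[OF id b \<phi>b] plane_density(3)[OF id nb \<phi>b] using i by simp
qed

lemma pushed_partition_exists: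
 assumes lip: "bounded_lipschitz_domain G" and nor: "normal_wrt_x2_axis G"
 shows "\<exists>N \<eta> \<eta>' J p q c r s0. pushed_partition G N \<eta> \<eta>' J p q c r s0"
proof -
 obtain N \<eta> \<eta>' J p q c r s0 where sp: "\<forall>i t. ((\<eta> :: nat => real => real) i has_real_derivative \<eta>' i t) (at t)" "\<forall>i. continuous_on UNIV (\<eta>' i)"
  "\<forall>i t. 0 \<le> \<eta> i t \<and> \<eta> i t \<le> 1" "\<forall>t. (\<Sum>i<N. \<eta> i t) \<le> 1" "\<forall>x\<in>closure G. (\<Sum>i<N. \<eta> i (fst x)) = 1"
  "\<forall>i. compact (J i)" "\<forall>i. \<forall>x\<in>closure G. \<eta> i (fst x) \<noteq> 0 --> fst x \<in> J i"
  "\<forall>i<N. pushes_inside G (J i) (p i) (q i) (c i) r s0"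
  using strip_partition[OF assms] by (elim exE conjE)
 have dom: "open G" "bounded G" "G \<noteq> {}" using lip by (simp_all add: bounded_lipschitz_domain_def)
 obtain x where "x \<in> G" using dom(3) by blast
 then have "x \<in> closure G" using closure_subset by blast
 then have "(\<Sum>i<N. \<eta> i (fst x)) = 1" using sp(5) by blast
 then have "N > 0" by (cases N) auto
 then have rs: "r > 0" "s0 > 0" using sp(8) unfolding pushes_inside_def by blast+
 have "pushed_partition G N \<eta> \<eta>' J p q c r s0"
  by (unfold_locales; (rule dom rs)?; use sp in blast)
 then show ?thesis by blast
qed

context dirichlet_problem begin

lemma Linf_measurable_bound:
 assumes "v \<in> Linf G" shows "v \<in> borel_measurable (lebesgue_on G)" and "\<exists>C. AE x in lebesgue_on G. \<bar>v x\<bar> \<le> C"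
 using assms by (simp_all add: Linf_def)

lemma Linf_integrable:
 assumes "v \<in> Linf G" shows "integrable (lebesgue_on G) v"
proof -
 interpret finite_measure "lebesgue_on G" by (rule finite_G)
 obtain C where "AE x in lebesgue_on G. \<bar>v x\<bar> \<le> C" using Linf_measurable_bound(2)[OF assms] by blast
 then show ?thesis using Linf_measurable_bound(1)[OF assms] by (intro integrable_const_bound[of v C]) auto
qed

lemma Linf_orlicz_add:
 assumes v: "v \<in> borel_measurable (lebesgue_on G)" "AE x in lebesgue_on G. \<bar>v x\<bar> \<le> C" and g: "g \<in> orlicz A G"
 shows "(%x. v x + g x) \<in> orlicz A G"
 unfolding orlicz_iff
proof
 have gi: "g \<in> borel_measurable (lebesgue_on G)" "integrable (lebesgue_on G) (%x. A \<bar>g x\<bar>)" using g unfolding orlicz_iff by blast+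
 show m: "(%x. v x + g x) \<in> borel_measurable (lebesgue_on G)" using v(1) gi(1) by (rule borel_measurable_add)
 show "integrable (lebesgue_on G) (%x. A \<bar>v x + g x\<bar>)"
 proof (rule integrable_bound[OF _ A_measurable[OF m]])
  show "integrable (lebesgue_on G) (%x. c3 * (A (max C 0) + A \<bar>g x\<bar>))" using gi(2) const_integrable by auto
  show "AE x in lebesgue_on G. norm (A \<bar>v x + g x\<bar>) \<le> norm (c3 * (A (max C 0) + A \<bar>g x\<bar>))"
   using v(2)
  proof eventually_elim
   case (elim x)
   have "A \<bar>v x\<bar> \<le> A (max C 0)" using elim by (intro A_mono) auto
   then have "c3 * (A \<bar>v x\<bar> + A \<bar>g x\<bar>) \<le> c3 * (A (max C 0) + A \<bar>g x\<bar>)" using c3 by (intro mult_left_mono) auto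
   moreover have "0 \<le> A \<bar>v x + g x\<bar>" by (rule A_nonneg) simp
   ultimately show ?case using A_add[of "v x" "g x"] by simp
  qed
 qed
qed

lemma zero_orlicz: "(%x. 0) \<in> orlicz A G" unfolding orlicz_iff using A_zero by simp

lemma conj_measurable: "N_conjugate A \<in> borel_measurable borel" by (rule borel_measurable_mono[OF conj_mono])

text \<open>Weak duality, from Young's inequality in both variables.\<close>

lemma lagrangian_le:
 assumes w1: "integrable (lebesgue_on G) (weak_deriv G e1 w)" and w2: "weak_deriv G e2 w \<in> orlicz A G"
  and \<tau>: "\<tau> \<in> Linf_orlicz (N_conjugate A) G"
 shows "lagrangian G f1 A w \<tau> \<le> ereal ((LINT x|lebesgue_on G. f1 (weak_deriv G e1 w x)) + (LINT x|lebesgue_on G. A \<bar>weak_deriv G e2 w x\<bar>))"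
proof -
 let ?L = "lebesgue_on G" and ?w1 = "weak_deriv G e1 w" and ?w2 = "weak_deriv G e2 w"
 let ?t1 = "%x. fst (\<tau> x)" and ?t2 = "%x. snd (\<tau> x)"
 have "?t1 \<in> Linf G" and t2: "?t2 \<in> orlicz (N_conjugate A) G" using \<tau> by (simp_all add: Linf_orlicz_def)
 then obtain C where t1: "?t1 \<in> borel_measurable ?L" "AE x in ?L. \<bar>?t1 x\<bar> \<le> C" using Linf_measurable_bound by blast
 have i1: "integrable ?L (%x. ?t1 x * ?w1 x)"
 proof (rule integrable_bound)
  show "integrable ?L (%x. C * abs (?w1 x))" using w1 by auto
  show "(%x. ?t1 x * ?w1 x) \<in> borel_measurable ?L" using t1(1) borel_measurable_integrable[OF w1] by (rule borel_measurable_times)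
  show "AE x in ?L. norm (?t1 x * ?w1 x) \<le> norm (C * abs (?w1 x))"
   using t1(2)
  proof eventually_elim
   case (elim x)
   have "abs (?t1 x) * abs (?w1 x) \<le> C * abs (?w1 x)" using elim by (rule mult_right_mono) simp
   then show ?case unfolding real_norm_def abs_mult[of "?t1 x"] by linarith
  qed
 qed
 obtain l where l: "l > 0" "(\<integral>\<^sup>+ x. ennreal (N_conjugate A (l * abs (?t2 x))) \<partial>?L) < \<infinity>" and m2: "?t2 \<in> borel_measurable ?L"
  using t2 unfolding orlicz_def by blast
 have m3: "(%x. l * abs (?t2 x)) \<in> borel_measurable ?L" using m2 by (intro borel_measurable_times borel_measurable_abs borel_measurable_const)
 have iN: "integrable ?L (%x. N_conjugate A (l * abs (?t2 x)))"
  by (rule integrableI_nonneg[OF measurable_compose[OF m3 conj_measurable]]) (use l(2) conj_nonneg in auto)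
 obtain D where D: "D > 0" "!!t. A (1 / l * abs t) \<le> D * A \<bar>t\<bar>" using A_scale[of "1 / l"] l(1) by auto
 have w2i: "integrable ?L (%x. A \<bar>?w2 x\<bar>)" "?w2 \<in> borel_measurable ?L" using w2 unfolding orlicz_iff by blast+
 have i2: "integrable ?L (%x. ?t2 x * ?w2 x)"
 proof (rule integrable_abs_le)
  show "integrable ?L (%x. N_conjugate A (l * abs (?t2 x)) + D * A \<bar>?w2 x\<bar>)" using iN w2i by auto
  show "(%x. ?t2 x * ?w2 x) \<in> borel_measurable ?L" using m2 w2i(2) by (rule borel_measurable_times)
  show "abs (?t2 x * ?w2 x) \<le> N_conjugate A (l * abs (?t2 x)) + D * A \<bar>?w2 x\<bar>" for x
  proof -
   have "l * abs (?t2 x) * (1 / l * abs (?w2 x)) - A (1 / l * abs (?w2 x)) \<le> N_conjugate A (l * abs (?t2 x))"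
    by (rule conj_young) (use l(1) in simp)
   moreover have "l * abs (?t2 x) * (1 / l * abs (?w2 x)) = abs (?t2 x) * abs (?w2 x)" using l(1) by simp
   ultimately show ?thesis using D(2)[of "?w2 x"] unfolding abs_mult[of "?t2 x"] by linarith
  qed
 qed
 have f1i: "integrable ?L (%x. f1 (?w1 x))" by (rule f1_comp_integrable[OF w1])
 have eq: "(LINT x|?L. \<tau> x \<bullet> weak_gradient G w x) = (LINT x|?L. ?t1 x * ?w1 x) + (LINT x|?L. ?t2 x * ?w2 x)"
  unfolding inner_prod_def weak_gradient_def fst_conv snd_conv inner_real_def using i1 i2 by (rule integral_add)
 have E1: "ereal (LINT x|?L. ?t1 x * ?w1 x - f1 (?w1 x)) \<le> ext_integral ?L (%x. convex_conjugate f1 (?t1 x))"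
  by (rule ext_integral_ge) (use i1 f1i conjugate_young in auto)
 have E2: "ereal (LINT x|?L. ?t2 x * ?w2 x - A \<bar>?w2 x\<bar>) \<le> ext_integral ?L (%x. ereal (N_conjugate A \<bar>?t2 x\<bar>))"
 proof (rule ext_integral_ge)
  show "integrable ?L (%x. ?t2 x * ?w2 x - A \<bar>?w2 x\<bar>)" using i2 w2i by simp
  show "AE x in ?L. ereal (?t2 x * ?w2 x - A \<bar>?w2 x\<bar>) \<le> ereal (N_conjugate A \<bar>?t2 x\<bar>)"
  proof (rule always_eventually, rule allI)
   fix x
   have "?t2 x * ?w2 x \<le> abs (?t2 x) * abs (?w2 x)" using abs_ge_self[of "?t2 x * ?w2 x"] by (simp add: abs_mult)
   then show "ereal (?t2 x * ?w2 x - A \<bar>?w2 x\<bar>) \<le> ereal (N_conjugate A \<bar>?t2 x\<bar>)"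
    using conj_young[of "abs (?w2 x)" "abs (?t2 x)"] by simp
  qed
 qed
 have "lagrangian G f1 A w \<tau> \<le> ereal ((LINT x|?L. ?t1 x * ?w1 x) + (LINT x|?L. ?t2 x * ?w2 x))
   - ereal (LINT x|?L. ?t1 x * ?w1 x - f1 (?w1 x)) - ereal (LINT x|?L. ?t2 x * ?w2 x - A \<bar>?w2 x\<bar>)"
  unfolding lagrangian_def eq by (intro ereal_minus_mono E1 E2 order.refl)
 also have "... = ereal ((LINT x|?L. f1 (?w1 x)) + (LINT x|?L. A \<bar>?w2 x\<bar>))"
  using i1 i2 f1i w2i by simp
 finally show ?thesis .
qed

text \<open>The four measures are the positive and negative parts of the singular part of the derivative and of the boundary
 part that arises when \<open>u - u0\<close> is extended by zero.\<close>

lemma dual_le_K_functional: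
 assumes lip: "bounded_lipschitz_domain G" and nor: "normal_wrt_x2_axis G" and u0: "u0 \<in> W1inf G"
  and u: "u \<in> C_BV G A u0" and \<tau>: "\<tau> \<in> Linf_orlicz (N_conjugate A) G"
 shows "dual_functional G f1 A u0 \<tau> \<le> K_functional G f1 A u0 u"
proof -
 let ?L = "lebesgue_on G" and ?n = "outward_normal G" and ?bm = "boundary_measure G"
 have u0L: "u0 \<in> Linf G" using u0 by (simp add: W1inf_def)
 obtain v1 v2 where v: "v1 \<in> Linf G" "has_weak_deriv G e1 u0 v1" "v2 \<in> Linf G" "has_weak_deriv G e2 u0 v2"
  using u0 unfolding W1inf_def by blast
 note vi = Linf_integrable[OF v(1)] Linf_integrable[OF v(3)] Linf_integrable[OF u0L]
 obtain B where v2B: "AE x in ?L. \<bar>v2 x\<bar> \<le> B" using Linf_measurable_bound(2)[OF v(3)] by blast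
 have v2m: "v2 \<in> borel_measurable ?L" by (rule Linf_measurable_bound(1)[OF v(3)])
 have uB: "u \<in> BV G" using u by (simp add: C_BV_def)
 then have ui: "integrable ?L u" by (simp add: BV_def L1_def)
 obtain \<rho> S h where d: "has_lebesgue_decomposition G e1 u \<rho> S h" using deriv_measure_rep[OF op bd uB, of e1] by blast
 obtain g t0 where g: "g \<in> orlicz A G" "has_weak_deriv G e2 u g"
  and t0: "has_trace G (%x. u x - u0 x) t0" "AE x in ?bm. t0 x * snd (?n x) = 0"
  using u unfolding C_BV_def by blast
 have t: "has_trace G (%x. u0 x - u x) (%x. - t0 x)" by (rule has_trace_uminus[OF op bd t0(1)])
 note gi = orlicz_integrable[OF g(1)]
 have r1: "deriv_rep G e1 u \<rho> S h" by (rule lebesgue_decomposition_deriv_rep[OF op d])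
 have r2: "deriv_rep G e2 u g (null_measure_on G) (%_. 1)" by (rule weak_deriv_deriv_rep[OF op g(2) gi(2)])
 have \<rho>i: "integrable ?L \<rho>" and S: "finite_borel_measure_on G S" using r1 by (simp_all add: deriv_rep_def)
 have hi: "integrable S h" by (rule sing_density_integrable[OF d])
 have q1: "deriv_rep G e1 (%x. u x - u0 x) (%x. \<rho> x - v1 x) S h"
  using deriv_rep_comb[OF op disjI1[OF refl] ui r1 vi(3) v(2) vi(1), of 1 "-1"] by simp
 have q2: "deriv_rep G e2 (%x. u x - u0 x) (%x. g x - v2 x) (null_measure_on G) (%_. 1)"
  using deriv_rep_comb[OF op disjI2[OF refl] ui r2 vi(3) v(4) vi(2), of 1 "-1"] by simp
 define b where "b x = (?n x \<bullet> e1) * (- t0 x)" for x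
 have bi: "integrable ?bm b"
  unfolding b_def using integrable_normal_component[of G "%x. - t0 x" e1] t0(1) by (simp add: has_trace_def)
 have nbi: "integrable ?bm (%x. - b x)" using bi by simp
 have nhi: "integrable S (%x. - h x)" using hi by simp
 have sb: "bounded (space S)" "bounded (space ?bm)"
  using bd bounded_subset[OF bounded_closure[OF bd]] by (simp_all add: fbm(3)[OF S] space_boundary_measure frontier_def Diff_subset)
 have idS: "(%x. x) \<in> measurable S borel" using fbm(2)[OF S] by (intro measurableI) (auto simp: sets_restrict_space fbm(3)[OF S])
 have idb: "(%x. x) \<in> measurable ?bm borel" by (rule borel_measurable_boundary_measure) simp
 obtain U where U: "U \<in> borel_measurable borel" "integrable lborel U" "\<forall>x. x \<notin> G --> U x = 0" "AE x in ?L. u x - u0 x = U x"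
  using borel_representative_integrable[OF integrable_diff[OF ui vi(3)] Gb] by blast
 obtain R where R: "R \<in> borel_measurable borel" "integrable lborel R" "\<forall>x. x \<notin> G --> R x = 0" "AE x in ?L. \<rho> x - v1 x = R x"
  using borel_representative_integrable[OF integrable_diff[OF \<rho>i vi(1)] Gb] by blast
 obtain \<gamma> where \<gamma>: "\<gamma> \<in> borel_measurable borel" "integrable lborel \<gamma>" "\<forall>x. x \<notin> G --> \<gamma> x = 0" "AE x in ?L. g x - v2 x = \<gamma> x"
  using borel_representative_integrable[OF integrable_diff[OF gi(2) vi(2)] Gb] by blast
 have swap: "(LINT x|?L. F x * \<phi> x) = (LBINT x. Gv x * \<phi> x)"
  if F: "integrable ?L F" "AE x in ?L. F x = Gv x" and Gv: "Gv \<in> borel_measurable borel" "\<forall>x. x \<notin> G --> Gv x = 0" and \<phi>: "continuous_on UNIV \<phi>" for F Gv \<phi> :: "plane => real"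
 proof -
  have \<phi>b: "\<phi> \<in> borel_measurable borel" by (rule borel_measurable_continuous_onI[OF \<phi>])
  have "(LINT x|?L. F x * \<phi> x) = (LINT x|?L. Gv x * \<phi> x)"
  proof (rule integral_cong_AE)
   show "(%x. F x * \<phi> x) \<in> borel_measurable ?L" "(%x. Gv x * \<phi> x) \<in> borel_measurable ?L"
    by (intro borel_measurable_times borel_measurable_integrable[OF F(1)] borel_measurable_lebesgue_on \<phi>b Gv(1))+
   show "AE x in ?L. F x * \<phi> x = Gv x * \<phi> x" using F(2) by eventually_elim (simp only:)
  qed
  also have "... = (LBINT x. Gv x * \<phi> x)"
  proof (rule integral_lebesgue_on_eq(1)[OF Gb])
   show "(%x. Gv x * \<phi> x) \<in> borel_measurable borel" using Gv(1) \<phi>b by (rule borel_measurable_times)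
   show "Gv x * \<phi> x = 0" if "x \<notin> G" for x unfolding Gv(2)[rule_format, OF that] by (rule mult_zero_left)
  qed
  finally show ?thesis .
 qed
 define M where "M = (%k::nat. if k = 0 then plane_density S h else if k = 1 then plane_density S (%x. - h x)
   else if k = 2 then plane_density ?bm b else plane_density ?bm (%x. - b x))"
 define sg where "sg = (%k::nat. if k = 0 \<or> k = 2 then 1 else (-1::real))"
 have sumI: "(\<Sum>k<4. F k) = F 0 + F 1 + F 2 + F 3" for F :: "nat => real" by (simp add: eval_nat_numeral)
 have M_simps: "M 0 = plane_density S h" "M 1 = plane_density S (%x. - h x)" "M 2 = plane_density ?bm b" "M 3 = plane_density ?bm (%x. - b x)"
  and sg_simps: "sg 0 = 1" "sg 1 = -1" "sg 2 = 1" "sg 3 = -1" by (simp_all add: M_def sg_def)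
 have M: "finite_measure (M k)" "sets (M k) = sets borel" if "k \<in> {..<4}" for k
  unfolding M_def using plane_density(1,2)[OF idS hi] plane_density(1,2)[OF idS nhi] plane_density(1,2)[OF idb bi] plane_density(1,2)[OF idb nbi] by auto
 have D1: "(LBINT x. U x * partial_deriv e1 \<phi> x) = - ((LBINT x. \<phi> x * R x) + (\<Sum>k<4. sg k * (LINT x|M k. \<phi> x)))"
  if c: "C_k (Suc 0) \<phi>" for \<phi>
 proof -
  have cc: "continuous_on UNIV \<phi>" "continuous_on UNIV (partial_deriv e1 \<phi>)" using C_k_continuous[OF c] c by auto
  have gg: "gauss_green G e1 (%x. u x - u0 x) t0" using t0(1) by (simp add: has_trace_def)
  have bb: "(LINT x|?bm. \<phi> x * (?n x \<bullet> e1) * t0 x) = - (LINT x|?bm. \<phi> x * b x)"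
   unfolding b_def integral_minus[symmetric] by (simp add: mult.assoc)
  have "(LBINT x. U x * partial_deriv e1 \<phi> x) = (LINT x|?L. (u x - u0 x) * partial_deriv e1 \<phi> x)"
   by (rule swap[symmetric, OF integrable_diff[OF ui vi(3)] U(4,1,3) cc(2)])
  also have "... = - ((LINT x|?L. \<phi> x * (\<rho> x - v1 x)) + (LINT x|S. \<phi> x * h x)) + (LINT x|?bm. \<phi> x * (?n x \<bullet> e1) * t0 x)"
   by (rule gg[unfolded gauss_green_iff[OF op bd q1], THEN spec, THEN mp, OF c])
  also have "(LINT x|?L. \<phi> x * (\<rho> x - v1 x)) = (LBINT x. \<phi> x * R x)"
   using swap[OF integrable_diff[OF \<rho>i vi(1)] R(4,1,3) cc(1)] by (simp only: mult.commute)
  finally show ?thesis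
   unfolding bb plane_density_diff[OF idS hi sb(1) cc(1)] plane_density_diff[OF idb bi sb(2) cc(1)] sumI M_simps sg_simps by simp
 qed
 have D2: "(LBINT x. U x * partial_deriv e2 \<phi> x) = - (LBINT x. \<phi> x * \<gamma> x)" if c: "C_k (Suc 0) \<phi>" for \<phi>
 proof -
  have cc: "continuous_on UNIV \<phi>" "continuous_on UNIV (partial_deriv e2 \<phi>)" using C_k_continuous[OF c] c by auto
  have gg: "gauss_green G e2 (%x. u x - u0 x) t0" using t0(1) by (simp add: has_trace_def)
  have bb: "(LINT x|?bm. \<phi> x * (?n x \<bullet> e2) * t0 x) = 0"
  proof (rule integral_eq_zero_AE)
   show "AE x in ?bm. \<phi> x * (?n x \<bullet> e2) * t0 x = 0"
    using t0(2)
   proof eventually_elim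
    case (elim x)
    then show ?case by (cases "?n x") auto
   qed
  qed
  have "(LBINT x. U x * partial_deriv e2 \<phi> x) = (LINT x|?L. (u x - u0 x) * partial_deriv e2 \<phi> x)"
   by (rule swap[symmetric, OF integrable_diff[OF ui vi(3)] U(4,1,3) cc(2)])
  also have "... = - ((LINT x|?L. \<phi> x * (g x - v2 x)) + (LINT x|null_measure_on G. \<phi> x * 1)) + (LINT x|?bm. \<phi> x * (?n x \<bullet> e2) * t0 x)"
   by (rule gg[unfolded gauss_green_iff[OF op bd q2], THEN spec, THEN mp, OF c])
  also have "(LINT x|?L. \<phi> x * (g x - v2 x)) = (LBINT x. \<phi> x * \<gamma> x)"
   using swap[OF integrable_diff[OF gi(2) vi(2)] \<gamma>(4,1,3) cc(1)] by (simp only: mult.commute)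
  finally show ?thesis unfolding bb null_measure_on(2)[OF Gb] by simp
 qed
 have "AE x in ?L. \<bar>- v2 x\<bar> \<le> B" using v2B by simp
 then have go: "(%x. - v2 x + g x) \<in> orlicz A G" using v2m by (intro Linf_orlicz_add[OF _ _ g(1)]) auto
 have A\<gamma>: "integrable lborel (%x. A \<bar>\<gamma> x\<bar>)"
 proof -
  have "AE x in ?L. A \<bar>- v2 x + g x\<bar> = A \<bar>\<gamma> x\<bar>" using \<gamma>(4) by eventually_elim (simp add: algebra_simps)
  then have "integrable ?L (%x. A \<bar>\<gamma> x\<bar>)" by (rule integrable_lebesgue_on_AE(1)[OF Gb orlicz_integrable(1)[OF go]])
  moreover have "A \<bar>\<gamma> x\<bar> = 0" if "x \<notin> G" for x using \<gamma>(3)[rule_format, OF that] A_zero by simp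
  ultimately show ?thesis using integral_lebesgue_on_eq(2)[OF Gb A_measurable[OF \<gamma>(1)]] by blast
 qed
 have k1: "(LINT x|?L. f1 (v1 x + R x)) = (LINT x|?L. f1 (\<rho> x))"
 proof (rule integrable_lebesgue_on_AE(2)[OF Gb f1_comp_integrable[OF \<rho>i]])
  show "AE x in ?L. f1 (\<rho> x) = f1 (v1 x + R x)" using R(4) by eventually_elim (simp add: algebra_simps)
 qed
 have k2: "(LINT x|?L. A \<bar>v2 x + \<gamma> x\<bar>) = (LINT x|?L. A \<bar>g x\<bar>)"
 proof (rule integrable_lebesgue_on_AE(2)[OF Gb gi(1)])
  show "AE x in ?L. A \<bar>g x\<bar> = A \<bar>v2 x + \<gamma> x\<bar>" using \<gamma>(4) by eventually_elim (simp add: algebra_simps)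
 qed
 have k3: "(\<Sum>k<4. recession f1 (sg k) * measure (M k) UNIV) = (LINT x|S. recession f1 (h x)) + (LINT x|?bm. recession f1 (b x))"
  unfolding sumI M_simps sg_simps plane_density(4)[OF idS hi] plane_density(4)[OF idS nhi] plane_density(4)[OF idb bi] plane_density(4)[OF idb nbi]
   recession_integral(2)[OF hi] recession_integral(2)[OF bi] by simp
 have b_eq: "- t0 x * fst (?n x) = b x" for x unfolding b_def by (cases "?n x") simp
 have Ku: "K_functional G f1 A u0 u = ereal ((LINT x|?L. f1 (\<rho> x)) + (LINT x|S. recession f1 (h x))
  + (LINT x|?bm. recession f1 (b x)) + (LINT x|?L. A \<bar>g x\<bar>))"
  using K_functional_eq[OF d t g(2,1)] unfolding b_eq .
 obtain N \<eta> \<eta>' J p q c' r s0 where "pushed_partition G N \<eta> \<eta>' J p q c' r s0" using pushed_partition_exists[OF lip nor] by blast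
 then interpret P: pushed_partition G N \<eta> \<eta>' J p q c' r s0 .
 show ?thesis
  unfolding Ku
 proof (rule ereal_le_epsilon2)
  fix eps :: real assume eps: "eps > 0"
  have "\<exists>\<phi>\<in>test_functions G. (LINT x|?L. f1 (v1 x + partial_deriv e1 \<phi> x)) + (LINT x|?L. A \<bar>v2 x + partial_deriv e2 \<phi> x\<bar>)
   \<le> (LINT x|?L. f1 (v1 x + R x)) + (\<Sum>k<4. recession f1 (sg k) * measure (M k) UNIV) + (LINT x|?L. A \<bar>v2 x + \<gamma> x\<bar>) + eps"
   by (rule P.smooth_competitor[OF linear_growth_integrand_axioms delta2_N_function_axioms U(2) U(3)[rule_format] R(2) R(3)[rule_format]
     \<gamma>(2) \<gamma>(3)[rule_format] D1 D2 M vi(1) v2m v2B A\<gamma> eps])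
  then obtain \<phi> where \<phi>: "\<phi> \<in> test_functions G" "(LINT x|?L. f1 (v1 x + partial_deriv e1 \<phi> x)) + (LINT x|?L. A \<bar>v2 x + partial_deriv e2 \<phi> x\<bar>)
   \<le> (LINT x|?L. f1 (\<rho> x)) + ((LINT x|S. recession f1 (h x)) + (LINT x|?bm. recession f1 (b x))) + (LINT x|?L. A \<bar>g x\<bar>) + eps"
   unfolding k1 k2 k3 by blast
  note t\<phi> = test_has_weak_deriv[OF op \<phi>(1)]
  define w where "w x = 1 * u0 x + 1 * \<phi> x" for x
  have wi: "integrable ?L w" unfolding w_def using vi(3) t\<phi>(1)[OF disjI1[OF refl]] by simp
  have d1: "has_weak_deriv G e1 w (%x. 1 * v1 x + 1 * partial_deriv e1 \<phi> x)"
   by (rule has_weak_derivI_rep[OF op wi]) (unfold w_def, rule deriv_rep_comb[OF op disjI1[OF refl] vi(3)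
     weak_deriv_deriv_rep[OF op v(2) vi(1)] t\<phi>(1)[OF disjI1[OF refl]] t\<phi>(3)[OF disjI1[OF refl]] t\<phi>(2)[OF disjI1[OF refl]]], simp)
  have d2: "has_weak_deriv G e2 w (%x. 1 * v2 x + 1 * partial_deriv e2 \<phi> x)"
   by (rule has_weak_derivI_rep[OF op wi]) (unfold w_def, rule deriv_rep_comb[OF op disjI2[OF refl] vi(3)
     weak_deriv_deriv_rep[OF op v(4) vi(2)] t\<phi>(1)[OF disjI1[OF refl]] t\<phi>(3)[OF disjI2[OF refl]] t\<phi>(2)[OF disjI2[OF refl]]], simp)
  have ae1: "AE x in ?L. v1 x + partial_deriv e1 \<phi> x = weak_deriv G e1 w x" using weak_deriv_AE[OF op d1] by simp
  have ae2: "AE x in ?L. v2 x + partial_deriv e2 \<phi> x = weak_deriv G e2 w x" using weak_deriv_AE[OF op d2] by simp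
  have i1: "integrable ?L (%x. v1 x + partial_deriv e1 \<phi> x)" using vi(1) t\<phi>(2)[OF disjI1[OF refl]] by (rule integrable_add)
  have i2: "integrable ?L (%x. v2 x + partial_deriv e2 \<phi> x)" using vi(2) t\<phi>(2)[OF disjI2[OF refl]] by (rule integrable_add)
  have w1i: "integrable ?L (weak_deriv G e1 w)" by (rule integrable_lebesgue_on_AE(1)[OF Gb i1 ae1])
  have po: "partial_deriv e2 \<phi> \<in> orlicz A G"
  proof -
   have "\<phi> \<in> test_functions UNIV" using \<phi>(1) test_functions_mono by blast
   then have "partial_deriv e2 \<phi> \<in> test_functions UNIV" using test_partial by blast
   then obtain C where C: "\<forall>x\<in>G. \<bar>partial_deriv e2 \<phi> x\<bar> \<le> C" using test_bounded_borel unfolding bounded_borel_on_def by blast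
   have "(%x. partial_deriv e2 \<phi> x + 0) \<in> orlicz A G"
   proof (rule Linf_orlicz_add[OF _ _ zero_orlicz])
    show "partial_deriv e2 \<phi> \<in> borel_measurable ?L" using t\<phi>(2)[OF disjI2[OF refl]] by auto
    show "AE x in ?L. \<bar>partial_deriv e2 \<phi> x\<bar> \<le> C" by (rule AE_I2) (use C in simp)
   qed
   then show ?thesis by simp
  qed
  have o: "(%x. v2 x + partial_deriv e2 \<phi> x) \<in> orlicz A G" by (rule Linf_orlicz_add[OF v2m v2B po])
  have aeA: "AE x in ?L. A \<bar>v2 x + partial_deriv e2 \<phi> x\<bar> = A \<bar>weak_deriv G e2 w x\<bar>" using ae2 by eventually_elim (simp only:)
  have aeF: "AE x in ?L. f1 (v1 x + partial_deriv e1 \<phi> x) = f1 (weak_deriv G e1 w x)" using ae1 by eventually_elim (simp only:)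
  note LA = integrable_lebesgue_on_AE[OF Gb orlicz_integrable(1)[OF o] aeA]
  note LF = integrable_lebesgue_on_AE[OF Gb f1_comp_integrable[OF i1] aeF]
  have w2o: "weak_deriv G e2 w \<in> orlicz A G"
   unfolding orlicz_iff using LA(1) borel_measurable_lebesgue_on_AE[OF Gb borel_measurable_integrable[OF i2] ae2] by blast
  have j1: "(%x. 1 * v1 x + 1 * partial_deriv e1 \<phi> x) \<in> L1 G" and j2: "(%x. 1 * v2 x + 1 * partial_deriv e2 \<phi> x) \<in> L1 G"
   unfolding L1_def using i1 i2 by simp_all
  have wW: "w \<in> W11 G" unfolding W11_def using d1 d2 j1 j2 wi unfolding L1_def by blast
  have "(%x. w x - u0 x) = \<phi>" by (rule ext) (simp add: w_def)
  then have wC: "w \<in> C_Sob G A u0" unfolding C_Sob_def using wW w2o test_W11_0[OF op \<phi>(1)] by simp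
  have "dual_functional G f1 A u0 \<tau> \<le> lagrangian G f1 A w \<tau>"
   unfolding dual_functional_def by (rule INF_lower[OF wC])
  also have "... \<le> ereal ((LINT x|?L. f1 (weak_deriv G e1 w x)) + (LINT x|?L. A \<bar>weak_deriv G e2 w x\<bar>))"
   by (rule lagrangian_le[OF w1i w2o \<tau>])
  also have "... \<le> ereal ((LINT x|?L. f1 (\<rho> x)) + (LINT x|S. recession f1 (h x)) + (LINT x|?bm. recession f1 (b x)) + (LINT x|?L. A \<bar>g x\<bar>) + eps)"
   unfolding LA(2) LF(2) using \<phi>(2) by simp
  finally show "dual_functional G f1 A u0 \<tau> \<le> ereal ((LINT x|?L. f1 (\<rho> x)) + (LINT x|S. recession f1 (h x)) + (LINT x|?bm. recession f1 (b x)) + (LINT x|?L. A \<bar>g x\<bar>)) + ereal eps"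
   by simp
 qed
qed

text \<open>The derivative is a function, so its singular part vanishes and its density is the weak derivative.\<close>

lemma ac_deriv_vertical:
 assumes g: "has_weak_deriv G e2 u g" "integrable (lebesgue_on G) g"
 shows "AE x in lebesgue_on G. g x = ac_deriv G e2 u x"
proof -
 have d: "has_lebesgue_decomposition G e2 u g (null_measure_on G) (%_. 1)"
 proof (rule lebesgue_decompositionI[OF op weak_deriv_deriv_rep[OF op g]])
  show "{} \<in> null_sets lborel" "{} \<subseteq> G" by simp_all
  have sp: "space (null_measure_on G) = G" by (rule fbm(3)[OF null_measure_on(1)[OF Gb]])
  then have "G \<in> sets (null_measure_on G)" using sets.top[of "null_measure_on G"] by simp
  then have "emeasure (null_measure_on G) G = 0"
   by (rule iffD1[OF AE_iff_measurable[of _ _ "%_. False"] null_measure_on(3)[OF Gb]]) (simp add: sp)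
  then show "emeasure (null_measure_on G) (G - {}) = 0" by simp
 qed simp
 then have "\<exists>S h. has_lebesgue_decomposition G e2 u (ac_deriv G e2 u) S h"
  unfolding ac_deriv_def by (intro someI[of "%\<rho>. \<exists>S h. has_lebesgue_decomposition G e2 u \<rho> S h" g]) blast
 then obtain S h where "has_lebesgue_decomposition G e2 u (ac_deriv G e2 u) S h" by blast
 from lebesgue_decomposition_unique(1)[OF op d this] show ?thesis .
qed

text \<open>The first component is bounded by the growth rate of \<open>f1\<close>; the second is controlled by the growth
 condition on the conjugate.\<close>

lemma stress_in_dual_space:
 assumes \<rho>: "integrable (lebesgue_on G) \<rho>" and g: "g \<in> orlicz A G"
  and s1: "AE x in lebesgue_on G. f1' (\<rho> x) = fst (\<sigma> x)" and s2: "AE x in lebesgue_on G. f2' (g x) = snd (\<sigma> x)"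
 shows "\<sigma> \<in> Linf_orlicz (N_conjugate A) G"
proof -
 let ?L = "lebesgue_on G"
 have gi: "g \<in> borel_measurable ?L" "integrable ?L (%x. A \<bar>g x\<bar>)" using g unfolding orlicz_iff by blast+
 have m1: "(%x. f1' (\<rho> x)) \<in> borel_measurable ?L"
  using borel_measurable_continuous_onI[OF f1'_cont] borel_measurable_integrable[OF \<rho>] by (rule measurable_compose[rotated])
 have "(%x. fst (\<sigma> x)) \<in> borel_measurable ?L" by (rule borel_measurable_lebesgue_on_AE[OF Gb m1 s1])
 moreover have "AE x in ?L. \<bar>fst (\<sigma> x)\<bar> \<le> a3" using s1
 proof eventually_elim
  case (elim x) then show ?case using f1'_bound[of "\<rho> x"] by simp
 qed
 ultimately have "(%x. fst (\<sigma> x)) \<in> Linf G" unfolding Linf_def by blast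
 moreover have "(%x. snd (\<sigma> x)) \<in> borel_measurable ?L" by (rule borel_measurable_lebesgue_on_AE[OF Gb f2'_measurable[OF gi(1)] s2])
 moreover have "(\<integral>\<^sup>+ x. ennreal (N_conjugate A (1 * \<bar>snd (\<sigma> x)\<bar>)) \<partial>?L) < \<infinity>"
 proof -
  have "(\<integral>\<^sup>+ x. ennreal (N_conjugate A (1 * \<bar>snd (\<sigma> x)\<bar>)) \<partial>?L) \<le> (\<integral>\<^sup>+ x. ennreal (c * (A \<bar>g x\<bar> + 1)) \<partial>?L)"
  proof (rule nn_integral_mono_AE)
   show "AE x in ?L. ennreal (N_conjugate A (1 * \<bar>snd (\<sigma> x)\<bar>)) \<le> ennreal (c * (A \<bar>g x\<bar> + 1))"
    using s2
   proof eventually_elim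
    case (elim x)
    have "N_conjugate A (A' \<bar>g x\<bar>) \<le> c * (A \<bar>g x\<bar> + 1)" by (rule conj_bound) simp
    then show ?case unfolding elim[symmetric] mult_1_left f2'_abs by (rule ennreal_leI)
   qed
  qed
  also have "... < \<infinity>"
  proof -
   have "integrable ?L (%x. c * (A \<bar>g x\<bar> + 1))" using gi(2) const_integrable by auto
   then show ?thesis unfolding real_integrable_def by (auto simp: less_top)
  qed
  finally show ?thesis .
 qed
 ultimately show ?thesis unfolding Linf_orlicz_def orlicz_def using zero_less_one by blast
qed

end

theorem theorem3p2:
  fixes \<Omega> :: "plane set" and u0 u :: "plane \<Rightarrow> real"
    and f1 A A' :: "real \<Rightarrow> real" and f :: "plane \<Rightarrow> real" and \<sigma> :: "plane \<Rightarrow> plane"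
    and a1 a2 a3 a4 c3 c :: real
  assumes "bounded_lipschitz_domain \<Omega>" and "normal_wrt_x2_axis \<Omega>"
    and "u0 \<in> W1inf \<Omega>"
    and "N_function A"
    and "\<And>t. t \<ge> 0 \<Longrightarrow> (A has_real_derivative A' t) (at t within {0..})"
    and "continuous_on {0..} A'"
    and "convex_on UNIV f1" and "f1 C1_differentiable_on UNIV"
    and "a1 > 0" and "a3 > 0" and "a2 \<ge> 0" and "a4 \<ge> 0"
    and "\<And>t. a1 * \<bar>t\<bar> - a2 \<le> f1 t \<and> f1 t \<le> a3 * \<bar>t\<bar> + a4"
    and "c3 > 0" and "\<And>s t. A \<bar>s + t\<bar> \<le> c3 * (A \<bar>s\<bar> + A \<bar>t\<bar>)"
    and "\<And>t. t \<ge> 0 \<Longrightarrow> N_conjugate A (A' t) \<le> c * (A t + 1)"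
    and "\<And>\<xi>. f \<xi> = f1 (fst \<xi>) + A \<bar>snd \<xi>\<bar>"
    and "u \<in> C_BV \<Omega> A u0"
    and "\<And>w. w \<in> C_BV \<Omega> A u0 \<Longrightarrow> K_functional \<Omega> f1 A u0 u \<le> K_functional \<Omega> f1 A u0 w"
    and "\<And>x. \<sigma> x = gradient f (ac_gradient \<Omega> u x)"
  shows "\<sigma> \<in> Linf_orlicz (N_conjugate A) \<Omega> \<and>
    (\<forall>\<tau> \<in> Linf_orlicz (N_conjugate A) \<Omega>.
       dual_functional \<Omega> f1 A u0 \<tau> \<le> dual_functional \<Omega> f1 A u0 \<sigma>)"
proof -
 obtain f1' where f1': "!!t. (f1 has_vector_derivative f1' t) (at t)" "continuous_on UNIV f1'"
  using assms(8) unfolding C1_differentiable_on_def by blast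
 interpret dirichlet_problem f1 f1' a1 a2 a3 a4 A A' c3 c \<Omega>
 proof
  show "(f1 has_real_derivative f1' t) (at t)" for t
   using f1'(1) by (simp only: has_real_derivative_iff_has_vector_derivative)
  show "open \<Omega>" "bounded \<Omega>" using assms(1) by (simp_all add: bounded_lipschitz_domain_def)
 qed (fact assms f1')+
 have \<sigma>_eq: "\<sigma> x = (f1' (ac_deriv \<Omega> e1 u x), f2' (ac_deriv \<Omega> e2 u x))" for x
 proof -
  let ?\<xi> = "ac_gradient \<Omega> u x"
  have "((%\<xi>::plane. f1 (fst \<xi>)) has_derivative (%h. f1' (fst ?\<xi>) * fst h)) (at ?\<xi>)"
   by (rule has_derivative_compose[where f = "fst :: plane => real" and f' = fst, OF has_derivative_fst[OF has_derivative_ident]])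
     (rule f1_deriv[unfolded has_field_derivative_def])
  moreover have "((%\<xi>::plane. A \<bar>snd \<xi>\<bar>) has_derivative (%h. f2' (snd ?\<xi>) * snd h)) (at ?\<xi>)"
   by (rule has_derivative_compose[where f = "snd :: plane => real" and f' = snd and g = "%t. A \<bar>t\<bar>", OF has_derivative_snd[OF has_derivative_ident]])
     (rule f2_deriv[unfolded has_field_derivative_def])
  ultimately have "((%\<xi>. f1 (fst \<xi>) + A \<bar>snd \<xi>\<bar>) has_derivative (%h. f1' (fst ?\<xi>) * fst h + f2' (snd ?\<xi>) * snd h)) (at ?\<xi>)"
   by (rule has_derivative_add)
  moreover have "f = (%\<xi>. f1 (fst \<xi>) + A \<bar>snd \<xi>\<bar>)" by (rule ext) (rule assms(17))
  ultimately have "(f has_derivative (%h. f1' (fst ?\<xi>) * fst h + f2' (snd ?\<xi>) * snd h)) (at ?\<xi>)" by simp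
  from partial_deriv_eq[OF this] show ?thesis unfolding assms(20) gradient_def by (simp add: ac_gradient_def)
 qed
 have uB: "u \<in> BV \<Omega>" using assms(18) by (simp add: C_BV_def)
 obtain \<rho> S h where "has_lebesgue_decomposition \<Omega> e1 u \<rho> S h" using deriv_measure_rep[OF op bd uB, of e1] by blast
 then have d: "\<exists>S h. has_lebesgue_decomposition \<Omega> e1 u (ac_deriv \<Omega> e1 u) S h"
  unfolding ac_deriv_def by (intro someI[of "%\<rho>. \<exists>S h. has_lebesgue_decomposition \<Omega> e1 u \<rho> S h" \<rho>]) blast
 then have \<rho>i: "integrable (lebesgue_on \<Omega>) (ac_deriv \<Omega> e1 u)" by (auto simp: has_lebesgue_decomposition_def L1_def)
 obtain g where g: "g \<in> orlicz A \<Omega>" "has_weak_deriv \<Omega> e2 u g" using assms(18) unfolding C_BV_def by blast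
 have s1: "AE x in lebesgue_on \<Omega>. f1' (ac_deriv \<Omega> e1 u x) = fst (\<sigma> x)" by (simp add: \<sigma>_eq)
 have s2: "AE x in lebesgue_on \<Omega>. f2' (g x) = snd (\<sigma> x)"
  using ac_deriv_vertical[OF g(2) orlicz_integrable(2)[OF g(1)]] by eventually_elim (simp add: \<sigma>_eq)
 have s1': "AE x in lebesgue_on \<Omega>. fst (\<sigma> x) = f1' (ac_deriv \<Omega> e1 u x)" using s1 by eventually_elim (rule sym)
 have s2': "AE x in lebesgue_on \<Omega>. snd (\<sigma> x) = f2' (g x)" using s2 by eventually_elim (rule sym)
 have "K_functional \<Omega> f1 A u0 u \<le> dual_functional \<Omega> f1 A u0 \<sigma>"
  unfolding dual_functional_def
  by (rule INF_greatest) (rule lagrangian_stress_ge[OF assms(18,19) _ d g s1' s2'])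
 then show ?thesis
  using stress_in_dual_space[OF \<rho>i g(1) s1 s2] dual_le_K_functional[OF assms(1-3) assms(18)] order_trans by blast
qed

end
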